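(* Let $1\le k\le n-1$. The number of type $C_n$ $k$-triangulations coincides with the number of symmetric fans of $k$ non-intersecting Dyck paths (in the nesting polyomino for type $C_n$). Equivalently, the number of maximal (symmetric) $0$-$1$-fillings of the nesting polyomino for type $C_n$ whose longest north-east chain has length $k$ coincides with the number of maximal (symmetric) $0$-$1$-fillings of the crossing polyomino for type $C_n$ whose longest south-east chain has length $k$.
   Context: $k$-triangulations. Consider the $2n$-gon with vertices labelled clockwise $1,2,\dots,n,-1,-2,\dots,-n$. Let $\omega$ be a set of diagonals (pairs of distinct vertices) invariant under rotation by $180^\circ$: if $\{i,j\}\in\omega$ then $\{-i,-j\}\in\omega$. Two diagonals cross if their endpoints can be written $\{i,j\}$ and $\{k',l'\}$ with $i<k'<j<l'$ in the crossing order $1<2<\dots<n<-1<-2<\dots<-n$. A maximal crossing of $\omega$ is a largest subset of mutually crossing diagonals. $\omega$ is a type $C_n$ $k$-triangulation if its maximal crossing has cardinality $k$ and $\omega$ is maximal, i.e. adding any further diagonal (together with its image under the rotation) increases the cardinality of the maximal crossing. (Sides of the polygon cross nothing, so it does not matter for the count whether they are regarded as diagonals.) Polyominoes. The nesting polyomino for type $C_n$ has $n$ columns labelled $1,\dots,n$ from left to right and rows labelled from top to bottom $2,3,\dots,n,-n,\dots,-2,-1$; the columns have heights $2n-1,2n-2,\dots,n$ and are bottom-aligned, so that the box $(i,j)$ (column $i$, row $j$) belongs to it iff $i<j$ in the order $1<2<\dots<n<-n<\dots<-1$. The crossing polyomino has the same shape and column labels, but its rows are labelled from top to bottom $2,3,\dots,n,-1,-2,\dots,-n$.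 In both, the main diagonal consists of the boxes $(i,-i)$, $1\le i\le n$, and fillings are required to be symmetric: for $1\le i,j\le n$ the boxes $(i,-j)$ and $(j,-i)$ have the same entry. A set $\omega$ of diagonals (pairs of distinct vertices) of the $2n$-gon with vertices labelled clockwise $1,2,\dots,n,-1,-2,\dots,-n$ that is invariant under rotation by $180^\circ$ is encoded by the $0$-$1$-filling of the crossing polyomino with ones exactly in the boxes $(i,j)$ with $\{i,j\}\in\omega$. A north-east chain of length $k$ in a filling of the nesting polyomino is a sequence of $k$ non-zero entries, each strictly to the right of and strictly above the preceding one. A south-east chain of length $k$ in a filling of the crossing polyomino is a sequence of $k$ non-zero entries, each strictly to the right of and strictly below the preceding one, such that the smallest rectangle containing all of them is contained in the polyomino. A $0$-$1$-filling of the nesting (crossing) polyomino is maximal if replacing a zero by a one in any box (and in its mirror box, by symmetry) increases the length of the longest north-east (south-east) chain. Fans. A symmetric fan of $k$ non-intersecting Dyck paths is a family of $k$ paths of boxes in the nesting polyomino starting in the boxes $(1,2),(2,3),\dots,(k,k+1)$ respectively, taking unit south or east steps, ending upon reaching the main diagonal, and such that no two of the paths share a box. *)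

theory Defs
  imports Main "HOL-Library.FuncSet" "HOL-Library.Disjoint_Sets"
begin

definition vertices :: "nat \<Rightarrow> int set" where
  "vertices n = {- int n..int n} - {0}"

(* Positions of the labels in the orders 1 < ... < n < -1 < ... < -n and
   1 < ... < n < -n < ... < -1 respectively; both map the vertices onto {1..2n}. *)
definition crossing_pos :: "nat \<Rightarrow> int \<Rightarrow> int" where
  "crossing_pos n i = (if i > 0 then i else int n - i)"

definition nesting_pos :: "nat \<Rightarrow> int \<Rightarrow> int" where
  "nesting_pos n i = (if i > 0 then i else 2 * int n + 1 + i)"


subsection \<open>Triangulations\<close>

(* The sides of the polygon are included. *)
definition diagonals :: "nat \<Rightarrow> int set set" where
  "diagonals n = {{i, j} |i j. i \<in> vertices n \<and> j \<in> vertices n \<and> i \<noteq> j}"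

definition rotate180 :: "int set \<Rightarrow> int set" where
  "rotate180 d = uminus ` d"

definition interleaved :: "nat \<Rightarrow> int set \<Rightarrow> int set \<Rightarrow> bool" where
  "interleaved n d e \<longleftrightarrow> (\<exists>i j k l. d = {i, j} \<and> e = {k, l} \<and>
     crossing_pos n i < crossing_pos n k \<and>
     crossing_pos n k < crossing_pos n j \<and>
     crossing_pos n j < crossing_pos n l)"

definition crosses :: "nat \<Rightarrow> int set \<Rightarrow> int set \<Rightarrow> bool" where
  "crosses n d e \<longleftrightarrow> interleaved n d e \<or> interleaved n e d"

definition max_crossing :: "nat \<Rightarrow> int set set \<Rightarrow> nat" where
  "max_crossing n \<omega> = Max (card ` {S. S \<subseteq> \<omega> \<and> pairwise (crosses n) S})"

definition triangulations :: "nat \<Rightarrow> nat \<Rightarrow> int set set set" where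
  "triangulations n k = {\<omega>. \<omega> \<subseteq> diagonals n \<and> (\<forall>d\<in>\<omega>. rotate180 d \<in> \<omega>) \<and>
     max_crossing n \<omega> = k \<and>
     (\<forall>d\<in>diagonals n - \<omega>. max_crossing n \<omega> < max_crossing n (\<omega> \<union> {d, rotate180 d}))}"


subsection \<open>Polyominoes and fillings\<close>

(* The box (i, j) lies in column i and in the row labelled j. *)
type_synonym box = "int \<times> int"

definition nesting_polyomino :: "nat \<Rightarrow> box set" where
  "nesting_polyomino n =
     {(i, j). i \<in> {1..int n} \<and> j \<in> vertices n \<and> nesting_pos n i < nesting_pos n j}"

definition crossing_polyomino :: "nat \<Rightarrow> box set" where
  "crossing_polyomino n =
     {(i, j). i \<in> {1..int n} \<and> j \<in> vertices n \<and> crossing_pos n i < crossing_pos n j}"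

definition main_diagonal :: "nat \<Rightarrow> box set" where
  "main_diagonal n = {(i, - i) |i. i \<in> {1..int n}}"

definition symmetric_fillings :: "nat \<Rightarrow> box set \<Rightarrow> (box \<Rightarrow> nat) set" where
  "symmetric_fillings n P =
     {F \<in> P \<rightarrow>\<^sub>E {0, 1}. \<forall>i\<in>{1..int n}. \<forall>j\<in>{1..int n}. F (i, - j) = F (j, - i)}"

(* Boxes in positively labelled rows have no partner under the symmetry. *)
fun mirror :: "box \<Rightarrow> box" where
  "mirror (i, j) = (if j < 0 then (- j, - i) else (i, j))"

definition ne_chain :: "nat \<Rightarrow> (box \<Rightarrow> nat) \<Rightarrow> box list \<Rightarrow> bool" where
  "ne_chain n F bs \<longleftrightarrow> set bs \<subseteq> nesting_polyomino n \<and> (\<forall>b\<in>set bs. F b \<noteq> 0) \<and>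
     successively (\<lambda>b c. fst b < fst c \<and> nesting_pos n (snd c) < nesting_pos n (snd b)) bs"

(* Smallest rectangle of rows and columns containing all boxes in B; rows lie further
   down the larger their position. *)
definition bounding_rectangle :: "nat \<Rightarrow> box set \<Rightarrow> box set" where
  "bounding_rectangle n B = {(i, j). j \<in> vertices n \<and>
     (\<exists>b\<in>B. fst b \<le> i) \<and> (\<exists>b\<in>B. i \<le> fst b) \<and>
     (\<exists>b\<in>B. crossing_pos n (snd b) \<le> crossing_pos n j) \<and>
     (\<exists>b\<in>B. crossing_pos n j \<le> crossing_pos n (snd b))}"

definition se_chain :: "nat \<Rightarrow> (box \<Rightarrow> nat) \<Rightarrow> box list \<Rightarrow> bool" where
  "se_chain n F bs \<longleftrightarrow> set bs \<subseteq> crossing_polyomino n \<and> (\<forall>b\<in>set bs. F b \<noteq> 0) \<and>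
     successively (\<lambda>b c. fst b < fst c \<and> crossing_pos n (snd b) < crossing_pos n (snd c)) bs \<and>
     bounding_rectangle n (set bs) \<subseteq> crossing_polyomino n"

definition longest_ne :: "nat \<Rightarrow> (box \<Rightarrow> nat) \<Rightarrow> nat" where
  "longest_ne n F = Max (length ` {bs. ne_chain n F bs})"

definition longest_se :: "nat \<Rightarrow> (box \<Rightarrow> nat) \<Rightarrow> nat" where
  "longest_se n F = Max (length ` {bs. se_chain n F bs})"

definition maximal_nesting_fillings :: "nat \<Rightarrow> nat \<Rightarrow> (box \<Rightarrow> nat) set" where
  "maximal_nesting_fillings n k = {F \<in> symmetric_fillings n (nesting_polyomino n).
     longest_ne n F = k \<and>
     (\<forall>b\<in>nesting_polyomino n. F b = 0 \<longrightarrow> longest_ne n F < longest_ne n (F(b := 1, mirror b := 1)))}"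

definition maximal_crossing_fillings :: "nat \<Rightarrow> nat \<Rightarrow> (box \<Rightarrow> nat) set" where
  "maximal_crossing_fillings n k = {F \<in> symmetric_fillings n (crossing_polyomino n).
     longest_se n F = k \<and>
     (\<forall>b\<in>crossing_polyomino n. F b = 0 \<longrightarrow> longest_se n F < longest_se n (F(b := 1, mirror b := 1)))}"


subsection \<open>Fans of Dyck paths\<close>

definition south_or_east :: "nat \<Rightarrow> box \<Rightarrow> box \<Rightarrow> bool" where
  "south_or_east n b c \<longleftrightarrow>
     (fst c = fst b \<and> nesting_pos n (snd c) = nesting_pos n (snd b) + 1) \<or>
     (fst c = fst b + 1 \<and> snd c = snd b)"

definition dyck_paths :: "nat \<Rightarrow> nat \<Rightarrow> box list set" where
  "dyck_paths n i = {bs. bs \<noteq> [] \<and> set bs \<subseteq> nesting_polyomino n \<and>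
     hd bs = (int i, int i + 1) \<and> successively (south_or_east n) bs \<and>
     last bs \<in> main_diagonal n \<and> set (butlast bs) \<inter> main_diagonal n = {}}"

definition symmetric_fans :: "nat \<Rightarrow> nat \<Rightarrow> (nat \<Rightarrow> box list) set" where
  "symmetric_fans n k =
     {p \<in> (\<Pi>\<^sub>E i\<in>{1..k}. dyck_paths n i). disjoint_family_on (\<lambda>i. set (p i)) {1..k}}"

end

theory Submission
  imports Defs "HOL-Library.Multiset" "HOL-Library.Sublist"
    "HOL-Computational_Algebra.Formal_Power_Series" "HOL-Computational_Algebra.Polynomial_FPS"
begin

text \<open>
A symmetric set of boxes is recorded by its part on one side of the main diagonal: the boxes of \<^term>\<open>reps n\<close>,
one for each orbit of the mirror. Call such a part a nesting face if the symmetric set has no north-east chain of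
more than \<open>k\<close> boxes, and a crossing face if it has no south-east chain of more than \<open>k\<close> boxes with bounding
rectangle inside the polyomino. No face has more than \<open>k\<close> boxes on the main diagonal or more than
\<open>fan_dim n k\<close> boxes off it, and every face lies in a \<^emph>\<open>top\<close> face, one that attains both bounds. Hence
maximal means top, and the maximal nesting fillings, the maximal crossing fillings and the triangulations
correspond to top faces (lemma \<open>card_maximal_eq_top_faces\<close>). A symmetric fan is determined by its set of
boxes, and these sets are exactly the top nesting faces. What remains is that the two families have
equally many top faces (theorem \<open>card_top_faces\<close>). This is seen by comparing Hilbert functions.

Count the fillings by natural numbers
whose support is a face, by the weight in which an entry on the main diagonal counts once and any other
entry twice. A face with \<open>d\<close> boxes on and \<open>e\<close> boxes off the diagonal contributes
\<open>(z / (1 - z))^d (z^2 / (1 - z^2))^e\<close> to the generating function. Multiplied by the largest power of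
\<open>1 - z^2\<close> that can occur, this is a polynomial which vanishes at \<open>z = 1\<close> unless the face is top, and then
takes the value \<open>2^k\<close>. So the generating function knows the number of top faces (theorem \<open>card_top_faces_eq\<close>).

That both families have equally many fillings of each weight (theorem \<open>card_word_fillings\<close>) is a consequence of
the Robinson--Schensted--Knuth correspondence. Read every row of a filling as a weakly increasing word in the column
labels. The rows with negative labels form an \<open>n\<close> by \<open>n\<close> matrix that is symmetric about its antidiagonal.
The rows with positive labels are then added one at a time, the row labelled \<open>e + 1\<close> using letters up
to \<open>e\<close>: reading the rows from top to bottom in the nesting polyomino means prepending them to the word,
reading from bottom to top in the crossing polyomino means appending them. In both cases the forbidden chains are strictly decreasing
subsequences, and by Schensted's theorem the condition bounds the number of rows of the shapes of
certain insertion tableaux. Whether rows are prepended or appended, a filling is determined by this sequence of shapes, the same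
sequences occur (lemma \<open>word_fillings_shapes_bij\<close>), and the sequence determines the weight. The passage between
appending and prepending rests on the fact that reversing and complementing a word preserves the shape.

That every face lies in a top face is proved separately for the two families. A nesting face is
covered by a fan whose paths are the level sets of a rank function built from the lengths of longest
chains (lemma \<open>fan_above\<close>). For crossing faces, the boxes outside the face are the comparators of a sorting network on
\<open>2 (n - k)\<close> sites with the symmetry of the hyperoctahedral group; the absence of long chains says that the network sorts the
reversed sequence, and the comparators that actually exchange something form the complement of a top face
that contains the given one (lemma \<open>crossing_face_extends\<close>).
\<close>

section \<open>Words and the Knuth relations\<close>

inductive knuth :: "nat list \<Rightarrow> nat list \<Rightarrow> bool" (infix "\<approx>" 50) where
  knuth_refl: "w \<approx> w"
| knuth_sym: "w \<approx> w' \<Longrightarrow> w' \<approx> w"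
| knuth_trans: "w \<approx> w' \<Longrightarrow> w' \<approx> w'' \<Longrightarrow> w \<approx> w''"
| knuth1: "x \<le> y \<Longrightarrow> y < z \<Longrightarrow> u @ [x, z, y] @ v \<approx> u @ [z, x, y] @ v"
| knuth2: "x < y \<Longrightarrow> y \<le> z \<Longrightarrow> u @ [y, x, z] @ v \<approx> u @ [y, z, x] @ v"

declare knuth_trans [trans]

lemma knuth_context: "w \<approx> w' \<Longrightarrow> p @ w @ q \<approx> p @ w' @ q"
proof (induction rule: knuth.induct)
  case (knuth1 x y z u v)
  from knuth.knuth1[OF this, of "p @ u" "v @ q"] show ?case by simp
next
  case (knuth2 x y z u v)
  from knuth.knuth2[OF this, of "p @ u" "v @ q"] show ?case by simp
next
  case (knuth_trans w w' w'')
  from knuth.knuth_trans[OF knuth_trans.IH] show ?case .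
qed (rule knuth.knuth_refl, rule knuth.knuth_sym)

lemma knuth_mset: "w \<approx> w' \<Longrightarrow> mset w = mset w'"
  by (induction rule: knuth.induct) auto

lemma knuth_filter: "w \<approx> w' \<Longrightarrow> filter (\<lambda>x. x \<le> c) w \<approx> filter (\<lambda>x. x \<le> c) w'"
proof (induction rule: knuth.induct)
  case (knuth1 x y z u v)
  then show ?case using knuth.knuth1[OF knuth1, of "filter (\<lambda>x. x \<le> c) u" "filter (\<lambda>x. x \<le> c) v"]
    by (auto simp: knuth.knuth_refl)
next
  case (knuth2 x y z u v)
  then show ?case using knuth.knuth2[OF knuth2, of "filter (\<lambda>x. x \<le> c) u" "filter (\<lambda>x. x \<le> c) v"]
    by (auto simp: knuth.knuth_refl)
next
  case (knuth_trans w w' w'')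
  from knuth.knuth_trans[OF knuth_trans.IH] show ?case .
qed (rule knuth.knuth_refl, rule knuth.knuth_sym)

text \<open>Reversing and complementing a word over \<open>{1..N}\<close>; on tableaux this is Schuetzenberger's evacuation.\<close>

definition star :: "nat \<Rightarrow> nat list \<Rightarrow> nat list" where
  "star N w = map (\<lambda>x. Suc N - x) (rev w)"

lemma star_append: "star N (u @ v) = star N v @ star N u"
  by (simp add: star_def)

lemma star_star: "set w \<subseteq> {..Suc N} \<Longrightarrow> star N (star N w) = w"
  by (induction w) (auto simp: star_def)

lemma knuth_star: "w \<approx> w' \<Longrightarrow> set w \<subseteq> {..N} \<Longrightarrow> star N w \<approx> star N w'"
proof (induction rule: knuth.induct)
  case (knuth_sym w w')
  then have "set w = set w'" using knuth_mset[of w w'] mset_eq_setD by blast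
  then have "star N w \<approx> star N w'" using knuth_sym by simp
  then show ?case by (rule knuth.knuth_sym)
next
  case (knuth_trans w w' w'')
  then have "set w = set w'" using knuth_mset[of w w'] mset_eq_setD by blast
  then show ?case using knuth_trans.IH knuth_trans.prems knuth.knuth_trans[of "star N w" "star N w'" "star N w''"] by simp
next
  case (knuth1 x y z u v)
  then have "Suc N - z < Suc N - y" "Suc N - y \<le> Suc N - x" by auto
  from knuth.knuth2[OF this, of "star N v" "star N u"]
  show ?case by (simp add: star_def)
next
  case (knuth2 x y z u v)
  then have "Suc N - z \<le> Suc N - y" "Suc N - y < Suc N - x" by auto
  from knuth.knuth1[OF this, of "star N v" "star N u"]
  show ?case by (simp add: star_def)
qed (blast intro: knuth.intros)

subsection \<open>Strictly decreasing subsequences\<close>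

definition has_dec :: "nat list \<Rightarrow> nat \<Rightarrow> bool" where
  "has_dec w m \<longleftrightarrow> (\<exists>ys. subseq ys w \<and> sorted_wrt (>) ys \<and> length ys = m)"

lemma subseq_append3:
  assumes "subseq ys (u @ t @ v)"
  obtains a b c where "ys = a @ b @ c" "subseq a u" "subseq b t" "subseq c v"
proof -
  obtain a r where 1: "ys = a @ r" "subseq a u" "subseq r (t @ v)"
    using assms by (auto simp: subseq_append_iff)
  obtain b c where "r = b @ c" "subseq b t" "subseq c v"
    using 1(3) by (auto simp: subseq_append_iff)
  with 1 that show ?thesis by blast
qed

text \<open>Replacing a factor by one whose decreasing subsequences are as long and stay between the old letters
cannot shorten the decreasing subsequences of the whole word.\<close>

lemma has_dec_swap:
  assumes "\<And>b. subseq b t \<Longrightarrow> sorted_wrt (>) b \<Longrightarrow>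
     \<exists>b'. subseq b' t' \<and> sorted_wrt (>) b' \<and> length b' = length b \<and>
       (\<forall>x\<in>set b'. \<exists>y\<in>set b. x \<le> y) \<and> (\<forall>x\<in>set b'. \<exists>y\<in>set b. y \<le> x)"
    and "has_dec (u @ t @ v) m"
  shows "has_dec (u @ t' @ v) m"
proof -
  obtain ys where ys: "subseq ys (u @ t @ v)" "sorted_wrt (>) ys" "length ys = m"
    using assms(2) by (auto simp: has_dec_def)
  obtain a b c where abc: "ys = a @ b @ c" "subseq a u" "subseq b t" "subseq c v"
    using subseq_append3[OF ys(1)] by blast
  have sb: "sorted_wrt (>) b" using ys(2) abc(1) by (simp add: sorted_wrt_append)
  obtain b' where b': "subseq b' t'" "sorted_wrt (>) b'" "length b' = length b"
     "\<forall>x\<in>set b'. \<exists>y\<in>set b. x \<le> y" "\<forall>x\<in>set b'. \<exists>y\<in>set b. y \<le> x"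
    using assms(1)[OF abc(3) sb] by blast
  have "sorted_wrt (>) (a @ b' @ c)"
  proof -
    have 1: "x > y" if h: "x \<in> set a" "y \<in> set b'" for x y
    proof -
      obtain z where "z \<in> set b" "y \<le> z" using b'(4) h(2) by blast
      moreover have "x > z" using ys(2) h(1) \<open>z \<in> set b\<close> by (simp add: abc(1) sorted_wrt_append)
      ultimately show ?thesis by simp
    qed
    have 2: "x > y" if h: "x \<in> set b'" "y \<in> set c" for x y
    proof -
      obtain z where "z \<in> set b" "z \<le> x" using b'(5) h(1) by blast
      moreover have "z > y" using ys(2) h(2) \<open>z \<in> set b\<close> by (simp add: abc(1) sorted_wrt_append)
      ultimately show ?thesis by simp
    qed
    show ?thesis using ys(2) b'(2) 1 2 by (simp add: abc(1) sorted_wrt_append ball_Un)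
  qed
  moreover have "subseq (a @ b' @ c) (u @ t' @ v)"
    using abc b'(1) by (intro list_emb_append_mono) auto
  ultimately show ?thesis using ys(3) abc(1) b'(3) unfolding has_dec_def
    by (intro exI[of _ "a @ b' @ c"]) auto
qed

lemma subseq3:
  "subseq b [x, y, z] \<longleftrightarrow> b \<in> {[], [x], [y], [z], [x,y], [x,z], [y,z], [x,y,z]}"
  unfolding in_set_subseqs[symmetric] by (auto simp: Let_def simp del: in_set_subseqs)

text \<open>A decreasing subsequence that uses the pair \<open>z, x\<close> exchanged by a Knuth relation can use
\<open>z, y\<close> or \<open>y, x\<close> instead; all other decreasing subsequences survive the exchange.\<close>

lemma knuth_has_dec: "w \<approx> w' \<Longrightarrow> has_dec w m = has_dec w' m"
proof (induction rule: knuth.induct)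
  case (knuth1 x y z u v)
  show ?case
  proof
    assume "has_dec (u @ [x, z, y] @ v) m"
    then show "has_dec (u @ [z, x, y] @ v) m"
    proof (rule has_dec_swap[rotated])
      fix b assume "subseq b [x,z,y]" "sorted_wrt (>) b"
      then show "\<exists>b'. subseq b' [z,x,y] \<and> sorted_wrt (>) b' \<and> length b' = length b \<and>
       (\<forall>x\<in>set b'. \<exists>y\<in>set b. x \<le> y) \<and> (\<forall>x\<in>set b'. \<exists>y\<in>set b. y \<le> x)"
        using knuth1 unfolding subseq3 by (elim insertE emptyE) (rule exI[of _ b]; simp)+
    qed
  next
    assume "has_dec (u @ [z, x, y] @ v) m"
    then show "has_dec (u @ [x, z, y] @ v) m"
    proof (rule has_dec_swap[rotated])
      fix b assume b: "subseq b [z,x,y]" "sorted_wrt (>) b"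
      show "\<exists>b'. subseq b' [x,z,y] \<and> sorted_wrt (>) b' \<and> length b' = length b \<and>
       (\<forall>x\<in>set b'. \<exists>y\<in>set b. x \<le> y) \<and> (\<forall>x\<in>set b'. \<exists>y\<in>set b. y \<le> x)"
      proof (cases "b = [z,x]")
        case True
        then show ?thesis using knuth1 by (intro exI[of _ "[z,y]"]) auto
      next
        case False
        then show ?thesis using b(1)[unfolded subseq3] b(2) knuth1
          by (elim insertE emptyE) (rule exI[of _ b]; simp)+
      qed
    qed
  qed
next
  case (knuth2 x y z u v)
  show ?case
  proof
    assume "has_dec (u @ [y, x, z] @ v) m"
    then show "has_dec (u @ [y, z, x] @ v) m"
    proof (rule has_dec_swap[rotated])
      fix b assume "subseq b [y,x,z]" "sorted_wrt (>) b"
      then show "\<exists>b'. subseq b' [y,z,x] \<and> sorted_wrt (>) b' \<and> length b' = length b \<and>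
       (\<forall>x\<in>set b'. \<exists>y\<in>set b. x \<le> y) \<and> (\<forall>x\<in>set b'. \<exists>y\<in>set b. y \<le> x)"
        using knuth2 unfolding subseq3 by (elim insertE emptyE) (rule exI[of _ b]; simp)+
    qed
  next
    assume "has_dec (u @ [y, z, x] @ v) m"
    then show "has_dec (u @ [y, x, z] @ v) m"
    proof (rule has_dec_swap[rotated])
      fix b assume b: "subseq b [y,z,x]" "sorted_wrt (>) b"
      show "\<exists>b'. subseq b' [y,x,z] \<and> sorted_wrt (>) b' \<and> length b' = length b \<and>
       (\<forall>x\<in>set b'. \<exists>y\<in>set b. x \<le> y) \<and> (\<forall>x\<in>set b'. \<exists>y\<in>set b. y \<le> x)"
      proof (cases "b = [z,x]")
        case True
        then show ?thesis using knuth2 by (intro exI[of _ "[y,x]"]) auto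
      next
        case False
        then show ?thesis using b(1)[unfolded subseq3] b(2) knuth2
          by (elim insertE emptyE) (rule exI[of _ b]; simp)+
      qed
    qed
  qed
qed auto

section \<open>Insertion tableaux\<close>

subsection \<open>Row insertion\<close>

text \<open>A row of a tableau is the multiset of its letters. Inserting \<open>a\<close> displaces the least letter above
\<open>a\<close>, returned as a list of length at most one.\<close>

definition bumped :: "nat multiset \<Rightarrow> nat \<Rightarrow> nat list" where
  "bumped R a = (if \<exists>y\<in>#R. a < y then [Min {y. y \<in># R \<and> a < y}] else [])"

definition step :: "nat multiset \<Rightarrow> nat \<Rightarrow> nat multiset" where
  "step R a = add_mset a (R - mset (bumped R a))"

text \<open>A row acts as a transducer: it reads a word, keeps a state (\<open>row_insert\<close>), and emits the displaced letters
(\<open>row_output\<close>), which form the input of the next row. The rows of the insertion tableau are the final states of this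
cascade.\<close>

fun row_insert :: "nat multiset \<Rightarrow> nat list \<Rightarrow> nat multiset" where
  "row_insert R [] = R" | "row_insert R (a # w) = row_insert (step R a) w"

fun row_output :: "nat multiset \<Rightarrow> nat list \<Rightarrow> nat list" where
  "row_output R [] = []" | "row_output R (a # w) = bumped R a @ row_output (step R a) w"

lemma row_insert_append: "row_insert R (u @ v) = row_insert (row_insert R u) v"
  by (induction u arbitrary: R) auto

lemma row_output_append: "row_output R (u @ v) = row_output R u @ row_output (row_insert R u) v"
  by (induction u arbitrary: R) auto

lemma bumped_eqI:
  assumes "y \<in># R" "a < y" "\<And>z. z \<in># R \<Longrightarrow> a < z \<Longrightarrow> y \<le> z"
  shows "bumped R a = [y]"
proof -
  have "Min {y. y \<in># R \<and> a < y} = y"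
    using assms by (intro Min_eqI) (auto intro: finite_subset[of _ "set_mset R"])
  then show ?thesis using assms by (auto simp: bumped_def)
qed

lemma bumped_cases:
  obtains (None) "bumped R a = []" "\<And>z. z \<in># R \<Longrightarrow> z \<le> a"
  | (Some) y where "bumped R a = [y]" "y \<in># R" "a < y" "\<And>z. z \<in># R \<Longrightarrow> a < z \<Longrightarrow> y \<le> z"
proof (cases "\<exists>y\<in>#R. a < y")
  case True
  let ?S = "{y. y \<in># R \<and> a < y}"
  have fin: "finite ?S" by (auto intro: finite_subset[of _ "set_mset R"])
  have "Min ?S \<in> ?S" using True fin by (intro Min_in) auto
  moreover have "\<And>z. z \<in> ?S \<Longrightarrow> Min ?S \<le> z" using fin by auto
  ultimately show ?thesis using Some[of "Min ?S"] True by (auto simp: bumped_def)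
next
  case False
  then show ?thesis using None by (auto simp: bumped_def not_less)
qed

lemma step_Some: "bumped R a = [y] \<Longrightarrow> step R a = add_mset a (R - {#y#})"
  by (simp add: step_def)

lemma step_mset: "mset (bumped R a) + step R a = add_mset a R"
  by (rule bumped_cases[of R a]) (auto simp: step_def)

lemma row_insert_row_output_mset: "mset (row_output R w) + row_insert R w = mset w + R"
proof (induction w arbitrary: R)
  case (Cons a w)
  have "mset (row_output R (a # w)) + row_insert R (a # w) = mset (bumped R a) + (mset w + step R a)"
    using Cons[of "step R a"] by (simp add: add.assoc)
  also have "\<dots> = mset w + (mset (bumped R a) + step R a)" by (simp add: ac_simps)
  also have "\<dots> = mset (a # w) + R" by (simp add: step_mset)
  finally show ?case .
qed simp

lemma step_filter:
  assumes "a \<le> c"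
  shows "bumped (filter_mset (\<lambda>x. x \<le> c) R) a = filter (\<lambda>x. x \<le> c) (bumped R a)"
    and "step (filter_mset (\<lambda>x. x \<le> c) R) a = filter_mset (\<lambda>x. x \<le> c) (step R a)"
proof -
  show *: "bumped (filter_mset (\<lambda>x. x \<le> c) R) a = filter (\<lambda>x. x \<le> c) (bumped R a)"
  proof (cases R a rule: bumped_cases)
    case None
    then have "\<not> (\<exists>z\<in>#filter_mset (\<lambda>x. x \<le> c) R. a < z)" by fastforce
    then show ?thesis using None(1) by (auto simp: bumped_def)
  next
    case (Some y)
    show ?thesis
    proof (cases "y \<le> c")
      case True
      then have "bumped (filter_mset (\<lambda>x. x \<le> c) R) a = [y]" using Some by (intro bumped_eqI) auto
      then show ?thesis using True Some by simp
    next
      case False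
      have "\<not> (\<exists>z\<in>#filter_mset (\<lambda>x. x \<le> c) R. a < z)" using Some(4) False by fastforce
      then show ?thesis using False Some(1) by (auto simp: bumped_def)
    qed
  qed
  show "step (filter_mset (\<lambda>x. x \<le> c) R) a = filter_mset (\<lambda>x. x \<le> c) (step R a)"
    using assms unfolding step_def * by (simp add: multiset_eq_iff)
qed

lemma step_filter_greater:
  assumes "c < a"
  shows "filter (\<lambda>x. x \<le> c) (bumped R a) = []"
    and "filter_mset (\<lambda>x. x \<le> c) (step R a) = filter_mset (\<lambda>x. x \<le> c) R"
proof -
  show 1: "filter (\<lambda>x. x \<le> c) (bumped R a) = []"
    by (rule bumped_cases[of R a]) (use assms in auto)
  show "filter_mset (\<lambda>x. x \<le> c) (step R a) = filter_mset (\<lambda>x. x \<le> c) R"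
    by (rule bumped_cases[of R a]) (use assms in \<open>auto simp: step_def multiset_eq_iff\<close>)
qed

text \<open>Letters above \<open>c\<close> never influence those up to \<open>c\<close>, so restricting the alphabet commutes with insertion.\<close>

lemma row_insert_filter: "filter_mset (\<lambda>x. x \<le> c) (row_insert R w) =
    row_insert (filter_mset (\<lambda>x. x \<le> c) R) (filter (\<lambda>x. x \<le> c) w)"
  by (induction w arbitrary: R) (auto simp: step_filter step_filter_greater)

lemma row_output_filter: "filter (\<lambda>x. x \<le> c) (row_output R w) =
    row_output (filter_mset (\<lambda>x. x \<le> c) R) (filter (\<lambda>x. x \<le> c) w)"
  by (induction w arbitrary: R) (auto simp: step_filter step_filter_greater)

subsection \<open>Row insertion and Knuth relations\<close>

lemma remove1_in: "a \<noteq> b \<Longrightarrow> a \<in># C - {#b#} \<longleftrightarrow> a \<in># C"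
  by (auto simp: in_diff_count not_in_iff)

lemma remove_two_commute:
  assumes "q \<in># M" "r \<in># M" "q \<noteq> r"
  shows "add_mset z (add_mset x (M - {#q#}) - {#r#}) = add_mset x (add_mset z (M - {#r#}) - {#q#})"
proof -
  obtain M' where "M = add_mset q (add_mset r M')"
    using assms by (metis insert_noteq_member multi_member_split)
  then show ?thesis using assms(3) by (auto simp: multiset_eq_iff)
qed

lemma rwI: "sorted l \<Longrightarrow> mset l = A \<Longrightarrow> sorted_list_of_multiset A = l"
  by (metis sorted_list_of_multiset_mset sorted_sort_id)

text \<open>The assumption provides two letters above \<open>z\<close>, so that every insertion displaces something; this
removes the boundary cases.\<close>

lemma insertion_knuth1:
  assumes "x \<le> y" "y < z" and inf: "\<And>p. \<exists>t\<in>#R - {#p#}. z < t"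
  shows "row_insert R [x,z,y] = row_insert R [z,x,y] \<and> row_output R [x,z,y] \<approx> row_output R [z,x,y]"
proof -
  obtain g where g: "g \<in># R" "z < g" using inf by (meson in_diffD)
  obtain p where p: "bumped R x = [p]" "p \<in># R" "x < p" "\<And>t. t \<in># R \<Longrightarrow> x < t \<Longrightarrow> p \<le> t"
    by (rule bumped_cases[of R x]) (use g assms in force)+
  obtain q where q: "bumped R z = [q]" "q \<in># R" "z < q" "\<And>t. t \<in># R \<Longrightarrow> z < t \<Longrightarrow> q \<le> t"
    by (rule bumped_cases[of R z]) (use g assms in force)+
  have pq: "p \<le> q" using p(4) q assms by force
  show ?thesis
  proof (cases "p \<le> z")
    case True
    then have pnq: "p \<noteq> q" using q by simp
    let ?R1 = "add_mset x (R - {#p#})" and ?R2 = "add_mset z (R - {#q#})"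
    have b1: "bumped ?R1 z = [q]"
      by (intro bumped_eqI) (use q pnq assms(1,2) in \<open>auto simp: remove1_in dest: in_diffD\<close>)
    have b2: "bumped ?R2 x = [p]"
      by (intro bumped_eqI) (use p pnq True assms(1,2) in \<open>auto simp: remove1_in dest: in_diffD\<close>)
    let ?R3 = "add_mset z (add_mset x (R - {#p#} - {#q#}))"
    have r3: "step ?R1 z = ?R3" "step ?R2 x = ?R3"
      using b1 b2 pnq p(2) q(2)
      by (auto simp: step_Some multiset_eq_iff not_in_iff)
    obtain s where s: "bumped ?R3 y = [s]" "s \<in># ?R3" "y < s" "\<And>t. t \<in># ?R3 \<Longrightarrow> y < t \<Longrightarrow> s \<le> t"
      by (rule bumped_cases[of ?R3 y]) (use assms in force)+
    have "s \<le> z" using s(4)[of z] assms by simp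
    moreover have "p \<le> s" using s(2,3) p(4) True assms by (auto dest!: in_diffD)
    ultimately have "p \<le> s" "s < q" using q by auto
    then have "[p, q, s] \<approx> [q, p, s]" using knuth1[of p s q "[]" "[]"] by simp
    then show ?thesis
      using p(1) q(1) b1 b2 r3 s(1) step_Some[OF p(1)] step_Some[OF q(1)] by simp
  next
    case False
    then have pq: "p = q" using p q pq assms by (metis antisym not_le)
    let ?R1 = "add_mset x (R - {#p#})" and ?R2 = "add_mset z (R - {#p#})"
    have noxz: "t \<le> x \<or> z < t" if "t \<in># R" for t using p(4)[OF that] False by force
    obtain q2 where q2: "bumped ?R1 z = [q2]" "q2 \<in># ?R1" "z < q2" "\<And>t. t \<in># ?R1 \<Longrightarrow> z < t \<Longrightarrow> q2 \<le> t"
    proof (rule bumped_cases[of ?R1 z])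
      assume n: "\<And>t. t \<in># ?R1 \<Longrightarrow> t \<le> z"
      show ?thesis using n inf[of p] by force
    qed blast
    have q2R: "q2 \<in># R - {#p#}" "p \<le> q2" using q2 assms p(4)[of q2] by (auto dest: in_diffD)
    have b2: "bumped ?R2 x = [z]"
      by (rule bumped_eqI) (use noxz assms(1,2) in \<open>auto dest!: in_diffD\<close>, force)
    let ?R3 = "add_mset z (add_mset x (R - {#p#} - {#q2#}))" and ?R4 = "add_mset x (R - {#p#})"
    have r: "step ?R1 z = ?R3" "step ?R2 x = ?R4"
      using q2(1) b2 q2R by (auto simp: step_Some)
    have b3: "bumped ?R3 y = [z]"
      by (rule bumped_eqI) (use noxz assms(1,2) in \<open>auto dest!: in_diffD\<close>, force)
    have b4: "bumped ?R4 y = [q2]"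
    proof (rule bumped_eqI)
      fix t assume t: "t \<in># ?R4" "y < t"
      then have "z < t" using noxz[of t] assms by (auto dest: in_diffD)
      then show "q2 \<le> t" using q2(4) t by blast
    qed (use q2 assms in auto)
    have "step ?R3 y = step ?R4 y"
      using b3 b4 q2R by (auto simp: step_Some add_mset_commute)
    moreover have "[p, q2, z] \<approx> [p, z, q2]"
      using knuth2[of z p q2 "[]" "[]"] False q2R by (auto intro: knuth_sym)
    ultimately show ?thesis using p(1) q(1) pq q2(1) b2 r b3 b4 step_Some[OF p(1)] step_Some[OF q(1)] by simp
  qed
qed

lemma insertion_knuth2:
  assumes "x < y" "y \<le> z" and inf: "\<And>p. \<exists>t\<in>#R - {#p#}. z < t"
  shows "row_insert R [y,x,z] = row_insert R [y,z,x] \<and> row_output R [y,x,z] \<approx> row_output R [y,z,x]"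
proof -
  obtain g where g: "g \<in># R" "z < g" using inf by (meson in_diffD)
  obtain p where p: "bumped R y = [p]" "p \<in># R" "y < p" "\<And>t. t \<in># R \<Longrightarrow> y < t \<Longrightarrow> p \<le> t"
    by (rule bumped_cases[of R y]) (use g assms in force)+
  let ?R1 = "add_mset y (R - {#p#})"
  obtain q where q: "bumped ?R1 x = [q]" "q \<in># ?R1" "x < q" "\<And>t. t \<in># ?R1 \<Longrightarrow> x < t \<Longrightarrow> q \<le> t"
    by (rule bumped_cases[of ?R1 x]) (use assms in force)+
  have qy: "q \<le> y" using q(4)[of y] assms by simp
  obtain r where r: "bumped ?R1 z = [r]" "r \<in># ?R1" "z < r" "\<And>t. t \<in># ?R1 \<Longrightarrow> z < t \<Longrightarrow> r \<le> t"
  proof (rule bumped_cases[of ?R1 z])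
    assume n: "\<And>t. t \<in># ?R1 \<Longrightarrow> t \<le> z"
    show ?thesis using n inf[of p] by force
  qed blast
  have qr: "q \<noteq> r" using qy r assms by simp
  let ?R2 = "add_mset x (?R1 - {#q#})" and ?R3 = "add_mset z (?R1 - {#r#})"
  have b2: "bumped ?R2 z = [r]"
    by (rule bumped_eqI) (use r qr assms(1,2) in \<open>auto simp: remove1_in dest: in_diffD\<close>)
  have b3: "bumped ?R3 x = [q]"
  proof (rule bumped_eqI)
    show "q \<in># ?R3" using q(2) qr by (auto simp: in_diff_count)
    fix t assume "t \<in># ?R3" "x < t"
    then show "q \<le> t" using q(4) order_trans[OF qy assms(2)] by (auto dest!: in_diffD)
  qed (use q in simp)
  have s: "step ?R2 z = step ?R3 x"
    unfolding step_Some[OF b2] step_Some[OF b3] using remove_two_commute[OF q(2) r(2) qr] by simp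
  have "q < p" "p \<le> r" using qy p r assms by (auto dest!: in_diffD)
  then have "[p, q, r] \<approx> [p, r, q]" using knuth2[of q p r "[]" "[]"] by simp
  then show ?thesis using p(1) q(1) r(1) b2 b3 s step_Some[OF p(1)] step_Some[OF q(1)] step_Some[OF r(1)] by simp
qed

text \<open>The extra assumption of the two preceding lemmas costs nothing: add two very large letters to the row and afterwards
restrict the alphabet to the original letters.\<close>

lemma knuth_row_insert_row_output_aux:
  assumes *: "\<And>R :: nat multiset. (\<And>p. \<exists>t\<in>#R - {#p#}. z < t) \<Longrightarrow>
      row_insert R w = row_insert R w' \<and> row_output R w \<approx> row_output R w'"
    and "\<forall>x\<in>set w. x \<le> z" "\<forall>x\<in>set w'. x \<le> z"
  shows "row_insert R w = row_insert R w' \<and> row_output R w \<approx> row_output R w'"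
proof -
  define c where "c = Max (insert z (set_mset R))"
  have c: "z \<le> c" "\<forall>x\<in>#R. x \<le> c" by (auto simp: c_def)
  \<comment> \<open>Two copies of the large letter, because the assumption must hold after the removal of any letter.\<close>
  let ?R = "{#Suc c, Suc c#} + R"
  have f: "filter_mset (\<lambda>x. x \<le> c) ?R = R" using c by (simp add: filter_mset_eq_conv)
  have w: "filter (\<lambda>x. x \<le> c) w = w" "filter (\<lambda>x. x \<le> c) w' = w'" using assms(2,3) c(1) by (auto simp: filter_id_conv)
  have i: "\<exists>t\<in>#?R - {#p#}. z < t" for p
    using c by (intro bexI[of _ "Suc c"]) (cases "p = Suc c"; auto simp: less_Suc_eq_le remove1_in)+
  have h: "row_insert ?R w = row_insert ?R w'" "row_output ?R w \<approx> row_output ?R w'" using *[of ?R] i by blast+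
  from arg_cong[OF h(1), of "filter_mset (\<lambda>x. x \<le> c)"] knuth_filter[OF h(2), of c]
  show ?thesis unfolding row_insert_filter row_output_filter f w by blast
qed

text \<open>Knuth equivalent words lead a row to the same state, and their outputs are again equivalent. Iterating
this down the cascade shows that the whole tableau is an invariant of the plactic class.\<close>

lemma knuth_row_insert_row_output: "w \<approx> w' \<Longrightarrow> row_insert R w = row_insert R w' \<and> row_output R w \<approx> row_output R w'"
proof (induction arbitrary: R rule: knuth.induct)
  case (knuth_trans w w' w'')
  then show ?case using knuth.knuth_trans by metis
next
  case (knuth1 x y z u v)
  have h: "row_insert (row_insert R u) [x,z,y] = row_insert (row_insert R u) [z,x,y] \<and> row_output (row_insert R u) [x,z,y] \<approx> row_output (row_insert R u) [z,x,y]"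
    by (rule knuth_row_insert_row_output_aux[where z = z], rule insertion_knuth1) (use knuth1 in auto)
  show ?case
    using h knuth_context[OF conjunct2[OF h], of "row_output R u" "row_output (row_insert (row_insert R u) [x,z,y]) v"]
    by (simp only: row_insert_append row_output_append conjunct1[OF h])
next
  case (knuth2 x y z u v)
  have h: "row_insert (row_insert R u) [y,x,z] = row_insert (row_insert R u) [y,z,x] \<and> row_output (row_insert R u) [y,x,z] \<approx> row_output (row_insert R u) [y,z,x]"
    by (rule knuth_row_insert_row_output_aux[where z = z], rule insertion_knuth2) (use knuth2 in auto)
  show ?case
    using h knuth_context[OF conjunct2[OF h], of "row_output R u" "row_output (row_insert (row_insert R u) [y,x,z]) v"]
    by (simp only: row_insert_append row_output_append conjunct1[OF h])
qed (auto intro: knuth_refl knuth_sym)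

subsection \<open>A word is Knuth equivalent to its insertion tableau\<close>

abbreviation row_of :: "nat multiset \<Rightarrow> nat list" where "row_of R \<equiv> sorted_list_of_multiset R"

text \<open>Together with the next lemma this is the classical reason why row insertion respects the Knuth relations:
the new letter moves left past the larger letters of the row, then the displaced letter moves left to the front.\<close>

lemma bubble_left: "a < y \<Longrightarrow> \<forall>t\<in>set l. y \<le> t \<Longrightarrow> sorted l \<Longrightarrow> y # l @ [a] \<approx> y # a # l"
proof (induction l rule: rev_induct)
  case (snoc t l)
  let ?p = "last (y # l)"
  have p: "a < ?p" "?p \<le> t"
    using snoc.prems by (cases l rule: rev_cases; force simp: sorted_append)+
  have "y # (l @ [t]) @ [a] = butlast (y # l) @ [?p, t, a] @ []" by (simp only: append_assoc append_Nil2) (metis append.assoc append_Cons append_Nil append_butlast_last_id list.distinct(1))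
  also have "\<dots> \<approx> butlast (y # l) @ [?p, a, t] @ []" by (rule knuth_sym, rule knuth2[OF p])
  also have "\<dots> = (y # l @ [a]) @ [t]" by (simp only: append_assoc append_Nil2) (metis append.assoc append_Cons append_Nil append_butlast_last_id list.distinct(1))
  also have "\<dots> \<approx> (y # a # l) @ [t]"
    using knuth_context[of "y # l @ [a]" "y # a # l" "[]" "[t]"] snoc by (simp add: sorted_append)
  finally show ?case by simp
qed (simp add: knuth_refl)

lemma bubble_front: "a < y \<Longrightarrow> \<forall>t\<in>set l. t \<le> a \<Longrightarrow> sorted l \<Longrightarrow> l @ [y, a] \<approx> y # l @ [a]"
proof (induction l arbitrary: a rule: rev_induct)
  case (snoc t l)
  have t: "t \<le> a" "t < y" "\<forall>x\<in>set l. x \<le> t" using snoc.prems by (auto simp: sorted_append)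
  have "(l @ [t]) @ [y, a] = l @ [t, y, a] @ []" by simp
  also have "\<dots> \<approx> l @ [y, t, a] @ []" by (rule knuth1) (use snoc.prems t in auto)
  also have "\<dots> = (l @ [y, t]) @ [a]" by simp
  also have "\<dots> \<approx> (y # l @ [t]) @ [a]"
    using knuth_context[OF snoc.IH[of t], of "[]" "[a]"] t snoc.prems by (simp add: sorted_append)
  finally show ?case by simp
qed (simp add: knuth_refl)

lemma row_of_append: "\<forall>x\<in>#A. \<forall>y\<in>#B. x \<le> y \<Longrightarrow> row_of (A + B) = row_of A @ row_of B"
  by (rule rwI) (auto simp: sorted_append)

lemma insert_knuth: "row_of R @ [a] \<approx> bumped R a @ row_of (step R a)"
proof (cases R a rule: bumped_cases)
  case None
  have "row_of (R + {#a#}) = row_of R @ row_of {#a#}" by (rule row_of_append) (use None in auto)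
  then show ?thesis using None by (simp add: step_def knuth_refl)
next
  case (Some y)
  let ?L = "filter_mset (\<lambda>t. t \<le> a) R" and ?G = "filter_mset (\<lambda>t. \<not> t \<le> a) R - {#y#}"
  have G: "\<forall>t\<in>#?G. y \<le> t" using Some(4) by (auto dest!: in_diffD)
  have R: "R = ?L + ({#y#} + ?G)"
    using Some(2,3) multiset_partition[of R "\<lambda>t. t \<le> a"] by simp
  have "row_of R = row_of ?L @ row_of ({#y#} + ?G)"
    by (subst R, rule row_of_append) (use Some(3) G in force)
  also have "row_of ({#y#} + ?G) = row_of {#y#} @ row_of ?G" by (rule row_of_append) (use G in auto)
  finally have 1: "row_of R = row_of ?L @ y # row_of ?G" by simp
  have "step R a = ?L + ({#a#} + ?G)" 
    using arg_cong[OF R, of "\<lambda>M. add_mset a (M - {#y#})"] Some(1) by (simp add: step_Some)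
  then have "row_of (step R a) = row_of (?L + ({#a#} + ?G))" by simp
  also have "\<dots> = row_of ?L @ row_of ({#a#} + ?G)" by (rule row_of_append) (use Some(3) G in force)
  also have "row_of ({#a#} + ?G) = row_of {#a#} @ row_of ?G" by (rule row_of_append) (use Some(3) G in force)
  finally have 2: "row_of (step R a) = row_of ?L @ a # row_of ?G" by simp
  have "row_of R @ [a] = row_of ?L @ (y # row_of ?G @ [a]) @ []" using 1 by simp
  also have "\<dots> \<approx> row_of ?L @ (y # a # row_of ?G) @ []"
    by (rule knuth_context, rule bubble_left) (use Some(3) G in auto)
  also have "\<dots> = [] @ (row_of ?L @ [y, a]) @ row_of ?G" by simp
  also have "\<dots> \<approx> [] @ (y # row_of ?L @ [a]) @ row_of ?G"
    by (rule knuth_context, rule bubble_front) (use Some(3) in auto)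
  finally show ?thesis using 2 Some(1) by simp
qed

lemma run_knuth: "row_of R @ w \<approx> row_output R w @ row_of (row_insert R w)"
proof (induction w arbitrary: R)
  case (Cons a w)
  have "row_of R @ a # w = [] @ (row_of R @ [a]) @ w" by simp
  also have "\<dots> \<approx> [] @ (bumped R a @ row_of (step R a)) @ w" by (rule knuth_context, rule insert_knuth)
  also have "\<dots> = bumped R a @ (row_of (step R a) @ w) @ []" by simp
  also have "\<dots> \<approx> bumped R a @ (row_output (step R a) w @ row_of (row_insert (step R a) w)) @ []"
    by (rule knuth_context, rule Cons.IH)
  finally show ?case by simp
qed (simp add: knuth_refl)

subsection \<open>Insertion of a whole row\<close>

lemma row_output_Nil: "\<forall>x\<in>#R. \<forall>a\<in>set w. x \<le> a \<Longrightarrow> sorted w \<Longrightarrow> row_output R w = [] \<and> row_insert R w = mset w + R"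
proof (induction w arbitrary: R)
  case (Cons a w)
  then have "bumped R a = []" by (auto simp: bumped_def)
  then show ?case using Cons by (auto simp: step_def)
qed simp

lemma row_output_sorted: "sorted w \<Longrightarrow> sorted (row_output R w)"
proof (induction w arbitrary: R)
  case (Cons a w)
  show ?case
  proof (cases R a rule: bumped_cases)
    case None
    then show ?thesis using row_output_Nil[of R "a # w"] Cons.prems by fastforce
  next
    case (Some y)
    show ?thesis
    proof (cases w)
      case (Cons b v)
      then have ab: "a \<le> b" using Cons.prems by simp
      have IH: "sorted (bumped (step R a) b @ row_output (step (step R a) b) v)"
        using Cons.IH[of "step R a"] Cons.prems Cons by simp
      show ?thesis
      proof (cases "step R a" b rule: bumped_cases)
        case None
        then have "row_output (step R a) w = []" using row_output_Nil[of "step R a" w] Cons.prems Cons by fastforce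
        then show ?thesis using Some by simp
      next
        case (Some y')
        have "y' \<in># R - {#y#}" using Some(2,3) ab \<open>bumped R a = [y]\<close> by (simp add: step_Some)
        then have "y \<le> y'" using \<open>\<And>z. z \<in># R \<Longrightarrow> a < z \<Longrightarrow> y \<le> z\<close> Some(3) ab by (meson in_diffD le_less_trans)
        then show ?thesis using IH Some(1) \<open>bumped R a = [y]\<close> Cons by auto
      qed
    qed (use Some in simp)
  qed
qed simp

definition count_le :: "nat multiset \<Rightarrow> nat \<Rightarrow> nat" where
  "count_le R c = size (filter_mset (\<lambda>x. x \<le> c) R)"

lemma count_le_Suc: "count_le R (Suc c) = count_le R c + count R (Suc c)"
proof -
  have "filter_mset (\<lambda>x. x \<le> Suc c) R = filter_mset (\<lambda>x. x \<le> c) R + replicate_mset (count R (Suc c)) (Suc c)"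
    by (auto simp: multiset_eq_iff)
  then show ?thesis by (simp add: count_le_def)
qed

lemma size_step: "size (step R a) = (if \<exists>y\<in>#R. a < y then size R else Suc (size R))"
proof (cases R a rule: bumped_cases)
  case None
  then have "\<not> (\<exists>y\<in>#R. a < y)" by (meson not_le)
  then show ?thesis using None(1) by (simp add: step_def)
next
  case (Some y)
  then have "size R = Suc (size (R - {#y#}))" by (simp add: size_Suc_Diff1)
  then show ?thesis using Some by (auto simp: step_Some)
qed

lemma size_row_insert_mono: "size R \<le> size (row_insert R w)"
proof (induction w arbitrary: R)
  case (Cons a w)
  have "size R \<le> size (step R a)" by (simp add: size_step)
  also have "\<dots> \<le> size (row_insert (step R a) w)" by (rule Cons)
  finally show ?case by simp
qed simp

text \<open>Copies of a letter above all others serve as free places: each insertion that would lengthen the row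
consumes one of them as long as there are any.\<close>

lemma size_row_insert_replicate:
  "\<forall>x\<in>#R. x < M \<Longrightarrow> \<forall>x\<in>set w. x < M \<Longrightarrow>
    size (row_insert (R + replicate_mset p M) w) = max (size R + p) (size (row_insert R w))"
proof (induction w arbitrary: R p)
  case (Cons a w)
  show ?case
  proof (cases R a rule: bumped_cases)
    case (Some y)
    have b: "bumped (R + replicate_mset p M) a = [y]"
      by (rule bumped_eqI) (use Some Cons.prems in \<open>auto split: if_splits intro: less_imp_le\<close>)
    have s: "step (R + replicate_mset p M) a = step R a + replicate_mset p M"
      using b Some(1,2) by (simp add: step_Some)
    have "\<forall>x\<in>#step R a. x < M" using Some Cons.prems by (auto simp: step_Some dest: in_diffD)
    moreover have "size (step R a) = size R" using Some by (auto simp: size_step)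
    ultimately show ?thesis using Cons.IH[of "step R a" p] Cons.prems s by simp
  next
    case None
    have sR: "step R a = add_mset a R" using None by (simp add: step_def)
    show ?thesis
    proof (cases p)
      case 0
      then show ?thesis using size_row_insert_mono[of R "a # w"] by simp
    next
      case (Suc p')
      have b: "bumped (R + replicate_mset p M) a = [M]"
        by (rule bumped_eqI) (use None Cons.prems Suc in \<open>auto split: if_splits dest: le_less_trans\<close>)
      have s: "step (R + replicate_mset p M) a = add_mset a R + replicate_mset p' M"
        using b Suc by (simp add: step_Some)
      have "\<forall>x\<in>#add_mset a R. x < M" using Cons.prems by auto
      from Cons.IH[OF this, of p'] show ?thesis using Cons.prems s Suc sR by simp
    qed
  qed
qed (simp add: max_def)

text \<open>For a weakly increasing input the state of a row satisfies a recursion in the size of the alphabet,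
a maximum plus the number of new letters, which becomes the local growth rule below.\<close>

lemma row_insertion_row_insert:
  "count_le (row_insert R (row_of X)) (Suc c) = max (count_le R (Suc c)) (count_le (row_insert R (row_of X)) c) + count X (Suc c)"
proof -
  let ?f = "filter_mset (\<lambda>x. x \<le> Suc c)" and ?g = "filter_mset (\<lambda>x. x \<le> c)"
  have split: "?f A = ?g A + replicate_mset (count A (Suc c)) (Suc c)" for A :: "nat multiset"
    by (auto simp: multiset_eq_iff)
  have flt: "filter (\<lambda>x. x \<le> c) (row_of A) = row_of (filter_mset (\<lambda>x. x \<le> c) A)" for A :: "nat multiset" and c
    by (rule rwI[symmetric]) (simp_all only: sorted_wrt_filter sorted_sorted_list_of_multiset mset_filter mset_sorted_list_of_multiset)
  have rep: "row_of (replicate_mset n a) = replicate n a" for n and a :: nat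
    by (induction n) (auto simp: insort_is_Cons)
  have X: "row_of (?f X) = row_of (?g X) @ replicate (count X (Suc c)) (Suc c)"
    unfolding split by (subst row_of_append) (auto simp: rep)
  let ?r1 = "row_insert (?f R) (row_of (?g X))"
  have r1: "?g ?r1 = ?g (row_insert R (row_of X))"
    by (simp add: row_insert_filter flt filter_filter_mset conj_commute le_Suc_eq cong: conj_cong) 
  have le: "\<forall>x\<in>#?r1. x \<le> Suc c"
  proof
    fix x assume "x \<in># ?r1"
    then have "x \<in># mset (row_output (?f R) (row_of (?g X))) + ?r1" by simp
    then have "x \<in># mset (row_of (?g X)) + ?f R" by (simp only: row_insert_row_output_mset)
    then show "x \<le> Suc c" by auto
  qed
  have "?f (row_insert R (row_of X)) = row_insert (?f R) (row_of (?f X))" by (simp add: row_insert_filter flt)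
  also have "\<dots> = row_insert ?r1 (replicate (count X (Suc c)) (Suc c))" by (simp add: X row_insert_append)
  also have "\<dots> = mset (replicate (count X (Suc c)) (Suc c)) + ?r1"
    using le by (intro row_output_Nil[THEN conjunct2]) (auto simp: sorted_replicate)
  finally have 1: "count_le (row_insert R (row_of X)) (Suc c) = size ?r1 + count X (Suc c)" by (simp add: count_le_def)
  have "size ?r1 = max (size (?g R) + count R (Suc c)) (size (row_insert (?g R) (row_of (?g X))))"
    unfolding split[of R] by (rule size_row_insert_replicate) auto
  also have "size (?g R) + count R (Suc c) = count_le R (Suc c)" by (simp add: count_le_def split[of R])
  also have "size (row_insert (?g R) (row_of (?g X))) = count_le (row_insert R (row_of X)) c" by (simp add: count_le_def row_insert_filter flt)
  finally show ?thesis using 1 by simp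
qed

lemma row_insertion_row_output:
  "count (mset (row_output R (row_of X))) (Suc c) = min (count_le R (Suc c)) (count_le (row_insert R (row_of X)) c) - count_le R c"
proof -
  have "count (mset (row_output R (row_of X)) + row_insert R (row_of X)) (Suc c) = count (X + R) (Suc c)"
    by (simp add: row_insert_row_output_mset)
  moreover have "count_le R c \<le> count_le (row_insert R (row_of X)) c"
    unfolding count_le_def row_insert_filter by (rule size_row_insert_mono)
  ultimately show ?thesis using row_insertion_row_insert[of R X c] count_le_Suc[of R c] count_le_Suc[of "row_insert R (row_of X)" c] by simp
qed

section \<open>Growth diagrams\<close>

subsection \<open>The local rule\<close>

text \<open>\<open>strip \<kappa> \<rho>\<close> says that the partition \<open>\<rho>\<close> arises from \<open>\<kappa>\<close> by adding a horizontal strip.\<close>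

definition strip :: "(nat \<Rightarrow> nat) \<Rightarrow> (nat \<Rightarrow> nat) \<Rightarrow> bool" where
  "strip \<kappa> \<rho> \<longleftrightarrow> (\<forall>i. \<rho> (Suc i) \<le> \<kappa> i \<and> \<kappa> i \<le> \<rho> i)"

text \<open>Fomin's local rule for the Robinson--Schensted--Knuth correspondence: \<open>l\<close>, \<open>m\<close>, \<open>v\<close> are three corners of a
cell with entry \<open>x\<close>, and the result is the fourth. Its symmetry in \<open>m\<close> and \<open>v\<close> is the symmetry of the correspondence.\<close>

fun growth :: "(nat \<Rightarrow> nat) \<Rightarrow> (nat \<Rightarrow> nat) \<Rightarrow> (nat \<Rightarrow> nat) \<Rightarrow> nat \<Rightarrow> nat \<Rightarrow> nat" where
  "growth l m v x 0 = max (m 0) (v 0) + x"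
| "growth l m v x (Suc i) = max (m (Suc i)) (v (Suc i)) + min (m i) (v i) - l i"

text \<open>The corner opposite to \<open>r\<close>, recovered from the other three.\<close>

definition growth_inv :: "(nat \<Rightarrow> nat) \<Rightarrow> (nat \<Rightarrow> nat) \<Rightarrow> (nat \<Rightarrow> nat) \<Rightarrow> nat \<Rightarrow> nat" where
  "growth_inv m v r i = max (m (Suc i)) (v (Suc i)) + min (m i) (v i) - r (Suc i)"

lemma growth_commute: "growth l m v x i = growth l v m x i"
  by (cases i) (auto simp: max.commute min.commute)

lemma growth_strip:
  assumes "strip l m" "strip l v"
  shows "strip m (growth l m v x)" "strip v (growth l m v x)"
proof -
  have "growth l m v x (Suc i) \<le> m i \<and> m i \<le> growth l m v x i" for i
    using assms[unfolded strip_def, rule_format, of i] assms[unfolded strip_def, rule_format, of "i - 1"]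
    by (cases i) (auto simp: max_def min_def)
  then show "strip m (growth l m v x)" by (simp add: strip_def)
  have "growth l m v x (Suc i) \<le> v i \<and> v i \<le> growth l m v x i" for i
    using assms[unfolded strip_def, rule_format, of i] assms[unfolded strip_def, rule_format, of "i - 1"]
    by (cases i) (auto simp: max_def min_def)
  then show "strip v (growth l m v x)" by (simp add: strip_def)
qed

lemma growth_inv_strip:
  assumes "strip m r" "strip v r"
  shows "strip (growth_inv m v r) m" "strip (growth_inv m v r) v"
    and "growth (growth_inv m v r) m v (r 0 - max (m 0) (v 0)) = r"
proof -
  note s = assms[unfolded strip_def, rule_format]
  have "m (Suc i) \<le> growth_inv m v r i \<and> growth_inv m v r i \<le> m i \<and> v (Suc i) \<le> growth_inv m v r i \<and> growth_inv m v r i \<le> v i" for i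
    using s[of i] s[of "Suc i"] unfolding growth_inv_def max_def min_def by (simp split: if_splits) linarith
  then show "strip (growth_inv m v r) m" "strip (growth_inv m v r) v" by (simp_all add: strip_def)
  show "growth (growth_inv m v r) m v (r 0 - max (m 0) (v 0)) = r"
  proof
    fix i show "growth (growth_inv m v r) m v (r 0 - max (m 0) (v 0)) i = r i"
    proof (cases i)
      case (Suc j)
      then show ?thesis using s[of j] s[of "Suc j"] by (auto simp: growth_inv_def max_def min_def)
    qed (use s in auto)
  qed
qed

lemma growth_inv_growth:
  assumes "strip l m" "strip l v"
  shows "growth_inv m v (growth l m v x) = l" "growth l m v x 0 - max (m 0) (v 0) = x"
proof
  note s = assms[unfolded strip_def, rule_format]
  fix i show "growth_inv m v (growth l m v x) i = l i"
    using s[of i] by (auto simp: growth_inv_def max_def min_def)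
qed simp

subsection \<open>Insertion tableaux as chains of shapes\<close>

definition tableau_row :: "nat \<Rightarrow> nat list \<Rightarrow> nat multiset" where
  "tableau_row i w = row_insert {#} ((row_output {#} ^^ i) w)"

text \<open>The insertion tableau seen as a chain of partitions: \<open>shape w c\<close> is the shape formed by its letters up to \<open>c\<close>.\<close>

definition shape :: "nat list \<Rightarrow> nat \<Rightarrow> nat \<Rightarrow> nat" where
  "shape w c i = count_le (tableau_row i w) c"

lemma knuth_pow_row_output: "w \<approx> w' \<Longrightarrow> (row_output {#} ^^ i) w \<approx> (row_output {#} ^^ i) w'"
  by (induction i) (use knuth_row_insert_row_output in auto)

lemma knuth_tableau_row: "w \<approx> w' \<Longrightarrow> tableau_row i w = tableau_row i w'"
  unfolding tableau_row_def using knuth_row_insert_row_output[OF knuth_pow_row_output] by blast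

lemma knuth_shape: "w \<approx> w' \<Longrightarrow> shape w = shape w'"
  by (simp add: shape_def fun_eq_iff knuth_tableau_row)

lemma pow_row_output_filter:
  "(row_output {#} ^^ i) (filter (\<lambda>x. x \<le> c) w) = filter (\<lambda>x. x \<le> c) ((row_output {#} ^^ i) w)"
  by (induction i) (simp_all add: row_output_filter)

lemma shape_filter: "shape (filter (\<lambda>x. x \<le> c) w) d i = shape w (min c d) i"
proof -
  have "tableau_row i (filter (\<lambda>x. x \<le> c) w) = filter_mset (\<lambda>x. x \<le> c) (tableau_row i w)"
    unfolding tableau_row_def pow_row_output_filter row_insert_filter by simp
  moreover have "filter_mset (\<lambda>x. x \<le> d) (filter_mset (\<lambda>x. x \<le> c) M) = filter_mset (\<lambda>x. x \<le> min c d) M" for M :: "nat multiset"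
    by (auto simp: multiset_eq_iff)
  ultimately show ?thesis by (simp add: shape_def count_le_def)
qed

lemma set_row_output: "set (row_output R w) \<subseteq> set_mset R \<union> set w" "set_mset (row_insert R w) \<subseteq> set_mset R \<union> set w"
  using arg_cong[OF row_insert_row_output_mset[of R w], of set_mset] by auto

lemma set_pow_row_output: "set ((row_output {#} ^^ i) w) \<subseteq> set w"
  by (induction i) (use set_row_output(1) in fastforce)+

lemma set_tableau_row: "set_mset (tableau_row i w) \<subseteq> set w"
  using set_row_output(2)[of "{#}" "(row_output {#} ^^ i) w"] set_pow_row_output[of i w] by (auto simp: tableau_row_def)

lemma shape_0: "0 \<notin> set w \<Longrightarrow> shape w 0 i = 0"
  using set_tableau_row[of i w] by (auto simp: shape_def count_le_def filter_mset_eq_conv intro!: gr0I)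

lemma shape_beyond: "set w \<subseteq> {..N} \<Longrightarrow> N \<le> c \<Longrightarrow> shape w c i = size (tableau_row i w)"
  using set_tableau_row[of i w] by (force simp: shape_def count_le_def intro!: arg_cong[of _ _ size] filter_mset_eq_conv[THEN iffD2])

fun bumped_row :: "nat \<Rightarrow> nat list \<Rightarrow> nat multiset \<Rightarrow> nat multiset" where
  "bumped_row 0 u X = X"
| "bumped_row (Suc i) u X = mset (row_output (tableau_row i u) (row_of (bumped_row i u X)))"

lemma pow_row_output_append_row: "(row_output {#} ^^ i) (u @ row_of X) = (row_output {#} ^^ i) u @ row_of (bumped_row i u X)"
  by (induction i) (simp_all add: row_output_append sorted_sort_id row_output_sorted tableau_row_def)

lemma tableau_row_append_row: "tableau_row i (u @ row_of X) = row_insert (tableau_row i u) (row_of (bumped_row i u X))"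
  by (simp add: tableau_row_def pow_row_output_append_row row_insert_append)

text \<open>Appending a weakly increasing word to \<open>u\<close> adds one column of cells to the growth diagram, whose entries are the multiplicities in \<open>X\<close>.\<close>

lemma shape_append_row:
  "shape (u @ row_of X) (Suc c) = growth (shape u c) (shape u (Suc c)) (shape (u @ row_of X) c) (count X (Suc c))"
proof
  fix i
  have *: "shape (u @ row_of X) (Suc c) j = max (shape u (Suc c) j) (shape (u @ row_of X) c j) + count (bumped_row j u X) (Suc c)" for j
    unfolding shape_def tableau_row_append_row by (rule row_insertion_row_insert)
  show "shape (u @ row_of X) (Suc c) i = growth (shape u c) (shape u (Suc c)) (shape (u @ row_of X) c) (count X (Suc c)) i"
  proof (cases i)
    case (Suc j)
    have "count (bumped_row (Suc j) u X) (Suc c) = min (shape u (Suc c) j) (shape (u @ row_of X) c j) - shape u c j"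
      using row_insertion_row_output[of "tableau_row j u" "bumped_row j u X" c] by (simp add: shape_def tableau_row_append_row)
    moreover have "shape u c j \<le> min (shape u (Suc c) j) (shape (u @ row_of X) c j)"
      unfolding shape_def tableau_row_append_row using size_row_insert_mono[of "filter_mset (\<lambda>x. x \<le> c) (tableau_row j u)"]
      by (simp add: count_le_Suc count_le_def[of _ c] row_insert_filter)
    ultimately show ?thesis using *[of i] Suc by simp
  qed (use *[of 0] in simp)
qed

lemma append_row_strips:
  assumes "\<And>c. strip (shape u c) (shape u (Suc c))" "0 \<notin> set u" "0 \<notin># X"
  shows "strip (shape u c) (shape (u @ row_of X) c) \<and> strip (shape (u @ row_of X) c) (shape (u @ row_of X) (Suc c))"
proof -
  have z: "shape (u @ row_of X) 0 i = 0" "shape u 0 i = 0" for i using assms by (auto intro!: shape_0)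
  have s: "strip (shape u c) (shape (u @ row_of X) c)" for c
  proof (induction c)
    case (Suc c)
    show ?case unfolding shape_append_row[of u X c] by (rule growth_strip(1)[OF assms(1) Suc])
  qed (simp add: strip_def z)
  show ?thesis using s[of c] growth_strip(2)[OF assms(1) s] unfolding shape_append_row[of u X c] by blast
qed

lemma shape_strip: "0 \<notin> set w \<Longrightarrow> strip (shape w c) (shape w (Suc c))"
proof (induction w arbitrary: c rule: rev_induct)
  case Nil
  have "(row_output {#} ^^ i) [] = []" for i by (induction i) auto
  then have "tableau_row i [] = {#}" for i by (simp add: tableau_row_def)
  then show ?case by (simp add: strip_def shape_def count_le_def)
next
  case (snoc a w)
  then show ?case using append_row_strips[of w "{#a#}" c] by simp
qed

lemma shape_strip_row: "0 \<notin> set u \<Longrightarrow> 0 \<notin># X \<Longrightarrow> strip (shape u c) (shape (u @ row_of X) c)"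
  using append_row_strips[of u X c] shape_strip by blast

text \<open>Gelfand--Tsetlin patterns: tableaux with letters in \<open>{1..N}\<close> given as chains of partitions. Beyond \<open>N\<close> the chain is constant,
so that a pattern is determined by its values up to \<open>N\<close>.\<close>

definition GT :: "nat \<Rightarrow> (nat \<Rightarrow> nat \<Rightarrow> nat) \<Rightarrow> bool" where
  "GT N P \<longleftrightarrow> (\<forall>i. P 0 i = 0) \<and> (\<forall>c<N. strip (P c) (P (Suc c))) \<and> (\<forall>c\<ge>N. P c = P N)"

lemma shape_GT: "set w \<subseteq> {1..N} \<Longrightarrow> GT N (shape w)"
proof -
  assume w: "set w \<subseteq> {1..N}"
  then have "0 \<notin> set w" "set w \<subseteq> {..N}" by auto
  then show ?thesis by (auto simp: GT_def shape_0 shape_strip shape_beyond fun_eq_iff)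
qed

definition tableau_word :: "nat \<Rightarrow> nat list \<Rightarrow> nat list" where
  "tableau_word k w = concat (map (\<lambda>i. row_of (tableau_row i w)) (rev [0..<k]))"

lemma length_pow_row_output: "length ((row_output {#} ^^ i) w) + (\<Sum>j<i. size (tableau_row j w)) = length w"
proof (induction i)
  case (Suc i)
  have "length (row_output {#} v) + size (row_insert {#} v) = length v" for v
    using arg_cong[OF row_insert_row_output_mset[of "{#}" v], of size] by simp
  from this[of "(row_output {#} ^^ i) w"] Suc show ?case by (simp add: tableau_row_def)
qed simp

lemma length_row_output_less: "w \<noteq> [] \<Longrightarrow> length (row_output {#} w) < length w"
proof -
  assume "w \<noteq> []"
  then obtain a v where w: "w = a # v" by (cases w) auto
  have "size (step {#} a) \<le> size (row_insert {#} w)" unfolding w by (simp add: size_row_insert_mono)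
  then show ?thesis using arg_cong[OF row_insert_row_output_mset[of "{#}" w], of size] by (simp add: step_def)
qed

lemma pow_row_output_Nil: "length w \<le> k \<Longrightarrow> (row_output {#} ^^ k) w = []"
proof (induction k arbitrary: w)
  case (Suc k)
  show ?case
  proof (cases w)
    case (Cons a v)
    then have "length (row_output {#} w) \<le> k" using length_row_output_less[of w] Suc.prems by simp
    then show ?thesis using Suc.IH by (simp add: funpow_swap1)
  next
    case Nil
    then show ?thesis using set_pow_row_output[of "Suc k" "[]"] by auto
  qed
qed simp

lemma knuth_tableau_word: "w \<approx> (row_output {#} ^^ k) w @ tableau_word k w"
proof (induction k)
  case (Suc k)
  let ?v = "(row_output {#} ^^ k) w"
  have "?v @ tableau_word k w \<approx> (row_output {#} ?v @ row_of (row_insert {#} ?v)) @ tableau_word k w"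
    using knuth_context[OF run_knuth[of "{#}" ?v], of "[]" "tableau_word k w"] by simp
  from knuth_trans[OF Suc this] show ?case by (simp add: tableau_word_def tableau_row_def)
qed (simp add: tableau_word_def knuth_refl)

lemma knuth_tableau_word_full: "length w \<le> k \<Longrightarrow> w \<approx> tableau_word k w"
  using knuth_tableau_word[of w k] pow_row_output_Nil[of w k] by simp

text \<open>The tableau, hence its reading word, can be read off from the shapes, and each word is equivalent to that reading word.\<close>

lemma shape_eq_knuth:
  assumes "shape u = shape v" "0 \<notin> set u" "0 \<notin> set v"
  shows "u \<approx> v"
proof -
  have "tableau_row i u = tableau_row i v" for i
  proof (rule multiset_eqI)
    fix a
    have "0 \<notin># tableau_row i u" "0 \<notin># tableau_row i v" using set_tableau_row assms by blast+
    moreover have "count (tableau_row i w) (Suc c) = shape w (Suc c) i - shape w c i" for w c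
      by (simp add: shape_def count_le_Suc)
    ultimately show "count (tableau_row i u) a = count (tableau_row i v) a"
      using assms(1) by (cases a) (auto simp: not_in_iff)
  qed
  then have "tableau_word k u = tableau_word k v" for k by (simp add: tableau_word_def)
  then show ?thesis
    using knuth_tableau_word_full[of u "length u + length v"] knuth_tableau_word_full[of v "length u + length v"]
    by (metis knuth_sym knuth_trans le_add1 le_add2)
qed

subsection \<open>Reversing and complementing a word preserves the shape\<close>

definition row_word :: "nat \<Rightarrow> nat list \<Rightarrow> bool" where
  "row_word j w \<longleftrightarrow> (\<exists>ls. length ls = j \<and> (\<forall>l\<in>set ls. sorted l) \<and> w = concat ls)"

lemma row_word_row_output: "row_word j w \<Longrightarrow> row_word j (row_output R w)"
proof (induction j arbitrary: w R)
  case 0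
  then show ?case by (simp add: row_word_def)
next
  case (Suc j)
  then obtain l ls where l: "length ls = j" "\<forall>l\<in>set ls. sorted l" "sorted l" "w = l @ concat ls"
    by (auto simp: row_word_def length_Suc_conv)
  have "row_word j (concat ls)" using l by (auto simp: row_word_def)
  from Suc.IH[OF this] obtain ls' where "length ls' = j" "\<forall>l\<in>set ls'. sorted l" "row_output (row_insert R l) (concat ls) = concat ls'"
    by (auto simp: row_word_def)
  then show ?case unfolding row_word_def using l(3,4) row_output_sorted
    by (intro exI[of _ "row_output R l # ls'"]) (auto simp: row_output_append)
qed

lemma row_word_pow_row_output: "row_word j w \<Longrightarrow> (row_output {#} ^^ j) w = []"
proof (induction j arbitrary: w)
  case (Suc j)
  then obtain l ls where l: "length ls = j" "\<forall>l\<in>set ls. sorted l" "sorted l" "w = l @ concat ls"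
    by (auto simp: row_word_def length_Suc_conv)
  have "row_word j (concat ls)" using l by (auto simp: row_word_def)
  moreover have "row_output {#} w = row_output (row_insert {#} l) (concat ls)"
    using l row_output_Nil[of "{#}" l] by (simp add: row_output_append)
  ultimately show ?case using Suc.IH row_word_row_output by (simp add: funpow_swap1)
qed (auto simp: row_word_def)

lemma size_tableau_row_append: "size (tableau_row i u) \<le> size (tableau_row i (u @ v))"
proof -
  have "\<exists>v'. (row_output {#} ^^ i) (u @ v) = (row_output {#} ^^ i) u @ v'"
    by (induction i) (auto simp: row_output_append)
  then obtain v' where "(row_output {#} ^^ i) (u @ v) = (row_output {#} ^^ i) u @ v'" by blast
  then show ?thesis by (simp add: tableau_row_def row_insert_append size_row_insert_mono)
qed

text \<open>A half of Greene's theorem. A row emits a concatenation of \<open>j\<close> weakly increasing words when fed with one,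
and the first of these words passes the empty row without output; so such a word is absorbed by the first \<open>j\<close> rows.\<close>

lemma rows_dominate:
  assumes "row_word j u"
  shows "length u \<le> (\<Sum>i<j. size (tableau_row i (u @ v)))"
proof -
  have "length u = (\<Sum>i<j. size (tableau_row i u))"
    using length_pow_row_output[of j u] row_word_pow_row_output[OF assms] by simp
  also have "\<dots> \<le> (\<Sum>i<j. size (tableau_row i (u @ v)))" by (intro sum_mono size_tableau_row_append)
  finally show ?thesis .
qed

lemma star_sorted: "sorted l \<Longrightarrow> sorted (star N l)"
  unfolding star_def sorted_wrt_map sorted_wrt_rev by (erule sorted_wrt_mono_rel[rotated]) simp

lemma star_concat: "star N (concat ls) = concat (map (star N) (rev ls))"
  by (induction ls) (simp_all add: star_append star_def)

lemma length_star [simp]: "length (star N w) = length w"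
  by (simp add: star_def)

lemma set_star: "set w \<subseteq> {1..N} \<Longrightarrow> set (star N w) \<subseteq> {1..N}"
  by (fastforce simp: star_def)

text \<open>The image under \<open>star\<close> of the reading word of a tableau begins with the images of its first \<open>j\<close> rows, which
are weakly increasing, so the preceding lemma applies. As \<open>star\<close> is an involution, equality follows.\<close>

lemma star_dominates:
  assumes "set w \<subseteq> {1..N}"
  shows "(\<Sum>i<j. size (tableau_row i w)) \<le> (\<Sum>i<j. size (tableau_row i (star N w)))"
proof -
  define k where "k = j + length w"
  have "w \<approx> tableau_word k w" by (rule knuth_tableau_word_full) (simp add: k_def)
  then have "star N w \<approx> star N (tableau_word k w)" by (rule knuth_star) (use assms in auto)
  moreover have "star N (tableau_word k w) = concat (map (\<lambda>i. star N (row_of (tableau_row i w))) [0..<k])"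
    by (simp add: tableau_word_def star_concat rev_map comp_def)
  moreover have "[0..<k] = [0..<j] @ [j..<k]" unfolding k_def by (rule upt_add_eq_append) simp
  ultimately have e: "star N w \<approx> concat (map (\<lambda>i. star N (row_of (tableau_row i w))) [0..<j]) @
     concat (map (\<lambda>i. star N (row_of (tableau_row i w))) [j..<k])" (is "_ \<approx> ?u @ ?v") by simp
  have "row_word j ?u" unfolding row_word_def
    by (intro exI[of _ "map (\<lambda>i. star N (row_of (tableau_row i w))) [0..<j]"]) (auto simp: star_sorted)
  from rows_dominate[OF this, of ?v] have "length ?u \<le> (\<Sum>i<j. size (tableau_row i (star N w)))"
    by (simp add: knuth_tableau_row[OF e])
  moreover have "length (row_of M) = size M" for M
    by (metis mset_sorted_list_of_multiset size_mset)
  then have "length ?u = (\<Sum>i<j. size (tableau_row i w))"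
    by (simp add: length_concat comp_def interv_sum_list_conv_sum_set_nat atLeast0LessThan)
  ultimately show ?thesis by simp
qed

lemma star_shape:
  assumes "set w \<subseteq> {1..N}"
  shows "size (tableau_row i (star N w)) = size (tableau_row i w)"
proof -
  have ss: "star N (star N w) = w" by (rule star_star) (use assms in auto)
  have "(\<Sum>i<j. size (tableau_row i w)) = (\<Sum>i<j. size (tableau_row i (star N w)))" for j
    using star_dominates[OF assms, of j] star_dominates[OF set_star[OF assms], of j] ss by simp
  from this[of "Suc i"] this[of i] show ?thesis by simp
qed

lemma shape_star_shape: "set w \<subseteq> {1..N} \<Longrightarrow> shape (star N w) N = shape w N"
proof
  fix i assume w: "set w \<subseteq> {1..N}"
  then have "set w \<subseteq> {..N}" "set (star N w) \<subseteq> {..N}" using set_star[OF w] by auto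
  then show "shape (star N w) N i = shape w N i" using star_shape[OF w] by (simp add: shape_beyond)
qed

lemma row_insert_empty_iff: "row_insert {#} v = {#} \<longleftrightarrow> v = []"
proof (cases v)
  case (Cons a u)
  have "size (step {#} a) \<le> size (row_insert {#} v)" unfolding Cons by (simp add: size_row_insert_mono)
  then show ?thesis using Cons by (auto simp: step_def)
qed simp

lemma has_dec_sorted_append: "sorted l \<Longrightarrow> has_dec (l @ v) (Suc m) \<Longrightarrow> has_dec v m"
proof -
  assume l: "sorted l" and "has_dec (l @ v) (Suc m)"
  then obtain ys where ys: "subseq ys (l @ v)" "sorted_wrt (>) ys" "length ys = Suc m"
    by (auto simp: has_dec_def)
  then obtain a b where ab: "ys = a @ b" "subseq a l" "subseq b v" by (auto simp: subseq_append_iff)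
  have sa: "sorted a" using ab(2) l using sorted_nths by (auto simp: subseq_conv_nths)
  have "length a \<le> 1"
  proof (rule ccontr)
    assume "\<not> length a \<le> 1"
    then obtain x y c where "a = x # y # c" by (cases a; cases "tl a") auto
    then show False using sa ys(2) ab(1) by auto
  qed
  then have "length b \<ge> m" using ys(3) ab(1) by simp
  then have "subseq (drop (length b - m) b) v" "sorted_wrt (>) (drop (length b - m) b)"
      "length (drop (length b - m) b) = m"
    using ab ys(2) by (auto simp: sorted_wrt_append sorted_wrt_drop intro: subseq_order.trans[OF suffix_imp_subseq[OF suffix_drop]])
  then show ?thesis unfolding has_dec_def by blast
qed

lemma row_word_has_dec: "row_word k w \<Longrightarrow> \<not> has_dec w (Suc k)"
proof (induction k arbitrary: w)
  case 0
  then show ?case by (auto simp: row_word_def has_dec_def)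
next
  case (Suc k)
  then obtain l ls where l: "length ls = k" "\<forall>l\<in>set ls. sorted l" "sorted l" "w = l @ concat ls"
    by (auto simp: row_word_def length_Suc_conv)
  have "row_word k (concat ls)" using l by (auto simp: row_word_def)
  then show ?case using Suc.IH has_dec_sorted_append l by blast
qed

lemma has_dec_prefix: "has_dec v m \<Longrightarrow> has_dec (u @ v) m"
  unfolding has_dec_def using list_emb_append2 by blast

text \<open>Every letter of row \<open>j\<close> has a smaller letter in the row above it, because consecutive shapes differ by horizontal strips.
Climbing to the first row produces a decreasing subsequence of the reading word.\<close>

lemma tableau_word_column:
  assumes "0 \<notin> set w" "a \<in># tableau_row j w"
  shows "\<exists>ys. subseq (a # ys) (tableau_word (Suc j) w) \<and> sorted_wrt (>) (a # ys) \<and> length ys = j"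
  using assms(2)
proof (induction j arbitrary: a)
  case 0
  then show ?case by (auto simp: tableau_word_def subseq_singleton_left)
next
  case (Suc j)
  have "a \<noteq> 0" using subsetD[OF set_tableau_row Suc.prems] assms(1) by metis
  then obtain c where a: "a = Suc c" by (cases a) auto
  have "0 < shape w (Suc c) (Suc j)" using Suc.prems a by (auto simp: shape_def count_le_def size_eq_0_iff_empty filter_mset_eq_conv simp flip: nonempty_has_size)
  also have "\<dots> \<le> shape w c j" using shape_strip[OF assms(1), of c] by (auto simp: strip_def)
  finally have "filter_mset (\<lambda>x. x \<le> c) (tableau_row j w) \<noteq> {#}" unfolding shape_def count_le_def nonempty_has_size .
  then obtain b where "b \<in># filter_mset (\<lambda>x. x \<le> c) (tableau_row j w)" by (meson multiset_nonemptyE)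
  then have b: "b \<in># tableau_row j w" "b \<le> c" by auto
  obtain ys where ys: "subseq (b # ys) (tableau_word (Suc j) w)" "sorted_wrt (>) (b # ys)" "length ys = j"
    using Suc.IH[OF b(1)] by blast
  have "tableau_word (Suc (Suc j)) w = row_of (tableau_row (Suc j) w) @ tableau_word (Suc j) w" by (simp add: tableau_word_def)
  moreover have "subseq [a] (row_of (tableau_row (Suc j) w))" using Suc.prems by (simp add: subseq_singleton_left)
  ultimately have "subseq (a # b # ys) (tableau_word (Suc (Suc j)) w)"
    using ys(1) list_emb_append_mono[of "(=)" "[a]" "row_of (tableau_row (Suc j) w)" "b # ys"] by simp
  then show ?case using ys a b(2) by (intro exI[of _ "b # ys"]) auto
qed

text \<open>Schensted's theorem: the longest strictly decreasing subsequence is as long as the first column of the tableau.\<close>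

lemma has_dec_iff: "0 \<notin> set w \<Longrightarrow> has_dec w (Suc k) \<longleftrightarrow> tableau_row k w \<noteq> {#}"
proof
  assume "has_dec w (Suc k)"
  show "tableau_row k w \<noteq> {#}"
  proof
    assume "tableau_row k w = {#}"
    then have "(row_output {#} ^^ k) w = []" by (simp add: tableau_row_def row_insert_empty_iff)
    then have "w \<approx> tableau_word k w" using knuth_tableau_word[of w k] by simp
    moreover have "row_word k (tableau_word k w)" unfolding row_word_def tableau_word_def
      by (intro exI[of _ "map (\<lambda>i. row_of (tableau_row i w)) (rev [0..<k])"]) auto
    ultimately show False using \<open>has_dec w (Suc k)\<close> row_word_has_dec knuth_has_dec by blast
  qed
next
  assume "0 \<notin> set w" "tableau_row k w \<noteq> {#}"
  then obtain a where "a \<in># tableau_row k w" by (meson multiset_nonemptyE)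
  from tableau_word_column[OF \<open>0 \<notin> set w\<close> this] have "has_dec (tableau_word (Suc k) w) (Suc k)"
    unfolding has_dec_def by (metis length_Cons)
  then show "has_dec w (Suc k)" using knuth_has_dec[OF knuth_tableau_word[of w "Suc k"]] has_dec_prefix by blast
qed

subsection \<open>The Pieri bijection\<close>

lemma GT_0: "GT N P \<Longrightarrow> P 0 = (\<lambda>_. 0)"
  by (simp add: GT_def fun_eq_iff)

lemma GT_strip: "GT N P \<Longrightarrow> c < N \<Longrightarrow> strip (P c) (P (Suc c))"
  by (simp add: GT_def)

lemma GT_beyond: "GT N P \<Longrightarrow> N \<le> c \<Longrightarrow> P c = P N"
  unfolding GT_def by blast

lemma GT_I: "(\<And>i. P 0 i = 0) \<Longrightarrow> (\<And>c. c < N \<Longrightarrow> strip (P c) (P (Suc c))) \<Longrightarrow>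
    (\<And>c. N \<le> c \<Longrightarrow> P c = P N) \<Longrightarrow> GT N P"
  unfolding GT_def by blast

lemma GT_mono:
  assumes "GT N P" "c \<le> d" shows "P c i \<le> P d i"
  using assms(2)
proof (induction rule: dec_induct)
  case (step n)
  have "P n i \<le> P (Suc n) i"
  proof (cases "n < N")
    case False
    then have "P (Suc n) = P n" using GT_beyond[OF assms(1), of n] GT_beyond[OF assms(1), of "Suc n"] by simp
    then show ?thesis by simp
  qed (use GT_strip[OF assms(1)] in \<open>auto simp: strip_def\<close>)
  then show ?case using step by simp
qed simp

lemma GT_ext: "GT N P \<Longrightarrow> GT N Q \<Longrightarrow> (\<And>c. c \<le> N \<Longrightarrow> P c = Q c) \<Longrightarrow> P = Q"
  using GT_beyond[of N P] GT_beyond[of N Q] by (metis ext nat_le_linear order_refl)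

lemma GT_zero: "GT N P \<Longrightarrow> P N = (\<lambda>_. 0) \<Longrightarrow> P = (\<lambda>_ _. 0)"
proof (intro ext)
  fix c i assume P: "GT N P" "P N = (\<lambda>_. 0)"
  show "P c i = 0"
  proof (cases "c \<le> N")
    case True then show ?thesis using GT_mono[OF P(1) True, of i] P(2) by simp
  next
    case False then show ?thesis using GT_beyond[OF P(1), of c] P(2) by simp
  qed
qed

lemma GT_restrict: "GT (Suc N) P \<Longrightarrow> GT N (\<lambda>c. P (min c N))"
  by (rule GT_I) (use GT_0[of "Suc N" P] GT_strip[of "Suc N" P] in \<open>auto simp: min_def\<close>)

text \<open>One column of a growth diagram, with \<open>l\<close> on its left and \<open>r\<close> on its right.\<close>

definition grows :: "nat \<Rightarrow> (nat \<Rightarrow> nat \<Rightarrow> nat) \<Rightarrow> nat multiset \<Rightarrow> (nat \<Rightarrow> nat \<Rightarrow> nat) \<Rightarrow> bool" where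
  "grows N l X r \<longleftrightarrow> (\<forall>c<N. r (Suc c) = growth (l c) (l (Suc c)) (r c) (count X (Suc c)))"

text \<open>Going down from \<open>N\<close>, the inverse of the local rule recovers the left side of a column of the growth diagram together with its
entries from the right side and the last shape on the left.\<close>

lemma pieri_exists:
  assumes "GT N r" "strip \<kappa> (r N)"
  shows "\<exists>l X. GT N l \<and> l N = \<kappa> \<and> set_mset X \<subseteq> {1..N} \<and> grows N l X r"
  using assms
proof (induction N arbitrary: r \<kappa>)
  case 0
  then have "\<kappa> = (\<lambda>_. 0)" using GT_0[OF 0(1)] by (auto simp: strip_def fun_eq_iff)
  then show ?case by (intro exI[of _ "\<lambda>_ _. 0"] exI[of _ "{#}"]) (auto simp: GT_def grows_def)
next
  case (Suc N)
  define \<kappa>' where "\<kappa>' = growth_inv \<kappa> (r N) (r (Suc N))"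
  define x where "x = r (Suc N) 0 - max (\<kappa> 0) (r N 0)"
  have s: "strip (r N) (r (Suc N))" using GT_strip[OF Suc.prems(1)] by simp
  note i = growth_inv_strip[OF Suc.prems(2) s, folded \<kappa>'_def x_def]
  have "strip \<kappa>' ((\<lambda>c. r (min c N)) N)" using i(2) by simp
  from Suc.IH[OF GT_restrict[OF Suc.prems(1)] this] obtain l X where l: "GT N l" "l N = \<kappa>'"
    "set_mset X \<subseteq> {1..N}" "grows N l X (\<lambda>c. r (min c N))" by blast
  let ?l = "\<lambda>c. if c \<le> N then l c else \<kappa>" and ?X = "X + replicate_mset x (Suc N)"
  have "strip (l c) (l (Suc c))" if "c < N" for c using GT_strip[OF l(1) that] .
  then have "GT (Suc N) ?l" using GT_0[OF l(1)] l(2) i(1) by (intro GT_I) (auto simp: less_Suc_eq)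
  moreover have "set_mset ?X \<subseteq> {1..Suc N}" using l(3) by auto
  moreover have "Suc N \<notin># X" using l(3) by auto
  then have "grows (Suc N) ?l ?X r" unfolding grows_def
    using l(2,4) i(3) by (auto simp: grows_def less_Suc_eq not_in_iff)
  ultimately show ?case by (intro exI[of _ ?l] exI[of _ ?X]) simp
qed

lemma grows_strip:
  assumes "GT N l" "grows N l X r" "r 0 = (\<lambda>_. 0)" "c \<le> N"
  shows "strip (l c) (r c)"
  using assms(4)
proof (induction c)
  case 0
  then show ?case using GT_0[OF assms(1)] assms(3) by (simp add: strip_def)
next
  case (Suc c)
  then have "r (Suc c) = growth (l c) (l (Suc c)) (r c) (count X (Suc c))" "strip (l c) (l (Suc c))" "strip (l c) (r c)"
    using assms(2) GT_strip[OF assms(1)] by (auto simp: grows_def)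
  then show ?case using growth_strip by metis
qed

lemma pieri_unique:
  assumes "GT N l" "GT N l'" "l N = l' N" "set_mset X \<subseteq> {1..N}" "set_mset X' \<subseteq> {1..N}"
    "grows N l X r" "grows N l' X' r" "r 0 = (\<lambda>_. 0)"
  shows "l = l' \<and> X = X'"
proof -
  have eq: "l c = growth_inv (l (Suc c)) (r c) (r (Suc c)) \<and> count X (Suc c) = r (Suc c) 0 - max (l (Suc c) 0) (r c 0)"
    if "GT N l" "grows N l X r" "c < N" for c l X
  proof -
    have g: "r (Suc c) = growth (l c) (l (Suc c)) (r c) (count X (Suc c))" "strip (l c) (l (Suc c))"
      using that(2,3) GT_strip[OF that(1)] by (auto simp: grows_def)
    have "strip (l c) (r c)" using grows_strip[OF that(1,2) assms(8)] that(3) by simp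
    from growth_inv_growth[OF g(2) this, of "count X (Suc c)"] show ?thesis unfolding g(1)[symmetric] by simp
  qed
  have l: "l c = l' c" if "c \<le> N" for c
    using that
  proof (induction rule: inc_induct)
    case (step c)
    then show ?case using eq[OF assms(1,6), of c] eq[OF assms(2,7), of c] by simp
  qed (rule assms(3))
  have "X = X'"
  proof (rule multiset_eqI)
    fix a
    show "count X a = count X' a"
    proof (cases "a \<in> {1..N}")
      case True
      then obtain c where "a = Suc c" "c < N" by (cases a) auto
      then show ?thesis using eq[OF assms(1,6), of c] eq[OF assms(2,7), of c] l[of "Suc c"] by simp
    next
      case False
      then have "a \<notin># X" "a \<notin># X'" using assms(4,5) by blast+
      then show ?thesis by (simp add: not_in_iff)
    qed
  qed
  then show ?thesis using GT_ext[OF assms(1,2)] l by blast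
qed

lemma shape_grows: "grows N (shape u) X (shape (u @ row_of X))"
  by (simp add: grows_def shape_append_row)

lemma shape_append_rowI:
  assumes "set u \<subseteq> {1..N}" "set_mset X \<subseteq> {1..N}" "GT N r" "grows N (shape u) X r"
  shows "shape (u @ row_of X) = r"
proof (rule GT_ext[OF shape_GT assms(3)])
  show "set (u @ row_of X) \<subseteq> {1..N}" using assms by simp
  have "0 \<notin> set (u @ row_of X)" using assms by auto
  then show "shape (u @ row_of X) c = r c" if "c \<le> N" for c using that
  proof (induction c)
    case 0
    then show ?case using GT_0[OF assms(3)] by (simp add: shape_0 fun_eq_iff)
  next
    case (Suc c)
    then show ?case using assms(4) by (simp add: grows_def shape_append_row)
  qed
qed

subsection \<open>The Robinson--Schensted--Knuth correspondence\<close>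

lemma shape_Nil: "shape [] = (\<lambda>_ _. 0)"
  by (intro GT_zero[OF shape_GT[of "[]" 0]]) (auto simp: shape_0)

text \<open>Here \<open>P\<close> is the insertion tableau and \<open>Q\<close> the recording tableau; the rows \<open>Xs\<close> of the matrix are recovered
from the last to the first.\<close>

lemma RSK_exists:
  assumes "GT N P" "Q 0 = (\<lambda>_. 0)" "\<And>r. r < n \<Longrightarrow> strip (Q r) (Q (Suc r))" "Q n = P N"
  shows "\<exists>Xs. length Xs = n \<and> (\<forall>X\<in>set Xs. set_mset X \<subseteq> {1..N}) \<and>
     shape (concat (map row_of Xs)) = P \<and> (\<forall>r\<le>n. shape (concat (map row_of (take r Xs))) N = Q r)"
  using assms
proof (induction n arbitrary: P)
  case 0
  then have "P = (\<lambda>_ _. 0)" using GT_zero by metis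
  then show ?case using 0 by (simp add: shape_Nil)
next
  case (Suc n)
  have "strip (Q n) (P N)" using Suc.prems(3)[of n] Suc.prems(4) by simp
  from pieri_exists[OF Suc.prems(1) this] obtain l X where l: "GT N l" "l N = Q n"
    "set_mset X \<subseteq> {1..N}" "grows N l X P" by blast
  obtain Xs where Xs: "length Xs = n" "\<forall>X\<in>set Xs. set_mset X \<subseteq> {1..N}"
     "shape (concat (map row_of Xs)) = l" "\<forall>r\<le>n. shape (concat (map row_of (take r Xs))) N = Q r"
    using Suc.IH[OF l(1) Suc.prems(2)] Suc.prems(3) l(2) by auto
  have "shape (concat (map row_of Xs) @ row_of X) = P"
    by (rule shape_append_rowI[of _ N]) (use Xs l Suc.prems(1) in auto)
  then have P: "shape (concat (map row_of (Xs @ [X]))) = P" by simp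
  have "shape (concat (map row_of (take r (Xs @ [X])))) N = Q r" if "r \<le> Suc n" for r
    using that Xs(1,4) P Suc.prems(4) by (cases "r = Suc n") auto
  then show ?case using Xs l P by (intro exI[of _ "Xs @ [X]"]) auto
qed

lemma RSK_unique:
  assumes "length Xs = n" "length Ys = n" "\<forall>X\<in>set Xs. set_mset X \<subseteq> {1..N}" "\<forall>X\<in>set Ys. set_mset X \<subseteq> {1..N}"
    "shape (concat (map row_of Xs)) = shape (concat (map row_of Ys))"
    "\<And>r. r \<le> n \<Longrightarrow> shape (concat (map row_of (take r Xs))) N = shape (concat (map row_of (take r Ys))) N"
  shows "Xs = Ys"
  using assms
proof (induction n arbitrary: Xs Ys)
  case (Suc n)
  obtain Xs' X Ys' Y where e: "Xs = Xs' @ [X]" "Ys = Ys' @ [Y]" "length Xs' = n" "length Ys' = n"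
    using Suc.prems(1,2) by (metis length_Suc_conv_rev)
  let ?u = "concat (map row_of Xs')" and ?v = "concat (map row_of Ys')"
  have s: "set ?u \<subseteq> {1..N}" "set ?v \<subseteq> {1..N}" "set_mset X \<subseteq> {1..N}" "set_mset Y \<subseteq> {1..N}"
    using Suc.prems(3,4) e by auto
  have "shape ?u = shape ?v \<and> X = Y"
  proof (rule pieri_unique[where N = N and r = "shape (?u @ row_of X)"])
    show "shape ?u N = shape ?v N" using Suc.prems(6)[of n] e by simp
    show "grows N (shape ?v) Y (shape (?u @ row_of X))" using shape_grows[of N ?v Y] Suc.prems(5) e by simp
    have "set (?u @ row_of X) \<subseteq> {1..N}" using s by simp
    then have "0 \<notin> set (?u @ row_of X)" by (metis atLeastAtMost_iff not_one_le_zero subsetD)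
    then show "shape (?u @ row_of X) 0 = (\<lambda>_. 0)" using shape_0 by blast
  qed (use s shape_GT shape_grows in auto)
  moreover have "shape (concat (map row_of (take r Xs'))) N = shape (concat (map row_of (take r Ys'))) N" if "r \<le> n" for r
    using Suc.prems(6)[of r] that e by simp
  ultimately show ?case using Suc.IH[of Xs' Ys'] Suc.prems(3,4) e by simp
qed simp

text \<open>Every pattern is the tableau of some word: choose the recording tableau equal to it.\<close>

lemma GT_realized: "GT N P \<Longrightarrow> \<exists>w. set w \<subseteq> {1..N} \<and> shape w = P"
proof -
  assume P: "GT N P"
  have "\<exists>Xs. length Xs = N \<and> (\<forall>X\<in>set Xs. set_mset X \<subseteq> {1..N}) \<and>
     shape (concat (map row_of Xs)) = P \<and> (\<forall>r\<le>N. shape (concat (map row_of (take r Xs))) N = P r)"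
    by (rule RSK_exists[OF P]) (use GT_0[OF P] GT_strip[OF P] in auto)
  then obtain Xs where "\<forall>X\<in>set Xs. set_mset X \<subseteq> {1..N}" "shape (concat (map row_of Xs)) = P" by blast
  then show ?thesis by (intro exI[of _ "concat (map row_of Xs)"]) auto
qed

subsection \<open>Matrices symmetric about the antidiagonal\<close>

definition row_list :: "nat \<Rightarrow> (nat \<Rightarrow> nat) \<Rightarrow> nat list" where
  "row_list N x = concat (map (\<lambda>c. replicate (x c) c) [1..<Suc N])"

definition mword :: "nat \<Rightarrow> (nat \<Rightarrow> nat \<Rightarrow> nat) \<Rightarrow> nat \<Rightarrow> nat list" where
  "mword N A r = concat (map (\<lambda>i. row_list N (A i)) [1..<Suc r])"

lemma set_row_list: "set (row_list N x) \<subseteq> {1..N}"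
  by (auto simp: row_list_def)

lemma set_mword: "set (mword N A r) \<subseteq> {1..N}"
  using set_row_list by (auto simp: mword_def)

lemma row_list_Suc: "row_list (Suc N) x = row_list N x @ replicate (x (Suc N)) (Suc N)"
  by (simp add: row_list_def)

lemma sorted_row_list: "sorted (row_list N x)"
proof (induction N)
  case (Suc N)
  then show ?case using set_row_list[of N x] by (auto simp: row_list_Suc sorted_append sorted_replicate)
qed (simp add: row_list_def)

lemma sort_row_list [simp]: "sort (row_list N x) = row_list N x"
  by (rule sorted_sort_id[OF sorted_row_list])

lemma row_list_row_of: "row_list N x = row_of (mset (row_list N x))"
  by simp

lemma count_row_list: "count (mset (row_list N x)) c = (if c \<in> {1..N} then x c else 0)"
  by (induction N) (auto simp: row_list_Suc row_list_def[of 0] count_mset simp flip: count_mset)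

lemma row_list_of_mset: "set_mset X \<subseteq> {1..N} \<Longrightarrow> row_list N (count X) = row_of X"
  by (subst row_list_row_of, rule arg_cong[of _ _ row_of])
     (auto simp: multiset_eq_iff count_row_list not_in_iff[symmetric])

lemma length_row_list: "length (row_list N x) = (\<Sum>c\<in>{1..N}. x c)"
  by (induction N) (simp_all add: row_list_Suc row_list_def[of 0])

lemma mword_Suc: "mword N A (Suc r) = mword N A r @ row_list N (A (Suc r))"
  by (simp add: mword_def)

text \<open>Transposing the matrix reflects the growth diagram, and the local rule is symmetric.\<close>

lemma mword_shape_transpose:
  assumes "r \<le> N" "c \<le> N"
  shows "shape (mword N A r) c = shape (mword N (\<lambda>i j. A j i) c) r"
  using assms
proof (induction r arbitrary: c)
  case 0
  have "0 \<notin> set (mword N B c)" for B using set_mword by fastforce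
  then show ?case by (simp add: mword_def[of _ _ 0] shape_Nil fun_eq_iff shape_0)
next
  case (Suc r)
  note r = Suc.IH and Rprem = Suc.prems(1)
  from Suc.prems(2) show ?case
  proof (induction c)
    case 0
    have "0 \<notin> set (mword N B c)" for B c using set_mword by fastforce
    then show ?case by (simp add: mword_def[of _ _ 0] shape_Nil fun_eq_iff shape_0)
  next
    case (Suc c)
    have g: "shape (mword N B (Suc a)) (Suc b) = growth (shape (mword N B a) b) (shape (mword N B a) (Suc b))
        (shape (mword N B (Suc a)) b) (B (Suc a) (Suc b))" if "b < N" for a b B
      using shape_append_row[of "mword N B a" "mset (row_list N (B (Suc a)))" b] that
      by (simp add: mword_Suc count_row_list)
    let ?T = "\<lambda>i j. A j i"
    have "shape (mword N A (Suc r)) (Suc c) = growth (shape (mword N A r) c) (shape (mword N A r) (Suc c))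
        (shape (mword N A (Suc r)) c) (A (Suc r) (Suc c))" by (rule g) (use Suc.prems in simp)
    also have "\<dots> = growth (shape (mword N ?T c) r) (shape (mword N ?T (Suc c)) r)
        (shape (mword N ?T c) (Suc r)) (A (Suc r) (Suc c))"
      using Suc.IH Suc.prems r Rprem by simp
    also have "\<dots> = growth (shape (mword N ?T c) r) (shape (mword N ?T c) (Suc r))
        (shape (mword N ?T (Suc c)) r) (A (Suc r) (Suc c))" by (rule ext, rule growth_commute)
    also have "\<dots> = shape (mword N ?T (Suc c)) (Suc r)" by (rule g[symmetric]) (use Rprem in simp)
    finally show ?case .
  qed
qed

definition square :: "nat \<Rightarrow> (nat \<Rightarrow> nat \<Rightarrow> nat) \<Rightarrow> bool" where
  "square N A \<longleftrightarrow> (\<forall>r c. A r c \<noteq> 0 \<longrightarrow> r \<in> {1..N} \<and> c \<in> {1..N})"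

lemma mword_rows: "mword N A r = concat (map row_of (map (\<lambda>i. mset (row_list N (A i))) [1..<Suc r]))"
  by (simp add: mword_def comp_def del: upt_Suc)

lemma matrix_unique:
  assumes "square N A" "square N B" "shape (mword N A N) = shape (mword N B N)"
    "shape (mword N (\<lambda>i j. A j i) N) = shape (mword N (\<lambda>i j. B j i) N)"
  shows "A = B"
proof -
  let ?R = "\<lambda>A. map (\<lambda>i. mset (row_list N (A i))) [1..<Suc N]"
  have t: "concat (map row_of (take r (?R A))) = mword N A r" if "r \<le> N" for A r
    unfolding mword_rows using that by (simp add: take_map del: upt_Suc)
  have "?R A = ?R B"
  proof (rule RSK_unique[of _ N _ N])
    fix r assume "r \<le> N"
    then show "shape (concat (map row_of (take r (?R A)))) N = shape (concat (map row_of (take r (?R B)))) N"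
      unfolding t[OF \<open>r \<le> N\<close>] using mword_shape_transpose[of r N N] assms(4) by simp
  qed (use set_row_list assms(3) in \<open>auto simp: mword_rows simp del: upt_Suc\<close>)
  then have e: "mset (row_list N (A i)) = mset (row_list N (B i))" if "i \<in> {1..N}" for i
    using that by (auto simp: map_eq_conv simp del: upt_Suc)
  show ?thesis
  proof (intro ext)
    fix r c
    show "A r c = B r c"
    proof (cases "r \<in> {1..N} \<and> c \<in> {1..N}")
      case True
      then show ?thesis using arg_cong[OF e, of r "\<lambda>M. count M c"] by (simp add: count_row_list)
    next
      case False
      then have "A r c = 0" "B r c = 0" using assms(1,2) unfolding square_def by blast+
      then show ?thesis by simp
    qed
  qed
qed

lemma matrix_exists:
  assumes "GT N P" "GT N Q" "P N = Q N"
  shows "\<exists>A. square N A \<and> shape (mword N A N) = P \<and> shape (mword N (\<lambda>i j. A j i) N) = Q"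
proof -
  have "\<exists>Xs. length Xs = N \<and> (\<forall>X\<in>set Xs. set_mset X \<subseteq> {1..N}) \<and>
     shape (concat (map row_of Xs)) = P \<and> (\<forall>r\<le>N. shape (concat (map row_of (take r Xs))) N = Q r)"
    by (rule RSK_exists[OF assms(1)]) (use GT_0[OF assms(2)] GT_strip[OF assms(2)] assms(3) in auto)
  then obtain Xs where Xs: "length Xs = N" "\<forall>X\<in>set Xs. set_mset X \<subseteq> {1..N}"
    "shape (concat (map row_of Xs)) = P" "\<forall>r\<le>N. shape (concat (map row_of (take r Xs))) N = Q r" by blast
  define A where "A = (\<lambda>i c. if i \<in> {1..N} then count (Xs ! (i - 1)) c else 0)"
  have X: "set_mset (Xs ! (i - 1)) \<subseteq> {1..N}" if "i \<in> {1..N}" for i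
  proof -
    have "i - 1 < length Xs" using Xs(1) that by auto
    then show ?thesis using Xs(2) nth_mem by blast
  qed
  have sq: "square N A" unfolding square_def A_def using X by (auto simp: not_in_iff) (metis Suc_eq_plus1 atLeastAtMost_iff count_inI subsetD One_nat_def)+
  have row: "row_list N (A (Suc i)) = row_of (Xs ! i)" if "i < N" for i
    using X[of "Suc i"] that by (simp add: A_def row_list_of_mset)
  have w: "mword N A r = concat (map row_of (take r Xs))" if "r \<le> N" for r
    using that
  proof (induction r)
    case (Suc r)
    then show ?case using Xs(1) by (simp add: mword_Suc row take_Suc_conv_app_nth)
  qed (simp add: mword_def)
  have "shape (mword N (\<lambda>i j. A j i) N) = Q"
  proof (rule GT_ext[OF shape_GT[OF set_mword] assms(2)])
    fix r assume "r \<le> N"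
    then show "shape (mword N (\<lambda>i j. A j i) N) r = Q r"
      using mword_shape_transpose[of r N N A] w[of r] Xs(4) by simp
  qed
  then show ?thesis using sq w[of N] Xs by auto
qed

definition rot :: "nat \<Rightarrow> (nat \<Rightarrow> nat \<Rightarrow> nat) \<Rightarrow> nat \<Rightarrow> nat \<Rightarrow> nat" where
  "rot N A r c = A (Suc N - r) (Suc N - c)"

lemma rev_upt_complement: "rev [1..<Suc N] = map (\<lambda>i. Suc N - i) [1..<Suc N]"
  by (rule nth_equalityI) (auto simp: rev_nth simp del: upt_Suc)

lemma star_row_list: "star N (row_list N x) = row_list N (\<lambda>c. x (Suc N - c))"
proof -
  have r: "star N (replicate m c) = replicate m (Suc N - c)" for m c by (simp add: star_def)
  show ?thesis unfolding row_list_def star_concat rev_map rev_upt_complement map_map comp_def r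
    by (rule arg_cong[of _ _ concat], rule map_cong) auto
qed

lemma mword_rot: "mword N (rot N A) N = star N (mword N A N)"
  unfolding mword_def star_concat rev_map rev_upt_complement map_map comp_def star_row_list
  by (rule arg_cong[of _ _ concat], rule map_cong) (simp_all add: rot_def[abs_def])

lemma star_mword_cong:
  assumes "shape (mword N A N) = shape (mword N B N)"
  shows "shape (mword N (rot N A) N) = shape (mword N (rot N B) N)"
proof -
  have "0 \<notin> set (mword N A N)" "0 \<notin> set (mword N B N)" using set_mword by fastforce+
  from shape_eq_knuth[OF assms this] have "star N (mword N A N) \<approx> star N (mword N B N)"
    by (rule knuth_star) (use set_mword[of N A N] in auto)
  then show ?thesis unfolding mword_rot by (rule knuth_shape)
qed

text \<open>Symmetry about the antidiagonal, the composition of transposition and half turn.\<close>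

definition persymmetric :: "nat \<Rightarrow> (nat \<Rightarrow> nat \<Rightarrow> nat) \<Rightarrow> bool" where
  "persymmetric N A \<longleftrightarrow> square N A \<and> (\<lambda>i j. A j i) = rot N A"

lemma square_rot: "square N A \<Longrightarrow> square N (rot N A)"
  unfolding square_def rot_def
proof (intro allI impI)
  fix r c assume s: "\<forall>r c. A r c \<noteq> 0 \<longrightarrow> r \<in> {1..N} \<and> c \<in> {1..N}" and "A (Suc N - r) (Suc N - c) \<noteq> 0"
  then have "Suc N - r \<in> {1..N} \<and> Suc N - c \<in> {1..N}" by blast
  then show "r \<in> {1..N} \<and> c \<in> {1..N}" by auto
qed

lemma rot_rot: "square N A \<Longrightarrow> rot N (rot N A) = A"
proof (intro ext)
  fix r c assume s: "square N A"
  show "rot N (rot N A) r c = A r c"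
  proof (cases "r \<le> Suc N \<and> c \<le> Suc N")
    case False
    then have "\<not> (r \<in> {1..N} \<and> c \<in> {1..N})" "\<not> (Suc N - (Suc N - r) \<in> {1..N} \<and> Suc N - (Suc N - c) \<in> {1..N}) \<or> r > Suc N \<or> c > Suc N" by auto
    moreover have "A r c = 0" using s calculation(1) unfolding square_def by blast
    moreover have "rot N (rot N A) r c = 0"
    proof -
      have "\<not> (r \<in> {1..N} \<and> c \<in> {1..N})" using False by auto
      then show ?thesis using square_rot[OF square_rot[OF s]] unfolding square_def by blast
    qed
    ultimately show ?thesis by simp
  qed (simp add: rot_def)
qed

text \<open>Transposition exchanges the tableaux \<open>P\<close> and \<open>Q\<close>, and a half turn applies evacuation to both. So for a persymmetric matrix
\<open>Q\<close> is the evacuation of \<open>P\<close>, and \<open>P\<close> determines the matrix.\<close>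

lemma persymmetric_unique:
  assumes "persymmetric N A" "persymmetric N B" "shape (mword N A N) = shape (mword N B N)"
  shows "A = B"
proof (rule matrix_unique[OF _ _ assms(3)])
  show "shape (mword N (\<lambda>i j. A j i) N) = shape (mword N (\<lambda>i j. B j i) N)"
    using assms(1,2) star_mword_cong[OF assms(3)] by (simp add: persymmetric_def)
qed (use assms in \<open>auto simp: persymmetric_def\<close>)

text \<open>Take the matrix whose pair of tableaux is \<open>P\<close> and its evacuation \<open>Q\<close>, which has the right shape
because evacuation preserves shapes. Its transpose and its half turn then have the same pair of tableaux.\<close>

lemma persymmetric_exists:
  assumes "GT N P"
  shows "\<exists>A. persymmetric N A \<and> shape (mword N A N) = P"
proof -
  obtain B where B: "square N B" "shape (mword N B N) = P"
    using matrix_exists[OF assms assms refl] by blast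
  define Q where "Q = shape (mword N (rot N B) N)"
  have "Q N = P N" unfolding Q_def mword_rot using shape_star_shape[OF set_mword, of N B N] B(2) by simp
  moreover have "GT N Q" unfolding Q_def by (rule shape_GT[OF set_mword])
  ultimately obtain A where A: "square N A" "shape (mword N A N) = P" "shape (mword N (\<lambda>i j. A j i) N) = Q"
    using matrix_exists[OF assms, of Q] by auto
  let ?T = "\<lambda>i j. A j i"
  have sqT: "square N ?T" using A(1) by (auto simp: square_def)
  have "?T = rot N A"
  proof (rule matrix_unique[OF sqT square_rot[OF A(1)]])
    show "shape (mword N ?T N) = shape (mword N (rot N A) N)"
      using star_mword_cong[of N A B] A B by (simp add: Q_def)
    have "shape (mword N (rot N ?T) N) = shape (mword N (rot N (rot N B)) N)"
      by (rule star_mword_cong) (simp add: A(3) Q_def)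
    then have "shape (mword N (rot N ?T) N) = P" using rot_rot[OF B(1)] B(2) by simp
    moreover have "(\<lambda>i j. rot N A j i) = rot N ?T" by (simp add: rot_def fun_eq_iff)
    ultimately show "shape (mword N (\<lambda>i j. ?T j i) N) = shape (mword N (\<lambda>i j. rot N A j i) N)"
      using A(2) by simp
  qed
  then show ?thesis using A by (auto simp: persymmetric_def)
qed

section \<open>Two ways of adding rows\<close>

subsection \<open>Appending and prepending\<close>

definition append_row :: "nat multiset \<Rightarrow> nat list \<Rightarrow> nat list" where "append_row X w = w @ row_of X"
definition prepend_row :: "nat multiset \<Rightarrow> nat list \<Rightarrow> nat list" where "prepend_row X w = row_of X @ w"

text \<open>What the argument needs of an operation that adds a row \<open>X\<close> to a word \<open>w\<close>, for it to apply to appending and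
prepending alike: the new letters are those of \<open>X\<close>, restriction of the alphabet is respected, the shape grows by a horizontal strip,
and the tableau of \<open>w\<close> and \<open>X\<close> are determined by the new tableau and the old shape, both of which can be prescribed.\<close>

definition pieri_op :: "(nat multiset \<Rightarrow> nat list \<Rightarrow> nat list) \<Rightarrow> bool" where
  "pieri_op op \<longleftrightarrow> (\<forall>X w. set (op X w) = set_mset X \<union> set w \<and> length (op X w) = size X + length w) \<and>
   (\<forall>X w c. filter (\<lambda>x. x \<le> c) (op X w) = op (filter_mset (\<lambda>x. x \<le> c) X) (filter (\<lambda>x. x \<le> c) w)) \<and>
   (\<forall>d c \<kappa>. GT d c \<longrightarrow> strip \<kappa> (c d) \<longrightarrow> (\<exists>l X. GT d l \<and> l d = \<kappa> \<and> set_mset X \<subseteq> {1..d} \<and>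
       (\<forall>w. set w \<subseteq> {1..d} \<longrightarrow> shape w = l \<longrightarrow> shape (op X w) = c))) \<and>
   (\<forall>d w w' X X'. set w \<subseteq> {1..d} \<longrightarrow> set w' \<subseteq> {1..d} \<longrightarrow> set_mset X \<subseteq> {1..d} \<longrightarrow> set_mset X' \<subseteq> {1..d} \<longrightarrow>
       shape (op X w) = shape (op X' w') \<longrightarrow> shape w d = shape w' d \<longrightarrow> X = X' \<and> shape w = shape w') \<and>
   (\<forall>d w X. set w \<subseteq> {1..d} \<longrightarrow> set_mset X \<subseteq> {1..d} \<longrightarrow> strip (shape w d) (shape (op X w) d))"

lemma row_of_filter: "filter (\<lambda>x. x \<le> c) (row_of X) = row_of (filter_mset (\<lambda>x. x \<le> c) X)"
  by (rule rwI[symmetric]) (simp_all only: sorted_wrt_filter sorted_sorted_list_of_multiset mset_filter mset_sorted_list_of_multiset)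

lemma size_row_of: "length (row_of X) = size X"
  by (metis mset_sorted_list_of_multiset size_mset)

lemma zero_notin: "A \<subseteq> {1..d::nat} \<Longrightarrow> 0 \<notin> A"
  by auto

lemma append_row_inj:
  assumes "set w \<subseteq> {1..d}" "set w' \<subseteq> {1..d}" "set_mset X \<subseteq> {1..d}" "set_mset X' \<subseteq> {1..d}"
    "shape (append_row X w) = shape (append_row X' w')" "shape w d = shape w' d"
  shows "X = X' \<and> shape w = shape w'"
proof -
  have "shape w = shape w' \<and> X = X'"
  proof (rule pieri_unique)
    show "grows d (shape w') X' (shape (append_row X w))" using shape_grows[of d w' X'] assms(5) by (simp add: append_row_def)
    show "grows d (shape w) X (shape (append_row X w))" unfolding append_row_def by (rule shape_grows)
    have "0 \<notin> set (append_row X w)" using zero_notin[OF assms(1)] zero_notin[OF assms(3)] by (simp add: append_row_def)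
    then show "shape (append_row X w) 0 = (\<lambda>_. 0)" by (auto simp: shape_0)
  qed (use assms shape_GT in auto)
  then show ?thesis by simp
qed

lemma append_row_exists:
  assumes "GT d c" "strip \<kappa> (c d)"
  shows "\<exists>l X. GT d l \<and> l d = \<kappa> \<and> set_mset X \<subseteq> {1..d} \<and>
       (\<forall>w. set w \<subseteq> {1..d} \<longrightarrow> shape w = l \<longrightarrow> shape (append_row X w) = c)"
proof -
  from pieri_exists[OF assms] obtain l X where l: "GT d l" "l d = \<kappa>" "set_mset X \<subseteq> {1..d}" "grows d l X c" by blast
  have "shape (append_row X w) = c" if "set w \<subseteq> {1..d}" "shape w = l" for w
    unfolding append_row_def by (rule shape_append_rowI[OF that(1) l(3) assms(1)]) (use l(4) that(2) in simp)
  then show ?thesis using l by blast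
qed

lemma append_row_strip: "set w \<subseteq> {1..d} \<Longrightarrow> set_mset X \<subseteq> {1..d} \<Longrightarrow> strip (shape w d) (shape (append_row X w) d)"
  unfolding append_row_def by (intro shape_strip_row) (auto dest: zero_notin)

lemma pieri_op_R: "pieri_op append_row"
  unfolding pieri_op_def
proof (intro conjI allI impI, goal_cases)
  case (4 d c \<kappa>)
  then show ?case by (rule append_row_exists)
next
  case (5 d w w' X X')
  then show ?case using append_row_inj by blast
next
  case (6 d w w' X X')
  then show ?case using append_row_inj by blast
next
  case (7 d w X)
  then show ?case by (rule append_row_strip)
qed (simp_all add: append_row_def row_of_filter size_row_of Un_commute)

definition compl_mset :: "nat \<Rightarrow> nat multiset \<Rightarrow> nat multiset" where
  "compl_mset d X = image_mset (\<lambda>x. Suc d - x) X"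

lemma star_row_of: "star d (row_of X) = row_of (compl_mset d X)"
proof (rule rwI[symmetric])
  show "mset (star d (row_of X)) = compl_mset d X"
    by (simp add: star_def compl_mset_def)
qed (simp add: star_sorted)

lemma compl_compl: "set_mset X \<subseteq> {1..d} \<Longrightarrow> compl_mset d (compl_mset d X) = X"
  unfolding compl_mset_def multiset.map_comp comp_def
  by (rule trans[OF image_mset_cong, of _ _ "\<lambda>x. x"]) auto

lemma set_compl: "set_mset X \<subseteq> {1..d} \<Longrightarrow> set_mset (compl_mset d X) \<subseteq> {1..d}"
  by (fastforce simp: compl_mset_def)

lemma star_prepend_row: "star d (prepend_row X w) = append_row (compl_mset d X) (star d w)"
  by (simp add: prepend_row_def append_row_def star_append star_row_of)

lemma shape_eq_star:
  assumes "set u \<subseteq> {1..d}" "set v \<subseteq> {1..d}"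
  shows "shape (star d u) = shape (star d v) \<longleftrightarrow> shape u = shape v"
proof -
  have i: "shape (star d u) = shape (star d v)" if "shape u = shape v" "set u \<subseteq> {1..d}" "set v \<subseteq> {1..d}" for u v
    by (rule knuth_shape, rule knuth_star, rule shape_eq_knuth) (use that in \<open>auto dest: zero_notin\<close>)
  have s: "star d (star d u) = u" "star d (star d v) = v" using assms by (auto intro!: star_star)
  show ?thesis using i[of u v] i[of "star d u" "star d v"] assms s set_star by auto
qed

lemma prepend_row_inj:
  assumes "set w \<subseteq> {1..d}" "set w' \<subseteq> {1..d}" "set_mset X \<subseteq> {1..d}" "set_mset X' \<subseteq> {1..d}"
    "shape (prepend_row X w) = shape (prepend_row X' w')" "shape w d = shape w' d"
  shows "X = X' \<and> shape w = shape w'"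
proof -
  have s: "set (prepend_row X w) \<subseteq> {1..d}" "set (prepend_row X' w') \<subseteq> {1..d}" using assms by (simp_all add: prepend_row_def)
  have "shape (star d (prepend_row X w)) = shape (star d (prepend_row X' w'))" using shape_eq_star[OF s] assms(5) by simp
  then have e: "shape (append_row (compl_mset d X) (star d w)) = shape (append_row (compl_mset d X') (star d w'))" by (simp add: star_prepend_row)
  have h: "shape (star d w) d = shape (star d w') d" using shape_star_shape assms(1,2,6) by simp
  have "compl_mset d X = compl_mset d X' \<and> shape (star d w) = shape (star d w')"
    using append_row_inj[OF _ _ _ _ e h] set_star[OF assms(1)] set_star[OF assms(2)] set_compl[OF assms(3)] set_compl[OF assms(4)] by blast
  then have "compl_mset d X = compl_mset d X'" "shape w = shape w'" using shape_eq_star[OF assms(1,2)] by auto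
  from arg_cong[OF this(1), of "compl_mset d"] this(2) show ?thesis
    by (simp only: compl_compl[OF assms(3)] compl_compl[OF assms(4)] simp_thms)
qed

text \<open>The involution \<open>star\<close> turns prepending into appending and preserves shapes and tableau equality, so that the two operations have the same properties.\<close>

lemma prepend_row_exists:
  assumes "GT d c" "strip \<kappa> (c d)"
  shows "\<exists>l X. GT d l \<and> l d = \<kappa> \<and> set_mset X \<subseteq> {1..d} \<and>
       (\<forall>w. set w \<subseteq> {1..d} \<longrightarrow> shape w = l \<longrightarrow> shape (prepend_row X w) = c)"
proof -
  obtain v where v: "set v \<subseteq> {1..d}" "shape v = c" using GT_realized[OF assms(1)] by blast
  have "GT d (shape (star d v))" by (rule shape_GT, rule set_star) (use v in simp)
  moreover have "strip \<kappa> (shape (star d v) d)" using shape_star_shape[OF v(1)] v(2) assms(2) by simp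
  ultimately obtain l X where l: "GT d l" "l d = \<kappa>" "set_mset X \<subseteq> {1..d}"
    "\<And>w. set w \<subseteq> {1..d} \<Longrightarrow> shape w = l \<Longrightarrow> shape (append_row X w) = shape (star d v)"
    using append_row_exists by metis
  obtain u where u: "set u \<subseteq> {1..d}" "shape u = l" using GT_realized[OF l(1)] by blast
  have u': "set (star d u) \<subseteq> {1..d}" by (rule set_star[OF u(1)])
  have "GT d (shape (star d u))" by (rule shape_GT[OF u'])
  moreover have "shape (star d u) d = \<kappa>" using shape_star_shape[OF u(1)] u(2) l(2) by simp
  moreover have "shape (prepend_row (compl_mset d X) w) = c" if w: "set w \<subseteq> {1..d}" "shape w = shape (star d u)" for w
  proof -
    have "shape (star d w) = shape (star d (star d u))" using shape_eq_star[OF w(1) u'] w(2) by simp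
    moreover have "star d (star d u) = u" using u(1) by (auto intro!: star_star)
    ultimately have "shape (append_row X (star d w)) = shape (star d v)" using l(4)[OF set_star[OF w(1)]] u(2) by simp
    then have "shape (star d (prepend_row (compl_mset d X) w)) = shape (star d v)" by (simp add: star_prepend_row compl_compl[OF l(3)])
    moreover have "set (prepend_row (compl_mset d X) w) \<subseteq> {1..d}" using set_compl[OF l(3)] w(1) by (simp add: prepend_row_def)
    ultimately show ?thesis using shape_eq_star v by blast
  qed
  ultimately show ?thesis using set_compl[OF l(3)] by blast
qed

lemma prepend_row_strip:
  assumes "set w \<subseteq> {1..d}" "set_mset X \<subseteq> {1..d}"
  shows "strip (shape w d) (shape (prepend_row X w) d)"
proof -
  have s: "set (prepend_row X w) \<subseteq> {1..d}" using assms by (simp add: prepend_row_def)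
  have "strip (shape (star d w) d) (shape (append_row (compl_mset d X) (star d w)) d)"
    using append_row_strip set_star[OF assms(1)] set_compl[OF assms(2)] by blast
  then show ?thesis using shape_star_shape[OF s] shape_star_shape[OF assms(1)] by (simp add: star_prepend_row)
qed

lemma pieri_op_L: "pieri_op prepend_row"
  unfolding pieri_op_def
proof (intro conjI allI impI, goal_cases)
  case (4 d c \<kappa>)
  then show ?case by (rule prepend_row_exists)
next
  case (5 d w w' X X')
  then show ?case using prepend_row_inj by blast
next
  case (6 d w w' X X')
  then show ?case using prepend_row_inj by blast
next
  case (7 d w X)
  then show ?case by (rule prepend_row_strip)
qed (simp_all add: prepend_row_def row_of_filter size_row_of)

subsection \<open>Fillings and sequences of shapes\<close>

text \<open>The word after the rows \<open>n - 1, \<dots>, d\<close> have been added to \<open>s\<close> by \<open>op\<close>; row \<open>e\<close> uses letters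
up to \<open>e\<close> with multiplicities \<open>U e\<close>.\<close>

function stage_word :: "(nat multiset \<Rightarrow> nat list \<Rightarrow> nat list) \<Rightarrow> nat \<Rightarrow> nat list \<Rightarrow> (nat \<Rightarrow> nat \<Rightarrow> nat) \<Rightarrow> nat \<Rightarrow> nat list" where
  "stage_word op n s U d = (if d < n then op (mset (row_list d (U d))) (stage_word op n s U (Suc d)) else s)"
  by pat_completeness auto
termination by (relation "measure (\<lambda>(op, n, s, U, d). n - d)") auto

declare stage_word.simps [simp del]

lemma stage_word_top: "stage_word op n s U n = s"
  by (simp add: stage_word.simps)

lemma stage_word_less: "d < n \<Longrightarrow> stage_word op n s U d = op (mset (row_list d (U d))) (stage_word op n s U (Suc d))"
  by (simp add: stage_word.simps[of op n s U d])

abbreviation letters_le :: "nat \<Rightarrow> nat list \<Rightarrow> nat list" where "letters_le d w \<equiv> filter (\<lambda>x. x \<le> d) w"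

lemma pieri_op_set: "pieri_op op \<Longrightarrow> set (op X w) = set_mset X \<union> set w"
  and pieri_op_length: "pieri_op op \<Longrightarrow> length (op X w) = size X + length w"
  unfolding pieri_op_def by (elim conjE, simp)+

lemma pieri_op_filter: "pieri_op op \<Longrightarrow> letters_le c (op X w) = op (filter_mset (\<lambda>x. x \<le> c) X) (letters_le c w)"
  unfolding pieri_op_def by (elim conjE) simp

lemma pieri_op_exists: "pieri_op op \<Longrightarrow> GT d c \<Longrightarrow> strip \<kappa> (c d) \<Longrightarrow>
    \<exists>l X. GT d l \<and> l d = \<kappa> \<and> set_mset X \<subseteq> {1..d} \<and>
       (\<forall>w. set w \<subseteq> {1..d} \<longrightarrow> shape w = l \<longrightarrow> shape (op X w) = c)"
  unfolding pieri_op_def by (elim conjE) simp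

lemma pieri_op_inj:
  assumes "pieri_op op" "set w \<subseteq> {1..d}" "set w' \<subseteq> {1..d}" "set_mset X \<subseteq> {1..d}"
    "set_mset X' \<subseteq> {1..d}" "shape (op X w) = shape (op X' w')" "shape w d = shape w' d"
  shows "X = X' \<and> shape w = shape w'"
proof -
  have "\<forall>d w w' X X'. set w \<subseteq> {1..d} \<longrightarrow> set w' \<subseteq> {1..d} \<longrightarrow> set_mset X \<subseteq> {1..d} \<longrightarrow> set_mset X' \<subseteq> {1..d} \<longrightarrow>
       shape (op X w) = shape (op X' w') \<longrightarrow> shape w d = shape w' d \<longrightarrow> X = X' \<and> shape w = shape w'"
    using assms(1) unfolding pieri_op_def by (elim conjE) assumption
  then show ?thesis using assms(2-) by blast
qed

lemma pieri_op_strip: "pieri_op op \<Longrightarrow> set w \<subseteq> {1..d} \<Longrightarrow> set_mset X \<subseteq> {1..d} \<Longrightarrow> strip (shape w d) (shape (op X w) d)"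
  unfolding pieri_op_def by (elim conjE) simp

lemma stage_word_cong:
  assumes "\<And>e. d \<le> e \<Longrightarrow> e < n \<Longrightarrow> U e = U' e" "d \<le> n"
  shows "stage_word op n s U d = stage_word op n s U' d"
  using assms(2,1)
proof (induction rule: inc_induct)
  case (step d)
  then show ?case by (simp add: stage_word_less)
qed (simp add: stage_word_top)

lemma set_stage_word:
  assumes "pieri_op op" "set s \<subseteq> {1..n}" "d \<le> n"
  shows "set (stage_word op n s U d) \<subseteq> {1..n}"
  using assms(3)
proof (induction rule: inc_induct)
  case (step d)
  then show ?case using set_row_list[of d "U d"] by (auto simp: stage_word_less pieri_op_set[OF assms(1)])
qed (simp only: stage_word_top assms(2))

lemma set_letters_le: "set w \<subseteq> {1..n} \<Longrightarrow> set (letters_le d w) \<subseteq> {1..d}"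
  by auto

lemma letters_le_stage_word:
  assumes "pieri_op op" "d < n"
  shows "letters_le d (stage_word op n s U d) = op (mset (row_list d (U d))) (letters_le d (stage_word op n s U (Suc d)))"
proof -
  have "filter_mset (\<lambda>x. x \<le> d) (mset (row_list d (U d))) = mset (row_list d (U d))"
    using set_row_list[of d "U d"] by (auto simp: filter_mset_eq_conv)
  then show ?thesis using assms by (simp add: stage_word_less pieri_op_filter del: mset_filter)
qed

lemma shape_letters_le: "shape (letters_le d w) = (\<lambda>a. shape w (min a d))"
  by (auto simp: fun_eq_iff shape_filter min.commute)

definition triangular :: "nat \<Rightarrow> nat \<Rightarrow> (nat \<Rightarrow> nat \<Rightarrow> nat) \<Rightarrow> bool" where
  "triangular n d U \<longleftrightarrow> (\<forall>e i. U e i \<noteq> 0 \<longrightarrow> d \<le> e \<and> e < n \<and> i \<in> {1..e})"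

text \<open>Reconstruction of a filling from its sequence of shapes: \<open>\<sigma> e\<close> is the shape of the word at stage \<open>e\<close> in letters up
to \<open>e\<close>, and \<open>\<tau> e\<close> its shape in these letters before row \<open>e\<close> is added. Each stage is an application of the Pieri
bijection in the alphabet \<open>{1..d}\<close>; the pattern is then lengthened by one step, and at \<open>d = n\<close> it is the tableau
of a persymmetric matrix.\<close>

lemma stage_exists:
  assumes op: "pieri_op op" and "d \<le> n" "GT d c" "\<sigma> d = c d"
    "\<And>e. d \<le> e \<Longrightarrow> e < n \<Longrightarrow> strip (\<tau> e) (\<sigma> e) \<and> strip (\<tau> e) (\<sigma> (Suc e))"
  shows "\<exists>A U. persymmetric n A \<and> triangular n d U \<and> shape (letters_le d (stage_word op n (mword n A n) U d)) = c \<and>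
     (\<forall>e. d \<le> e \<and> e \<le> n \<longrightarrow> shape (stage_word op n (mword n A n) U e) e = \<sigma> e) \<and>
     (\<forall>e. d \<le> e \<and> e < n \<longrightarrow> shape (stage_word op n (mword n A n) U (Suc e)) e = \<tau> e)"
  using assms(2-)
proof (induction arbitrary: c rule: inc_induct)
  case base
  obtain A where A: "persymmetric n A" "shape (mword n A n) = c" using persymmetric_exists[OF base(1)] by blast
  have "letters_le n (mword n A n) = mword n A n" using set_mword[of n A n] by (auto simp: filter_id_conv)
  then show ?case using A base by (intro exI[of _ A] exI[of _ "\<lambda>_ _. 0"]) (auto simp: stage_word_top triangular_def)
next
  case (step d)
  have row_insert: "strip (\<tau> d) (c d)" using step.prems(2) step.prems(3)[of d] step.hyps by simp
  obtain l X where l: "GT d l" "l d = \<tau> d" "set_mset X \<subseteq> {1..d}"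
     "\<And>w. set w \<subseteq> {1..d} \<Longrightarrow> shape w = l \<Longrightarrow> shape (op X w) = c"
    using pieri_op_exists[OF op step.prems(1) row_insert] by metis
  define c' where "c' = (\<lambda>a. if a \<le> d then l a else \<sigma> (Suc d))"
  have "strip (l d) (\<sigma> (Suc d))" using l(2) step.prems(3)[of d] step.hyps by simp
  then have "GT (Suc d) c'" using GT_0[OF l(1)] GT_strip[OF l(1)]
    by (intro GT_I) (auto simp: c'_def less_Suc_eq)
  then have "\<exists>A U. persymmetric n A \<and> triangular n (Suc d) U \<and> shape (letters_le (Suc d) (stage_word op n (mword n A n) U (Suc d))) = c' \<and>
     (\<forall>e. Suc d \<le> e \<and> e \<le> n \<longrightarrow> shape (stage_word op n (mword n A n) U e) e = \<sigma> e) \<and>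
     (\<forall>e. Suc d \<le> e \<and> e < n \<longrightarrow> shape (stage_word op n (mword n A n) U (Suc e)) e = \<tau> e)"
    by (rule step.IH) (use step.prems(3) in \<open>auto simp: c'_def\<close>)
  then obtain A U where A: "persymmetric n A" and U: "triangular n (Suc d) U" and
    1: "shape (letters_le (Suc d) (stage_word op n (mword n A n) U (Suc d))) = c'" and
    2: "\<And>e. Suc d \<le> e \<Longrightarrow> e \<le> n \<Longrightarrow> shape (stage_word op n (mword n A n) U e) e = \<sigma> e" and
    3: "\<And>e. Suc d \<le> e \<Longrightarrow> e < n \<Longrightarrow> shape (stage_word op n (mword n A n) U (Suc e)) e = \<tau> e" by blast
  let ?U = "U(d := count X)" and ?s = "mword n A n"
  have g: "stage_word op n ?s ?U e = stage_word op n ?s U e" if "Suc d \<le> e" "e \<le> n" for e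
    by (rule stage_word_cong) (use that in auto)
  have sub: "set (stage_word op n ?s U (Suc d)) \<subseteq> {1..n}" by (rule set_stage_word[OF op set_mword]) (use step.hyps in simp)
  have lw: "shape (stage_word op n ?s U (Suc d)) a = l a" if "a \<le> d" for a
    using fun_cong[OF 1, of a] that by (simp add: shape_letters_le c'_def min_def)
  have "shape (letters_le d (stage_word op n ?s U (Suc d))) = l"
    unfolding shape_letters_le
  proof (rule ext)
    fix a show "shape (stage_word op n ?s U (Suc d)) (min a d) = l a"
      using lw[of "min a d"] GT_beyond[OF l(1), of a] by (cases "a \<le> d") (auto simp: min_def)
  qed
  then have "shape (op X (letters_le d (stage_word op n ?s U (Suc d)))) = c" by (rule l(4)[OF set_letters_le[OF sub]])
  moreover have "mset (row_list d (count X)) = X" using l(3) by (simp add: row_list_of_mset)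
  ultimately have c: "shape (letters_le d (stage_word op n ?s ?U d)) = c"
    using letters_le_stage_word[OF op, of d n ?s ?U] step.hyps by (simp add: g)
  have "shape (stage_word op n ?s ?U d) d = \<sigma> d" using fun_cong[OF c, of d] step.prems(2) by (simp add: shape_letters_le)
  then have "shape (stage_word op n ?s ?U e) e = \<sigma> e" if "d \<le> e" "e \<le> n" for e
    using that 2 g by (cases "e = d") auto
  moreover have "shape (stage_word op n ?s ?U (Suc e)) e = \<tau> e" if "d \<le> e" "e < n" for e
    using that 3 g lw[of d] l(2) by (cases "e = d") auto
  moreover have "triangular n d ?U" unfolding triangular_def
  proof (intro allI impI)
    fix e i assume h: "?U e i \<noteq> 0"
    show "d \<le> e \<and> e < n \<and> i \<in> {1..e}"
    proof (cases "e = d")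
      case True
      then have "i \<in># X" using h by (simp add: not_in_iff)
      then show ?thesis using True l(3) step.hyps by auto
    next
      case False
      then show ?thesis using h U unfolding triangular_def by (metis Suc_leD fun_upd_other)
    qed
  qed
  ultimately show ?case using A c by blast
qed

lemma stage_unique:
  assumes op: "pieri_op op" and "d \<le> n" "persymmetric n A" "persymmetric n A'" "triangular n d U" "triangular n d U'"
    "shape (letters_le d (stage_word op n (mword n A n) U d)) = shape (letters_le d (stage_word op n (mword n A' n) U' d))"
    "\<And>e. d \<le> e \<Longrightarrow> e \<le> n \<Longrightarrow> shape (stage_word op n (mword n A n) U e) e = shape (stage_word op n (mword n A' n) U' e) e"
    "\<And>e. d \<le> e \<Longrightarrow> e < n \<Longrightarrow> shape (stage_word op n (mword n A n) U (Suc e)) e = shape (stage_word op n (mword n A' n) U' (Suc e)) e"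
  shows "A = A' \<and> U = U'"
  using assms(2,5-)
proof (induction arbitrary: U U' rule: inc_induct)
  case base
  have "letters_le n (mword n B n) = mword n B n" for B using set_mword[of n B n] by (auto simp: filter_id_conv)
  then have "A = A'" using base(3) persymmetric_unique[OF assms(3,4)] by (simp add: stage_word_top)
  moreover have "U e i = 0" "U' e i = 0" for e i using base(1,2) unfolding triangular_def by (metis leD)+
  then have "U = U'" by (simp add: fun_eq_iff)
  ultimately show ?case by simp
next
  case (step d)
  let ?g = "stage_word op n (mword n A n) U" and ?g' = "stage_word op n (mword n A' n) U'"
  have sub: "set (?g (Suc d)) \<subseteq> {1..n}" "set (?g' (Suc d)) \<subseteq> {1..n}"
    using set_stage_word[OF op set_mword] step.hyps by auto
  have "mset (row_list d (U d)) = mset (row_list d (U' d)) \<and> shape (letters_le d (?g (Suc d))) = shape (letters_le d (?g' (Suc d)))"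
  proof (rule pieri_op_inj[OF op set_letters_le[OF sub(1)] set_letters_le[OF sub(2)]])
    show "shape (op (mset (row_list d (U d))) (letters_le d (?g (Suc d)))) = shape (op (mset (row_list d (U' d))) (letters_le d (?g' (Suc d))))"
      using step.prems(3) letters_le_stage_word[OF op] step.hyps by simp
    show "shape (letters_le d (?g (Suc d))) d = shape (letters_le d (?g' (Suc d))) d"
      using step.prems(5)[of d] step.hyps by (simp add: shape_letters_le)
  qed (use set_row_list in auto)
  then have row: "mset (row_list d (U d)) = mset (row_list d (U' d))" and
    l: "shape (?g (Suc d)) (min a d) = shape (?g' (Suc d)) (min a d)" for a
    by (auto simp: shape_letters_le fun_eq_iff)
  have "U d i = U' d i" for i
    using arg_cong[OF row, of "\<lambda>M. count M i"] step.prems(1,2) unfolding triangular_def count_row_list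
    by (cases "i \<in> {1..d}") (simp, metis)
  then have Ud: "U d = U' d" by blast
  let ?V = "U(d := (\<lambda>_. 0))" and ?V' = "U'(d := (\<lambda>_. 0))"
  have gV: "stage_word op n s ?V e = stage_word op n s U e" "stage_word op n s ?V' e = stage_word op n s U' e" if "Suc d \<le> e" "e \<le> n" for e s
    by (rule stage_word_cong; use that in simp)+
  have "A = A' \<and> ?V = ?V'"
  proof (rule step.IH)
    show "triangular n (Suc d) ?V" "triangular n (Suc d) ?V'" using step.prems(1,2)
      unfolding triangular_def by (metis (no_types, lifting) Suc_leI fun_upd_apply le_neq_implies_less)+
    have "shape (?g (Suc d)) (min a (Suc d)) = shape (?g' (Suc d)) (min a (Suc d))" for a
      using l[of a] step.prems(4)[of "Suc d"] step.hyps by (cases "a \<le> d"; cases "a = Suc d") (auto simp: min_def)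
    then show "shape (letters_le (Suc d) (stage_word op n (mword n A n) ?V (Suc d))) = shape (letters_le (Suc d) (stage_word op n (mword n A' n) ?V' (Suc d)))"
      using step.hyps by (simp add: gV shape_letters_le)
    show "shape (stage_word op n (mword n A n) ?V e) e = shape (stage_word op n (mword n A' n) ?V' e) e"
      if "Suc d \<le> e" "e \<le> n" for e unfolding gV[OF that] using step.prems(4) that by simp
    show "shape (stage_word op n (mword n A n) ?V (Suc e)) e = shape (stage_word op n (mword n A' n) ?V' (Suc e)) e"
      if e: "Suc d \<le> e" "e < n" for e
    proof -
      have "Suc d \<le> Suc e" "Suc e \<le> n" using e by auto
      then show ?thesis using step.prems(5) e by (simp add: gV del: fun_upd_apply)
    qed
  qed
  then show ?case using Ud by (metis fun_upd_triv fun_upd_upd)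
qed

lemma stage_strips:
  assumes "pieri_op op" "e < n"
  shows "strip (shape (stage_word op n (mword n A n) U (Suc e)) e) (shape (stage_word op n (mword n A n) U e) e)"
    and "strip (shape (stage_word op n (mword n A n) U (Suc e)) e) (shape (stage_word op n (mword n A n) U (Suc e)) (Suc e))"
proof -
  let ?g = "stage_word op n (mword n A n) U"
  have s: "set (?g (Suc e)) \<subseteq> {1..n}" by (rule set_stage_word[OF assms(1) set_mword]) (use assms in simp)
  have "strip (shape (letters_le e (?g (Suc e))) e) (shape (op (mset (row_list e (U e))) (letters_le e (?g (Suc e)))) e)"
    by (rule pieri_op_strip[OF assms(1) set_letters_le[OF s]]) (use set_row_list in auto)
  then show "strip (shape (?g (Suc e)) e) (shape (?g e) e)"
    unfolding letters_le_stage_word[OF assms, symmetric] shape_letters_le by simp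
  show "strip (shape (?g (Suc e)) e) (shape (?g (Suc e)) (Suc e))"
    by (rule shape_strip) (use s in auto)
qed

lemma GT_parts: "GT N P \<Longrightarrow> c \<le> N \<Longrightarrow> c \<le> i \<Longrightarrow> P c i = 0"
proof (induction c arbitrary: i)
  case 0
  then show ?case using GT_0 by metis
next
  case (Suc c)
  then obtain j where "i = Suc j" "c \<le> j" by (cases i) auto
  moreover have "P (Suc c) (Suc j) \<le> P c j" using GT_strip[OF Suc.prems(1), of c] Suc.prems(2) by (simp add: strip_def)
  ultimately show ?case using Suc by fastforce
qed

lemma length_shape:
  assumes "set w \<subseteq> {1..n}" "e \<le> n"
  shows "length (letters_le e w) = (\<Sum>i<n. shape w e i)"
proof -
  have b: "size (tableau_row i (letters_le e w)) = shape w e i" for i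
  proof -
    have "set (letters_le e w) \<subseteq> {..e}" by auto
    from shape_beyond[OF this order_refl, of i] show ?thesis by (simp add: shape_letters_le)
  qed
  have "shape w e n = 0" by (rule GT_parts[OF shape_GT[OF assms(1)] assms(2,2)])
  then have "(row_output {#} ^^ n) (letters_le e w) = []" using b[of n] by (simp add: tableau_row_def row_insert_empty_iff)
  then show ?thesis using length_pow_row_output[of n "letters_le e w"] by (simp add: b)
qed

lemma has_dec_shape: "0 \<notin> set w \<Longrightarrow> has_dec (letters_le e w) (Suc k) \<longleftrightarrow> shape w e k \<noteq> 0"
proof -
  assume w: "0 \<notin> set w"
  have "set (letters_le e w) \<subseteq> {..e}" by auto
  from shape_beyond[OF this order_refl, of k] have "shape w e k = size (tableau_row k (letters_le e w))" by (simp add: shape_letters_le)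
  then show ?thesis using has_dec_iff[of "letters_le e w" k] w by simp
qed

text \<open>Pairs of a persymmetric matrix and a triangular array whose words have no decreasing subsequence of more than \<open>k\<close> letters
when cut to the letters up to \<open>e\<close> at stage \<open>e\<close>. With prepended rows these are the fillings of the nesting polyomino
without long north-east chains, with appended rows those of the crossing polyomino without long south-east chains.\<close>

definition word_fillings :: "(nat multiset \<Rightarrow> nat list \<Rightarrow> nat list) \<Rightarrow> nat \<Rightarrow> nat \<Rightarrow> ((nat \<Rightarrow> nat \<Rightarrow> nat) \<times> (nat \<Rightarrow> nat \<Rightarrow> nat)) set" where
  "word_fillings op n k = {(A, U). persymmetric n A \<and> triangular n 0 U \<and>
     (\<forall>e\<le>n. \<not> has_dec (letters_le e (stage_word op n (mword n A n) U e)) (Suc k))}"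

definition word_fillings_weight :: "nat \<Rightarrow> (nat \<Rightarrow> nat \<Rightarrow> nat) \<times> (nat \<Rightarrow> nat \<Rightarrow> nat) \<Rightarrow> nat" where
  "word_fillings_weight n = (\<lambda>(A, U). (\<Sum>r\<in>{1..n}. \<Sum>c\<in>{1..n}. A r c) + 2 * (\<Sum>e<n. \<Sum>i\<in>{1..e}. U e i))"

definition word_fillings_shapes :: "(nat multiset \<Rightarrow> nat list \<Rightarrow> nat list) \<Rightarrow> nat \<Rightarrow>
    (nat \<Rightarrow> nat \<Rightarrow> nat) \<times> (nat \<Rightarrow> nat \<Rightarrow> nat) \<Rightarrow> (nat \<Rightarrow> nat \<Rightarrow> nat) \<times> (nat \<Rightarrow> nat \<Rightarrow> nat)" where
  "word_fillings_shapes op n = (\<lambda>(A, U).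
     (\<lambda>e. if e \<le> n then shape (stage_word op n (mword n A n) U e) e else (\<lambda>_. 0),
      \<lambda>e. if e < n then shape (stage_word op n (mword n A n) U (Suc e)) e else (\<lambda>_. 0)))"

text \<open>The number of letters up to \<open>e\<close> in a word is the size of the corresponding shape, so row \<open>e\<close> has as many letters as the strip
between \<open>\<tau> e\<close> and \<open>\<sigma> e\<close>.\<close>

lemma word_fillings_weight_shapes:
  assumes "pieri_op op" "word_fillings_shapes op n (A, U) = (\<sigma>, \<tau>)"
  shows "word_fillings_weight n (A, U) = (\<Sum>i<n. \<sigma> n i) + 2 * (\<Sum>e<n. (\<Sum>i<n. \<sigma> e i) - (\<Sum>i<n. \<tau> e i))"
proof -
  let ?g = "stage_word op n (mword n A n) U"
  have s: "set (?g e) \<subseteq> {1..n}" if "e \<le> n" for e by (rule set_stage_word[OF assms(1) set_mword that])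
  have \<sigma>: "\<sigma> = (\<lambda>e. if e \<le> n then shape (?g e) e else (\<lambda>_. 0))" "\<tau> = (\<lambda>e. if e < n then shape (?g (Suc e)) e else (\<lambda>_. 0))"
    using assms(2) by (simp_all add: word_fillings_shapes_def)
  have "letters_le n (mword n A n) = mword n A n" using set_mword[of n A n] by (auto simp: filter_id_conv)
  then have "length (mword n A n) = (\<Sum>i<n. \<sigma> n i)"
    using length_shape[OF set_mword, of n n A n] by (simp add: \<sigma> stage_word_top)
  moreover have "length (mword n A n) = (\<Sum>r\<in>{1..n}. \<Sum>c\<in>{1..n}. A r c)"
    by (simp add: mword_def length_concat comp_def length_row_list interv_sum_list_conv_sum_set_nat
        atLeastLessThanSuc_atLeastAtMost del: upt_Suc)
  moreover have "(\<Sum>i\<in>{1..e}. U e i) = (\<Sum>i<n. \<sigma> e i) - (\<Sum>i<n. \<tau> e i)" if "e < n" for e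
  proof -
    have "length (letters_le e (?g e)) = (\<Sum>i\<in>{1..e}. U e i) + length (letters_le e (?g (Suc e)))"
      unfolding letters_le_stage_word[OF assms(1) that] pieri_op_length[OF assms(1)] by (simp add: length_row_list)
    then show ?thesis using length_shape[OF s, of e e] length_shape[OF s, of "Suc e" e] that by (simp add: \<sigma>)
  qed
  ultimately show ?thesis by (simp add: word_fillings_weight_def)
qed

text \<open>The possible sequences of shapes. They are described without reference to \<open>op\<close>, which is why
appending and prepending lead to equally many fillings.\<close>

definition shape_seqs :: "nat \<Rightarrow> nat \<Rightarrow> ((nat \<Rightarrow> nat \<Rightarrow> nat) \<times> (nat \<Rightarrow> nat \<Rightarrow> nat)) set" where
  "shape_seqs n k = {(\<sigma>, \<tau>). \<sigma> 0 = (\<lambda>_. 0) \<and> (\<forall>e>n. \<sigma> e = (\<lambda>_. 0)) \<and> (\<forall>e\<ge>n. \<tau> e = (\<lambda>_. 0)) \<and>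
     (\<forall>e<n. strip (\<tau> e) (\<sigma> e) \<and> strip (\<tau> e) (\<sigma> (Suc e))) \<and> (\<forall>e\<le>n. \<sigma> e k = 0)}"

lemma word_fillings_shapes_bij:
  assumes op: "pieri_op op"
  shows "bij_betw (word_fillings_shapes op n) (word_fillings op n k) (shape_seqs n k)"
  unfolding bij_betw_def
proof
  have z: "0 \<notin> set (stage_word op n (mword n A n) U e)" if "e \<le> n" for A U e
    using set_stage_word[OF op set_mword that] by fastforce
  have f0: "letters_le 0 (stage_word op n (mword n A n) U 0) = []" for A U using z[of 0 A U] by (auto simp: filter_empty_conv intro!: gr0I)
  show "inj_on (word_fillings_shapes op n) (word_fillings op n k)"
  proof (rule inj_onI, clarify)
    fix A U A' U' assume c: "(A, U) \<in> word_fillings op n k" "(A', U') \<in> word_fillings op n k" "word_fillings_shapes op n (A, U) = word_fillings_shapes op n (A', U')"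
    have "A = A' \<and> U = U'"
    proof (rule stage_unique[OF op, of 0 n])
      show "shape (letters_le 0 (stage_word op n (mword n A n) U 0)) = shape (letters_le 0 (stage_word op n (mword n A' n) U' 0))"
        unfolding f0 ..
    qed (use c in \<open>auto simp: word_fillings_def word_fillings_shapes_def fun_eq_iff split: if_splits\<close>)
    then show "A = A' \<and> U = U'" .
  qed
  show "word_fillings_shapes op n ` word_fillings op n k = shape_seqs n k"
  proof
    show "word_fillings_shapes op n ` word_fillings op n k \<subseteq> shape_seqs n k"
      using stage_strips[OF op] z has_dec_shape[OF z] shape_0[OF z]
      by (auto simp: word_fillings_def shape_seqs_def word_fillings_shapes_def fun_eq_iff)
    show "shape_seqs n k \<subseteq> word_fillings_shapes op n ` word_fillings op n k"
    proof
      fix x assume x: "x \<in> shape_seqs n k"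
      obtain \<sigma> \<tau> where row_insert: "x = (\<sigma>, \<tau>)" by (cases x)
      have "GT 0 (\<lambda>_ _. 0)" by (rule GT_I) auto
      from stage_exists[OF op _ this, of n \<sigma> \<tau>] x obtain A U where A: "persymmetric n A" "triangular n 0 U"
        "\<forall>e\<le>n. shape (stage_word op n (mword n A n) U e) e = \<sigma> e" "\<forall>e<n. shape (stage_word op n (mword n A n) U (Suc e)) e = \<tau> e"
        by (auto simp: row_insert shape_seqs_def)
      have "(A, U) \<in> word_fillings op n k" using A x has_dec_shape[OF z] by (auto simp: word_fillings_def row_insert shape_seqs_def)
      moreover have "word_fillings_shapes op n (A, U) = x" using A x by (auto simp: word_fillings_shapes_def row_insert shape_seqs_def fun_eq_iff)
      ultimately show "x \<in> word_fillings_shapes op n ` word_fillings op n k" by force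
    qed
  qed
qed

theorem card_word_fillings: "card {x \<in> word_fillings prepend_row n k. word_fillings_weight n x = t} = card {x \<in> word_fillings append_row n k. word_fillings_weight n x = t}"
proof -
  define W where "W = (\<lambda>(\<sigma> :: nat \<Rightarrow> nat \<Rightarrow> nat, \<tau> :: nat \<Rightarrow> nat \<Rightarrow> nat).
    (\<Sum>i<n. \<sigma> n i) + 2 * (\<Sum>e<n. (\<Sum>i<n. \<sigma> e i) - (\<Sum>i<n. \<tau> e i)))"
  have "card {x \<in> word_fillings op n k. word_fillings_weight n x = t} = card {y \<in> shape_seqs n k. W y = t}" if op: "pieri_op op" for op
  proof (rule bij_betw_same_card[of "word_fillings_shapes op n"])
    note b = word_fillings_shapes_bij[OF op, of n k]
    have w: "word_fillings_weight n x = W (word_fillings_shapes op n x)" for x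
      using word_fillings_weight_shapes[OF op, of n "fst x" "snd x"] by (cases "word_fillings_shapes op n x") (simp add: W_def)
    have "inj_on (word_fillings_shapes op n) {x \<in> word_fillings op n k. word_fillings_weight n x = t}"
      using b by (auto simp: bij_betw_def intro: inj_on_subset)
    moreover have "word_fillings_shapes op n ` {x \<in> word_fillings op n k. word_fillings_weight n x = t} = {y \<in> shape_seqs n k. W y = t}"
      unfolding bij_betw_imp_surj_on[OF b, symmetric] w by blast
    ultimately show "bij_betw (word_fillings_shapes op n) {x \<in> word_fillings op n k. word_fillings_weight n x = t} {y \<in> shape_seqs n k. W y = t}"
      by (simp add: bij_betw_def)
  qed
  then show ?thesis using pieri_op_L pieri_op_R by simp
qed

section \<open>Counting top-dimensional faces by weighted fillings\<close>

definition box_weight :: "'a set \<Rightarrow> 'a \<Rightarrow> nat" where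
  "box_weight D b = (if b \<in> D then 1 else 2)"

definition fill_count :: "'a set \<Rightarrow> 'a set \<Rightarrow> nat \<Rightarrow> nat" where
  "fill_count D \<sigma> t = card {f :: 'a \<Rightarrow> nat. {b. f b \<noteq> 0} = \<sigma> \<and> (\<Sum>b\<in>\<sigma>. box_weight D b * f b) = t}"

lemma box_weight_pos: "0 < box_weight D b"
  by (simp add: box_weight_def)

lemma finite_fillings:
  assumes "finite \<sigma>"
  shows "finite {f :: 'a \<Rightarrow> nat. {b. f b \<noteq> 0} \<subseteq> \<sigma> \<and> (\<Sum>b\<in>\<sigma>. box_weight D b * f b) = t}"
proof (rule finite_subset)
  show "{f :: 'a \<Rightarrow> nat. {b. f b \<noteq> 0} \<subseteq> \<sigma> \<and> (\<Sum>b\<in>\<sigma>. box_weight D b * f b) = t} \<subseteq>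
      {f. \<forall>b. (b \<in> \<sigma> \<longrightarrow> f b \<in> {..t}) \<and> (b \<notin> \<sigma> \<longrightarrow> f b = 0)}"
  proof clarify
    fix f :: "'a \<Rightarrow> nat" and b
    assume f: "{b. f b \<noteq> 0} \<subseteq> \<sigma>" and t: "t = (\<Sum>b\<in>\<sigma>. box_weight D b * f b)"
    have "f b \<le> box_weight D b * f b" using box_weight_pos[of D b] by simp
    also have "\<dots> \<le> (\<Sum>b\<in>\<sigma>. box_weight D b * f b)" if "b \<in> \<sigma>" using assms that by (intro member_le_sum) auto
    finally show "(b \<in> \<sigma> \<longrightarrow> f b \<in> {..(\<Sum>b\<in>\<sigma>. box_weight D b * f b)}) \<and> (b \<notin> \<sigma> \<longrightarrow> f b = 0)"
      using f by auto
  qed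
  show "finite {f. \<forall>b. (b \<in> \<sigma> \<longrightarrow> f b \<in> {..t}) \<and> (b \<notin> \<sigma> \<longrightarrow> f b = 0)}"
    by (rule finite_set_of_finite_funs[OF assms]) simp
qed

lemma finite_fillings_eq:
  assumes "finite \<sigma>"
  shows "finite {f :: 'a \<Rightarrow> nat. {b. f b \<noteq> 0} = \<sigma> \<and> (\<Sum>b\<in>\<sigma>. box_weight D b * f b) = t}"
  by (rule finite_subset[OF _ finite_fillings[OF assms, of D t]]) auto

text \<open>Split the fillings with support \<open>insert b \<sigma>\<close> by whether the entry in \<open>b\<close> is one or larger, and subtract one from it.\<close>

lemma fill_count_insert:
  assumes "finite \<sigma>" "b \<notin> \<sigma>" "w = box_weight D b"
  shows "fill_count D (insert b \<sigma>) t =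
    (if w \<le> t then fill_count D \<sigma> (t - w) + fill_count D (insert b \<sigma>) (t - w) else 0)"
proof -
  define S where "S = (\<lambda>\<sigma> t. {f :: 'a \<Rightarrow> nat. {b. f b \<noteq> 0} = \<sigma> \<and> (\<Sum>b\<in>\<sigma>. box_weight D b * f b) = t})"
  have fin: "finite (S \<sigma> t)" "finite (S (insert b \<sigma>) t)" for t
    by (simp_all only: S_def finite_fillings_eq finite_insert assms(1))
  have sum: "(\<Sum>a\<in>insert b \<sigma>. box_weight D a * f a) = w * f b + (\<Sum>a\<in>\<sigma>. box_weight D a * f a)" for f
    using assms by simp
  have upd: "(\<Sum>a\<in>\<sigma>. box_weight D a * (f(b := x)) a) = (\<Sum>a\<in>\<sigma>. box_weight D a * f a)" for f x
    by (rule sum.cong) (use assms(2) in auto)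
  show ?thesis
  proof (cases "w \<le> t")
    case False
    have "S (insert b \<sigma>) t = {}"
    proof (rule ccontr)
      assume "S (insert b \<sigma>) t \<noteq> {}"
      then obtain f where "{a. f a \<noteq> 0} = insert b \<sigma>" "w * f b + (\<Sum>a\<in>\<sigma>. box_weight D a * f a) = t"
        unfolding S_def sum by blast
      then have "f b \<noteq> 0" "w * f b \<le> t" by (blast, linarith)
      then have "f b \<ge> 1" by simp
      moreover have "w \<le> w * f b" using \<open>f b \<ge> 1\<close> by simp
      ultimately show False using False \<open>w * f b \<le> t\<close> by linarith
    qed
    then have "card (S (insert b \<sigma>) t) = 0" by simp
    then show ?thesis using False by (simp only: fill_count_def S_def if_False)
  next
    case True
    have nz: "f b \<noteq> 0" if "f \<in> S (insert b \<sigma>) u" for f u using that unfolding S_def by blast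
    let ?A = "{f \<in> S (insert b \<sigma>) t. f b = 1}" and ?B = "{f \<in> S (insert b \<sigma>) t. f b \<noteq> 1}"
    have "S (insert b \<sigma>) t = ?A \<union> ?B" by blast
    then have "card (S (insert b \<sigma>) t) = card ?A + card ?B"
      using card_Un_disjoint[of ?A ?B] fin(2)[of t] by auto
    moreover have "card ?A = card (S \<sigma> (t - w))"
    proof (rule bij_betw_same_card[of "\<lambda>f. f(b := 0)"], rule bij_betw_byWitness[where f' = "\<lambda>f. f(b := 1)"])
      show "\<forall>f\<in>?A. (f(b := 0))(b := 1) = f" by (auto simp: fun_eq_iff)
      show "\<forall>f\<in>S \<sigma> (t - w). (f(b := 1))(b := 0) = f" using assms(2) by (auto simp: S_def fun_eq_iff)
      show "(\<lambda>f. f(b := 0)) ` ?A \<subseteq> S \<sigma> (t - w)"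
      proof clarify
        fix f assume f: "f \<in> S (insert b \<sigma>) t" "f b = 1"
        have "{a. (f(b := 0)) a \<noteq> 0} = {a. f a \<noteq> 0} - {b}" by auto
        then show "f(b := 0) \<in> S \<sigma> (t - w)"
          using f assms(2) unfolding S_def sum mem_Collect_eq upd by auto
      qed
      show "(\<lambda>f. f(b := 1)) ` S \<sigma> (t - w) \<subseteq> ?A"
      proof clarify
        fix f assume f: "f \<in> S \<sigma> (t - w)"
        have "{a. (f(b := 1)) a \<noteq> 0} = insert b {a. f a \<noteq> 0}" by auto
        then show "f(b := 1) \<in> S (insert b \<sigma>) t \<and> (f(b := 1)) b = 1"
          using f True unfolding S_def sum mem_Collect_eq upd by auto
      qed
    qed
    moreover have "card ?B = card (S (insert b \<sigma>) (t - w))"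
    proof (rule bij_betw_same_card[of "\<lambda>f. f(b := f b - 1)"], rule bij_betw_byWitness[where f' = "\<lambda>f. f(b := f b + 1)"])
      show "\<forall>f\<in>?B. (f(b := f b - 1))(b := (f(b := f b - 1)) b + 1) = f"
        using nz by (fastforce simp: fun_eq_iff)
      show "\<forall>f\<in>S (insert b \<sigma>) (t - w). (f(b := f b + 1))(b := (f(b := f b + 1)) b - 1) = f"
        by (auto simp: fun_eq_iff)
      show "(\<lambda>f. f(b := f b - 1)) ` ?B \<subseteq> S (insert b \<sigma>) (t - w)"
      proof clarify
        fix f assume f: "f \<in> S (insert b \<sigma>) t" "f b \<noteq> 1"
        then have fb: "{a. f a \<noteq> 0} = insert b \<sigma>" "w * f b + (\<Sum>a\<in>\<sigma>. box_weight D a * f a) = t"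
          unfolding S_def sum by auto
        then have "f b \<noteq> 0" by blast
        then have "f b > 1" using f(2) by simp
        moreover have "w * f b = w * (f b - 1) + w" using \<open>f b \<noteq> 0\<close> by (cases "f b") simp_all
        moreover have "{a. (f(b := f b - 1)) a \<noteq> 0} = {a. f a \<noteq> 0}" using \<open>1 < f b\<close> by auto
        ultimately show "f(b := f b - 1) \<in> S (insert b \<sigma>) (t - w)"
          unfolding S_def sum mem_Collect_eq upd using fb by simp
      qed
      show "(\<lambda>f. f(b := f b + 1)) ` S (insert b \<sigma>) (t - w) \<subseteq> ?B"
      proof clarify
        fix f assume f: "f \<in> S (insert b \<sigma>) (t - w)"
        then have fb: "{a. f a \<noteq> 0} = insert b \<sigma>" "w * f b + (\<Sum>a\<in>\<sigma>. box_weight D a * f a) = t - w"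
          unfolding S_def sum by auto
        then have "f b \<noteq> 0" by blast
        then have "{a. (f(b := f b + 1)) a \<noteq> 0} = {a. f a \<noteq> 0}" by auto
        then show "f(b := f b + 1) \<in> S (insert b \<sigma>) t \<and> (f(b := f b + 1)) b \<noteq> 1"
          unfolding S_def sum mem_Collect_eq upd using fb True \<open>f b \<noteq> 0\<close> by simp
      qed
    qed
    ultimately show ?thesis using True by (simp add: fill_count_def S_def)
  qed
qed

definition fill_fps :: "'a set \<Rightarrow> 'a set \<Rightarrow> int fps" where
  "fill_fps D \<sigma> = Abs_fps (\<lambda>t. int (fill_count D \<sigma> t))"

lemma fill_fps_insert:
  assumes "finite \<sigma>" "b \<notin> \<sigma>"
  shows "fill_fps D (insert b \<sigma>) * (1 - fps_X ^ box_weight D b) = fps_X ^ box_weight D b * fill_fps D \<sigma>"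
proof -
  have "fill_fps D (insert b \<sigma>) = fps_X ^ box_weight D b * (fill_fps D \<sigma> + fill_fps D (insert b \<sigma>))"
    by (rule fps_ext) (auto simp: fill_fps_def fps_X_power_mult_nth fill_count_insert[OF assms refl, where D = D])
  then show ?thesis by (simp add: algebra_simps)
qed

text \<open>The generating function of the fillings with support \<open>\<sigma>\<close> is the product of the geometric series \<open>z^w / (1 - z^w)\<close> over the
weights \<open>w\<close> of the boxes in \<open>\<sigma>\<close>.\<close>

lemma fill_fps_eq:
  assumes "finite \<sigma>"
  shows "fill_fps D \<sigma> * ((1 - fps_X) ^ card (\<sigma> \<inter> D) * (1 - fps_X\<^sup>2) ^ card (\<sigma> - D)) =
     fps_X ^ (card (\<sigma> \<inter> D) + 2 * card (\<sigma> - D))"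
  using assms
proof (induction rule: finite_induct)
  case empty
  have "{f :: 'a \<Rightarrow> nat. {b. f b \<noteq> 0} = {} \<and> (\<Sum>b\<in>{}. box_weight D b * f b) = t} = (if t = 0 then {\<lambda>_. 0} else {})" for t
    by (auto simp: fun_eq_iff)
  then have "fill_fps D {} = 1" by (intro fps_ext) (simp add: fill_fps_def fill_count_def)
  then show ?case by simp
next
  case (insert b \<sigma>)
  show ?case
  proof (cases "b \<in> D")
    case True
    then have e: "insert b \<sigma> \<inter> D = insert b (\<sigma> \<inter> D)" "insert b \<sigma> - D = \<sigma> - D" by auto
    have "fill_fps D (insert b \<sigma>) * ((1 - fps_X) ^ Suc (card (\<sigma> \<inter> D)) * (1 - fps_X\<^sup>2) ^ card (\<sigma> - D)) =
      (fill_fps D (insert b \<sigma>) * (1 - fps_X)) * ((1 - fps_X) ^ card (\<sigma> \<inter> D) * (1 - fps_X\<^sup>2) ^ card (\<sigma> - D))"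
      by (simp add: algebra_simps)
    also have "\<dots> = fps_X * (fill_fps D \<sigma> * ((1 - fps_X) ^ card (\<sigma> \<inter> D) * (1 - fps_X\<^sup>2) ^ card (\<sigma> - D)))"
      using fill_fps_insert[OF insert(1,2), of D] True by (simp add: box_weight_def mult.assoc)
    also have "\<dots> = fps_X ^ (Suc (card (\<sigma> \<inter> D)) + 2 * card (\<sigma> - D))" by (simp add: insert.IH)
    finally show ?thesis unfolding e using insert(1,2) by simp
  next
    case False
    then have e: "insert b \<sigma> \<inter> D = \<sigma> \<inter> D" "insert b \<sigma> - D = insert b (\<sigma> - D)" by auto
    have "fill_fps D (insert b \<sigma>) * ((1 - fps_X) ^ card (\<sigma> \<inter> D) * (1 - fps_X\<^sup>2) ^ Suc (card (\<sigma> - D))) =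
      (fill_fps D (insert b \<sigma>) * (1 - fps_X\<^sup>2)) * ((1 - fps_X) ^ card (\<sigma> \<inter> D) * (1 - fps_X\<^sup>2) ^ card (\<sigma> - D))"
      by (simp add: algebra_simps)
    also have "\<dots> = fps_X\<^sup>2 * (fill_fps D \<sigma> * ((1 - fps_X) ^ card (\<sigma> \<inter> D) * (1 - fps_X\<^sup>2) ^ card (\<sigma> - D)))"
      using fill_fps_insert[OF insert(1,2), of D] False by (simp add: box_weight_def mult.assoc numeral_2_eq_2)
    also have "\<dots> = fps_X ^ (card (\<sigma> \<inter> D) + 2 * Suc (card (\<sigma> - D)))"
      by (simp add: insert.IH flip: power_add)
    finally show ?thesis unfolding e using insert(1,2) by simp
  qed
qed

text \<open>The numerator of the generating function over the common denominator \<open>(1 - z^2)^(k + e)\<close>. A factor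
\<open>1 - z\<close> of the denominator is supplemented by \<open>1 + z\<close>.\<close>

definition face_poly :: "nat \<Rightarrow> nat \<Rightarrow> 'a set \<Rightarrow> 'a set \<Rightarrow> int poly" where
  "face_poly k e D \<sigma> = monom 1 (card (\<sigma> \<inter> D) + 2 * card (\<sigma> - D)) * [:1, 1:] ^ card (\<sigma> \<inter> D) *
     [:1, 0, -1:] ^ ((k - card (\<sigma> \<inter> D)) + (e - card (\<sigma> - D)))"

lemma fill_fps_face_poly:
  assumes "finite \<sigma>" "card (\<sigma> \<inter> D) \<le> k" "card (\<sigma> - D) \<le> e"
  shows "fill_fps D \<sigma> * (1 - fps_X\<^sup>2) ^ (k + e) = fps_of_poly (face_poly k e D \<sigma>)"
proof -
  let ?d = "card (\<sigma> \<inter> D)" and ?e = "card (\<sigma> - D)"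
  have "k + e = ?d + ?e + ((k - ?d) + (e - ?e))" using assms by simp
  then have "(1 - fps_X\<^sup>2 :: int fps) ^ (k + e) =
     (1 - fps_X\<^sup>2) ^ ?d * (1 - fps_X\<^sup>2) ^ ?e * (1 - fps_X\<^sup>2) ^ ((k - ?d) + (e - ?e))"
    by (metis power_add)
  also have "(1 - fps_X\<^sup>2 :: int fps) ^ ?d = (1 - fps_X) ^ ?d * (1 + fps_X) ^ ?d"
    unfolding power_mult_distrib[symmetric] by (rule arg_cong[of _ _ "\<lambda>x. x ^ ?d"]) (simp add: algebra_simps power2_eq_square)
  finally have "fill_fps D \<sigma> * (1 - fps_X\<^sup>2) ^ (k + e) =
    (fill_fps D \<sigma> * ((1 - fps_X) ^ ?d * (1 - fps_X\<^sup>2) ^ ?e)) * ((1 + fps_X) ^ ?d * (1 - fps_X\<^sup>2) ^ ((k - ?d) + (e - ?e)))"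
    by (simp only: mult_ac)
  moreover have "fps_of_poly [:1, 0, -1:] = (1 - fps_X\<^sup>2 :: int fps)" "fps_of_poly [:1, 1:] = (1 + fps_X :: int fps)"
    by (simp_all add: fps_of_poly_pCons power2_eq_square)
  ultimately show ?thesis
    by (simp add: fill_fps_eq[OF assms(1)] face_poly_def fps_of_poly_mult fps_of_poly_power fps_of_poly_monom mult.assoc)
qed

lemma poly_face_poly: 
  assumes "card (\<sigma> \<inter> D) \<le> k" "card (\<sigma> - D) \<le> e"
  shows "poly (face_poly k e D \<sigma>) 1 = (if card (\<sigma> \<inter> D) = k \<and> card (\<sigma> - D) = e then 2 ^ k else 0)"
  using assms by (auto simp: face_poly_def poly_monom poly_mult poly_power power_0_left)

text \<open>The faces with \<open>k\<close> boxes in \<open>D\<close> and \<open>e\<close> boxes outside are those whose generating function has a pole of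
maximal order at \<open>z = 1\<close>, all with the same leading coefficient.\<close>

theorem card_top_faces_eq:
  fixes \<F> \<G> :: "'a set set"
  assumes fin: "finite P" "\<F> \<subseteq> Pow P" "\<G> \<subseteq> Pow P"
    and dim: "\<And>\<sigma>. \<sigma> \<in> \<F> \<union> \<G> \<Longrightarrow> card (\<sigma> \<inter> D) \<le> k \<and> card (\<sigma> - D) \<le> e"
    and count: "\<And>t. card {f :: 'a \<Rightarrow> nat. {b. f b \<noteq> 0} \<in> \<F> \<and> (\<Sum>b\<in>P. box_weight D b * f b) = t} =
                  card {f :: 'a \<Rightarrow> nat. {b. f b \<noteq> 0} \<in> \<G> \<and> (\<Sum>b\<in>P. box_weight D b * f b) = t}"
  shows "card {\<sigma> \<in> \<F>. card (\<sigma> \<inter> D) = k \<and> card (\<sigma> - D) = e} =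
         card {\<sigma> \<in> \<G>. card (\<sigma> \<inter> D) = k \<and> card (\<sigma> - D) = e}"
proof -
  have sum: "(\<Sum>\<sigma>\<in>\<H>. fill_fps D \<sigma>) = Abs_fps (\<lambda>t. int (card {f :: 'a \<Rightarrow> nat. {b. f b \<noteq> 0} \<in> \<H> \<and> (\<Sum>b\<in>P. box_weight D b * f b) = t}))"
    if H: "\<H> \<subseteq> Pow P" for \<H>
  proof (rule fps_ext)
    fix t
    have finH: "finite \<H>" using H fin(1) by (meson finite_Pow_iff finite_subset)
    have eq: "(\<Sum>b\<in>P. box_weight D b * f b) = (\<Sum>b\<in>{b. f b \<noteq> 0}. box_weight D b * f b)" if "{b. f b \<noteq> 0} \<in> \<H>" for f :: "'a \<Rightarrow> nat"
      by (rule sum.mono_neutral_right) (use that H fin(1) in auto)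
    have "{f :: 'a \<Rightarrow> nat. {b. f b \<noteq> 0} \<in> \<H> \<and> (\<Sum>b\<in>P. box_weight D b * f b) = t} =
       (\<Union>\<sigma>\<in>\<H>. {f. {b. f b \<noteq> 0} = \<sigma> \<and> (\<Sum>b\<in>\<sigma>. box_weight D b * f b) = t})"
      using eq by auto
    also have "card \<dots> = (\<Sum>\<sigma>\<in>\<H>. fill_count D \<sigma> t)" unfolding fill_count_def
    proof (rule card_UN_disjoint[OF finH])
      show "\<forall>\<sigma>\<in>\<H>. finite {f :: 'a \<Rightarrow> nat. {b. f b \<noteq> 0} = \<sigma> \<and> (\<Sum>b\<in>\<sigma>. box_weight D b * f b) = t}"
        using H fin(1) by (intro ballI finite_fillings_eq) (meson PowD finite_subset subsetD)
    qed auto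
    finally show "fps_nth (\<Sum>\<sigma>\<in>\<H>. fill_fps D \<sigma>) t = fps_nth (Abs_fps (\<lambda>t. int (card {f :: 'a \<Rightarrow> nat. {b. f b \<noteq> 0} \<in> \<H> \<and> (\<Sum>b\<in>P. box_weight D b * f b) = t}))) t"
      by (simp add: fps_sum_nth fill_fps_def)
  qed
  have poly: "fps_of_poly (\<Sum>\<sigma>\<in>\<H>. face_poly k e D \<sigma>) = (\<Sum>\<sigma>\<in>\<H>. fill_fps D \<sigma>) * (1 - fps_X\<^sup>2) ^ (k + e)"
    and eval: "poly (\<Sum>\<sigma>\<in>\<H>. face_poly k e D \<sigma>) 1 = 2 ^ k * int (card {\<sigma> \<in> \<H>. card (\<sigma> \<inter> D) = k \<and> card (\<sigma> - D) = e})"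
    if H: "\<H> \<subseteq> \<F> \<union> \<G>" for \<H>
  proof -
    have finH: "finite \<H>" using H fin by (meson finite_Pow_iff finite_subset le_sup_iff Un_least)
    have fs: "finite \<sigma>" if "\<sigma> \<in> \<H>" for \<sigma> using that H fin by (meson PowD UnE finite_subset subsetD)
    show "fps_of_poly (\<Sum>\<sigma>\<in>\<H>. face_poly k e D \<sigma>) = (\<Sum>\<sigma>\<in>\<H>. fill_fps D \<sigma>) * (1 - fps_X\<^sup>2) ^ (k + e)"
      unfolding fps_of_poly_sum sum_distrib_right
      by (rule sum.cong[OF refl], rule fill_fps_face_poly[symmetric]) (use fs dim H in auto)
    have "poly (\<Sum>\<sigma>\<in>\<H>. face_poly k e D \<sigma>) 1 = (\<Sum>\<sigma>\<in>\<H>. if card (\<sigma> \<inter> D) = k \<and> card (\<sigma> - D) = e then 2 ^ k else 0)"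
      unfolding poly_sum by (rule sum.cong[OF refl], rule poly_face_poly) (use dim H in auto)
    also have "\<dots> = (\<Sum>\<sigma>\<in>{\<sigma> \<in> \<H>. card (\<sigma> \<inter> D) = k \<and> card (\<sigma> - D) = e}. 2 ^ k)"
      by (rule sum.inter_filter[symmetric, OF finH])
    finally show "poly (\<Sum>\<sigma>\<in>\<H>. face_poly k e D \<sigma>) 1 = 2 ^ k * int (card {\<sigma> \<in> \<H>. card (\<sigma> \<inter> D) = k \<and> card (\<sigma> - D) = e})"
      by simp
  qed
  have "fps_of_poly (\<Sum>\<sigma>\<in>\<F>. face_poly k e D \<sigma>) = fps_of_poly (\<Sum>\<sigma>\<in>\<G>. face_poly k e D \<sigma>)"
    using poly[of \<F>] poly[of \<G>] sum[OF fin(2)] sum[OF fin(3)] count by simp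
  then have "(\<Sum>\<sigma>\<in>\<F>. face_poly k e D \<sigma>) = (\<Sum>\<sigma>\<in>\<G>. face_poly k e D \<sigma>)"
    by (simp add: fps_of_poly_eq_iff)
  then show ?thesis using eval[of \<F>] eval[of \<G>] by simp
qed

section \<open>Sorting networks\<close>

subsection \<open>Longest chains in rectangles\<close>

definition sechain :: "(nat \<times> nat) set \<Rightarrow> bool" where
  "sechain X \<longleftrightarrow> (\<forall>b\<in>X. \<forall>c\<in>X. b \<noteq> c \<longrightarrow> (fst b < fst c \<and> snd b < snd c) \<or> (fst c < fst b \<and> snd c < snd b))"

text \<open>The longest south-east chain of \<open>\<sigma>\<close> in the columns \<open>1, \<dots>, i\<close> and the rows \<open>a + 1, \<dots>, a + j\<close>.\<close>

fun chain_length :: "(nat \<times> nat) set \<Rightarrow> nat \<Rightarrow> nat \<Rightarrow> nat \<Rightarrow> nat" where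
  "chain_length \<sigma> a 0 j = 0"
| "chain_length \<sigma> a (Suc i) 0 = 0"
| "chain_length \<sigma> a (Suc i) (Suc j) = (if (Suc i, a + Suc j) \<in> \<sigma> then Suc (chain_length \<sigma> a i j)
     else max (chain_length \<sigma> a i (Suc j)) (chain_length \<sigma> a (Suc i) j))"

lemma chain_length_0 [simp]: "chain_length \<sigma> a i 0 = 0"
  by (cases i) auto

lemma sechain_le_chain_length:
  "sechain X \<Longrightarrow> X \<subseteq> \<sigma> \<Longrightarrow> X \<subseteq> {1..i} \<times> {a + 1..a + j} \<Longrightarrow> card X \<le> chain_length \<sigma> a i j"
proof (induction \<sigma> a i j arbitrary: X rule: chain_length.induct)
  case (3 \<sigma> a i j)
  have fin: "finite X" using 3(6) by (rule finite_subset) auto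
  let ?Y = "{b \<in> X. fst b \<noteq> Suc i \<and> snd b \<noteq> a + Suc j}"
  have top: "b = c" if "b \<in> X" "c \<in> X" "fst b = Suc i \<or> snd b = a + Suc j" "fst c = Suc i \<or> snd c = a + Suc j" for b c
  proof (rule ccontr)
    assume "b \<noteq> c"
    then have "(fst b < fst c \<and> snd b < snd c) \<or> (fst c < fst b \<and> snd c < snd b)"
      using 3(4) that(1,2) unfolding sechain_def by blast
    moreover have "fst b \<le> Suc i" "fst c \<le> Suc i" "snd b \<le> a + Suc j" "snd c \<le> a + Suc j"
      using 3(6) that(1,2) by auto
    ultimately show False using that(3,4) by auto
  qed
  have sub: "sechain Y" "Y \<subseteq> \<sigma>" if "Y \<subseteq> X" for Y using that 3(4,5) unfolding sechain_def by blast+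
  show ?case
  proof (cases "(Suc i, a + Suc j) \<in> \<sigma>")
    case True
    have "card ?Y \<le> chain_length \<sigma> a i j"
      by (rule 3(1)[OF True]) (use sub[of ?Y] 3(6) in \<open>auto simp: le_Suc_eq\<close>)
    moreover have "card X \<le> Suc (card ?Y)"
    proof (cases "X = ?Y")
      case False
      then obtain b where b: "b \<in> X" "fst b = Suc i \<or> snd b = a + Suc j" by blast
      then have "X = insert b ?Y" using top by blast
      then show ?thesis using fin by (metis (no_types, lifting) card_insert_le_m1 card_insert_if finite_insert le_SucI order_refl)
    qed simp
    ultimately show ?thesis using True by simp
  next
    case False
    show ?thesis
    proof (cases "\<exists>b\<in>X. fst b = Suc i")
      case True
      then obtain b where b: "b \<in> X" "fst b = Suc i" by blast
      then have "snd b \<noteq> a + Suc j" using False 3(5) by (metis prod.collapse subsetD)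
      then have "snd c \<noteq> a + Suc j" if "c \<in> X" for c using top[OF b(1) that] b(2) by auto
      then have "X \<subseteq> {1..Suc i} \<times> {a + 1..a + j}" using 3(6) by (fastforce simp: le_Suc_eq)
      from 3(3)[OF False 3(4,5) this] show ?thesis using False by simp
    next
      case noti: False
      then have "X \<subseteq> {1..i} \<times> {a + 1..a + Suc j}" using 3(6) by (fastforce simp: le_Suc_eq)
      from 3(2)[OF False 3(4,5) this] show ?thesis using False by simp
    qed
  qed
qed auto

lemma chain_length_sechain:
  "\<exists>X. sechain X \<and> X \<subseteq> \<sigma> \<and> X \<subseteq> {1..i} \<times> {a + 1..a + j} \<and> card X = chain_length \<sigma> a i j"
proof (induction \<sigma> a i j rule: chain_length.induct)
  case (3 \<sigma> a i j)
  show ?case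
  proof (cases "(Suc i, a + Suc j) \<in> \<sigma>")
    case True
    from 3(1)[OF this] obtain X where X: "sechain X" "X \<subseteq> \<sigma>" "X \<subseteq> {1..i} \<times> {a + 1..a + j}" "card X = chain_length \<sigma> a i j" by blast
    have "finite X" using X(3) by (rule finite_subset) auto
    moreover have "(Suc i, a + Suc j) \<notin> X" using X(3) by auto
    moreover have "sechain (insert (Suc i, a + Suc j) X)" using X(1,3) unfolding sechain_def by fastforce
    moreover have "insert (Suc i, a + Suc j) X \<subseteq> {1..Suc i} \<times> {a + 1..a + Suc j}" using X(3) by auto
    ultimately show ?thesis using True X(2,4) by (intro exI[of _ "insert (Suc i, a + Suc j) X"]) auto
  next
    case False
    from 3(2)[OF this] obtain X where X: "sechain X" "X \<subseteq> \<sigma>" "X \<subseteq> {1..i} \<times> {a + 1..a + Suc j}" "card X = chain_length \<sigma> a i (Suc j)" by blast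
    from 3(3)[OF False] obtain Y where Y: "sechain Y" "Y \<subseteq> \<sigma>" "Y \<subseteq> {1..Suc i} \<times> {a + 1..a + j}" "card Y = chain_length \<sigma> a (Suc i) j" by blast
    have "X \<subseteq> {1..Suc i} \<times> {a + 1..a + Suc j}" "Y \<subseteq> {1..Suc i} \<times> {a + 1..a + Suc j}" using X(3) Y(3) by auto
    then show ?thesis using False X Y by (cases "chain_length \<sigma> a i (Suc j) \<le> chain_length \<sigma> a (Suc i) j")
       (auto simp: max_def intro: exI[of _ X] exI[of _ Y])
  qed
qed (auto intro!: exI[of _ "{}"] simp: sechain_def)

subsection \<open>Comparators and the hyperoctahedral group\<close>

text \<open>A sequence \<open>w\<close> lives on the sites \<open>1 - m, \<dots>, m\<close>; the comparator at \<open>g\<close> puts the sites \<open>g\<close> and \<open>g + 1\<close> in increasing order.\<close>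

definition comparator :: "int \<Rightarrow> (int \<Rightarrow> int) \<Rightarrow> int \<Rightarrow> int" where
  "comparator g w = (if w (g + 1) < w g then w(g := w (g + 1), g + 1 := w g) else w)"

text \<open>The number of entries above the threshold \<open>t\<close> to the right of the gap after site \<open>g\<close>. On these functions a comparator acts
as the minimum in the lemma \<open>height_comparator_same\<close>, the same recursion that longest chains satisfy.\<close>

definition height :: "int \<Rightarrow> (int \<Rightarrow> int) \<Rightarrow> int \<Rightarrow> int \<Rightarrow> int" where
  "height m w t g = (\<Sum>s\<in>{g + 1..m}. if t < w s then 1 else 0)"

lemma height_rec: "g < m \<Longrightarrow> height m w t g = (if t < w (g + 1) then 1 else 0) + height m w t (g + 1)"
proof -
  assume "g < m"
  then have "{g + 1..m} = insert (g + 1) {g + 1 + 1..m}" by auto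
  then show ?thesis by (simp add: height_def)
qed

lemma height_cong: "(\<And>s. g < s \<Longrightarrow> s \<le> m \<Longrightarrow> w s = w' s) \<Longrightarrow> height m w t g = height m w' t g"
  unfolding height_def by (rule sum.cong) auto

lemma height_comparator_same:
  assumes "g < m"
  shows "height m (comparator g w) t g = min (height m w t (g - 1)) (height m w t (g + 1) + 1)"
proof -
  have 1: "height m (comparator g w) t (g + 1) = height m w t (g + 1)" by (rule height_cong) (auto simp: comparator_def)
  show ?thesis
    using height_rec[of "g - 1" m w t] height_rec[OF assms, of w t] height_rec[OF assms, of "comparator g w" t] assms 1
    by (auto simp: comparator_def min_def)
qed

lemma height_comparator_other:
  assumes "g < m" "h \<noteq> g"
  shows "height m (comparator g w) t h = height m w t h"
proof (cases "g < h")
  case True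
  then show ?thesis by (intro height_cong) (auto simp: comparator_def)
next
  case False
  then have "h \<le> g - 1" using assms by simp
  then show ?thesis
  proof (induction h rule: int_le_induct)
    case base
    have "height m (comparator g w) t (g + 1) = height m w t (g + 1)" by (rule height_cong) (auto simp: comparator_def)
    then show ?case using height_rec[of "g - 1" m _ t] height_rec[OF assms(1), of _ t] assms(1)
      by (auto simp: comparator_def)
  next
    case (step h)
    have "comparator g w h = w h" using step.hyps by (simp add: comparator_def)
    then show ?case using height_rec[of "h - 1" m _ t] step assms(1) by simp
  qed
qed

text \<open>The hyperoctahedral group: permutations that commute with the reflection \<open>s \<mapsto> 1 - s\<close> of the sites.\<close>

definition sym_perm :: "int \<Rightarrow> (int \<Rightarrow> int) \<Rightarrow> bool" where
  "sym_perm m w \<longleftrightarrow> inj_on w {1 - m..m} \<and> w ` {1 - m..m} \<subseteq> {1 - m..m} \<and> (\<forall>s\<in>{1 - m..m}. w (1 - s) = 1 - w s)"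

text \<open>A comparator together with its mirror image, so that the symmetry is preserved.\<close>

definition apply_comparator :: "nat \<Rightarrow> (int \<Rightarrow> int) \<Rightarrow> int \<Rightarrow> int" where
  "apply_comparator i w = (if i = 0 then comparator 0 w else comparator (- int i) (comparator (int i) w))"

definition swap_sites :: "nat \<Rightarrow> int \<Rightarrow> int" where
  "swap_sites i s = (if s = int i then int i + 1 else if s = int i + 1 then int i
     else if s = - int i then 1 - int i else if s = 1 - int i then - int i else s)"

lemma swap_sites_swap_sites [simp]: "swap_sites i (swap_sites i s) = s"
  by (auto simp: swap_sites_def)

lemma swap_sites_range: "int i < m \<Longrightarrow> swap_sites i s \<in> {1 - m..m} \<longleftrightarrow> s \<in> {1 - m..m}"
  by (auto simp: swap_sites_def)

lemma swap_sites_reflect: "swap_sites i (1 - s) = 1 - swap_sites i s"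
  by (auto simp: swap_sites_def)

lemma sym_permD: "sym_perm m w \<Longrightarrow> 1 - m \<le> s \<Longrightarrow> s \<le> m \<Longrightarrow> w (1 - s) = 1 - w s"
  by (simp add: sym_perm_def)

lemma apply_comparator_swap_sites:
  assumes "sym_perm m w" "int i < m"
  shows "apply_comparator i w = (if w (int i + 1) < w (int i) then w \<circ> swap_sites i else w)"
proof (cases "i = 0")
  case False
  have "w (- int i) = 1 - w (int i + 1)" "w (1 - int i) = 1 - w (int i)"
    using sym_permD[OF assms(1), of "int i + 1"] sym_permD[OF assms(1), of "int i"] assms(2) by auto
  then show ?thesis using False by (auto simp: apply_comparator_def comparator_def fun_eq_iff swap_sites_def)
qed (auto simp: apply_comparator_def comparator_def fun_eq_iff swap_sites_def)

lemma apply_comparator_sym_perm: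
  assumes "sym_perm m w" "int i < m"
  shows "sym_perm m (apply_comparator i w)"
proof -
  have inj: "inj_on w {1 - m..m}" and ran: "w ` {1 - m..m} \<subseteq> {1 - m..m}" using assms(1) by (auto simp: sym_perm_def)
  have "inj_on (w \<circ> swap_sites i) {1 - m..m}"
    using inj swap_sites_range[OF assms(2)] unfolding inj_on_def by (metis comp_apply swap_sites_swap_sites)
  moreover have "(w \<circ> swap_sites i) ` {1 - m..m} \<subseteq> {1 - m..m}"
    using ran swap_sites_range[OF assms(2)] by (auto simp: image_subset_iff)
  moreover have "(w \<circ> swap_sites i) (1 - x) = 1 - (w \<circ> swap_sites i) x" if "x \<in> {1 - m..m}" for x
    using sym_permD[OF assms(1), of "swap_sites i x"] swap_sites_range[OF assms(2), of x] that by (simp add: swap_sites_reflect)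
  ultimately have "sym_perm m (w \<circ> swap_sites i)" by (simp add: sym_perm_def)
  then show ?thesis using assms(1) by (simp add: apply_comparator_swap_sites[OF assms])
qed

definition inversions :: "int \<Rightarrow> (int \<Rightarrow> int) \<Rightarrow> (int \<times> int) set" where
  "inversions m w = {(s, t). 1 - m \<le> s \<and> s < t \<and> t \<le> m \<and> w t < w s}"

lemma finite_inversions: "finite (inversions m w)"
  by (rule finite_subset[of _ "{1 - m..m} \<times> {1 - m..m}"]) (auto simp: inversions_def)

lemma card_inversions_comparator:
  assumes "w (g + 1) < w g" "1 - m \<le> g" "g < m"
  shows "card (inversions m w) = Suc (card (inversions m (comparator g w)))"
proof -
  define \<tau> where "\<tau> = (\<lambda>s. if s = g then g + 1 else if s = g + 1 then g else s)"
  have c: "comparator g w = (\<lambda>s. w (\<tau> s))" using assms(1) by (auto simp: comparator_def \<tau>_def fun_eq_iff)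
  have tt: "\<tau> (\<tau> s) = s" for s by (auto simp: \<tau>_def)
  have lt: "\<tau> s < \<tau> t" if "s < t" "(s, t) \<noteq> (g, g + 1)" for s t using that by (auto simp: \<tau>_def)
  have r: "1 - m \<le> \<tau> s \<longleftrightarrow> 1 - m \<le> s" "\<tau> s \<le> m \<longleftrightarrow> s \<le> m" for s using assms(2,3) by (auto simp: \<tau>_def)
  have "bij_betw (\<lambda>(s, t). (\<tau> s, \<tau> t)) (inversions m w - {(g, g + 1)}) (inversions m (comparator g w))"
  proof (rule bij_betw_byWitness[where f' = "\<lambda>(s, t). (\<tau> s, \<tau> t)"])
    show "(\<lambda>(s, t). (\<tau> s, \<tau> t)) ` (inversions m w - {(g, g + 1)}) \<subseteq> inversions m (comparator g w)"
      using lt r by (auto simp: inversions_def c tt)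
    show "(\<lambda>(s, t). (\<tau> s, \<tau> t)) ` inversions m (comparator g w) \<subseteq> inversions m w - {(g, g + 1)}"
    proof clarify
      fix s t assume row_insert: "(s, t) \<in> inversions m (comparator g w)"
      have ne: "(s, t) \<noteq> (g, g + 1)" using row_insert assms(1) by (auto simp: inversions_def c \<tau>_def)
      have "(\<tau> s, \<tau> t) \<noteq> (g, g + 1)" using row_insert by (auto simp: inversions_def \<tau>_def split: if_splits)
      then show "(\<tau> s, \<tau> t) \<in> inversions m w - {(g, g + 1)}"
        using row_insert ne lt r by (auto simp: inversions_def c)
    qed
  qed (auto simp: tt)
  then have "card (inversions m w - {(g, g + 1)}) = card (inversions m (comparator g w))" by (rule bij_betw_same_card)
  moreover have "(g, g + 1) \<in> inversions m w" using assms by (auto simp: inversions_def)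
  ultimately show ?thesis using card_Suc_Diff1[OF finite_inversions, of "(g, g + 1)" m w] by simp
qed

definition crossed :: "int \<Rightarrow> (int \<Rightarrow> int) \<Rightarrow> int set" where
  "crossed m w = {s. 1 - m \<le> s \<and> s \<le> 0 \<and> 0 < w s}"

text \<open>The two statistics separate the two kinds of generators: the one at the centre changes the number of entries on the wrong side of the centre.\<close>

lemma card_inversions_apply_comparator:
  assumes "sym_perm m w" "int i < m" "apply_comparator i w \<noteq> w"
  shows "card (inversions m w) = card (inversions m (apply_comparator i w)) + (if i = 0 then 1 else 2)"
    and "card (crossed m w) = card (crossed m (apply_comparator i w)) + (if i = 0 then 1 else 0)"
proof -
  have lt: "w (int i + 1) < w (int i)" using assms(3) unfolding apply_comparator_swap_sites[OF assms(1,2)] by (auto split: if_splits)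
  have neg: "w (- int i) = 1 - w (int i + 1)" "w (1 - int i) = 1 - w (int i)"
    using sym_permD[OF assms(1), of "int i + 1"] sym_permD[OF assms(1), of "int i"] assms(2) by auto
  show "card (inversions m w) = card (inversions m (apply_comparator i w)) + (if i = 0 then 1 else 2)"
  proof (cases "i = 0")
    case True
    then show ?thesis using card_inversions_comparator[of w 0 m] lt assms(2) by (simp add: apply_comparator_def)
  next
    case False
    have "card (inversions m w) = Suc (card (inversions m (comparator (int i) w)))"
      by (rule card_inversions_comparator) (use lt assms(2) in auto)
    moreover have "comparator (int i) w (- int i + 1) < comparator (int i) w (- int i)"
      using lt neg False by (auto simp: comparator_def)
    then have "card (inversions m (comparator (int i) w)) = Suc (card (inversions m (apply_comparator i w)))"
      using card_inversions_comparator[of "comparator (int i) w" "- int i" m] assms(2) False by (simp add: apply_comparator_def)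
    ultimately show ?thesis using False by simp
  qed
  have fin: "finite (crossed m v)" for v by (rule finite_subset[of _ "{1 - m..0}"]) (auto simp: crossed_def)
  show "card (crossed m w) = card (crossed m (apply_comparator i w)) + (if i = 0 then 1 else 0)"
  proof (cases "i = 0")
    case True
    have "w 1 < w 0" "w 1 = 1 - w 0" using lt neg True by auto
    then have "0 < w 0" "w 1 \<le> 0" by auto
    then have "crossed m w = insert 0 (crossed m (apply_comparator i w))" "0 \<notin> crossed m (apply_comparator i w)"
      using lt True assms(2) by (auto simp: crossed_def apply_comparator_def comparator_def)
    then show ?thesis using True fin by simp
  next
    case False
    have "bij_betw (swap_sites i) (crossed m w) (crossed m (w \<circ> swap_sites i))"
      by (rule bij_betw_byWitness[where f' = "swap_sites i"])
         (use False assms(2) in \<open>auto simp: crossed_def swap_sites_def\<close>)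
    then show ?thesis using False lt by (simp add: apply_comparator_swap_sites[OF assms(1,2)] bij_betw_same_card)
  qed
qed

subsection \<open>Running a network\<close>

fun run :: "(nat \<times> nat) set \<Rightarrow> (int \<Rightarrow> int) \<Rightarrow> (nat \<times> nat) list \<Rightarrow> int \<Rightarrow> int" where
  "run Z w [] = w"
| "run Z w (l # ls) = run Z (if l \<in> Z then apply_comparator (snd l) w else w) ls"

text \<open>The letters of a network that actually exchange entries.\<close>

fun used :: "(nat \<times> nat) set \<Rightarrow> (int \<Rightarrow> int) \<Rightarrow> (nat \<times> nat) list \<Rightarrow> (nat \<times> nat) list" where
  "used Z w [] = []"
| "used Z w (l # ls) = (if l \<in> Z \<and> apply_comparator (snd l) w \<noteq> w then l # used Z (apply_comparator (snd l) w) ls else used Z w ls)"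

lemma set_used: "set (used Z w ls) \<subseteq> set ls \<inter> Z"
  by (induction ls arbitrary: w) auto

lemma distinct_used: "distinct ls \<Longrightarrow> distinct (used Z w ls)"
  by (induction ls arbitrary: w) (use set_used in fastforce)+

lemma run_cong: "set ls \<inter> Z = set ls \<inter> Z' \<Longrightarrow> run Z w ls = run Z' w ls"
proof (induction ls arbitrary: w)
  case (Cons l ls)
  have "l \<in> Z \<longleftrightarrow> l \<in> Z'" "set ls \<inter> Z = set ls \<inter> Z'" using Cons.prems by auto
  then show ?case using Cons.IH by simp
qed simp

text \<open>Comparators that exchange nothing can be switched off without effect.\<close>

lemma run_used: "distinct ls \<Longrightarrow> run (set (used Z w ls)) w ls = run Z w ls"
proof (induction ls arbitrary: w)
  case (Cons l ls)
  show ?case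
  proof (cases "l \<in> Z \<and> apply_comparator (snd l) w \<noteq> w")
    case True
    have "run (insert l (set (used Z (apply_comparator (snd l) w) ls))) (apply_comparator (snd l) w) ls = run (set (used Z (apply_comparator (snd l) w) ls)) (apply_comparator (snd l) w) ls"
      by (rule run_cong) (use Cons.prems in auto)
    then show ?thesis using True Cons by simp
  next
    case False
    then have "l \<notin> set (used Z w ls)" using set_used[of Z w ls] Cons.prems by auto
    then show ?thesis using False Cons by (cases "l \<in> Z") auto
  qed
qed simp

lemma run_append: "run Z w (u @ v) = run Z (run Z w u) v"
  by (induction u arbitrary: w) auto

lemma run_sym_perm:
  "sym_perm m w \<Longrightarrow> (\<And>l. l \<in> set ls \<Longrightarrow> int (snd l) < m) \<Longrightarrow> sym_perm m (run Z w ls)"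
  by (induction ls arbitrary: w) (auto simp: apply_comparator_sym_perm)

lemma used_count:
  assumes "sym_perm m w" "\<And>l. l \<in> set ls \<Longrightarrow> int (snd l) < m"
  shows "card (inversions m w) = card (inversions m (run Z w ls)) +
       length (filter (\<lambda>l. snd l = 0) (used Z w ls)) + 2 * length (filter (\<lambda>l. snd l \<noteq> 0) (used Z w ls))"
    and "card (crossed m w) = card (crossed m (run Z w ls)) + length (filter (\<lambda>l. snd l = 0) (used Z w ls))"
  using assms
proof (induction ls arbitrary: w)
  case (Cons l ls)
  {
    case 1
    show ?case using Cons.IH(1)[of "apply_comparator (snd l) w"] Cons.IH(1)[of w] 1 apply_comparator_sym_perm[of m w "snd l"]
      card_inversions_apply_comparator(1)[of m w "snd l"] by auto
  next
    case 2
    show ?case using Cons.IH(2)[of "apply_comparator (snd l) w"] Cons.IH(2)[of w] 2 apply_comparator_sym_perm[of m w "snd l"]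
      card_inversions_apply_comparator(2)[of m w "snd l"] by auto
  }
qed simp_all

text \<open>The chain lengths in the normalisation in which they satisfy the recursion of the heights. Above row \<open>a\<close>, where there are no
boxes to count, the value continues the recursion beyond the boundary.\<close>

definition chain_height :: "(nat \<times> nat) set \<Rightarrow> nat \<Rightarrow> nat \<Rightarrow> nat \<Rightarrow> int" where
  "chain_height \<sigma> a p q = (if a \<le> q then int p - int (chain_length \<sigma> a p (q - a)) else int p + int a - int q)"

lemma chain_height_rec:
  assumes "1 \<le> p" "1 \<le> q"
  shows "(p, q) \<notin> \<sigma> \<Longrightarrow> chain_height \<sigma> a p q = min (chain_height \<sigma> a p (q - 1)) (chain_height \<sigma> a (p - 1) q + 1)"
    and "(p, q) \<in> \<sigma> \<Longrightarrow> chain_height \<sigma> a p q = chain_height \<sigma> a (p - 1) (q - 1)"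
proof -
  obtain p' where p: "p = Suc p'" using assms by (cases p) auto
  have "((p, q) \<notin> \<sigma> \<longrightarrow> chain_height \<sigma> a p q = min (chain_height \<sigma> a p (q - 1)) (chain_height \<sigma> a (p - 1) q + 1)) \<and>
     ((p, q) \<in> \<sigma> \<longrightarrow> chain_height \<sigma> a p q = chain_height \<sigma> a (p - 1) (q - 1))"
  proof (cases "a < q")
    case True
    then obtain j where j: "q = a + Suc j" by (metis less_iff_Suc_add add_Suc_right)
    then have "q - a = Suc j" "q - 1 - a = j" "a \<le> q - 1" by auto
    then show ?thesis using p j by (auto simp: chain_height_def)
  next
    case False
    then show ?thesis using assms p by (auto simp: chain_height_def)
  qed
  then show "(p, q) \<notin> \<sigma> \<Longrightarrow> chain_height \<sigma> a p q = min (chain_height \<sigma> a p (q - 1)) (chain_height \<sigma> a (p - 1) q + 1)"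
    "(p, q) \<in> \<sigma> \<Longrightarrow> chain_height \<sigma> a p q = chain_height \<sigma> a (p - 1) (q - 1)" by auto
qed

lemma chain_height_0: "a \<le> q \<Longrightarrow> chain_height \<sigma> a 0 q = 0"
  by (simp add: chain_height_def)

lemma height_apply_comparator:
  assumes "int i < m"
  shows "h \<noteq> int i \<Longrightarrow> h \<noteq> - int i \<Longrightarrow> height m (apply_comparator i w) t h = height m w t h"
    and "height m (apply_comparator i w) t (- int i) = min (height m w t (- int i - 1)) (height m w t (1 - int i) + 1)"
    and "height m (apply_comparator i w) t (int i) = min (height m w t (int i - 1)) (height m w t (int i + 1) + 1)"
proof -
  have l: "- int i < m" using assms by simp
  note o = height_comparator_other[OF assms] height_comparator_other[OF l]
  show "h \<noteq> int i \<Longrightarrow> h \<noteq> - int i \<Longrightarrow> height m (apply_comparator i w) t h = height m w t h"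
    using o by (auto simp: apply_comparator_def)
  show "height m (apply_comparator i w) t (- int i) = min (height m w t (- int i - 1)) (height m w t (1 - int i) + 1)"
    using height_comparator_same[OF l] o(1) by (auto simp: apply_comparator_def)
  show "height m (apply_comparator i w) t (int i) = min (height m w t (int i - 1)) (height m w t (int i + 1) + 1)"
    using height_comparator_same[OF assms] height_comparator_same[of 0 m w t] o(2) assms by (auto simp: apply_comparator_def)
qed

text \<open>While the letters \<open>(p, m - 1), \<dots>, (p, 0)\<close> of row \<open>p\<close> are processed, the gaps from \<open>i\<close> on have reached row \<open>p\<close> and the others are still in row \<open>p - 1\<close>.\<close>

definition progress :: "nat \<Rightarrow> nat \<Rightarrow> nat \<Rightarrow> nat" where
  "progress p i j = (if i \<le> j then p else p - 1)"

text \<open>Boxes are given by column \<open>p\<close> and row position \<open>q\<close> in the crossing polyomino, and \<open>\<sigma>\<close> is a symmetric set that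
contains all boxes too close to the boundary to belong to a chain of more than \<open>k\<close> boxes. The letter \<open>(p, i)\<close> with \<open>i < m\<close> stands
for the box \<open>(p, p + n - i)\<close> and its mirror box. It is an active comparator iff its box lies outside \<open>\<sigma>\<close>.\<close>

locale network =
  fixes n k m :: nat and \<sigma> :: "(nat \<times> nat) set"
  assumes nmk: "n = m + k" and k1: "1 \<le> k" and m1: "1 \<le> m"
    and sym: "\<And>c r. c \<in> {1..n} \<Longrightarrow> r \<in> {1..n} \<Longrightarrow> (c, n + r) \<in> \<sigma> \<longleftrightarrow> (r, n + c) \<in> \<sigma>"
    and short: "\<And>p q. 1 \<le> p \<Longrightarrow> p \<le> n \<Longrightarrow> p < q \<Longrightarrow> q \<le> 2 * n \<Longrightarrow> q - p \<le> k \<or> 2 * n - k \<le> q - p \<Longrightarrow> (p, q) \<in> \<sigma>"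
begin

definition zeros :: "(nat \<times> nat) set" where
  "zeros = {(p, i). (p, p + n - i) \<notin> \<sigma>}"

text \<open>The heights of the current sequence at threshold \<open>t\<close> are, up to normalisation, the longest chains of \<open>\<sigma>\<close> in rows beyond \<open>n - t\<close>. The
gap \<open>- j\<close> refers to the box of the letter \<open>j\<close> in the current row and the gap \<open>j\<close> to its mirror box.\<close>

definition invariant :: "(nat \<Rightarrow> nat) \<Rightarrow> (int \<Rightarrow> int) \<Rightarrow> bool" where
  "invariant P w \<longleftrightarrow> (\<forall>t<m. \<forall>j\<le>m.
     (P j \<le> n - t \<longrightarrow> height m w t (- int j) = chain_height \<sigma> (n - t) (P j) (P j + n - j)) \<and>
     (1 \<le> j \<longrightarrow> P j - j \<le> n - t \<longrightarrow> height m w t (int j) = chain_height \<sigma> (n - t) (P j - j) (P j + n)))"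

lemma invariantD:
  assumes "invariant P w" "t < m" "j \<le> m"
  shows "P j \<le> n - t \<Longrightarrow> height m w t (- int j) = chain_height \<sigma> (n - t) (P j) (P j + n - j)"
    and "1 \<le> j \<Longrightarrow> P j - j \<le> n - t \<Longrightarrow> height m w t (int j) = chain_height \<sigma> (n - t) (P j - j) (P j + n)"
  using assms unfolding invariant_def by blast+

text \<open>Passing a letter means passing one box and its mirror box. If the box lies in \<open>\<sigma>\<close> both the chain length and the heights take the value diagonally
before it; otherwise the comparator forms the same minimum as the chain recursion.\<close>

lemma invariant_letter:
  assumes "1 \<le> p" "p \<le> n" "i < m" "invariant (progress p (Suc i)) w"
  shows "invariant (progress p i) (if (p, i) \<in> zeros then apply_comparator i w else w)" (is "invariant _ ?w")
  unfolding invariant_def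
proof (intro allI impI conjI)
  fix t j assume t: "t < m" and j: "j \<le> m"
  let ?P = "progress p (Suc i)" and ?a = "n - t"
  have im: "int i < int m" using assms(3) by simp
  have a1: "1 \<le> ?a" "?a \<le> n" using t nmk k1 by auto
  have other: "height m ?w t h = height m w t h" if "h \<noteq> int i" "h \<noteq> - int i" for h
    using height_apply_comparator(1)[OF im that] by simp
  note D = invariantD[OF assms(4) t]
  show "height m ?w t (- int j) = chain_height \<sigma> ?a (progress p i j) (progress p i j + n - j)" if pa: "progress p i j \<le> ?a"
  proof (cases "j = i")
    case False
    then have "progress p i j = ?P j" by (auto simp: progress_def)
    then show ?thesis using D(1)[OF j] pa other[of "- int j"] False by (cases "j = 0 \<and> i = 0") auto
  next
    case True
    let ?q = "p + n - i"
    have p: "p \<le> ?a" using pa True by (simp add: progress_def)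
    have up: "height m w t (- int i - 1) = chain_height \<sigma> ?a p (?q - 1)"
    proof -
      have "height m w t (- int (Suc i)) = chain_height \<sigma> ?a p (p + n - Suc i)"
        using D(1)[of "Suc i"] p assms(3) by (simp add: progress_def)
      moreover have "- int (Suc i) = - int i - 1" "p + n - Suc i = ?q - 1" by auto
      ultimately show ?thesis by (simp only:)
    qed
    have down: "height m w t (1 - int i) = chain_height \<sigma> ?a (p - 1) ?q"
    proof (cases i)
      case 0
      then show ?thesis using D(2)[of 1] p m1 by (simp add: progress_def)
    next
      case (Suc i')
      have "p - 1 + n - i' = ?q" using Suc assms(1) by simp
      then show ?thesis using D(1)[of i'] p assms(3) Suc by (simp add: progress_def)
    qed
    have old: "height m w t (- int i) = chain_height \<sigma> ?a (p - 1) (?q - 1)"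
    proof -
      have "p - 1 + n - i = ?q - 1" using assms by simp
      then show ?thesis using D(1)[of i] p assms(3) by (simp add: progress_def)
    qed
    have "height m ?w t (- int i) = chain_height \<sigma> ?a p ?q"
    proof -
      have q: "1 \<le> ?q" using assms(1,3) nmk by simp
      show ?thesis using chain_height_rec[OF assms(1) q, of \<sigma> ?a] height_apply_comparator(2)[OF im, of w t] up down old
        by (cases "(p, ?q) \<in> \<sigma>") (simp_all add: zeros_def)
    qed
    then show ?thesis using True by (simp add: progress_def)
  qed
  show "height m ?w t (int j) = chain_height \<sigma> ?a (progress p i j - j) (progress p i j + n)"
    if j1: "1 \<le> j" and pa: "progress p i j - j \<le> ?a"
  proof (cases "j = i")
    case False
    then have "progress p i j = ?P j" by (auto simp: progress_def)
    then show ?thesis using D(2)[OF j j1] pa other[of "int j"] False j1 by auto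
  next
    case True
    have c: "p - i \<le> ?a" using pa True by (simp add: progress_def)
    obtain i' where i': "i = Suc i'" using j1 True by (cases i) auto
    have up: "height m w t (int i + 1) = chain_height \<sigma> ?a (p - i - 1) (p + n)"
      using D(2)[of "Suc i"] c assms(3) by (simp add: progress_def add.commute)
    have down: "height m w t (int i - 1) = chain_height \<sigma> ?a (p - i) (p + n - 1)"
    proof (cases "i' = 0")
      case True
      then show ?thesis using D(1)[of 0] c i' assms(1) by (simp add: progress_def)
    next
      case False
      then show ?thesis using D(2)[of i'] c i' assms(1,3) by (simp add: progress_def)
    qed
    have old: "height m w t (int i) = chain_height \<sigma> ?a (p - i - 1) (p + n - 1)"
      using D(2)[of i] c i' assms(1,3) by (simp add: progress_def diff_commute)
    have "height m ?w t (int i) = chain_height \<sigma> ?a (p - i) (p + n)"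
    proof (cases "p \<le> i")
      case True
      have "?a \<le> p + n - 1" using assms(1) a1 by simp
      then show ?thesis using True height_apply_comparator(3)[OF im, of w t] up down old a1 assms(1) by (simp add: chain_height_0)
    next
      case False
      then have "(p - i, n + p) \<in> \<sigma> \<longleftrightarrow> (p, n + (p - i)) \<in> \<sigma>" using assms(2) by (intro sym) auto
      moreover have "n + (p - i) = p + n - i" using False by simp
      ultimately have mem: "(p - i, p + n) \<in> \<sigma> \<longleftrightarrow> (p, i) \<notin> zeros" by (simp add: zeros_def add.commute)
      have ge: "1 \<le> p - i" "1 \<le> p + n" using False by auto
      show ?thesis
      proof (cases "(p, i) \<in> zeros")
        case True
        then have "?w = apply_comparator i w" "(p - i, p + n) \<notin> \<sigma>" using mem by simp_all
        then show ?thesis using chain_height_rec(1)[OF ge \<open>(p - i, p + n) \<notin> \<sigma>\<close>, of ?a]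
          by (simp only: height_apply_comparator(3)[OF im] up down)
      next
        case False
        then have "?w = w" "(p - i, p + n) \<in> \<sigma>" using mem by simp_all
        then show ?thesis using chain_height_rec(2)[OF ge \<open>(p - i, p + n) \<in> \<sigma>\<close>, of ?a]
          by (simp only: old)
      qed
    qed
    then show ?thesis using True by (simp add: progress_def)
  qed
qed

lemma invariant_next_row:
  assumes "p < n" "invariant (progress p 0) w"
  shows "invariant (progress (Suc p) m) w"
  unfolding invariant_def
proof (intro allI impI conjI)
  fix t j assume t: "t < m" and j: "j \<le> m"
  let ?a = "n - t"
  have a1: "1 \<le> ?a" "?a \<le> n" using t nmk k1 by auto
  note D = invariantD[OF assms(2) t]
  show "height m w t (- int j) = chain_height \<sigma> ?a (progress (Suc p) m j) (progress (Suc p) m j + n - j)"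
    if pa: "progress (Suc p) m j \<le> ?a"
  proof (cases "j = m")
    case True
    have "(Suc p, Suc p + k) \<in> \<sigma>" by (rule short) (use assms k1 nmk in auto)
    then have "chain_height \<sigma> ?a (Suc p) (Suc p + k) = chain_height \<sigma> ?a p (p + k)"
      using chain_height_rec(2)[of "Suc p" "Suc p + k" \<sigma> ?a] by simp
    then show ?thesis using D(1)[of m] True pa nmk by (simp add: progress_def)
  next
    case False
    then show ?thesis using D(1)[OF j] pa j by (simp add: progress_def)
  qed
  show "height m w t (int j) = chain_height \<sigma> ?a (progress (Suc p) m j - j) (progress (Suc p) m j + n)"
    if j1: "1 \<le> j" and pa: "progress (Suc p) m j - j \<le> ?a"
  proof (cases "j = m")
    case True
    have "chain_height \<sigma> ?a (Suc p - m) (Suc p + n) = chain_height \<sigma> ?a (p - m) (p + n)"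
    proof (cases "Suc p \<le> m")
      case True
      then show ?thesis using a1 by (simp add: chain_height_0)
    next
      case False
      have "(Suc p - m, Suc p + n) \<in> \<sigma>" by (rule short) (use False assms nmk m1 in auto)
      then show ?thesis using chain_height_rec(2)[of "Suc p - m" "Suc p + n" \<sigma> ?a] False by (simp add: Suc_diff_le)
    qed
    then show ?thesis using D(2)[of m] True pa m1 by (simp add: progress_def)
  next
    case False
    then show ?thesis using D(2)[OF j j1] pa j by (simp add: progress_def)
  qed
qed

text \<open>The reversed sequence, the longest element of the hyperoctahedral group.\<close>

definition start :: "int \<Rightarrow> int" where "start s = 1 - s"

lemma height_start:
  assumes "t < m" "- int m \<le> g" "g \<le> int m"
  shows "height m start t g = max 0 (- int t - g)"
  using assms(3,2)
proof (induction g rule: int_le_induct)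
  case base
  then show ?case by (simp add: height_def)
next
  case (step g)
  have "start g = 1 - g" by (simp add: start_def)
  then show ?case using step height_rec[of "g - 1" m start t] by (auto simp: max_def)
qed

lemma invariant_start: "invariant (progress 0 0) start"
  unfolding invariant_def
proof (intro allI impI conjI)
  fix t j assume "t < m" "j \<le> m"
  then show "height m start t (- int j) = chain_height \<sigma> (n - t) (progress 0 0 j) (progress 0 0 j + n - j)"
    using nmk by (auto simp: height_start progress_def chain_height_def)
  show "height m start t (int j) = chain_height \<sigma> (n - t) (progress 0 0 j - j) (progress 0 0 j + n)"
    using \<open>t < m\<close> \<open>j \<le> m\<close> by (simp add: height_start progress_def chain_height_0)
qed

definition word :: "nat \<Rightarrow> (nat \<times> nat) list" where
  "word r = concat (map (\<lambda>p. map (Pair p) (rev [0..<m])) [1..<Suc r])"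

lemma invariant_row:
  assumes "1 \<le> p" "p \<le> n" "j \<le> m" "invariant (progress p j) w"
  shows "invariant (progress p 0) (run zeros w (map (Pair p) (rev [0..<j])))"
  using assms(3,4)
proof (induction j arbitrary: w)
  case (Suc j)
  have "invariant (progress p j) (if (p, j) \<in> zeros then apply_comparator j w else w)"
    by (rule invariant_letter[OF assms(1,2)]) (use Suc.prems in auto)
  from Suc.IH[OF _ this] Suc.prems(1) show ?case by (cases "(p, j) \<in> zeros") simp_all
qed simp

lemma invariant_word: "r \<le> n \<Longrightarrow> invariant (progress r 0) (run zeros start (word r))"
proof (induction r)
  case 0
  then show ?case using invariant_start by (simp add: word_def)
next
  case (Suc r)
  then have "invariant (progress (Suc r) m) (run zeros start (word r))" by (intro invariant_next_row) auto
  from invariant_row[OF _ _ order_refl this] Suc.prems show ?case by (simp add: word_def run_append)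
qed

lemma distinct_word: "distinct (word n)"
proof -
  have "distinct (word r) \<and> fst ` set (word r) \<subseteq> {1..r}" for r
  proof (induction r)
    case (Suc r)
    have "word (Suc r) = word r @ map (Pair (Suc r)) (rev [0..<m])" by (simp add: word_def)
    then show ?case using Suc by (auto simp: distinct_map inj_on_def)
  qed (simp add: word_def)
  then show ?thesis by blast
qed

lemma set_word: "set (word n) = {1..n} \<times> {0..<m}"
  by (auto simp: word_def)

definition final :: "int \<Rightarrow> int" where "final = run zeros start (word n)"

lemma sym_perm_start: "sym_perm m start"
  by (auto simp: sym_perm_def start_def inj_on_def)

lemma sym_perm_final: "sym_perm m final"
  unfolding final_def by (rule run_sym_perm[OF sym_perm_start]) (auto simp: set_word)

lemma height_final:
  assumes "t < m"
  shows "height m final t t = int (n - t) - int (chain_length \<sigma> (n - t) (n - t) (n + t))"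
proof -
  have i: "invariant (progress n 0) final" unfolding final_def by (rule invariant_word) simp
  have e: "chain_height \<sigma> (n - t) (n - t) (n + n) = int (n - t) - int (chain_length \<sigma> (n - t) (n - t) (n + t))"
  proof -
    have "n + n - (n - t) = n + t" "n - t \<le> n + n" using assms nmk by auto
    then show ?thesis by (simp add: chain_height_def)
  qed
  show ?thesis
  proof (cases "t = 0")
    case True
    then show ?thesis using invariantD(1)[OF i assms, of 0] e by (simp add: progress_def)
  next
    case False
    then show ?thesis using invariantD(2)[OF i assms, of t] e assms by (simp add: progress_def)
  qed
qed

lemma height_le: "g \<le> int m \<Longrightarrow> height m w t g \<le> int m - g"
proof -
  assume "g \<le> int m"
  have "height m w t g \<le> (\<Sum>s\<in>{g + 1..int m}. 1)" unfolding height_def by (rule sum_mono) auto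
  then show ?thesis using \<open>g \<le> int m\<close> by simp
qed

lemma height_full:
  assumes "height m w t g = int m - g" "g < s" "s \<le> int m"
  shows "t < w s"
proof (rule ccontr)
  assume "\<not> t < w s"
  then have "height m w t g = (\<Sum>s\<in>{g + 1..int m} - {s}. if t < w s then 1 else 0)"
    unfolding height_def using assms(2,3) by (subst sum.remove[of _ s]) auto
  also have "\<dots> \<le> (\<Sum>s\<in>{g + 1..int m} - {s}. 1)" by (rule sum_mono) auto
  also have "\<dots> = int m - g - 1" using assms(2,3) by simp
  finally show False using assms(1) by simp
qed

text \<open>The sequence is sorted iff at each threshold \<open>t\<close> all sites beyond \<open>t\<close> carry entries above \<open>t\<close>, and the
heights translate this into a bound on chains.\<close>

lemma sorted_iff:
  "(\<forall>t<m. chain_length \<sigma> (n - t) (n - t) (n + t) \<le> k) \<longleftrightarrow> (\<forall>s. 1 - int m \<le> s \<and> s \<le> int m \<longrightarrow> final s = s)"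
proof
  assume L: "\<forall>t<m. chain_length \<sigma> (n - t) (n - t) (n + t) \<le> k"
  have gt: "int t < final s" if "t < m" "int t < s" "s \<le> int m" for t s
  proof (rule height_full[OF _ that(2,3)])
    show "height m final t t = int m - int t"
      using height_final[OF that(1)] height_le[of t final t] L[rule_format, OF that(1)] that(1) nmk by simp
  qed
  have inj: "inj_on final {1 - int m..int m}" and ran: "final ` {1 - int m..int m} \<subseteq> {1 - int m..int m}"
    using sym_perm_final by (auto simp: sym_perm_def)
  have pos: "final s = s" if "1 \<le> s" "s \<le> int m" for s
    using that
  proof (induction "nat (int m - s)" arbitrary: s rule: less_induct)
    case less
    have "int (nat (s - 1)) < final s" by (rule gt) (use less.prems in auto)
    then have "s \<le> final s" using less.prems by simp
    moreover have "final s \<le> int m" using ran less.prems by (auto simp: image_subset_iff)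
    moreover have "\<not> s < final s"
    proof
      assume h: "s < final s"
      then have "final (final s) = final s" using less.hyps[of "final s"] less.prems \<open>final s \<le> int m\<close> by simp
      then have "final s = s" using inj less.prems h \<open>final s \<le> int m\<close> by (auto simp: inj_on_def)
      then show False using h by simp
    qed
    ultimately show ?case by simp
  qed
  show "\<forall>s. 1 - int m \<le> s \<and> s \<le> int m \<longrightarrow> final s = s"
  proof (intro allI impI)
    fix s assume s: "1 - int m \<le> s \<and> s \<le> int m"
    show "final s = s"
    proof (cases "1 \<le> s")
      case False
      then show ?thesis using pos[of "1 - s"] sym_permD[OF sym_perm_final, of "1 - s"] s by simp
    qed (use pos s in simp)
  qed
next
  assume f: "\<forall>s. 1 - int m \<le> s \<and> s \<le> int m \<longrightarrow> final s = s"
  show "\<forall>t<m. chain_length \<sigma> (n - t) (n - t) (n + t) \<le> k"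
  proof (intro allI impI)
    fix t assume t: "t < m"
    have "height m final t t = (\<Sum>s\<in>{int t + 1..int m}. 1)"
      unfolding height_def by (rule sum.cong) (use f m1 in auto)
    then show "chain_length \<sigma> (n - t) (n - t) (n + t) \<le> k" using height_final[OF t] t nmk by simp
  qed
qed

lemma crossed_start: "card (crossed m start) = m"
proof -
  have "crossed m start = {1 - int m..0}" by (auto simp: crossed_def start_def)
  then show ?thesis by simp
qed

lemma inversions_start: "card (inversions m start) + m = 2 * (m * m)"
proof -
  let ?S = "{1 - int m..int m}"
  let ?A = "{(s, t). s \<in> ?S \<and> t \<in> ?S \<and> s < t}" and ?B = "{(s, t). s \<in> ?S \<and> t \<in> ?S \<and> t < s}" and ?D = "(\<lambda>s. (s, s)) ` ?S"
  have A: "inversions m start = ?A" by (auto simp: inversions_def start_def)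
  have fin: "finite ?A" "finite ?B" by (rule finite_subset[of _ "?S \<times> ?S"]; auto)+
  have "card ?A = card ?B" by (rule bij_betw_same_card[of prod.swap], rule bij_betw_byWitness[where f' = prod.swap]) auto
  moreover have "?S \<times> ?S = ?A \<union> (?B \<union> ?D)" by auto
  then have "card (?S \<times> ?S) = card (?A \<union> (?B \<union> ?D))" by simp
  moreover have "card (?A \<union> (?B \<union> ?D)) = card ?A + (card ?B + card ?D)"
    using fin by (subst card_Un_disjoint, auto)+
  moreover have "card ?D = card ?S" by (rule card_image) (auto simp: inj_on_def)
  moreover have "nat (2 * int m) = 2 * m" by simp
  ultimately show ?thesis unfolding A by (simp add: card_cartesian_product)
qed

definition crossings :: "(nat \<times> nat) set" where
  "crossings = set (used zeros start (word n))"

lemma crossings_subset: "crossings \<subseteq> zeros \<inter> ({1..n} \<times> {0..<m})"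
  using set_used[of zeros start "word n"] by (auto simp: crossings_def set_word)

lemma card_crossings:
  assumes "\<forall>t<m. chain_length \<sigma> (n - t) (n - t) (n + t) \<le> k"
  shows "card {l \<in> crossings. snd l = 0} = m" "card {l \<in> crossings. snd l \<noteq> 0} = m * m - m"
proof -
  have f: "final s = s" if "1 - int m \<le> s" "s \<le> int m" for s using assms sorted_iff that by blast
  have "inversions m final = {}" "crossed m final = {}" using f m1 by (auto simp: inversions_def crossed_def)
  then have e: "card (inversions m final) = 0" "card (crossed m final) = 0" by simp_all
  have d: "distinct (used zeros start (word n))" by (rule distinct_used[OF distinct_word])
  have l: "length (filter P (used zeros start (word n))) = card {l \<in> crossings. P l}" for P
    using d distinct_card[of "filter P (used zeros start (word n))"] by (simp add: crossings_def)
  note u = used_count[OF sym_perm_start, of "word n" zeros, unfolded l, folded final_def]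
  show 1: "card {l \<in> crossings. snd l = 0} = m" using u(2) e crossed_start by (auto simp: set_word)
  have "card (inversions m start) = m + 2 * card {l \<in> crossings. snd l \<noteq> 0}" using u(1) e 1 by (auto simp: set_word)
  then show "card {l \<in> crossings. snd l \<noteq> 0} = m * m - m" using inversions_start by simp
qed

text \<open>Adding to \<open>\<sigma>\<close> all boxes whose comparators exchange nothing leaves the run of the network unchanged.\<close>

lemma same_crossings:
  assumes "\<forall>t<m. chain_length \<sigma> (n - t) (n - t) (n + t) \<le> k" "network n k m \<sigma>'"
    "network.zeros n \<sigma>' \<inter> ({1..n} \<times> {0..<m}) = crossings"
  shows "\<forall>t<m. chain_length \<sigma>' (n - t) (n - t) (n + t) \<le> k"
proof -
  interpret N: network n k m \<sigma>' by fact
  have "N.final = run crossings start (word n)" unfolding N.final_def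
    by (rule run_cong) (use assms(3) crossings_subset in \<open>auto simp: set_word\<close>)
  also have "\<dots> = final" unfolding final_def crossings_def by (rule run_used[OF distinct_word])
  finally show ?thesis using assms(1) sorted_iff N.sorted_iff by simp
qed

end

section \<open>Fans and nesting fillings\<close>

text \<open>One box from each orbit of the mirror; boxes in positively labelled rows are their own mirror boxes.\<close>

definition reps :: "nat \<Rightarrow> box set" where
  "reps n = {(i, j) \<in> nesting_polyomino n. 0 < j \<or> i \<le> - j}"

definition nested :: "nat \<Rightarrow> box \<Rightarrow> box \<Rightarrow> bool" where
  "nested n b c \<longleftrightarrow> fst b < fst c \<and> nesting_pos n (snd c) < nesting_pos n (snd b)"

definition ne_set :: "nat \<Rightarrow> box set \<Rightarrow> bool" where
  "ne_set n X \<longleftrightarrow> (\<forall>b\<in>X. \<forall>c\<in>X. b \<noteq> c \<longrightarrow> nested n b c \<or> nested n c b)"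

text \<open>The antidiagonal of a box. Paths cross each antidiagonal once, and \<^term>\<open>reps n\<close> consists of the antidiagonals up to the main diagonal.\<close>

definition level :: "nat \<Rightarrow> box \<Rightarrow> int" where
  "level n b = fst b + nesting_pos n (snd b)"

definition box_at :: "nat \<Rightarrow> int \<Rightarrow> int \<Rightarrow> box" where
  "box_at n s p = (p, if s - p \<le> int n then s - p else s - p - 2 * int n - 1)"

lemma nesting_pos_box_at: "p < s - p \<Longrightarrow> 1 \<le> p \<Longrightarrow> s - p \<le> 2 * int n \<Longrightarrow> nesting_pos n (snd (box_at n s p)) = s - p"
  by (auto simp: nesting_pos_def box_at_def)

lemma nesting_box_iff:
  "b \<in> nesting_polyomino n \<longleftrightarrow> 1 \<le> fst b \<and> fst b \<le> int n \<and> snd b \<noteq> 0 \<and> - int n \<le> snd b \<and> snd b \<le> int n \<and>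
     (0 < snd b \<longrightarrow> fst b < snd b)"
  by (cases b) (auto simp: nesting_polyomino_def vertices_def nesting_pos_def)

lemma nesting_pos_range: "b \<in> nesting_polyomino n \<Longrightarrow>
    fst b < nesting_pos n (snd b) \<and> nesting_pos n (snd b) \<le> 2 * int n"
  by (auto simp: nesting_box_iff nesting_pos_def)

lemma box_at_level: "b \<in> nesting_polyomino n \<Longrightarrow> box_at n (level n b) (fst b) = b"
  by (cases b) (auto simp: nesting_box_iff nesting_pos_def box_at_def level_def)

lemma reps_iff: "b \<in> reps n \<longleftrightarrow> b \<in> nesting_polyomino n \<and> level n b \<le> 2 * int n + 1"
  by (cases b) (auto simp: reps_def nesting_box_iff nesting_pos_def level_def)

lemma main_diagonal_iff: "b \<in> main_diagonal n \<longleftrightarrow> b \<in> nesting_polyomino n \<and> level n b = 2 * int n + 1"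
  by (cases b) (auto simp: main_diagonal_def nesting_box_iff nesting_pos_def level_def)

lemma box_at_in:
  assumes "1 \<le> p" "p < s - p" "s \<le> 2 * int n + 1"
  shows "box_at n s p \<in> nesting_polyomino n" "level n (box_at n s p) = s"
  using assms by (auto simp: nesting_box_iff box_at_def level_def nesting_pos_def)

lemma box_eq: "b \<in> nesting_polyomino n \<Longrightarrow> c \<in> nesting_polyomino n \<Longrightarrow> level n b = level n c \<Longrightarrow> fst b = fst c \<Longrightarrow> b = c"
  using box_at_level[of b n] box_at_level[of c n] by metis

lemma finite_nesting_polyomino: "finite (nesting_polyomino n)"
  by (rule finite_subset[of _ "{1..int n} \<times> {- int n..int n}"]) (auto simp: nesting_polyomino_def vertices_def)

subsection \<open>The rank function of a face\<close>

text \<open>Chains in \<open>reps n\<close> alone are considered here; this is equivalent to considering chains in the symmetric set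
(lemma \<open>nesting_faces_closure\<close>).\<close>

locale nesting_face =
  fixes n k :: nat and \<omega> :: "box set"
  assumes kn: "1 \<le> k" "k < n" and sub: "\<omega> \<subseteq> reps n"
    and face: "\<And>X. X \<subseteq> \<omega> \<Longrightarrow> ne_set n X \<Longrightarrow> card X \<le> k"
begin

definition below :: "int \<Rightarrow> int \<Rightarrow> box set set" where
  "below p q = {X. X \<subseteq> \<omega> \<and> ne_set n X \<and> (\<forall>b\<in>X. fst b \<le> p \<and> q \<le> nesting_pos n (snd b))}"

definition depth :: "int \<Rightarrow> int \<Rightarrow> int" where
  "depth p q = Max ((\<lambda>X. int (card X)) ` below p q)"

lemma finite_omega: "finite \<omega>"
  using sub finite_nesting_polyomino[of n] by (auto simp: reps_def intro: finite_subset)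

lemma finite_below: "finite (below p q)"
  by (rule finite_subset[of _ "Pow \<omega>"]) (auto simp: below_def finite_omega)

lemma empty_below: "{} \<in> below p q"
  by (simp add: below_def ne_set_def)

lemma depth_ge: "X \<in> below p q \<Longrightarrow> int (card X) \<le> depth p q"
  unfolding depth_def using finite_below by auto

lemma depth_obtain: obtains X where "X \<in> below p q" "int (card X) = depth p q"
proof -
  have "depth p q \<in> (\<lambda>X. int (card X)) ` below p q" unfolding depth_def
  proof (rule Max_in)
    show "finite ((\<lambda>X. int (card X)) ` below p q)" using finite_below by blast
    show "(\<lambda>X. int (card X)) ` below p q \<noteq> {}" using empty_below by blast
  qed
  then show ?thesis using that by auto
qed

lemma depth_le_k: "depth p q \<le> int k"
proof -
  obtain X where X: "X \<in> below p q" "int (card X) = depth p q" by (rule depth_obtain)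
  then have "card X \<le> k" using face by (simp add: below_def)
  then show ?thesis using X(2) by linarith
qed

lemma depth_mono: "p \<le> p' \<Longrightarrow> q' \<le> q \<Longrightarrow> depth p q \<le> depth p' q'"
proof -
  assume "p \<le> p'" "q' \<le> q"
  obtain X where X: "X \<in> below p q" "int (card X) = depth p q" by (rule depth_obtain)
  have "X \<in> below p' q'" using X(1) \<open>p \<le> p'\<close> \<open>q' \<le> q\<close> by (force simp: below_def)
  then show ?thesis using depth_ge X(2) by metis
qed

lemma depth_0: "p \<le> 0 \<Longrightarrow> depth p q = 0"
proof -
  assume p: "p \<le> 0"
  obtain X where X: "X \<in> below p q" "int (card X) = depth p q" by (rule depth_obtain)
  have "X = {}"
  proof (rule ccontr)
    assume "X \<noteq> {}"
    then obtain b where "b \<in> X" by blast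
    then have "fst b \<le> 0" "b \<in> reps n" using X(1) p sub by (auto simp: below_def)
    then show False by (auto simp: reps_iff nesting_box_iff)
  qed
  then show ?thesis using X(2) by simp
qed

lemma depth_step: "depth (p + 1) q \<le> depth p (q + 1) + 1"
proof -
  obtain X where X: "X \<in> below (p + 1) q" "int (card X) = depth (p + 1) q" by (rule depth_obtain)
  let ?Y = "{b \<in> X. fst b \<noteq> p + 1 \<and> nesting_pos n (snd b) \<noteq> q}"
  have fin: "finite X" using X(1) finite_omega by (auto simp: below_def intro: finite_subset)
  have "?Y \<in> below p (q + 1)" using X(1) by (fastforce simp: below_def ne_set_def)
  then have 1: "int (card ?Y) \<le> depth p (q + 1)" by (rule depth_ge)
  have top: "b = c" if "b \<in> X" "c \<in> X" "fst b = p + 1 \<or> nesting_pos n (snd b) = q" "fst c = p + 1 \<or> nesting_pos n (snd c) = q" for b c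
  proof (rule ccontr)
    assume "b \<noteq> c"
    then have "nested n b c \<or> nested n c b" using X(1) that(1,2) by (auto simp: below_def ne_set_def)
    moreover have "fst b \<le> p + 1" "fst c \<le> p + 1" "q \<le> nesting_pos n (snd b)" "q \<le> nesting_pos n (snd c)"
      using X(1) that(1,2) by (auto simp: below_def)
    ultimately show False using that(3,4) by (auto simp: nested_def)
  qed
  have "card X \<le> Suc (card ?Y)"
  proof (cases "X = ?Y")
    case False
    then obtain b where b: "b \<in> X" "fst b = p + 1 \<or> nesting_pos n (snd b) = q" by blast
    then have "X = insert b ?Y" using top by blast
    then have "card X = card (insert b ?Y)" by simp
    also have "\<dots> \<le> Suc (card ?Y)" by (rule card_insert_le_m1) simp_all
    finally show ?thesis .
  qed simp
  then show ?thesis using 1 X(2) by linarith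
qed

lemma depth_add:
  assumes "b \<in> \<omega>"
  shows "depth (fst b - 1) (nesting_pos n (snd b) + 1) + 1 \<le> depth (fst b) (nesting_pos n (snd b))"
proof -
  obtain X where X: "X \<in> below (fst b - 1) (nesting_pos n (snd b) + 1)"
    "int (card X) = depth (fst b - 1) (nesting_pos n (snd b) + 1)" by (rule depth_obtain)
  have n: "nested n c b" if "c \<in> X" for c using X(1) that by (fastforce simp: below_def nested_def)
  have "b \<notin> X" using n[of b] by (auto simp: nested_def)
  moreover have "finite X" using X(1) finite_omega by (auto simp: below_def intro: finite_subset)
  moreover have "insert b X \<in> below (fst b) (nesting_pos n (snd b))"
    using X(1) n assms by (fastforce simp: below_def ne_set_def nested_def)
  ultimately show ?thesis using depth_ge[of "insert b X"] X(2) by fastforce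
qed

lemma depth_le_p: "0 \<le> p \<Longrightarrow> depth p q \<le> p"
proof (induction p arbitrary: q rule: int_ge_induct)
  case (step p)
  then show ?case using depth_step[of p q] by (meson add_mono dual_order.trans order_refl)
qed (simp add: depth_0)

text \<open>The last column in which the antidiagonal \<open>s\<close> meets the polyomino.\<close>

definition max_column :: "int \<Rightarrow> int" where "max_column s = (s - 1) div 2"

text \<open>The number of paths that pass the antidiagonal \<open>s\<close> in the columns up to \<open>p\<close>. Chains of the face demand \<open>depth\<close>
paths; the second term says that all paths which have started, \<open>k\<close> or as many as there are columns, must fit into the columns of the antidiagonal.\<close>

definition rank :: "int \<Rightarrow> int \<Rightarrow> int" where
  "rank s p = max (depth p (s - p)) (min (int k) (max_column s) - max_column s + p)"

lemma rank_mono: "p \<le> p' \<Longrightarrow> rank s p \<le> rank s p'"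
  unfolding rank_def using depth_mono[of p p' "s - p'" "s - p"] by auto

lemma rank_step: "rank s (p + 1) \<le> rank s p + 1"
  unfolding rank_def using depth_step[of p "s - (p + 1)"] by auto

lemma rank_0: "rank s 0 \<le> 0"
  by (simp add: rank_def depth_0)

lemma rank_top: "0 \<le> max_column s \<Longrightarrow> rank s (max_column s) = min (int k) (max_column s)"
  unfolding rank_def using depth_le_k[of "max_column s" "s - max_column s"] depth_le_p[of "max_column s" "s - max_column s"] by auto

lemma rank_east: "rank s p \<le> rank (s + 1) (p + 1)"
proof -
  have "max_column (s + 1) \<le> max_column s + 1" unfolding max_column_def by linarith
  then show ?thesis unfolding rank_def using depth_mono[of p "p + 1" "s - p" "s - p"] by auto
qed

lemma rank_south: "rank (s + 1) p \<le> rank s p"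
proof -
  have "max_column s \<le> max_column (s + 1)" unfolding max_column_def by linarith
  then show ?thesis unfolding rank_def using depth_mono[of p p "s - p" "s + 1 - p"] by auto
qed

lemma column_exists:
  assumes "1 \<le> i" "i \<le> int k" "2 * i + 1 \<le> s"
  shows "\<exists>p. 1 \<le> p \<and> p \<le> max_column s \<and> rank s p = i \<and> rank s (p - 1) < i"
proof -
  have t: "i \<le> max_column s" unfolding max_column_def using assms(3) by linarith
  then have "i \<le> rank s (int (nat (max_column s)))" using rank_top[of s] assms by simp
  then have ex: "\<exists>p. i \<le> rank s (int p)" by blast
  define p where "p = (LEAST p. i \<le> rank s (int p))"
  have p: "i \<le> rank s (int p)" unfolding p_def by (rule LeastI_ex[OF ex])
  have "p \<noteq> 0" using p rank_0[of s] assms(1) by (cases p) auto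
  then obtain p' where p': "p = Suc p'" by (cases p) auto
  have "\<not> i \<le> rank s (int p')" unfolding p_def[symmetric] using not_less_Least[of p' "\<lambda>p. i \<le> rank s (int p)"] p' p_def by simp
  moreover have "p \<le> nat (max_column s)" unfolding p_def
    by (rule Least_le) (use rank_top[of s] t assms in simp)
  ultimately show ?thesis using p p' rank_step[of s "int p'"] by (intro exI[of _ "int p"]) (auto simp: add.commute)
qed

lemma column_unique:
  assumes "rank s p = i" "rank s (p - 1) < i" "rank s p' = i" "rank s (p' - 1) < i"
  shows "p = p'"
  using rank_mono[of p "p' - 1" s] rank_mono[of p' "p - 1" s] assms by linarith

text \<open>The column in which path \<open>i\<close> passes the antidiagonal \<open>s\<close>.\<close>

definition column :: "int \<Rightarrow> int \<Rightarrow> int" where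
  "column i s = (THE p. 1 \<le> p \<and> p \<le> max_column s \<and> rank s p = i \<and> rank s (p - 1) < i)"

lemma column:
  assumes "1 \<le> i" "i \<le> int k" "2 * i + 1 \<le> s"
  shows "1 \<le> column i s" "column i s \<le> max_column s" "rank s (column i s) = i" "rank s (column i s - 1) < i"
proof -
  have "\<exists>!p. 1 \<le> p \<and> p \<le> max_column s \<and> rank s p = i \<and> rank s (p - 1) < i"
    using column_exists[OF assms] column_unique by blast
  from theI'[OF this] show "1 \<le> column i s" "column i s \<le> max_column s" "rank s (column i s) = i" "rank s (column i s - 1) < i"
    unfolding column_def by blast+
qed

lemma column_start: "1 \<le> i \<Longrightarrow> i \<le> int k \<Longrightarrow> column i (2 * i + 1) = i"
proof -
  assume i: "1 \<le> i" "i \<le> int k"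
  let ?c = "column i (2 * i + 1)"
  note c = column[OF i order_refl]
  have t: "max_column (2 * i + 1) = i" by (simp add: max_column_def)
  have "rank (2 * i + 1) ?c \<le> ?c" using depth_le_p[of ?c] c(1) t i(2) by (simp add: rank_def)
  then show ?thesis using c(2,3) t by simp
qed

lemma column_step:
  assumes "1 \<le> i" "i \<le> int k" "2 * i + 1 \<le> s"
  shows "column i (s + 1) = column i s \<or> column i (s + 1) = column i s + 1"
proof -
  note c = column[OF assms]
  have s': "2 * i + 1 \<le> s + 1" using assms(3) by simp
  note c' = column[OF assms(1,2) s']
  have "column i s \<le> column i (s + 1)"
    using rank_south[of s "column i (s + 1)"] c'(3) c(4) rank_mono[of "column i (s + 1)" "column i s - 1" s] by linarith
  moreover have "column i (s + 1) \<le> column i s + 1"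
    using rank_east[of s "column i s"] c(3) c'(4) rank_mono[of "column i s + 1" "column i (s + 1) - 1" "s + 1"] by linarith
  ultimately show ?thesis by linarith
qed

lemma column_inj:
  assumes "1 \<le> i" "i \<le> int k" "2 * i + 1 \<le> s" "1 \<le> i'" "i' \<le> int k" "2 * i' + 1 \<le> s" "column i s = column i' s"
  shows "i = i'"
  using column(3)[OF assms(1-3)] column(3)[OF assms(4-6)] assms(7) by metis

lemma column_cover:
  assumes "b \<in> \<omega>"
  defines "i \<equiv> rank (level n b) (fst b)"
  shows "1 \<le> i" "i \<le> int k" "2 * i + 1 \<le> level n b" "column i (level n b) = fst b"
proof -
  let ?s = "level n b" and ?q = "nesting_pos n (snd b)"
  have b: "b \<in> nesting_polyomino n" using assms(1) sub by (auto simp: reps_def)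
  have r: "1 \<le> fst b" "fst b < ?q" using b nesting_pos_range[OF b] by (auto simp: nesting_box_iff)
  have s: "?s - fst b = ?q" "?s - (fst b - 1) = ?q + 1" by (auto simp: level_def)
  have lt: "rank ?s (fst b - 1) < i" unfolding i_def rank_def s using depth_add[OF assms(1)] by auto
  have d0: "0 \<le> depth p q" for p q using depth_ge[OF empty_below] by simp
  then have "0 \<le> rank ?s (fst b - 1)" by (simp add: rank_def max.coboundedI1)
  then show 1: "1 \<le> i" using lt by simp
  have t: "fst b \<le> max_column ?s" unfolding max_column_def level_def using r by linarith
  then have "i \<le> rank ?s (max_column ?s)" unfolding i_def by (rule rank_mono)
  then have "i \<le> min (int k) (max_column ?s)" using rank_top[of ?s] t r by simp
  then show 2: "i \<le> int k" "2 * i + 1 \<le> ?s" by (auto simp: max_column_def)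
  show "column i ?s = fst b"
    by (rule column_unique[OF column(3,4)[OF 1 2] i_def[symmetric, THEN meta_eq_to_obj_eq] lt])
qed

end

lemma south_or_east_level:
  "south_or_east n b c \<Longrightarrow> level n c = level n b + 1 \<and> fst b \<le> fst c \<and> fst c \<le> fst b + 1 \<and>
     nesting_pos n (snd b) \<le> nesting_pos n (snd c)"
  by (auto simp: south_or_east_def level_def)

lemma dyck_nth_level:
  assumes "bs \<in> dyck_paths n i" "r < length bs"
  shows "level n (bs ! r) = 2 * int i + 1 + int r"
  using assms(2)
proof (induction r)
  case 0
  then show ?case using assms(1) by (auto simp: dyck_paths_def hd_conv_nth level_def nesting_pos_def)
next
  case (Suc r)
  have "south_or_east n (bs ! r) (bs ! Suc r)"
    by (rule successively_nth) (use assms(1) Suc.prems in \<open>auto simp: dyck_paths_def\<close>)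
  then show ?case using Suc south_or_east_level by fastforce
qed

lemma dyck_length:
  assumes "bs \<in> dyck_paths n i"
  shows "int (length bs) = 2 * int n + 1 - 2 * int i"
proof -
  have "bs \<noteq> []" "last bs \<in> main_diagonal n" using assms by (auto simp: dyck_paths_def)
  then show ?thesis using dyck_nth_level[OF assms, of "length bs - 1"]
    by (simp add: last_conv_nth main_diagonal_iff of_nat_diff Suc_le_eq)
qed

lemma dyck_mono:
  assumes "bs \<in> dyck_paths n i" "r \<le> r'" "r' < length bs"
  shows "fst (bs ! r) \<le> fst (bs ! r') \<and> nesting_pos n (snd (bs ! r)) \<le> nesting_pos n (snd (bs ! r'))"
  using assms(2,3)
proof (induction rule: dec_induct)
  case (step m)
  have "south_or_east n (bs ! m) (bs ! Suc m)"
    by (rule successively_nth) (use assms(1) step.prems in \<open>auto simp: dyck_paths_def\<close>)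
  then show ?case using step south_or_east_level by fastforce
qed simp

lemma dyck_set:
  assumes "bs \<in> dyck_paths n i"
  shows "set bs \<subseteq> nesting_polyomino n" "set bs \<subseteq> reps n"
proof -
  show 1: "set bs \<subseteq> nesting_polyomino n" using assms by (auto simp: dyck_paths_def)
  show "set bs \<subseteq> reps n"
  proof
    fix b assume b: "b \<in> set bs"
    then obtain r where "r < length bs" "b = bs ! r" by (auto simp: in_set_conv_nth)
    then have "level n b \<le> 2 * int n + 1" using dyck_nth_level[OF assms, of r] dyck_length[OF assms] by simp
    then show "b \<in> reps n" using b 1 by (auto simp: reps_iff)
  qed
qed

lemma dyck_distinct: "bs \<in> dyck_paths n i \<Longrightarrow> distinct bs"
  unfolding distinct_conv_nth
proof (intro allI impI)
  fix r r' assume h: "bs \<in> dyck_paths n i" "r < length bs" "r' < length bs" "r \<noteq> r'"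
  then show "bs ! r \<noteq> bs ! r'" using dyck_nth_level[OF h(1,2)] dyck_nth_level[OF h(1,3)] by auto
qed

lemma dyck_not_nested:
  assumes "bs \<in> dyck_paths n i" "b \<in> set bs" "c \<in> set bs"
  shows "\<not> nested n b c"
proof -
  obtain r r' where r: "r < length bs" "b = bs ! r" "r' < length bs" "c = bs ! r'"
    using assms(2,3) by (auto simp: in_set_conv_nth)
  then show ?thesis using dyck_mono[OF assms(1), of r r'] dyck_mono[OF assms(1), of r' r]
    by (cases "r \<le> r'") (auto simp: nested_def)
qed

definition fan_filling :: "nat \<Rightarrow> (nat \<Rightarrow> box list) \<Rightarrow> box set" where
  "fan_filling k p = (\<Union>i\<in>{1..k}. set (p i))"

lemma fan_fillingI: "i \<in> {1..k} \<Longrightarrow> b \<in> set (p i) \<Longrightarrow> b \<in> fan_filling k p"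
  unfolding fan_filling_def by blast

text \<open>The number of boxes of a fan off the main diagonal.\<close>

definition fan_dim :: "nat \<Rightarrow> nat \<Rightarrow> nat" where
  "fan_dim n k = (\<Sum>i\<in>{1..k}. 2 * (n - i))"

lemma fanD:
  assumes "p \<in> symmetric_fans n k" "i \<in> {1..k}"
  shows "p i \<in> dyck_paths n i"
  using assms by (auto simp: symmetric_fans_def)

lemma fan_disjoint:
  "p \<in> symmetric_fans n k \<Longrightarrow> i \<in> {1..k} \<Longrightarrow> j \<in> {1..k} \<Longrightarrow> i \<noteq> j \<Longrightarrow> set (p i) \<inter> set (p j) = {}"
  by (auto simp: symmetric_fans_def disjoint_family_on_def)

lemma fan_filling_reps: "p \<in> symmetric_fans n k \<Longrightarrow> fan_filling k p \<subseteq> reps n"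
  using dyck_set(2) fanD unfolding fan_filling_def by blast

text \<open>A path that goes south and east meets a north-east chain at most once.\<close>

lemma fan_filling_chain:
  assumes p: "p \<in> symmetric_fans n k" and X: "X \<subseteq> fan_filling k p" "ne_set n X"
  shows "card X \<le> k"
proof -
  define f where "f = (\<lambda>b. SOME i. i \<in> {1..k} \<and> b \<in> set (p i))"
  have f: "f b \<in> {1..k} \<and> b \<in> set (p (f b))" if "b \<in> X" for b
    unfolding f_def by (rule someI_ex) (use X(1) that in \<open>unfold fan_filling_def, blast\<close>)
  have "inj_on f X"
  proof (rule inj_onI, rule ccontr)
    fix b c assume h: "b \<in> X" "c \<in> X" "f b = f c" "b \<noteq> c"
    then have "nested n b c \<or> nested n c b" using X(2) by (auto simp: ne_set_def)
    moreover have "b \<in> set (p (f b))" "c \<in> set (p (f b))" "f b \<in> {1..k}" using f[OF h(1)] f[OF h(2)] h(3) by simp_all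
    ultimately show False using dyck_not_nested[OF fanD[OF p]] by blast
  qed
  then have "card X \<le> card {1..k}" by (rule card_inj_on_le) (use f in auto)
  then show ?thesis by simp
qed

lemma dyck_card:
  assumes "bs \<in> dyck_paths n i" "i \<le> n"
  shows "card (set bs \<inter> main_diagonal n) = 1" "card (set bs - main_diagonal n) = 2 * (n - i)"
proof -
  have ne: "bs \<noteq> []" and l: "last bs \<in> main_diagonal n" and b: "set (butlast bs) \<inter> main_diagonal n = {}"
    using assms by (auto simp: dyck_paths_def)
  have s: "set bs = insert (last bs) (set (butlast bs))"
    using ne by (metis append_butlast_last_id list.simps(15) rotate1.simps(2) set_rotate1)
  then have "set bs \<inter> main_diagonal n = {last bs}" "set bs - main_diagonal n = set (butlast bs)" using l b by auto
  moreover have "card (set (butlast bs)) = length bs - 1"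
    using distinct_card[OF distinct_butlast[OF dyck_distinct[OF assms(1)]]] by simp
  ultimately show "card (set bs \<inter> main_diagonal n) = 1" "card (set bs - main_diagonal n) = 2 * (n - i)"
    using dyck_length[OF assms(1)] assms(2) by auto
qed

lemma fan_filling_card:
  assumes p: "p \<in> symmetric_fans n k" and "k \<le> n"
  shows "card (fan_filling k p \<inter> main_diagonal n) = k" "card (fan_filling k p - main_diagonal n) = fan_dim n k"
proof -
  have "fan_filling k p \<inter> main_diagonal n = (\<Union>i\<in>{1..k}. set (p i) \<inter> main_diagonal n)" by (auto simp: fan_filling_def)
  also have "card \<dots> = (\<Sum>i\<in>{1..k}. card (set (p i) \<inter> main_diagonal n))"
    by (rule card_UN_disjoint) (use fan_disjoint[OF p] in blast)+
  also have "\<dots> = (\<Sum>i\<in>{1..k}. 1)" by (rule sum.cong[OF refl], rule dyck_card(1)[OF fanD[OF p]]) (use assms(2) in auto)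
  finally show "card (fan_filling k p \<inter> main_diagonal n) = k" by simp
  have "fan_filling k p - main_diagonal n = (\<Union>i\<in>{1..k}. set (p i) - main_diagonal n)" by (auto simp: fan_filling_def)
  also have "card \<dots> = (\<Sum>i\<in>{1..k}. card (set (p i) - main_diagonal n))"
    by (rule card_UN_disjoint) (use fan_disjoint[OF p] in blast)+
  also have "\<dots> = fan_dim n k" unfolding fan_dim_def
    by (rule sum.cong[OF refl], rule dyck_card(2)[OF fanD[OF p]]) (use assms(2) in auto)
  finally show "card (fan_filling k p - main_diagonal n) = fan_dim n k" .
qed

subsection \<open>A fan is determined by its boxes\<close>

text \<open>Disjoint paths cannot overtake each other, because each step moves to the next antidiagonal and by at most one column. A path that starts \<open>j - i\<close> places earlier
is \<open>2 (j - i)\<close> steps ahead on the same antidiagonal.\<close>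

lemma fan_order:
  assumes p: "p \<in> symmetric_fans n k" and "1 \<le> i" "i < j" "j \<le> k" "r < length (p j)"
  shows "fst (p i ! (r + 2 * (j - i))) < fst (p j ! r)"
  using assms(5)
proof (induction r)
  have pi: "p i \<in> dyck_paths n i" and pj: "p j \<in> dyck_paths n j" using fanD[OF p] assms by auto
  have len: "r + 2 * (j - i) < length (p i)" if "r < length (p j)" for r
    using dyck_length[OF pi] dyck_length[OF pj] that assms by linarith
  have lev: "level n (p i ! (r + 2 * (j - i))) = level n (p j ! r)" if "r < length (p j)" for r
    using dyck_nth_level[OF pi len[OF that]] dyck_nth_level[OF pj that] assms by (simp add: of_nat_diff)
  have ne: "fst (p i ! (r + 2 * (j - i))) \<noteq> fst (p j ! r)" if "r < length (p j)" for r
  proof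
    assume "fst (p i ! (r + 2 * (j - i))) = fst (p j ! r)"
    moreover have "p i ! (r + 2 * (j - i)) \<in> set (p i)" "p j ! r \<in> set (p j)" using len[OF that] that by auto
    ultimately have "p i ! (r + 2 * (j - i)) = p j ! r"
      using box_eq[OF _ _ lev[OF that]] dyck_set(1)[OF pi] dyck_set(1)[OF pj] by blast
    then show False using fan_disjoint[OF p, of i j] assms \<open>p i ! _ \<in> set (p i)\<close> \<open>p j ! r \<in> set (p j)\<close> by auto
  qed
  {
    case 0
    have "p j ! 0 = (int j, int j + 1)" using pj 0 by (auto simp: dyck_paths_def hd_conv_nth)
    moreover have "p i ! (0 + 2 * (j - i)) \<in> nesting_polyomino n" using len[OF 0] dyck_set(1)[OF pi] nth_mem by blast
    then have "fst (p i ! (0 + 2 * (j - i))) < nesting_pos n (snd (p i ! (0 + 2 * (j - i))))" using nesting_pos_range by blast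
    moreover have "level n (p i ! (0 + 2 * (j - i))) = 2 * int j + 1"
      using lev[OF 0] dyck_nth_level[OF pj 0] by simp
    ultimately show ?case using ne[OF 0] by (simp add: level_def)
  next
    case (Suc r)
    have r: "r < length (p j)" using Suc.prems by simp
    have s: "south_or_east n (p j ! r) (p j ! Suc r)" "south_or_east n (p i ! (r + 2 * (j - i))) (p i ! Suc (r + 2 * (j - i)))"
      by (rule successively_nth; use pi pj Suc.prems len[OF Suc.prems] in \<open>auto simp: dyck_paths_def\<close>)+
    show ?case using Suc.IH[OF r] ne[OF Suc.prems] south_or_east_level[OF s(1)] south_or_east_level[OF s(2)] by simp
  }
qed

lemma rank_unique:
  fixes x y :: int
  assumes "finite T" "x \<in> T" "y \<in> T" "card {z \<in> T. z < x} = card {z \<in> T. z < y}"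
  shows "x = y"
proof (rule ccontr)
  assume "x \<noteq> y"
  have *: "card {z \<in> T. z < a} < card {z \<in> T. z < b}" if "a < b" "a \<in> T" for a b
    by (rule psubset_card_mono) (use assms(1) that in auto)
  show False using *[of x y] *[of y x] assms \<open>x \<noteq> y\<close> by (cases "x < y") auto
qed

text \<open>The paths before path \<open>j\<close> account for all boxes of the fan to the left of path \<open>j\<close> on an antidiagonal.\<close>

lemma fan_level_columns:
  assumes p: "p \<in> symmetric_fans n k" and j: "j \<in> {1..k}" and r: "r < length (p j)"
  shows "{z \<in> fst ` {b \<in> fan_filling k p. level n b = level n (p j ! r)}. z < fst (p j ! r)} =
     (\<lambda>i. fst (p i ! (r + 2 * (j - i)))) ` {1..<j}" (is "?L = ?R")
    and "inj_on (\<lambda>i. fst (p i ! (r + 2 * (j - i)))) {1..<j}"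
proof -
  have pj: "p j \<in> dyck_paths n j" using fanD[OF p j] .
  have len: "r + 2 * (j - i) < length (p i)" "level n (p i ! (r + 2 * (j - i))) = level n (p j ! r)" if "i \<in> {1..<j}" for i
  proof -
    have pi: "p i \<in> dyck_paths n i" using fanD[OF p] j that by auto
    show 1: "r + 2 * (j - i) < length (p i)" using dyck_length[OF pi] dyck_length[OF pj] that r by auto
    show "level n (p i ! (r + 2 * (j - i))) = level n (p j ! r)"
      using dyck_nth_level[OF pi 1] dyck_nth_level[OF pj r] that by (simp add: of_nat_diff)
  qed
  have lt: "fst (p i ! (r + 2 * (j - i))) < fst (p j ! r)" if "i \<in> {1..<j}" for i
    by (rule fan_order[OF p]) (use that j r in auto)
  show "?L = ?R"
  proof
    show "?R \<subseteq> ?L"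
    proof
      fix z assume "z \<in> ?R"
      then obtain i where i: "i \<in> {1..<j}" "z = fst (p i ! (r + 2 * (j - i)))" by blast
      have "p i ! (r + 2 * (j - i)) \<in> fan_filling k p" using len(1)[OF i(1)] i(1) j by (intro fan_fillingI[of i]) auto
      then show "z \<in> ?L" using i len(2)[OF i(1)] lt[OF i(1)] by auto
    qed
    show "?L \<subseteq> ?R"
    proof
      fix z assume "z \<in> ?L"
      then obtain b i where b: "b \<in> set (p i)" "i \<in> {1..k}" "level n b = level n (p j ! r)" "z = fst b" "z < fst (p j ! r)"
        by (auto simp: fan_filling_def)
      have pi: "p i \<in> dyck_paths n i" using fanD[OF p b(2)] .
      obtain q where q: "q < length (p i)" "b = p i ! q" using b(1) by (auto simp: in_set_conv_nth)
      have e: "2 * int i + int q = 2 * int j + int r"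
        using dyck_nth_level[OF pi q(1)] dyck_nth_level[OF pj r] b(3) q(2) by simp
      have "i < j"
      proof (rule ccontr)
        assume "\<not> i < j"
        then consider "i = j" | "j < i" by linarith
        then show False
        proof cases
          case 1
          then show False using e q b(4,5) by simp
        next
          case 2
          have "r = q + 2 * (i - j)" using e 2 by linarith
          then show False using fan_order[OF p _ 2 _ q(1)] j b(2,4,5) q(2) by auto
        qed
      qed
      moreover from this have "q = r + 2 * (j - i)" using e by linarith
      ultimately show "z \<in> ?R" using b(2,4) q(2) by auto
    qed
  qed
  show "inj_on (\<lambda>i. fst (p i ! (r + 2 * (j - i)))) {1..<j}"
  proof (rule inj_onI, rule ccontr)
    fix a b assume ab: "a \<in> {1..<j}" "b \<in> {1..<j}" "fst (p a ! (r + 2 * (j - a))) = fst (p b ! (r + 2 * (j - b)))" "a \<noteq> b"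
    have *: False if "a < b" "a \<in> {1..<j}" "b \<in> {1..<j}" "fst (p a ! (r + 2 * (j - a))) = fst (p b ! (r + 2 * (j - b)))" for a b
    proof -
      have "r + 2 * (j - a) = r + 2 * (j - b) + 2 * (b - a)" using that by auto
      then show False using fan_order[OF p _ that(1) _ len(1)[OF that(3)]] that j by (auto simp: add.assoc)
    qed
    show False using *[of a b] *[of b a] ab by (cases "a < b") auto
  qed
qed

text \<open>On each antidiagonal the \<open>j\<close>-th path of a fan occupies the \<open>j\<close>-th box of the fan, counted by columns.\<close>

lemma fan_filling_inj: "inj_on (fan_filling k) (symmetric_fans n k)"
proof (rule inj_onI)
  fix p p' assume p: "p \<in> symmetric_fans n k" and p': "p' \<in> symmetric_fans n k" and eq: "fan_filling k p = fan_filling k p'"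
  have "p j = p' j" if j: "j \<in> {1..k}" for j
  proof (rule nth_equalityI)
    have pj: "p j \<in> dyck_paths n j" "p' j \<in> dyck_paths n j" using fanD j p p' by auto
    show l: "length (p j) = length (p' j)" using dyck_length[OF pj(1)] dyck_length[OF pj(2)] by simp
    fix r assume r: "r < length (p j)"
    then have r': "r < length (p' j)" using l by simp
    have lev: "level n (p j ! r) = level n (p' j ! r)" using dyck_nth_level[OF pj(1) r] dyck_nth_level[OF pj(2) r'] by simp
    let ?T = "fst ` {b \<in> fan_filling k p. level n b = level n (p j ! r)}"
    have fin: "finite ?T" by (simp add: fan_filling_def)
    have c1: "card {z \<in> ?T. z < fst (p j ! r)} = j - 1"
      unfolding fan_level_columns(1)[OF p j r] using card_image[OF fan_level_columns(2)[OF p j r]] by simp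
    have c2: "card {z \<in> ?T. z < fst (p' j ! r)} = j - 1"
      unfolding eq lev fan_level_columns(1)[OF p' j r'] using card_image[OF fan_level_columns(2)[OF p' j r']] by simp
    have "p j ! r \<in> fan_filling k p" "p' j ! r \<in> fan_filling k p'"
      using j r r' by (auto intro: fan_fillingI)
    then have m: "fst (p j ! r) \<in> ?T" "fst (p' j ! r) \<in> ?T" using eq lev by auto
    have "fst (p j ! r) = fst (p' j ! r)" by (rule rank_unique[OF fin m]) (simp only: c1 c2)
    moreover have "p j ! r \<in> nesting_polyomino n" "p' j ! r \<in> nesting_polyomino n"
      using r r' dyck_set(1)[OF pj(1)] dyck_set(1)[OF pj(2)] by auto
    ultimately show "p j ! r = p' j ! r" using box_eq lev by blast
  qed
  moreover have "p j = p' j" if "j \<notin> {1..k}" for j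
    using p p' that by (auto simp: symmetric_fans_def PiE_def extensional_def)
  ultimately show "p = p'" by blast
qed

subsection \<open>Covering a face by a fan\<close>

text \<open>The paths are the columns where the rank function jumps. On consecutive antidiagonals these columns differ by at most one, so
the boxes form paths, and each box of the face lies at a jump.\<close>

lemma (in nesting_face) fan_above: "\<exists>p\<in>symmetric_fans n k. \<omega> \<subseteq> fan_filling k p"
proof -
  define path where "path = (\<lambda>i. map (\<lambda>s. box_at n s (column (int i) s)) [2 * int i + 1..2 * int n + 1])"
  have nth: "path i ! r = box_at n (2 * int i + 1 + int r) (column (int i) (2 * int i + 1 + int r))"
    if "r < length (path i)" for i r using that by (simp add: path_def)
  have len: "int (length (path i)) = 2 * int n + 1 - 2 * int i" if "i \<in> {1..k}" for i using that kn by (simp add: path_def)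
  have col: "1 \<le> column (int i) s" "column (int i) s < s - column (int i) s" if "i \<in> {1..k}" "2 * int i + 1 \<le> s" for i s
    using column(1,2)[of "int i" s] that by (auto simp: max_column_def)
  have inb: "box_at n s (column (int i) s) \<in> nesting_polyomino n" "level n (box_at n s (column (int i) s)) = s"
    "nesting_pos n (snd (box_at n s (column (int i) s))) = s - column (int i) s"
    if "i \<in> {1..k}" "2 * int i + 1 \<le> s" "s \<le> 2 * int n + 1" for i s
    using box_at_in[OF col[OF that(1,2)] that(3)] nesting_pos_box_at[OF col(2,1)[OF that(1,2)]] col(1)[OF that(1,2)] that(3) by auto
  have dyck: "path i \<in> dyck_paths n i" if i: "i \<in> {1..k}" for i
    unfolding dyck_paths_def mem_Collect_eq
  proof (intro conjI)
    show ne: "path i \<noteq> []" using len[OF i] i kn by auto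
    show "set (path i) \<subseteq> nesting_polyomino n" using inb(1)[OF i] by (auto simp: path_def)
    have "column (int i) (2 * int i + 1) = int i" by (rule column_start) (use i in auto)
    then show "hd (path i) = (int i, int i + 1)" using nth[of 0 i] ne i kn by (simp add: hd_conv_nth box_at_def)
    have suc: "south_or_east n (path i ! r) (path i ! Suc r)" if r: "Suc r < length (path i)" for r
    proof -
      let ?s = "2 * int i + 1 + int r"
      have s: "2 * int i + 1 \<le> ?s" "?s + 1 \<le> 2 * int n + 1" "2 * int i + 1 \<le> ?s + 1" "?s \<le> 2 * int n + 1" using r len[OF i] by auto
      have e: "path i ! r = box_at n ?s (column (int i) ?s)" "path i ! Suc r = box_at n (?s + 1) (column (int i) (?s + 1))"
        using nth[of r i] nth[of "Suc r" i] r by (simp_all add: algebra_simps)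
      have f: "fst (box_at n s p) = p" for s p by (simp add: box_at_def)
      have "column (int i) (?s + 1) = column (int i) ?s \<or> column (int i) (?s + 1) = column (int i) ?s + 1"
        by (rule column_step) (use i s in auto)
      then show ?thesis
      proof
        assume "column (int i) (?s + 1) = column (int i) ?s"
        then show ?thesis unfolding south_or_east_def e f inb(3)[OF i s(1,4)] inb(3)[OF i s(3,2)] by simp
      next
        assume "column (int i) (?s + 1) = column (int i) ?s + 1"
        then show ?thesis unfolding south_or_east_def e f by (simp add: box_at_def)
      qed
    qed
    show "successively (south_or_east n) (path i)"
      unfolding successively_conv_nth using suc by blast
    have l: "last (path i) = box_at n (2 * int n + 1) (column (int i) (2 * int n + 1))"
      using nth[of "length (path i) - 1" i] ne len[OF i] by (simp add: last_conv_nth of_nat_diff Suc_le_eq add.commute)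
    show "last (path i) \<in> main_diagonal n"
      unfolding l main_diagonal_iff using inb[OF i, of "2 * int n + 1"] i kn by auto
    show "set (butlast (path i)) \<inter> main_diagonal n = {}"
    proof -
      have "butlast (path i) = map (\<lambda>s. box_at n s (column (int i) s)) [2 * int i + 1..2 * int n]"
        using i kn by (simp add: path_def map_butlast upto_rec2[of "2 * int i + 1" "2 * int n + 1"] butlast_append)
      then show ?thesis using inb(2)[OF i] by (fastforce simp: main_diagonal_iff)
    qed
  qed
  let ?p = "\<lambda>i\<in>{1..k}. path i"
  have "set (path i) \<inter> set (path j) = {}" if "i \<in> {1..k}" "j \<in> {1..k}" "i \<noteq> j" for i j
  proof (rule ccontr)
    assume "set (path i) \<inter> set (path j) \<noteq> {}"
    then obtain b where b: "b \<in> set (path i)" "b \<in> set (path j)" by blast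
    obtain s where s1: "2 * int i + 1 \<le> s" "s \<le> 2 * int n + 1" "b = box_at n s (column (int i) s)"
      using b(1) by (auto simp: path_def)
    obtain s' where s2: "2 * int j + 1 \<le> s'" "s' \<le> 2 * int n + 1" "b = box_at n s' (column (int j) s')"
      using b(2) by (auto simp: path_def)
    have s: "2 * int i + 1 \<le> s" "s \<le> 2 * int n + 1" "2 * int j + 1 \<le> s'" "s' \<le> 2 * int n + 1"
      "box_at n s (column (int i) s) = box_at n s' (column (int j) s')" using s1 s2 by simp_all
    have "s = s'" using inb(2)[OF that(1) s(1,2)] inb(2)[OF that(2) s(3,4)] s(5) by simp
    moreover have "column (int i) s = column (int j) s'" using s(5) by (simp add: box_at_def)
    ultimately have "int i = int j" using column_inj[of "int i" s "int j"] s that by auto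
    then show False using that by simp
  qed
  then have "?p \<in> symmetric_fans n k" using dyck by (auto simp: symmetric_fans_def disjoint_family_on_def)
  moreover have "\<omega> \<subseteq> fan_filling k ?p"
  proof
    fix b assume b: "b \<in> \<omega>"
    define i where "i = nat (rank (level n b) (fst b))"
    note c = column_cover[OF b]
    have i: "int i = rank (level n b) (fst b)" "i \<in> {1..k}" using c(1,2) by (auto simp: i_def)
    have bn: "b \<in> nesting_polyomino n" "level n b \<le> 2 * int n + 1" using b sub by (auto simp: reps_iff)
    have "b = box_at n (level n b) (column (int i) (level n b))" using box_at_level[OF bn(1)] c(4) i(1) by simp
    moreover have "level n b \<in> set [2 * int i + 1..2 * int n + 1]" using c(3) i(1) bn(2) by simp
    ultimately have "b \<in> set (path i)" unfolding path_def set_map by (rule image_eqI)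
    then show "b \<in> fan_filling k ?p" using i(2) by (intro fan_fillingI[of i]) auto
  qed
  ultimately show ?thesis by blast
qed

definition nesting_faces :: "nat \<Rightarrow> nat \<Rightarrow> box set set" where
  "nesting_faces n k = {\<omega>. \<omega> \<subseteq> reps n \<and> (\<forall>X. X \<subseteq> \<omega> \<longrightarrow> ne_set n X \<longrightarrow> card X \<le> k)}"

definition top_faces :: "nat \<Rightarrow> nat \<Rightarrow> box set set \<Rightarrow> box set set" where
  "top_faces n k \<F> = {\<omega> \<in> \<F>. card (\<omega> \<inter> main_diagonal n) = k \<and> card (\<omega> - main_diagonal n) = fan_dim n k}"

lemma finite_reps: "finite (reps n)"
  using finite_nesting_polyomino[of n] by (auto simp: reps_def intro: finite_subset)

lemma nesting_face_extends:
  assumes "1 \<le> k" "k < n" "\<omega> \<in> nesting_faces n k"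
  shows "\<exists>p\<in>symmetric_fans n k. \<omega> \<subseteq> fan_filling k p \<and> fan_filling k p \<in> top_faces n k (nesting_faces n k)"
proof -
  interpret nesting_face n k \<omega> by unfold_locales (use assms in \<open>auto simp: nesting_faces_def\<close>)
  obtain p where p: "p \<in> symmetric_fans n k" "\<omega> \<subseteq> fan_filling k p" using fan_above by blast
  have "fan_filling k p \<in> top_faces n k (nesting_faces n k)"
    using fan_filling_reps[OF p(1)] fan_filling_chain[OF p(1)] fan_filling_card[OF p(1)] assms(2)
    by (auto simp: top_faces_def nesting_faces_def)
  then show ?thesis using p by blast
qed

text \<open>Top faces are determined by any top face inside them, since both attain the same two cardinalities.\<close>

lemma top_face_maximal:
  assumes "\<omega> \<in> top_faces n k \<F>" "\<omega>' \<in> top_faces n k \<F>" "\<omega> \<subseteq> \<omega>'" "finite \<omega>'"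
  shows "\<omega> = \<omega>'"
proof -
  have "\<omega> \<inter> main_diagonal n = \<omega>' \<inter> main_diagonal n" "\<omega> - main_diagonal n = \<omega>' - main_diagonal n"
    by (rule card_subset_eq; use assms in \<open>auto simp: top_faces_def\<close>)+
  then show ?thesis by blast
qed

lemma card_symmetric_fans:
  assumes "1 \<le> k" "k < n"
  shows "card (symmetric_fans n k) = card (top_faces n k (nesting_faces n k))"
proof (rule bij_betw_same_card[of "fan_filling k"], unfold bij_betw_def, intro conjI fan_filling_inj equalityI subsetI)
  fix \<omega> assume "\<omega> \<in> fan_filling k ` symmetric_fans n k"
  then show "\<omega> \<in> top_faces n k (nesting_faces n k)"
    using fan_filling_reps fan_filling_chain fan_filling_card assms by (auto simp: top_faces_def nesting_faces_def)
next
  fix \<omega> assume w: "\<omega> \<in> top_faces n k (nesting_faces n k)"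
  then have "\<omega> \<in> nesting_faces n k" by (simp add: top_faces_def)
  from nesting_face_extends[OF assms this] obtain p where p: "p \<in> symmetric_fans n k" "\<omega> \<subseteq> fan_filling k p"
    "fan_filling k p \<in> top_faces n k (nesting_faces n k)" by blast
  have "finite (fan_filling k p)" by (simp add: fan_filling_def)
  then show "\<omega> \<in> fan_filling k ` symmetric_fans n k" using top_face_maximal[OF w p(3,2)] p(1) by blast
qed

section \<open>Crossing fillings\<close>

definition closure :: "box set \<Rightarrow> box set" where
  "closure \<omega> = \<omega> \<union> mirror ` \<omega>"

definition se_set :: "nat \<Rightarrow> box set \<Rightarrow> bool" where
  "se_set n X \<longleftrightarrow> (\<forall>b\<in>X. \<forall>c\<in>X. fst b < crossing_pos n (snd c) \<and> (b \<noteq> c \<longrightarrow>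
     (fst b < fst c \<and> crossing_pos n (snd b) < crossing_pos n (snd c)) \<or>
     (fst c < fst b \<and> crossing_pos n (snd c) < crossing_pos n (snd b))))"

text \<open>Unlike for nesting faces, chains must be taken in the symmetric set: the mirror does not fold a south-east chain into one side.\<close>

definition crossing_faces :: "nat \<Rightarrow> nat \<Rightarrow> box set set" where
  "crossing_faces n k = {\<omega>. \<omega> \<subseteq> reps n \<and> (\<forall>X. X \<subseteq> closure \<omega> \<longrightarrow> se_set n X \<longrightarrow> card X \<le> k)}"

lemma nested_reflect:
  assumes "b \<in> nesting_polyomino n" "c \<in> nesting_polyomino n" "nested n b c"
  shows "nested n (if b \<in> reps n then b else mirror b) (if c \<in> reps n then c else mirror c)"
  using assms by (cases b; cases c) (auto simp: nested_def nesting_box_iff reps_def nesting_pos_def)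

lemma mirror_in: "b \<in> nesting_polyomino n \<Longrightarrow> mirror b \<in> nesting_polyomino n"
  by (cases b) (auto simp: nesting_box_iff)

lemma mirror_mirror: "b \<in> nesting_polyomino n \<Longrightarrow> mirror (mirror b) = b"
  by (cases b) (auto simp: nesting_box_iff)

lemma mirror_reps: "b \<in> reps n \<Longrightarrow> mirror b \<in> reps n \<Longrightarrow> mirror b = b"
  by (cases b) (auto simp: nesting_box_iff reps_def)

lemma not_reps_mirror: "b \<in> nesting_polyomino n \<Longrightarrow> b \<notin> reps n \<Longrightarrow> mirror b \<in> reps n"
  by (cases b) (auto simp: nesting_box_iff reps_def)

lemma closure_subset: "\<omega> \<subseteq> reps n \<Longrightarrow> closure \<omega> \<subseteq> nesting_polyomino n"
  using mirror_in by (auto simp: closure_def reps_def)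

lemma closure_reps: "\<omega> \<subseteq> reps n \<Longrightarrow> closure \<omega> \<inter> reps n = \<omega>"
  using mirror_reps unfolding closure_def by fastforce

lemma in_closure_iff:
  assumes "\<omega> \<subseteq> reps n" "b \<in> nesting_polyomino n"
  shows "b \<in> closure \<omega> \<longleftrightarrow> (if b \<in> reps n then b else mirror b) \<in> \<omega>"
proof (cases "b \<in> reps n")
  case True
  then show ?thesis using closure_reps[OF assms(1)] by auto
next
  case False
  then have "b \<notin> \<omega>" using assms(1) by blast
  moreover have "b \<in> mirror ` \<omega> \<longleftrightarrow> mirror b \<in> \<omega>"
    using mirror_mirror[OF assms(2)] mirror_mirror assms(1) by (force simp: reps_def image_iff)
  ultimately show ?thesis using False by (simp add: closure_def)
qed

text \<open>Replacing the boxes of a north-east chain beyond the main diagonal by their mirror boxes gives a chain again.\<close>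

lemma nesting_faces_closure:
  "nesting_faces n k = {\<omega>. \<omega> \<subseteq> reps n \<and> (\<forall>X. X \<subseteq> closure \<omega> \<longrightarrow> ne_set n X \<longrightarrow> card X \<le> k)}"
proof -
  have "card X \<le> k" if \<omega>: "\<omega> \<in> nesting_faces n k" and X: "X \<subseteq> closure \<omega>" "ne_set n X" for \<omega> X
  proof -
    have sub: "\<omega> \<subseteq> reps n" using \<omega> by (simp add: nesting_faces_def)
    define f where "f = (\<lambda>b. if b \<in> reps n then b else mirror b)"
    have P: "X \<subseteq> nesting_polyomino n" using X(1) closure_subset[OF sub] by blast
    have nest: "nested n (f b) (f c)" if "b \<in> X" "c \<in> X" "nested n b c" for b c
      unfolding f_def using nested_reflect[of b n c] that P by blast
    have "ne_set n (f ` X)" using X(2) nest unfolding ne_set_def by (metis imageE)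
    moreover have "f ` X \<subseteq> \<omega>"
    proof (rule image_subsetI)
      fix b assume b: "b \<in> X"
      then have "b \<in> closure \<omega>" "b \<in> nesting_polyomino n" using X(1) P by blast+
      then show "f b \<in> \<omega>" unfolding f_def using in_closure_iff[OF sub, of b] by blast
    qed
    moreover have "inj_on f X"
    proof (rule inj_onI, rule ccontr)
      fix b c assume h: "b \<in> X" "c \<in> X" "f b = f c" "b \<noteq> c"
      then have "nested n (f b) (f c) \<or> nested n (f c) (f b)" using X(2) nest unfolding ne_set_def by blast
      then show False using h(3) by (auto simp: nested_def)
    qed
    ultimately show ?thesis using \<omega> card_image[of f X] by (metis (no_types, lifting) mem_Collect_eq nesting_faces_def)
  qed
  moreover have "\<omega> \<in> nesting_faces n k" if "\<omega> \<subseteq> reps n" "\<forall>X. X \<subseteq> closure \<omega> \<longrightarrow> ne_set n X \<longrightarrow> card X \<le> k" for \<omega>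
    using that by (auto simp: nesting_faces_def closure_def)
  ultimately show ?thesis by (auto simp: nesting_faces_def)
qed

subsection \<open>Boxes as letters of the network\<close>

definition letter_box :: "nat \<Rightarrow> nat \<times> nat \<Rightarrow> box" where
  "letter_box n = (\<lambda>(p, i). if p \<le> i then (int p, int p + int n - int i) else (int p - int i, - int p))"

lemma letter_box_bij: "bij_betw (letter_box n) ({1..n} \<times> {0..<n}) (reps n)"
proof (rule bij_betw_byWitness[where f' = "\<lambda>(i, j). if 0 < j then (nat i, nat (i + int n - j)) else (nat (- j), nat (- j - i))"])
  show "letter_box n ` ({1..n} \<times> {0..<n}) \<subseteq> reps n"
    by (auto simp: letter_box_def reps_def nesting_box_iff split: if_splits)
  show "(\<lambda>(i, j). if 0 < j then (nat i, nat (i + int n - j)) else (nat (- j), nat (- j - i))) ` reps n \<subseteq> {1..n} \<times> {0..<n}"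
    by (auto simp: reps_def nesting_box_iff)
  show "\<forall>a\<in>{1..n} \<times> {0..<n}. (case letter_box n a of (i, j) \<Rightarrow> if 0 < j then (nat i, nat (i + int n - j)) else (nat (- j), nat (- j - i))) = a"
    by (auto simp: letter_box_def)
  show "\<forall>a'\<in>reps n. letter_box n (case a' of (i, j) \<Rightarrow> if 0 < j then (nat i, nat (i + int n - j)) else (nat (- j), nat (- j - i))) = a'"
    by (auto simp: letter_box_def reps_def nesting_box_iff)
qed

lemma letter_box_diagonal: "l \<in> {1..n} \<times> {0..<n} \<Longrightarrow> letter_box n l \<in> main_diagonal n \<longleftrightarrow> snd l = 0"
  by (auto simp: letter_box_def main_diagonal_def split: if_splits)

text \<open>The symmetric set in coordinates, together with the boxes that are irrelevant for chains of more than \<open>k\<close> boxes.\<close>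

definition grid :: "nat \<Rightarrow> nat \<Rightarrow> box set \<Rightarrow> (nat \<times> nat) set" where
  "grid n k \<omega> = (\<lambda>b. (nat (fst b), nat (crossing_pos n (snd b)))) ` closure \<omega> \<union>
     {(p, q). 1 \<le> p \<and> p \<le> n \<and> p < q \<and> q \<le> 2 * n \<and> (q - p \<le> k \<or> 2 * n - k \<le> q - p)}"

lemma coordinates_inj:
  "b \<in> nesting_polyomino n \<Longrightarrow> c \<in> nesting_polyomino n \<Longrightarrow>
    (nat (fst b), nat (crossing_pos n (snd b))) = (nat (fst c), nat (crossing_pos n (snd c))) \<Longrightarrow> b = c"
  by (cases b; cases c) (auto simp: nesting_box_iff crossing_pos_def eq_nat_nat_iff split: if_splits)

lemma grid_iff:
  assumes "\<omega> \<subseteq> reps n" "b \<in> nesting_polyomino n" "p = nat (fst b)" "q = nat (crossing_pos n (snd b))"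
  shows "(p, q) \<in> grid n k \<omega> \<longleftrightarrow> b \<in> closure \<omega> \<or> q - p \<le> k \<or> 2 * n - k \<le> q - p"
proof -
  have "(p, q) \<in> (\<lambda>b. (nat (fst b), nat (crossing_pos n (snd b)))) ` closure \<omega> \<longleftrightarrow> b \<in> closure \<omega>"
    using coordinates_inj[OF assms(2)] closure_subset[OF assms(1)] unfolding assms(3,4) by blast
  moreover have "1 \<le> p \<and> p \<le> n \<and> p < q \<and> q \<le> 2 * n"
    using assms(2) unfolding assms(3,4) by (cases b) (auto simp: nesting_box_iff crossing_pos_def)
  ultimately show ?thesis by (auto simp: grid_def)
qed

lemma network_grid:
  assumes "1 \<le> k" "k < n" "\<omega> \<subseteq> reps n"
  shows "network n k (n - k) (grid n k \<omega>)"
proof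
  fix c r assume c: "c \<in> {1..n}" and r: "r \<in> {1..n}"
  let ?b = "(int c, - int r)" and ?b' = "(int r, - int c)"
  have b: "?b \<in> nesting_polyomino n" "?b' \<in> nesting_polyomino n" using c r by (auto simp: nesting_box_iff)
  have "?b \<in> closure \<omega> \<longleftrightarrow> ?b' \<in> closure \<omega>"
    using in_closure_iff[OF assms(3) b(1)] in_closure_iff[OF assms(3) b(2)] c r
    by (cases "c \<le> r"; cases "r \<le> c") (auto simp: reps_def nesting_box_iff)
  moreover have "(c, n + r) \<in> grid n k \<omega> \<longleftrightarrow> ?b \<in> closure \<omega> \<or> n + r - c \<le> k \<or> 2 * n - k \<le> n + r - c"
    by (rule grid_iff[OF assms(3) b(1)]) (use r in \<open>auto simp: crossing_pos_def\<close>)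
  moreover have "(r, n + c) \<in> grid n k \<omega> \<longleftrightarrow> ?b' \<in> closure \<omega> \<or> n + c - r \<le> k \<or> 2 * n - k \<le> n + c - r"
    by (rule grid_iff[OF assms(3) b(2)]) (use c in \<open>auto simp: crossing_pos_def\<close>)
  ultimately show "(c, n + r) \<in> grid n k \<omega> \<longleftrightarrow> (r, n + c) \<in> grid n k \<omega>" using c r assms by auto
qed (use assms in \<open>auto simp: grid_def\<close>)

lemma sechain_inj:
  assumes "sechain X"
  shows "inj_on fst X" "inj_on snd X"
  using assms unfolding sechain_def inj_on_def by (metis less_irrefl)+

text \<open>A box with too few columns or rows around it has fewer than \<open>k\<close> chain companions.\<close>

lemma chain_not_short:
  assumes "sechain X" "X \<subseteq> {1..a} \<times> {a + 1..N}" "k < card X" "(p, q) \<in> X"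
  shows "k < q - p" "q - p < N - k"
proof -
  have fin: "finite X" using assms(2) by (rule finite_subset) auto
  let ?L = "{b \<in> X. fst b < p \<and> snd b < q}" and ?G = "{b \<in> X. p < fst b \<and> q < snd b}"
  have "X = insert (p, q) (?L \<union> ?G)"
    using assms(1,4) unfolding sechain_def by fastforce
  then have "card X = card (insert (p, q) (?L \<union> ?G))" by simp
  also have "\<dots> \<le> Suc (card (?L \<union> ?G))" by (rule card_insert_le_m1) simp_all
  also have "card (?L \<union> ?G) \<le> card ?L + card ?G" by (rule card_Un_le)
  finally have k: "k \<le> card ?L + card ?G" using assms(3) by simp
  note inj = sechain_inj[OF assms(1)]
  have sub: "?L \<subseteq> X" "?G \<subseteq> X" by auto
  have pq: "1 \<le> p" "p \<le> a" "a + 1 \<le> q" "q \<le> N" using assms(2,4) by auto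
  have "card (fst ` ?L) \<le> card {1..<p}" by (rule card_mono) (use assms(2) in auto)
  then have L1: "card ?L \<le> p - 1" using card_image[OF inj_on_subset[OF inj(1) sub(1)]] by simp
  have "card (snd ` ?L) \<le> card {a + 1..<q}" by (rule card_mono) (use assms(2) in auto)
  then have L2: "card ?L \<le> q - a - 1" using card_image[OF inj_on_subset[OF inj(2) sub(1)]] by simp
  have "card (fst ` ?G) \<le> card {p<..a}" by (rule card_mono) (use assms(2) in auto)
  then have G1: "card ?G \<le> a - p" using card_image[OF inj_on_subset[OF inj(1) sub(2)]] by simp
  have "card (snd ` ?G) \<le> card {q<..N}" by (rule card_mono) (use assms(2) in auto)
  then have G2: "card ?G \<le> N - q" using card_image[OF inj_on_subset[OF inj(2) sub(2)]] by simp
  show "k < q - p" "q - p < N - k" using k L1 L2 G1 G2 pq by linarith+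
qed

lemma chain_length_of_face:
  assumes "1 \<le> k" "k < n" "\<omega> \<in> crossing_faces n k"
  shows "\<forall>t<n - k. chain_length (grid n k \<omega>) (n - t) (n - t) (n + t) \<le> k"
proof (intro allI impI, rule ccontr)
  fix t assume t: "t < n - k" and L: "\<not> chain_length (grid n k \<omega>) (n - t) (n - t) (n + t) \<le> k"
  have sub: "\<omega> \<subseteq> reps n" using assms(3) by (simp add: crossing_faces_def)
  let ?a = "n - t"
  obtain X where X: "sechain X" "X \<subseteq> grid n k \<omega>" "X \<subseteq> {1..?a} \<times> {?a + 1..?a + (n + t)}" "card X = chain_length (grid n k \<omega>) ?a ?a (n + t)"
    using chain_length_sechain by blast
  have N: "?a + (n + t) = 2 * n" using t by simp
  have notshort: "\<not> (q - p \<le> k \<or> 2 * n - k \<le> q - p)" if "(p, q) \<in> X" for p q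
    using chain_not_short[OF X(1) X(3)[unfolded N] _ that, of k] L X(4) by linarith
  let ?g = "\<lambda>b. (nat (fst b), nat (crossing_pos n (snd b)))"
  have X': "X \<subseteq> ?g ` closure \<omega>"
  proof
    fix x assume x: "x \<in> X"
    obtain p q where pq: "x = (p, q)" by (cases x)
    show "x \<in> ?g ` closure \<omega>" using x X(2) notshort[of p q] unfolding grid_def pq by blast
  qed
  define Y where "Y = {b \<in> closure \<omega>. ?g b \<in> X}"
  have YP: "Y \<subseteq> nesting_polyomino n" using closure_subset[OF sub] by (auto simp: Y_def)
  have gY: "?g ` Y = X" using X' by (auto simp: Y_def)
  have pos: "0 < fst b" "0 < crossing_pos n (snd b)" if "b \<in> Y" for b
    using YP that by (auto simp: nesting_box_iff crossing_pos_def)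
  have "se_set n Y" unfolding se_set_def
  proof (intro ballI conjI impI)
    fix b c assume bc: "b \<in> Y" "c \<in> Y"
    have "?g b \<in> X" "?g c \<in> X" using bc by (auto simp: Y_def)
    then have "nat (fst b) \<le> ?a" "?a < nat (crossing_pos n (snd c))" using X(3) by auto
    then show "fst b < crossing_pos n (snd c)" by linarith
    assume "b \<noteq> c"
    then have "?g b \<noteq> ?g c" using coordinates_inj YP bc by blast
    then have "(fst (?g b) < fst (?g c) \<and> snd (?g b) < snd (?g c)) \<or> (fst (?g c) < fst (?g b) \<and> snd (?g c) < snd (?g b))"
      using X(1) \<open>?g b \<in> X\<close> \<open>?g c \<in> X\<close> unfolding sechain_def by blast
    then show "(fst b < fst c \<and> crossing_pos n (snd b) < crossing_pos n (snd c)) \<or>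
     (fst c < fst b \<and> crossing_pos n (snd c) < crossing_pos n (snd b))" using pos[OF bc(1)] pos[OF bc(2)] by auto
  qed
  moreover have "Y \<subseteq> closure \<omega>" by (auto simp: Y_def)
  ultimately have "card Y \<le> k" using assms(3) by (simp add: crossing_faces_def)
  moreover have "finite Y" using YP finite_nesting_polyomino finite_subset by blast
  then have "card X \<le> card Y" unfolding gY[symmetric] by (rule card_image_le)
  ultimately show False using L X(4) by simp
qed

lemma face_of_chain_length:
  assumes "1 \<le> k" "k < n" "\<omega> \<subseteq> reps n" "\<forall>t<n - k. chain_length (grid n k \<omega>) (n - t) (n - t) (n + t) \<le> k"
  shows "\<omega> \<in> crossing_faces n k"
  unfolding crossing_faces_def
proof (intro CollectI conjI assms(3) allI impI)
  fix X assume X: "X \<subseteq> closure \<omega>" "se_set n X"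
  have P: "X \<subseteq> nesting_polyomino n" using X(1) closure_subset[OF assms(3)] by blast
  then have fin: "finite X" using finite_nesting_polyomino finite_subset by blast
  show "card X \<le> k"
  proof (cases "X = {}")
    case False
    let ?g = "\<lambda>b. (nat (fst b), nat (crossing_pos n (snd b)))"
    define a where "a = nat (Max (fst ` X))"
    have "Max (fst ` X) \<in> fst ` X" using fin False by simp
    then obtain m where m: "m \<in> X" "fst m = Max (fst ` X)" by auto
    have pos: "1 \<le> fst b" "fst b \<le> int n" "crossing_pos n (snd b) \<le> 2 * int n" if "b \<in> X" for b
      using P that by (auto simp: nesting_box_iff crossing_pos_def)
    have a: "1 \<le> a" "a \<le> n" "int a = fst m" using pos[OF m(1)] m(2) by (auto simp: a_def)
    have le: "fst b \<le> int a" if "b \<in> X" for b using fin that a(3) m(2) by simp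
    have gt: "int a < crossing_pos n (snd b)" if "b \<in> X" for b using X(2) m(1) that a(3) unfolding se_set_def by metis
    have inj: "inj_on ?g X"
    proof (rule inj_onI)
      fix b c assume h: "b \<in> X" "c \<in> X" "?g b = ?g c"
      then have "b \<in> nesting_polyomino n" "c \<in> nesting_polyomino n" using P by blast+
      then show "b = c" using h(3) by (rule coordinates_inj)
    qed
    have sub: "?g ` X \<subseteq> {1..a} \<times> {a + 1..2 * n}"
    proof (rule image_subsetI)
      fix b assume b: "b \<in> X"
      show "?g b \<in> {1..a} \<times> {a + 1..2 * n}" using pos[OF b] le[OF b] gt[OF b] by (simp add: le_nat_iff nat_le_iff Suc_le_eq zless_nat_eq_int_zless)
    qed
    have ch: "sechain (?g ` X)" unfolding sechain_def
    proof (intro ballI impI)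
      fix x y assume "x \<in> ?g ` X" "y \<in> ?g ` X" "x \<noteq> y"
      then obtain b c where bc: "b \<in> X" "c \<in> X" "x = ?g b" "y = ?g c" "b \<noteq> c" by blast
      then have "(fst b < fst c \<and> crossing_pos n (snd b) < crossing_pos n (snd c)) \<or>
         (fst c < fst b \<and> crossing_pos n (snd c) < crossing_pos n (snd b))" using X(2) unfolding se_set_def by blast
      then show "fst x < fst y \<and> snd x < snd y \<or> fst y < fst x \<and> snd y < snd x"
        using bc pos[OF bc(1)] pos[OF bc(2)] gt[OF bc(1)] gt[OF bc(2)] by auto
    qed
    show ?thesis
    proof (cases "a \<le> k")
      case True
      have "inj_on fst (?g ` X)" by (rule sechain_inj(1)[OF ch])
      then have "card (?g ` X) \<le> card {1..a}" by (rule card_inj_on_le) (use sub in auto)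
      then show ?thesis using True card_image[OF inj] by simp
    next
      case False
      \<comment> \<open>The last column \<open>a\<close> of the chain determines a rectangle that contains it.\<close>
      define t where "t = n - a"
      have t: "t < n - k" "n - t = a" "a + (n + t) = 2 * n" using False a by (auto simp: t_def)
      have "card (?g ` X) \<le> chain_length (grid n k \<omega>) a a (n + t)"
      proof (rule sechain_le_chain_length[OF ch])
        show "?g ` X \<subseteq> grid n k \<omega>" using X(1) by (auto simp: grid_def)
        show "?g ` X \<subseteq> {1..a} \<times> {a + 1..a + (n + t)}" using sub unfolding t(3) .
      qed
      then show ?thesis using assms(4) t card_image[OF inj] by fastforce
    qed
  qed simp
qed

lemma fan_dim_eq: "k \<le> n \<Longrightarrow> fan_dim n k + ((n - k) * (n - k) - (n - k)) = n * n - n"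
proof (induction k)
  case (Suc k)
  define m where "m = n - Suc k"
  have a: "n - k = Suc m" "n - Suc k = m" using Suc.prems by (simp_all add: m_def)
  have b: "fan_dim n (Suc k) = fan_dim n k + 2 * m" by (simp add: fan_dim_def m_def)
  have c: "Suc m * Suc m - Suc m = 2 * m + (m * m - m)" by (cases m) auto
  have "fan_dim n k + (Suc m * Suc m - Suc m) = n * n - n" using Suc.IH Suc.prems unfolding a by simp
  then show ?case unfolding a b c by simp
qed (simp add: fan_dim_def)

text \<open>The boxes whose comparators are used in the run of the network form the complement of a face. Their number is the length of the longest element of the hyperoctahedral group, whatever the
face, and \<open>n - k\<close> of them lie on the main diagonal.\<close>

lemma crossing_face_extends:
  assumes k: "1 \<le> k" "k < n" and \<omega>: "\<omega> \<in> crossing_faces n k"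
  shows "\<exists>\<omega>'\<in>top_faces n k (crossing_faces n k). \<omega> \<subseteq> \<omega>'"
proof -
  define m where "m = n - k"
  have sub: "\<omega> \<subseteq> reps n" using \<omega> by (simp add: crossing_faces_def)
  interpret N: network n k m "grid n k \<omega>" unfolding m_def by (rule network_grid[OF k sub])
  have L: "\<forall>t<m. chain_length (grid n k \<omega>) (n - t) (n - t) (n + t) \<le> k" unfolding m_def by (rule chain_length_of_face[OF k \<omega>])
  let ?A = "{1..n} \<times> {0..<n}" and ?U = "N.crossings"
  have U: "?U \<subseteq> {1..n} \<times> {0..<m}" "?U \<subseteq> N.zeros" using N.crossings_subset by auto
  then have UA: "?U \<subseteq> ?A" by (auto simp: m_def)
  note bij = letter_box_bij[of n]
  have inj: "inj_on (letter_box n) ?A" using bij by (simp add: bij_betw_def)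
  define \<omega>' where "\<omega>' = letter_box n ` (?A - ?U)"
  have sub': "\<omega>' \<subseteq> reps n" using bij by (auto simp: \<omega>'_def bij_betw_def)
  have mem: "letter_box n l \<in> \<omega>' \<longleftrightarrow> l \<notin> ?U" if "l \<in> ?A" for l
    unfolding \<omega>'_def using inj_on_image_mem_iff[OF inj that, of "?A - ?U"] that by blast
  have grid: "(p, p + n - i) \<in> grid n k \<xi> \<longleftrightarrow> letter_box n (p, i) \<in> \<xi>"
    if xi: "\<xi> \<subseteq> reps n" and pi: "p \<in> {1..n}" "i < m" for \<xi> p i
  proof -
    let ?b = "if p \<le> i then (int p, int p + int n - int i) else (int p, int i - int p)"
    have b: "?b \<in> nesting_polyomino n" using pi by (auto simp: nesting_box_iff m_def)
    have "(p, p + n - i) \<in> grid n k \<xi> \<longleftrightarrow> ?b \<in> closure \<xi> \<or> p + n - i - p \<le> k \<or> 2 * n - k \<le> p + n - i - p"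
      by (rule grid_iff[OF xi b]) (use pi in \<open>auto simp: crossing_pos_def m_def\<close>)
    also have "\<dots> \<longleftrightarrow> ?b \<in> closure \<xi>" using pi k by (auto simp: m_def)
    also have "\<dots> \<longleftrightarrow> letter_box n (p, i) \<in> \<xi>"
    proof -
      have "i < n" using pi(2) by (simp add: m_def)
      have "(if ?b \<in> reps n then ?b else mirror ?b) = letter_box n (p, i)"
        using pi \<open>i < n\<close> b by (auto simp: reps_def letter_box_def nesting_box_iff)
      then show ?thesis using in_closure_iff[OF xi b] by simp
    qed
    finally show ?thesis .
  qed
  have "\<omega> \<subseteq> \<omega>'"
  proof
    fix b assume b: "b \<in> \<omega>"
    then obtain l where l: "l \<in> ?A" "b = letter_box n l" using bij sub unfolding bij_betw_def by blast
    have "l \<notin> ?U"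
    proof
      assume lU: "l \<in> ?U"
      obtain p i where pi: "l = (p, i)" by (cases l)
      then have "(p, p + n - i) \<notin> grid n k \<omega>" "p \<in> {1..n}" "i < m" using lU U by (auto simp: N.zeros_def)
      then show False using grid[OF sub, of p i] b l(2) pi by simp
    qed
    then show "b \<in> \<omega>'" using mem l by simp
  qed
  moreover have "\<omega>' \<in> crossing_faces n k"
  proof (rule face_of_chain_length[OF k sub'], fold m_def, rule N.same_crossings[OF L])
    show "network n k m (grid n k \<omega>')" unfolding m_def by (rule network_grid[OF k sub'])
    then interpret N': network n k m "grid n k \<omega>'" .
    show "network.zeros n (grid n k \<omega>') \<inter> ({1..n} \<times> {0..<m}) = ?U"
    proof (intro equalityI subsetI)
      fix l assume l: "l \<in> N'.zeros \<inter> ({1..n} \<times> {0..<m})"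
      obtain p i where pi: "l = (p, i)" by (cases l)
      have "letter_box n (p, i) \<notin> \<omega>'" "(p, i) \<in> ?A" using l grid[OF sub', of p i] by (auto simp: pi N'.zeros_def m_def)
      then show "l \<in> ?U" using mem pi by blast
    next
      fix l assume l: "l \<in> ?U"
      obtain p i where pi: "l = (p, i)" by (cases l)
      have "letter_box n (p, i) \<notin> \<omega>'" using mem[of l] l UA pi by blast
      then show "l \<in> N'.zeros \<inter> ({1..n} \<times> {0..<m})" using l U(1) grid[OF sub', of p i] by (auto simp: pi N'.zeros_def)
    qed
  qed
  moreover have "card (\<omega>' \<inter> main_diagonal n) = k"
  proof -
    let ?D = "{1..n} \<times> {0::nat}"
    have "\<omega>' \<inter> main_diagonal n = letter_box n ` {l \<in> ?A - ?U. letter_box n l \<in> main_diagonal n}"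
      unfolding \<omega>'_def by blast
    also have "{l \<in> ?A - ?U. letter_box n l \<in> main_diagonal n} = ?D - {l \<in> ?U. snd l = 0}"
      using k by (auto simp: letter_box_diagonal)
    finally have "\<omega>' \<inter> main_diagonal n = letter_box n ` (?D - {l \<in> ?U. snd l = 0})" .
    moreover have i: "inj_on (letter_box n) (?D - {l \<in> ?U. snd l = 0})" by (rule inj_on_subset[OF inj]) (use k in auto)
    moreover have "{l \<in> ?U. snd l = 0} \<subseteq> ?D" using UA by auto
    then have "card (?D - {l \<in> ?U. snd l = 0}) = card ?D - card {l \<in> ?U. snd l = 0}"
      by (intro card_Diff_subset) (auto intro: finite_subset)
    ultimately show ?thesis using N.card_crossings(1)[OF L] card_image[OF i] k by (simp add: card_cartesian_product m_def)
  qed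
  moreover have "card (\<omega>' - main_diagonal n) = fan_dim n k"
  proof -
    let ?D = "{1..n} \<times> {1..<n}"
    have "\<omega>' - main_diagonal n = letter_box n ` {l \<in> ?A - ?U. letter_box n l \<notin> main_diagonal n}"
      unfolding \<omega>'_def by blast
    also have "{l \<in> ?A - ?U. letter_box n l \<notin> main_diagonal n} = ?D - {l \<in> ?U. snd l \<noteq> 0}"
      using k by (auto simp: letter_box_diagonal)
    finally have "\<omega>' - main_diagonal n = letter_box n ` (?D - {l \<in> ?U. snd l \<noteq> 0})" .
    moreover have i: "inj_on (letter_box n) (?D - {l \<in> ?U. snd l \<noteq> 0})" by (rule inj_on_subset[OF inj]) (use k in auto)
    moreover have "{l \<in> ?U. snd l \<noteq> 0} \<subseteq> ?D" using UA by auto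
    then have "card (?D - {l \<in> ?U. snd l \<noteq> 0}) = card ?D - card {l \<in> ?U. snd l \<noteq> 0}"
      by (intro card_Diff_subset) (auto intro: finite_subset)
    moreover have "card ?D = n * n - n" by (simp add: card_cartesian_product diff_mult_distrib2)
    moreover have "fan_dim n k = (n * n - n) - ((n - k) * (n - k) - (n - k))"
      using fan_dim_eq[of k n] k by (metis add_diff_cancel_right' less_imp_le)
    ultimately show ?thesis using N.card_crossings(2)[OF L] card_image[OF i] by (simp add: m_def)
  qed
  ultimately show ?thesis by (auto simp: top_faces_def)
qed

section \<open>Equally many fillings of each weight\<close>

subsection \<open>Decreasing subsequences as chains\<close>

lemma sorted_wrt_subseq: "subseq xs ys \<Longrightarrow> sorted_wrt R ys \<Longrightarrow> sorted_wrt R xs"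
  by (induction rule: list_emb.induct) (auto dest: list_emb_set)

text \<open>A decreasing subsequence takes at most one letter from each weakly increasing block.\<close>

lemma dec_subseq_rows:
  assumes "\<And>j. j \<in> set ks \<Longrightarrow> sorted (g j)"
  shows "sorted_wrt (>) s \<Longrightarrow> subseq s (concat (map g ks)) \<longleftrightarrow>
    (\<exists>js. subseq js ks \<and> list_all2 (\<lambda>c j. c \<in> set (g j)) (s :: nat list) js)"
  using assms
proof (induction ks arbitrary: s)
  case (Cons k ks)
  have srt: "\<And>j. j \<in> set ks \<Longrightarrow> sorted (g j)" using Cons.prems(2) by simp
  show ?case
  proof
    assume "subseq s (concat (map g (k # ks)))"
    then obtain a b where ab: "s = a @ b" "subseq a (g k)" "subseq b (concat (map g ks))"
      by (auto simp: subseq_append_iff)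
    have b: "sorted_wrt (>) b" using Cons.prems(1) ab(1) by (simp add: sorted_wrt_append)
    obtain js where js: "subseq js ks" "list_all2 (\<lambda>c j. c \<in> set (g j)) b js"
      using Cons.IH[OF b srt] ab(3) by blast
    show "\<exists>js. subseq js (k # ks) \<and> list_all2 (\<lambda>c j. c \<in> set (g j)) s js"
    proof (cases a)
      case Nil
      then show ?thesis using js ab(1) by (auto intro: list_emb_Cons)
    next
      case (Cons x a')
      have "sorted a" using ab(2) Cons.prems(2) by (auto simp: subseq_conv_nths intro: sorted_nths)
      then have "a' = []" using Cons Cons.prems(1) ab(1) by (cases a') auto
      moreover have "x \<in> set (g k)" using ab(2) Cons by (metis list.set_intros(1) notin_set_nthsI subseq_conv_nths)
      ultimately show ?thesis using js ab(1) Cons by (intro exI[of _ "k # js"]) auto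
    qed
  next
    assume "\<exists>js. subseq js (k # ks) \<and> list_all2 (\<lambda>c j. c \<in> set (g j)) s js"
    then obtain js where js: "subseq js (k # ks)" "list_all2 (\<lambda>c j. c \<in> set (g j)) s js" by blast
    show "subseq s (concat (map g (k # ks)))"
    proof (cases "subseq js ks")
      case True
      then have "subseq s (concat (map g ks))" using Cons.IH[OF Cons.prems(1) srt] js(2) by blast
      then show ?thesis by (simp add: subseq_drop_many)
    next
      case False
      then obtain js' where j: "js = k # js'" "subseq js' ks" using js(1) by (cases js) (auto split: if_splits)
      then obtain c s' where s: "s = c # s'" "c \<in> set (g k)" "list_all2 (\<lambda>c j. c \<in> set (g j)) s' js'"
        using js(2) by (auto simp: list_all2_Cons2)
      then have "subseq s' (concat (map g ks))" using Cons.IH[OF _ srt, of s'] Cons.prems(1) j(2) by auto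
      moreover have "subseq [c] (g k)" using s(2) by (simp add: subseq_singleton_left)
      ultimately show ?thesis using list_emb_append_mono[of "(=)" "[c]" "g k" s'] s(1) by simp
    qed
  qed
qed (auto dest: list_emb_length)

text \<open>Chains of either kind, as sets of boxes whose rows are read in the order of \<open>pos\<close>.\<close>

definition descending :: "(int \<Rightarrow> int) \<Rightarrow> box set \<Rightarrow> bool" where
  "descending pos X \<longleftrightarrow> (\<forall>b\<in>X. \<forall>c\<in>X. b \<noteq> c \<longrightarrow>
     (fst c < fst b \<and> pos (snd b) < pos (snd c)) \<or> (fst b < fst c \<and> pos (snd c) < pos (snd b)))"

text \<open>Decreasing subsequences of a word made of weakly increasing rows are chains of boxes, a box being a letter together with its row.\<close>

lemma has_dec_rows:
  assumes g: "\<And>j. j \<in> set ks \<Longrightarrow> sorted (g j)" and ks: "sorted_wrt (\<lambda>i j. pos i < pos j) ks"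
  shows "has_dec (concat (map g ks)) m \<longleftrightarrow>
    (\<exists>X. X \<subseteq> {(int c, j) |c j. j \<in> set ks \<and> c \<in> set (g j)} \<and> descending pos X \<and> card X = m)"
proof
  assume "has_dec (concat (map g ks)) m"
  then obtain s where s: "subseq s (concat (map g ks))" "sorted_wrt (>) s" "length s = m" by (auto simp: has_dec_def)
  have "\<exists>js. subseq js ks \<and> list_all2 (\<lambda>c j. c \<in> set (g j)) s js"
    using dec_subseq_rows[of ks g s, OF g s(2)] s(1) by simp
  then obtain js where js: "subseq js ks" "list_all2 (\<lambda>c j. c \<in> set (g j)) s js" by blast
  have l: "length js = length s" using js(2) by (simp add: list_all2_lengthD)
  have dj: "sorted_wrt (\<lambda>i j. pos i < pos j) js" by (rule sorted_wrt_subseq[OF js(1) ks])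
  define h where "h = (\<lambda>r. (int (s ! r), js ! r))"
  have desc: "fst (h r') < fst (h r) \<and> pos (snd (h r)) < pos (snd (h r'))" if "r < r'" "r' < m" for r r'
    using sorted_wrt_nth_less[OF s(2), of r r'] sorted_wrt_nth_less[OF dj, of r r'] that l s(3) by (simp add: h_def)
  have "inj_on h {..<m}"
  proof (rule inj_onI)
    fix r r' assume h: "r \<in> {..<m}" "r' \<in> {..<m}" "h r = h r'"
    then show "r = r'" using desc[of r r'] desc[of r' r] by (cases r r' rule: linorder_cases) auto
  qed
  then have "card (h ` {..<m}) = m" by (simp add: card_image)
  moreover have "descending pos (h ` {..<m})" unfolding descending_def
  proof (intro ballI impI)
    fix b c assume "b \<in> h ` {..<m}" "c \<in> h ` {..<m}" "b \<noteq> c"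
    then obtain r r' where r: "r < m" "r' < m" "b = h r" "c = h r'" "r \<noteq> r'" by blast
    then show "(fst c < fst b \<and> pos (snd b) < pos (snd c)) \<or> (fst b < fst c \<and> pos (snd c) < pos (snd b))"
      using desc[of r r'] desc[of r' r] by (cases r r' rule: linorder_cases) auto
  qed
  moreover have "h ` {..<m} \<subseteq> {(int c, j) |c j. j \<in> set ks \<and> c \<in> set (g j)}"
  proof (rule image_subsetI)
    fix r assume "r \<in> {..<m}"
    then have "r < length js" "s ! r \<in> set (g (js ! r))" using js(2) s(3) l by (auto simp: list_all2_conv_all_nth)
    moreover have "set js \<subseteq> set ks" using js(1) by (auto dest: list_emb_set)
    ultimately show "h r \<in> {(int c, j) |c j. j \<in> set ks \<and> c \<in> set (g j)}" using nth_mem by (fastforce simp: h_def)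
  qed
  ultimately show "\<exists>X. X \<subseteq> {(int c, j) |c j. j \<in> set ks \<and> c \<in> set (g j)} \<and> descending pos X \<and> card X = m" by blast
next
  assume "\<exists>X. X \<subseteq> {(int c, j) |c j. j \<in> set ks \<and> c \<in> set (g j)} \<and> descending pos X \<and> card X = m"
  then obtain X where X: "X \<subseteq> {(int c, j) |c j. j \<in> set ks \<and> c \<in> set (g j)}" "descending pos X" "card X = m" by blast
  have inj: "inj_on snd X"
  proof (rule inj_onI, rule ccontr)
    fix b c assume "b \<in> X" "c \<in> X" "snd b = snd c" "b \<noteq> c"
    then show False using X(2) unfolding descending_def by fastforce
  qed
  define js where "js = filter (\<lambda>j. j \<in> snd ` X) ks"
  define col where "col = (\<lambda>j. nat (fst (the_inv_into X snd j)))"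
  have col: "(int (col j), j) \<in> X" "col j \<in> set (g j)" if j: "j \<in> set js" for j
  proof -
    obtain b where b: "b \<in> X" "j = snd b" using j by (auto simp: js_def)
    then have "the_inv_into X snd j = b" using the_inv_into_f_f[OF inj] by simp
    moreover obtain c where "b = (int c, j)" "c \<in> set (g j)" using X(1) b by auto
    ultimately show "(int (col j), j) \<in> X" "col j \<in> set (g j)" using b(1) by (simp_all add: col_def)
  qed
  have dj: "sorted_wrt (\<lambda>i j. pos i < pos j) js" unfolding js_def using ks by (rule sorted_wrt_filter)
  have "sorted_wrt (>) (map col js)" unfolding sorted_wrt_map
  proof (rule sorted_wrt_mono_rel[OF _ dj])
    fix i j assume ij: "i \<in> set js" "j \<in> set js" "pos i < pos j"
    have "(int (col i), i) \<noteq> (int (col j), j)" using ij(3) by auto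
    then show "col j < col i" using X(2) col(1)[OF ij(1)] col(1)[OF ij(2)] ij(3) unfolding descending_def by fastforce
  qed
  moreover have "list_all2 (\<lambda>c j. c \<in> set (g j)) (map col js) js"
    using col(2) by (auto simp: list_all2_conv_all_nth)
  moreover have "subseq js ks" by (simp add: js_def)
  ultimately have "subseq (map col js) (concat (map g ks))" "sorted_wrt (>) (map col js)"
    using dec_subseq_rows[of ks g "map col js", OF g] by (metis, metis)
  moreover have "length (map col js) = m"
  proof -
    have "sorted_wrt (<) (map pos ks)" using ks by (simp add: sorted_wrt_map)
    then have "distinct ks" by (simp add: strict_sorted_iff distinct_map)
    then have "length js = card (set js)" unfolding js_def by (metis distinct_card distinct_filter)
    also have "set js = snd ` X" using X(1) by (auto simp: js_def)
    also have "card (snd ` X) = m" using card_image[OF inj] X(3) by simp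
    finally show ?thesis by simp
  qed
  ultimately show "has_dec (concat (map g ks)) m" unfolding has_dec_def by blast
qed

subsection \<open>The words of a filling\<close>

text \<open>The symmetric filling determined by its entries in \<^term>\<open>reps n\<close>.\<close>

definition reflect :: "nat \<Rightarrow> (box \<Rightarrow> nat) \<Rightarrow> box \<Rightarrow> nat" where
  "reflect n f b = (if b \<in> nesting_polyomino n then f (if b \<in> reps n then b else mirror b) else 0)"

text \<open>The rows labelled \<open>- n, \<dots>, -1\<close> of the symmetric filling determined by \<open>f\<close>. Symmetry about the main
diagonal of the polyomino is symmetry about the antidiagonal of this matrix.\<close>

definition square_part :: "nat \<Rightarrow> (box \<Rightarrow> nat) \<Rightarrow> nat \<Rightarrow> nat \<Rightarrow> nat" where
  "square_part n f r c = (if r \<in> {1..n} then reflect n f (int c, int r - (int n + 1)) else 0)"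

text \<open>The rows with positive labels, the row labelled \<open>e + 1\<close> being stage \<open>e\<close>.\<close>

definition triangle_part :: "(box \<Rightarrow> nat) \<Rightarrow> nat \<Rightarrow> nat \<Rightarrow> nat" where
  "triangle_part f e i = f (int i, int e + 1)"

lemma reflect_support: "{b. f b \<noteq> 0} \<subseteq> reps n \<Longrightarrow> {b. reflect n f b \<noteq> 0} = closure {b. f b \<noteq> 0}"
  using closure_subset[of "{b. f b \<noteq> 0}" n] in_closure_iff[of "{b. f b \<noteq> 0}" n]
  by (auto simp: reflect_def split: if_splits)

definition row_letters :: "nat \<Rightarrow> (box \<Rightarrow> nat) \<Rightarrow> int \<Rightarrow> nat list" where
  "row_letters n f j = (if 0 < j then row_list (nat j - 1) (triangle_part f (nat j - 1))
     else row_list n (square_part n f (nat (int n + 1 + j))))"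

lemma set_row_list_iff: "c \<in> set (row_list N x) \<longleftrightarrow> c \<in> {1..N} \<and> x c \<noteq> 0"
  by (auto simp: row_list_def)

lemma set_row_letters:
  assumes f: "{b. f b \<noteq> 0} \<subseteq> reps n" and j: "j \<in> vertices n"
  shows "c \<in> set (row_letters n f j) \<longleftrightarrow> reflect n f (int c, j) \<noteq> 0"
proof (cases "0 < j")
  case True
  then have "(int c, int (nat j - 1) + 1) = (int c, j)" by simp
  moreover have "(int c, j) \<in> reps n \<longleftrightarrow> (int c, j) \<in> nesting_polyomino n" using True by (simp add: reps_def)
  moreover have "(int c, j) \<in> nesting_polyomino n \<longleftrightarrow> c \<in> {1..nat j - 1}" using True j by (auto simp: nesting_box_iff vertices_def)
  ultimately show ?thesis using True by (auto simp: row_letters_def set_row_list_iff triangle_part_def reflect_def)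
next
  case False
  then have "nat (int n + 1 + j) \<in> {1..n}" "int (nat (int n + 1 + j)) - (int n + 1) = j" using j by (auto simp: vertices_def)
  moreover have "(int c, j) \<in> nesting_polyomino n \<longleftrightarrow> c \<in> {1..n}" using False j by (auto simp: nesting_box_iff vertices_def)
  ultimately show ?thesis using False by (auto simp: row_letters_def set_row_list_iff square_part_def reflect_def)
qed

definition late_rows :: "nat \<Rightarrow> nat \<Rightarrow> int list" where
  "late_rows n e = map int [Suc e..<Suc n]"

definition square_rows :: "nat \<Rightarrow> int list" where
  "square_rows n = map (\<lambda>r. int r - (int n + 1)) [1..<Suc n]"

lemma mword_square_part: "mword n (square_part n f) n = concat (map (row_letters n f) (square_rows n))"
proof -
  have "map (\<lambda>r. row_letters n f (int r - (int n + 1))) [1..<Suc n] = map (\<lambda>r. row_list n (square_part n f r)) [1..<Suc n]"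
    by (rule map_cong[OF refl]) (auto simp: row_letters_def)
  then show ?thesis by (simp only: mword_def square_rows_def map_map comp_def)
qed

lemma row_of_row_list: "row_of (mset (row_list N x)) = row_list N x"
  by (simp add: sorted_row_list sorted_sort_id)

lemma row_letters_late: "row_letters n f (int (Suc e)) = row_list e (triangle_part f e)"
  by (simp add: row_letters_def del: of_nat_Suc)

lemma late_rows_less: "e < n \<Longrightarrow> late_rows n e = int (Suc e) # late_rows n (Suc e)"
  by (simp add: late_rows_def upt_conv_Cons del: upt_Suc)

lemma late_rows_top: "late_rows n n = []"
  by (simp add: late_rows_def)

lemma stage_word_rows:
  assumes "e \<le> n"
  shows "stage_word prepend_row n (mword n (square_part n f) n) (triangle_part f) e =
           concat (map (row_letters n f) (late_rows n e @ square_rows n))" (is ?L)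
    and "stage_word append_row n (mword n (square_part n f) n) (triangle_part f) e =
           concat (map (row_letters n f) (square_rows n @ rev (late_rows n e)))" (is ?R)
proof -
  have "?L \<and> ?R" using assms
  proof (induction e rule: inc_induct)
    case base
    show ?case by (simp add: stage_word_top mword_square_part late_rows_top)
  next
    case (step e)
    then show ?case
      by (simp add: stage_word_less prepend_row_def append_row_def row_of_row_list late_rows_less row_letters_late del: of_nat_Suc sorted_list_of_multiset_mset)
  qed
  then show ?L ?R by blast+
qed

lemma set_rows: "e \<le> n \<Longrightarrow> set (late_rows n e @ square_rows n) = {j \<in> vertices n. j < 0 \<or> int e < j}"
proof -
  assume "e \<le> n"
  have "j \<in> set (late_rows n e) \<longleftrightarrow> int e < j \<and> j \<le> int n" for j
  proof -
    have "set (late_rows n e) = int ` {Suc e..n}" by (simp add: late_rows_def atLeastLessThanSuc_atLeastAtMost del: upt_Suc)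
    then show ?thesis by (simp add: image_int_atLeastAtMost Suc_le_eq del: of_nat_Suc) auto
  qed
  moreover have "j \<in> set (square_rows n) \<longleftrightarrow> - int n \<le> j \<and> j < 0" for j
  proof -
    have "set (square_rows n) = (\<lambda>j. j - (int n + 1)) ` (int ` {1..n})"
      by (simp add: square_rows_def image_image atLeastLessThanSuc_atLeastAtMost del: upt_Suc)
    also have "\<dots> = {- int n..-1}" by (simp add: image_int_atLeastAtMost image_minus_const_atLeastAtMost' del: image_image)
    finally show ?thesis by auto
  qed
  ultimately show ?thesis by (auto simp: vertices_def)
qed

lemma late_rows_sorted: "sorted_wrt (<) (late_rows n e)"
  unfolding late_rows_def sorted_wrt_map by (rule sorted_wrt_mono_rel[OF _ sorted_wrt_upt]) simp

lemma square_rows_sorted: "sorted_wrt (<) (square_rows n)"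
  unfolding square_rows_def sorted_wrt_map by (rule sorted_wrt_mono_rel[OF _ sorted_wrt_upt]) simp

lemma late_rows_pos: "j \<in> set (late_rows n e) \<Longrightarrow> 0 < j \<and> j \<le> int n"
  by (auto simp: late_rows_def)

lemma square_rows_neg: "j \<in> set (square_rows n) \<Longrightarrow> - int n \<le> j \<and> j < 0"
  by (auto simp: square_rows_def)

lemma nesting_rows_sorted: "sorted_wrt (\<lambda>i j. nesting_pos n i < nesting_pos n j) (late_rows n e @ square_rows n)"
  unfolding sorted_wrt_append
proof (intro conjI ballI)
  show "sorted_wrt (\<lambda>i j. nesting_pos n i < nesting_pos n j) (late_rows n e)"
    by (rule sorted_wrt_mono_rel[OF _ late_rows_sorted]) (auto dest!: late_rows_pos simp: nesting_pos_def)
  show "sorted_wrt (\<lambda>i j. nesting_pos n i < nesting_pos n j) (square_rows n)"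
    by (rule sorted_wrt_mono_rel[OF _ square_rows_sorted]) (auto dest!: square_rows_neg simp: nesting_pos_def)
qed (auto dest!: late_rows_pos square_rows_neg simp: nesting_pos_def)

lemma crossing_rows_sorted:
  "sorted_wrt (\<lambda>i j. - crossing_pos n i < - crossing_pos n j) (square_rows n @ rev (late_rows n e))"
  unfolding sorted_wrt_append sorted_wrt_rev
proof (intro conjI ballI)
  show "sorted_wrt (\<lambda>i j. - crossing_pos n j < - crossing_pos n i) (late_rows n e)"
    by (rule sorted_wrt_mono_rel[OF _ late_rows_sorted]) (auto dest!: late_rows_pos simp: crossing_pos_def)
  show "sorted_wrt (\<lambda>i j. - crossing_pos n i < - crossing_pos n j) (square_rows n)"
    by (rule sorted_wrt_mono_rel[OF _ square_rows_sorted]) (auto dest!: square_rows_neg simp: crossing_pos_def)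
qed (auto dest!: late_rows_pos square_rows_neg simp: crossing_pos_def)

text \<open>The boxes that occur in the word at stage \<open>e\<close> cut to the letters up to \<open>e\<close>.\<close>

definition fits :: "nat \<Rightarrow> box set \<Rightarrow> bool" where
  "fits e X \<longleftrightarrow> (\<forall>b\<in>X. fst b \<le> int e \<and> (snd b < 0 \<or> int e < snd b))"

lemma ne_set_descending: "ne_set n X \<longleftrightarrow> descending (nesting_pos n) X"
  unfolding ne_set_def descending_def nested_def by blast

lemma se_set_descending:
  "se_set n X \<longleftrightarrow> descending (\<lambda>j. - crossing_pos n j) X \<and> (\<forall>b\<in>X. \<forall>c\<in>X. fst b < crossing_pos n (snd c))"
  unfolding se_set_def descending_def by auto

text \<open>The largest column \<open>e\<close> of a chain fixes the stage at which the chain can be seen: its box with this column is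
the topmost one, and lies below the row labelled \<open>e\<close>.\<close>

lemma fits_nesting:
  assumes X: "X \<subseteq> nesting_polyomino n" "ne_set n X" "finite X" "X \<noteq> {}"
  shows "\<exists>e\<le>n. fits e X"
proof -
  have "Max (fst ` X) \<in> fst ` X" using X(3,4) by simp
  then obtain m where m: "m \<in> X" "fst m = Max (fst ` X)" by auto
  have P: "m \<in> nesting_polyomino n" using m(1) X(1) by blast
  have "fst b \<le> fst m \<and> (snd b < 0 \<or> fst m < snd b)" if b: "b \<in> X" for b
  proof -
    have 1: "fst b \<le> fst m" using b m(2) X(3) by simp
    have bP: "b \<in> nesting_polyomino n" using b X(1) by blast
    show ?thesis
    proof (cases "b = m")
      case True
      then show ?thesis using P by (auto simp: nesting_box_iff)
    next
      case False
      then have "nested n b m" using X(2) b m(1) 1 unfolding ne_set_def nested_def by fastforce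
      then show ?thesis using nesting_pos_range[OF P] 1 bP by (auto simp: nested_def nesting_pos_def nesting_box_iff split: if_splits)
    qed
  qed
  then have "fits (nat (fst m)) X" using P by (simp add: fits_def nesting_box_iff)
  then show ?thesis using P by (intro exI[of _ "nat (fst m)"]) (simp add: nesting_box_iff nat_le_iff)
qed

text \<open>For south-east chains it is the rectangle condition that puts all rows beyond the largest column.\<close>

lemma fits_crossing:
  assumes X: "X \<subseteq> nesting_polyomino n" "se_set n X" "finite X" "X \<noteq> {}"
  shows "\<exists>e\<le>n. fits e X"
proof -
  have "Max (fst ` X) \<in> fst ` X" using X(3,4) by simp
  then obtain m where m: "m \<in> X" "fst m = Max (fst ` X)" by auto
  have P: "m \<in> nesting_polyomino n" using m(1) X(1) by blast
  have "fst b \<le> fst m \<and> (snd b < 0 \<or> fst m < snd b)" if b: "b \<in> X" for b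
  proof -
    have 1: "fst b \<le> fst m" using b m(2) X(3) by simp
    have bP: "b \<in> nesting_polyomino n" using b X(1) by blast
    have "fst m < crossing_pos n (snd b)" using X(2) b m(1) unfolding se_set_def by blast
    then show ?thesis using 1 bP by (auto simp: crossing_pos_def nesting_box_iff split: if_splits)
  qed
  then have "fits (nat (fst m)) X" using P by (simp add: fits_def nesting_box_iff)
  then show ?thesis using P by (intro exI[of _ "nat (fst m)"]) (simp add: nesting_box_iff nat_le_iff)
qed

lemma fits_rectangle:
  assumes "fits e X" "X \<subseteq> nesting_polyomino n" "b \<in> X" "c \<in> X"
  shows "fst b < crossing_pos n (snd c)"
proof -
  have "c \<in> nesting_polyomino n" "b \<in> nesting_polyomino n" using assms by blast+
  moreover have "fst b \<le> int e" "snd c < 0 \<or> int e < snd c" using assms(1,3,4) unfolding fits_def by blast+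
  ultimately show ?thesis by (auto simp: crossing_pos_def nesting_box_iff)
qed

lemma truncated_word_chain:
  assumes f: "{b. f b \<noteq> 0} \<subseteq> reps n" and ks: "set ks = {j \<in> vertices n. j < 0 \<or> int e < j}"
    "sorted_wrt (\<lambda>i j. pos i < pos j) ks"
  shows "has_dec (letters_le e (concat (map (row_letters n f) ks))) m \<longleftrightarrow>
    (\<exists>X. X \<subseteq> closure {b. f b \<noteq> 0} \<and> fits e X \<and> descending pos X \<and> card X = m)"
proof -
  let ?g = "\<lambda>j. letters_le e (row_letters n f j)"
  have sub: "closure {b. f b \<noteq> 0} \<subseteq> nesting_polyomino n" by (rule closure_subset[OF f])
  have 1: "letters_le e (concat (map (row_letters n f) ks)) = concat (map ?g ks)" by (simp add: filter_concat comp_def)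
  have "{(int c, j) |c j. j \<in> set ks \<and> c \<in> set (?g j)} = {b \<in> closure {b. f b \<noteq> 0}. fst b \<le> int e \<and> (snd b < 0 \<or> int e < snd b)}"
    (is "?A = ?B")
  proof (intro equalityI subsetI)
    fix b assume "b \<in> ?A"
    then obtain c j where b: "b = (int c, j)" "j \<in> set ks" "c \<in> set (row_letters n f j)" "c \<le> e" by auto
    then have "reflect n f b \<noteq> 0" using set_row_letters[OF f, of j c] ks(1) by simp
    then show "b \<in> ?B" using reflect_support[OF f] b ks(1) by auto
  next
    fix b assume b: "b \<in> ?B"
    obtain i j where ij: "b = (i, j)" by (cases b)
    have P: "b \<in> nesting_polyomino n" using b sub by blast
    then have i: "i = int (nat i)" and j: "j \<in> vertices n" unfolding ij by (auto simp: nesting_box_iff vertices_def)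
    have "reflect n f (int (nat i), j) \<noteq> 0" using reflect_support[OF f] b ij i by auto
    then have "nat i \<in> set (row_letters n f j)" using set_row_letters[OF f j] by blast
    then have "j \<in> set ks \<and> nat i \<in> set (?g j)" using b j ij ks(1) by auto
    then show "b \<in> ?A" using i ij by blast
  qed
  moreover have "sorted (?g j)" for j by (rule sorted_wrt_filter) (simp add: row_letters_def sorted_row_list)
  ultimately have "has_dec (concat (map ?g ks)) m \<longleftrightarrow> (\<exists>X. X \<subseteq> ?B \<and> descending pos X \<and> card X = m)"
    using has_dec_rows[of ks ?g pos m, OF _ ks(2)] by simp
  also have "\<dots> \<longleftrightarrow> (\<exists>X. X \<subseteq> closure {b. f b \<noteq> 0} \<and> fits e X \<and> descending pos X \<and> card X = m)"
    by (rule arg_cong[of _ _ Ex]) (auto simp: fits_def)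
  finally show ?thesis unfolding 1 .
qed

text \<open>A common form of the two translations: the words at all stages avoid decreasing subsequences of more than \<open>k\<close> letters iff the symmetric
set has no chain of more than \<open>k\<close> boxes, provided each chain of the given kind can be seen at some stage.\<close>

lemma word_condition:
  assumes f: "{b. f b \<noteq> 0} \<subseteq> reps n"
    and w: "\<And>e. e \<le> n \<Longrightarrow> w e = concat (map (row_letters n f) (ks e)) \<and>
       set (ks e) = {j \<in> vertices n. j < 0 \<or> int e < j} \<and> sorted_wrt (\<lambda>i j. pos i < pos j) (ks e)"
    and C: "\<And>X. X \<subseteq> nesting_polyomino n \<Longrightarrow> C X \<Longrightarrow> descending pos X"
      "\<And>X. X \<subseteq> nesting_polyomino n \<Longrightarrow> C X \<Longrightarrow> finite X \<Longrightarrow> X \<noteq> {} \<Longrightarrow> \<exists>e\<le>n. fits e X"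
      "\<And>X e. X \<subseteq> nesting_polyomino n \<Longrightarrow> descending pos X \<Longrightarrow> fits e X \<Longrightarrow> C X"
  shows "(\<forall>e\<le>n. \<not> has_dec (letters_le e (w e)) (Suc k)) \<longleftrightarrow> (\<forall>X. X \<subseteq> closure {b. f b \<noteq> 0} \<longrightarrow> C X \<longrightarrow> card X \<le> k)"
proof -
  let ?S = "closure {b. f b \<noteq> 0}"
  have sub: "?S \<subseteq> nesting_polyomino n" by (rule closure_subset[OF f])
  have key: "has_dec (letters_le e (w e)) m \<longleftrightarrow> (\<exists>X. X \<subseteq> ?S \<and> fits e X \<and> descending pos X \<and> card X = m)" if "e \<le> n" for e m
    using truncated_word_chain[OF f, of "ks e" e pos m] w[OF that] by simp
  show ?thesis
  proof (intro iffI allI impI)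
    fix X assume h: "\<forall>e\<le>n. \<not> has_dec (letters_le e (w e)) (Suc k)" and X: "X \<subseteq> ?S" "C X"
    show "card X \<le> k"
    proof (rule ccontr)
      assume "\<not> card X \<le> k"
      then have card: "Suc k \<le> card X" by simp
      have fin: "finite X" using X(1) sub finite_nesting_polyomino[of n] by (meson finite_subset)
      have P: "X \<subseteq> nesting_polyomino n" using X(1) sub by blast
      obtain Y where Y: "Y \<subseteq> X" "card Y = Suc k" using card obtain_subset_with_card_n by metis
      obtain e where e: "e \<le> n" "fits e X" using C(2)[OF P X(2) fin] card by fastforce
      have "fits e Y" "descending pos Y" using e(2) C(1)[OF P X(2)] Y(1) unfolding fits_def descending_def by blast+
      then have "has_dec (letters_le e (w e)) (Suc k)" using key[OF e(1)] Y X(1) by blast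
      then show False using h e(1) by blast
    qed
  next
    fix e assume h: "\<forall>X. X \<subseteq> ?S \<longrightarrow> C X \<longrightarrow> card X \<le> k" and e: "e \<le> n"
    show "\<not> has_dec (letters_le e (w e)) (Suc k)"
    proof
      assume "has_dec (letters_le e (w e)) (Suc k)"
      then obtain X where X: "X \<subseteq> ?S" "fits e X" "descending pos X" "card X = Suc k" using key[OF e] by blast
      have "C X" using C(3)[OF _ X(3,2)] X(1) sub by blast
      then have "card X \<le> k" using h X(1) by blast
      then show False using X(4) by simp
    qed
  qed
qed

subsection \<open>Encoding fillings\<close>

definition encode :: "nat \<Rightarrow> (box \<Rightarrow> nat) \<Rightarrow> (nat \<Rightarrow> nat \<Rightarrow> nat) \<times> (nat \<Rightarrow> nat \<Rightarrow> nat)" where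
  "encode n f = (square_part n f, triangle_part f)"

definition decode :: "nat \<Rightarrow> (nat \<Rightarrow> nat \<Rightarrow> nat) \<times> (nat \<Rightarrow> nat \<Rightarrow> nat) \<Rightarrow> box \<Rightarrow> nat" where
  "decode n = (\<lambda>(A, U) (i, j). if (i, j) \<in> reps n then
     (if 0 < j then U (nat j - 1) (nat i) else A (nat (int n + 1 + j)) (nat i)) else 0)"

lemma reflect_mirror: "b \<in> nesting_polyomino n \<Longrightarrow> reflect n f (mirror b) = reflect n f b"
  using mirror_in[of b n] mirror_mirror[of b n] mirror_reps[of b n] not_reps_mirror[of b n]
  by (auto simp: reflect_def)

lemma decode_encode:
  assumes f: "{b. f b \<noteq> 0} \<subseteq> reps n"
  shows "decode n (encode n f) = f"
proof
  fix b :: box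
  obtain i j where b: "b = (i, j)" by (cases b)
  show "decode n (encode n f) b = f b"
  proof (cases "b \<in> reps n")
    case True
    then have P: "(i, j) \<in> nesting_polyomino n" "(i, j) \<in> reps n" by (auto simp: reps_def b)
    show ?thesis
    proof (cases "0 < j")
      case True
      then have "int (nat i) = i" "int (nat j - 1) + 1 = j" using P by (auto simp: nesting_box_iff)
      then show ?thesis using True P by (simp add: b decode_def encode_def triangle_part_def)
    next
      case False
      then have "int (nat i) = i" "int (nat (int n + 1 + j)) - (int n + 1) = j" "nat (int n + 1 + j) \<in> {1..n}"
        using P by (auto simp: nesting_box_iff)
      then show ?thesis using False P by (simp add: b decode_def encode_def square_part_def reflect_def)
    qed
  next
    case False
    then show ?thesis using f by (auto simp: b decode_def encode_def)
  qed
qed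

lemma encode_decode:
  assumes A: "persymmetric n A" and U: "triangular n 0 U"
  shows "encode n (decode n (A, U)) = (A, U)"
proof -
  let ?g = "decode n (A, U)"
  have sq: "A r c = 0" if "\<not> (r \<in> {1..n} \<and> c \<in> {1..n})" for r c using A that unfolding persymmetric_def square_def by blast
  have sym: "A r c = A (Suc n - c) (Suc n - r)" for r c
    using A unfolding persymmetric_def by (metis rot_def)
  have "square_part n ?g r c = A r c" for r c
  proof (cases "r \<in> {1..n} \<and> c \<in> {1..n}")
    case True
    then have r: "r \<in> {1..n}" and c: "c \<in> {1..n}" by blast+
    let ?b = "(int c, int r - (int n + 1))"
    have P: "?b \<in> nesting_polyomino n" using r c by (auto simp: nesting_box_iff)
    have neg: "int r - (int n + 1) < 0" using r by simp
    have 1: "square_part n ?g r c = ?g (if ?b \<in> reps n then ?b else mirror ?b)"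
      using r P by (simp add: square_part_def reflect_def)
    show ?thesis
    proof (cases "?b \<in> reps n")
      case True
      then show ?thesis using 1 neg by (simp add: decode_def)
    next
      case False
      have m: "mirror ?b = (int n + 1 - int r, - int c)" using neg by simp
      have "(int n + 1 - int r, - int c) \<in> reps n" using not_reps_mirror[OF P False] m by simp
      moreover have "nat (int n + 1 + - int c) = Suc n - c" "nat (int n + 1 - int r) = Suc n - r" using r c by auto
      ultimately show ?thesis using 1 False m sym[of r c] c by (simp add: decode_def)
    qed
  next
    case False
    then have "square_part n ?g r c = 0" by (auto simp: square_part_def reflect_def nesting_box_iff)
    then show ?thesis using sq False by simp
  qed
  moreover have "triangle_part ?g e i = U e i" for e i
  proof (cases "e < n \<and> i \<in> {1..e}")
    case True
    then have "(int i, int e + 1) \<in> reps n" by (auto simp: reps_def nesting_box_iff)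
    moreover have "nat (int e + 1) - 1 = e" by simp
    ultimately show ?thesis by (simp add: triangle_part_def decode_def)
  next
    case False
    then have "(int i, int e + 1) \<notin> reps n" by (auto simp: reps_def nesting_box_iff)
    moreover have "U e i = 0" using U False unfolding triangular_def by blast
    ultimately show ?thesis by (simp add: triangle_part_def decode_def)
  qed
  ultimately show ?thesis by (simp add: encode_def fun_eq_iff)
qed

lemma encode_in:
  assumes f: "{b. f b \<noteq> 0} \<subseteq> reps n"
  shows "persymmetric n (square_part n f)" "triangular n 0 (triangle_part f)"
proof -
  have "square_part n f r c = square_part n f (Suc n - c) (Suc n - r)" for r c
  proof (cases "r \<in> {1..n} \<and> c \<in> {1..n}")
    case True
    let ?b = "(int c, int r - (int n + 1))"
    have P: "?b \<in> nesting_polyomino n" using True by (auto simp: nesting_box_iff)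
    have "mirror ?b = (int (Suc n - r), int (Suc n - c) - (int n + 1))" using True by auto
    then show ?thesis using reflect_mirror[OF P, of f] True by (auto simp: square_part_def)
  next
    case False
    then have "square_part n f r c = 0" by (auto simp: square_part_def reflect_def nesting_box_iff)
    moreover have "\<not> (Suc n - c \<in> {1..n} \<and> Suc n - r \<in> {1..n})" using False by auto
    then have "square_part n f (Suc n - c) (Suc n - r) = 0"
      by (auto simp: square_part_def reflect_def nesting_box_iff)
    ultimately show ?thesis by simp
  qed
  moreover have "square n (square_part n f)" unfolding square_def
    by (auto simp: square_part_def reflect_def nesting_box_iff split: if_splits)
  ultimately show "persymmetric n (square_part n f)" unfolding persymmetric_def by (simp add: fun_eq_iff rot_def)
  show "triangular n 0 (triangle_part f)" unfolding triangular_def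
  proof (intro allI impI)
    fix e i assume "triangle_part f e i \<noteq> 0"
    then have "(int i, int e + 1) \<in> reps n" using f by (auto simp: triangle_part_def)
    then show "0 \<le> e \<and> e < n \<and> i \<in> {1..e}" by (auto simp: reps_def nesting_box_iff)
  qed
qed

text \<open>An entry off the diagonal in a negative row appears twice in the square part; entries in positive rows are counted twice by definition.\<close>

lemma encode_weight:
  assumes f: "{b. f b \<noteq> 0} \<subseteq> reps n"
  shows "word_fillings_weight n (encode n f) = (\<Sum>b\<in>reps n. box_weight (main_diagonal n) b * f b)"
proof -
  let ?N = "{b \<in> nesting_polyomino n. snd b < 0}" and ?D = "main_diagonal n"
  let ?NR = "{b \<in> reps n. snd b < 0}" and ?Pos = "{b \<in> reps n. 0 < snd b}"
  have fin: "finite ?N" "finite ?NR" "finite ?Pos" using finite_nesting_polyomino[of n] finite_reps[of n] by simp_all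
  have "(\<Sum>r\<in>{1..n}. \<Sum>c\<in>{1..n}. square_part n f r c) = (\<Sum>(r, c)\<in>{1..n} \<times> {1..n}. square_part n f r c)"
    by (rule sum.cartesian_product)
  also have "\<dots> = (\<Sum>b\<in>?N. reflect n f b)"
    by (rule sum.reindex_bij_witness[of _ "\<lambda>b. (nat (snd b + (int n + 1)), nat (fst b))" "\<lambda>(r, c). (int c, int r - (int n + 1))"])
       (auto simp: nesting_box_iff square_part_def)
  also have "\<dots> = (\<Sum>b\<in>?NR. reflect n f b) + (\<Sum>b\<in>?N - ?NR. reflect n f b)"
    by (subst add.commute, rule sum.subset_diff) (use fin in \<open>auto simp: reps_def\<close>)
  also have "(\<Sum>b\<in>?NR. reflect n f b) = (\<Sum>b\<in>?NR. f b)"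
    by (rule sum.cong[OF refl]) (auto simp: reflect_def reps_def)
  also have "(\<Sum>b\<in>?N - ?NR. reflect n f b) = (\<Sum>b\<in>{b \<in> ?NR. b \<notin> ?D}. f b)"
  proof (rule sum.reindex_bij_witness[of _ mirror mirror])
    fix b assume b: "b \<in> ?N - ?NR"
    then have nr: "b \<in> nesting_polyomino n" "b \<notin> reps n" "snd b < 0" by auto
    show "mirror (mirror b) = b" by (rule mirror_mirror[OF nr(1)])
    have "mirror b \<notin> ?D" using nr by (cases b) (auto simp: main_diagonal_def reps_def)
    moreover have "snd (mirror b) < 0" using nr by (cases b) (auto simp: nesting_box_iff)
    ultimately show "mirror b \<in> {b \<in> ?NR. b \<notin> ?D}" using not_reps_mirror[OF nr(1,2)] by simp
    show "f (mirror b) = reflect n f b" using nr by (simp add: reflect_def)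
  next
    fix b assume b: "b \<in> {b \<in> ?NR. b \<notin> ?D}"
    then have r: "b \<in> nesting_polyomino n" "b \<in> reps n" "snd b < 0" "b \<notin> ?D" by (auto simp: reps_def)
    show "mirror (mirror b) = b" by (rule mirror_mirror[OF r(1)])
    have "mirror b \<noteq> b" using r by (cases b) (auto simp: main_diagonal_def nesting_box_iff)
    then have "mirror b \<notin> reps n" using mirror_reps[OF r(2)] by blast
    moreover have "snd (mirror b) < 0" using r by (cases b) (auto simp: nesting_box_iff)
    ultimately show "mirror b \<in> ?N - ?NR" using mirror_in[OF r(1)] by simp
  qed
  finally have 1: "(\<Sum>r\<in>{1..n}. \<Sum>c\<in>{1..n}. square_part n f r c) = (\<Sum>b\<in>?NR. f b) + (\<Sum>b\<in>{b \<in> ?NR. b \<notin> ?D}. f b)" .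
  have "(\<Sum>e<n. \<Sum>i\<in>{1..e}. triangle_part f e i) = (\<Sum>(e, i)\<in>(SIGMA e:{..<n}. {1..e}). triangle_part f e i)"
    by (rule sum.Sigma) auto
  also have "\<dots> = (\<Sum>b\<in>?Pos. f b)"
    by (rule sum.reindex_bij_witness[of _ "\<lambda>b. (nat (snd b) - 1, nat (fst b))" "\<lambda>(e, i). (int i, int e + 1)"])
       (auto simp: reps_def nesting_box_iff triangle_part_def)
  finally have 2: "(\<Sum>e<n. \<Sum>i\<in>{1..e}. triangle_part f e i) = (\<Sum>b\<in>?Pos. f b)" .
  have "reps n = ?NR \<union> ?Pos" by (auto simp: reps_def nesting_box_iff)
  then have "(\<Sum>b\<in>reps n. box_weight ?D b * f b) = (\<Sum>b\<in>?NR \<union> ?Pos. box_weight ?D b * f b)" by simp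
  also have "\<dots> = (\<Sum>b\<in>?NR. box_weight ?D b * f b) + (\<Sum>b\<in>?Pos. box_weight ?D b * f b)"
    by (rule sum.union_disjoint) (use fin in auto)
  also have "(\<Sum>b\<in>?NR. box_weight ?D b * f b) = (\<Sum>b\<in>?NR. f b + (if b \<notin> ?D then f b else 0))"
    by (rule sum.cong[OF refl]) (simp add: box_weight_def)
  also have "\<dots> = (\<Sum>b\<in>?NR. f b) + (\<Sum>b\<in>{b \<in> ?NR. b \<notin> ?D}. f b)"
    using fin(2) by (simp only: sum.distrib sum.inter_filter)
  also have "(\<Sum>b\<in>?Pos. box_weight ?D b * f b) = 2 * (\<Sum>b\<in>?Pos. f b)"
    unfolding sum_distrib_left by (rule sum.cong[OF refl]) (auto simp: box_weight_def main_diagonal_def)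
  finally show ?thesis using 1 2 by (simp add: encode_def word_fillings_weight_def)
qed

lemma card_fillings_word_fillings:
  assumes "\<And>f. {b. f b \<noteq> 0} \<subseteq> reps n \<Longrightarrow>
      (\<forall>e\<le>n. \<not> has_dec (letters_le e (stage_word op n (mword n (square_part n f) n) (triangle_part f) e)) (Suc k)) \<longleftrightarrow> {b. f b \<noteq> 0} \<in> \<F>"
    and sub: "\<F> \<subseteq> Pow (reps n)"
  shows "card {f. {b. f b \<noteq> 0} \<in> \<F> \<and> (\<Sum>b\<in>reps n. box_weight (main_diagonal n) b * f b) = t} =
         card {x \<in> word_fillings op n k. word_fillings_weight n x = t}" (is "card ?L = card ?R")
proof (rule bij_betw_same_card[OF bij_betw_byWitness[where f = "encode n" and f' = "decode n"]])
  have supp: "{b. decode n x b \<noteq> 0} \<subseteq> reps n" for x by (auto simp: decode_def split: prod.splits if_splits)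
  show "\<forall>f\<in>?L. decode n (encode n f) = f" using decode_encode sub by blast
  show "\<forall>x\<in>?R. encode n (decode n x) = x" using encode_decode by (auto simp: word_fillings_def)
  show "encode n ` ?L \<subseteq> ?R"
  proof (rule image_subsetI)
    fix f assume f: "f \<in> ?L"
    then have s: "{b. f b \<noteq> 0} \<subseteq> reps n" using sub by blast
    then show "encode n f \<in> ?R" using f assms(1)[OF s] encode_in[OF s] encode_weight[OF s] by (simp add: word_fillings_def encode_def)
  qed
  show "decode n ` ?R \<subseteq> ?L"
  proof (rule image_subsetI)
    fix x assume x: "x \<in> ?R"
    obtain A U where AU: "x = (A, U)" by (cases x)
    have e: "encode n (decode n x) = x" using encode_decode[of n A U] x AU by (auto simp: word_fillings_def)
    then have "square_part n (decode n x) = A" "triangle_part (decode n x) = U" by (simp_all add: encode_def AU)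
    then have "{b. decode n x b \<noteq> 0} \<in> \<F>" using assms(1)[OF supp[of x]] x AU by (simp add: word_fillings_def)
    then show "decode n x \<in> ?L" using encode_weight[OF supp[of x]] e x by simp
  qed
qed

lemma nesting_word_condition:
  assumes f: "{b. f b \<noteq> 0} \<subseteq> reps n"
  shows "(\<forall>e\<le>n. \<not> has_dec (letters_le e (stage_word prepend_row n (mword n (square_part n f) n) (triangle_part f) e)) (Suc k)) \<longleftrightarrow>
    {b. f b \<noteq> 0} \<in> nesting_faces n k"
proof -
  have "(\<forall>e\<le>n. \<not> has_dec (letters_le e (stage_word prepend_row n (mword n (square_part n f) n) (triangle_part f) e)) (Suc k)) \<longleftrightarrow>
      (\<forall>X. X \<subseteq> closure {b. f b \<noteq> 0} \<longrightarrow> ne_set n X \<longrightarrow> card X \<le> k)"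
  proof (rule word_condition[OF f, where pos = "nesting_pos n" and ks = "\<lambda>e. late_rows n e @ square_rows n"])
    show "stage_word prepend_row n (mword n (square_part n f) n) (triangle_part f) e =
        concat (map (row_letters n f) (late_rows n e @ square_rows n)) \<and>
        set (late_rows n e @ square_rows n) = {j \<in> vertices n. j < 0 \<or> int e < j} \<and>
        sorted_wrt (\<lambda>i j. nesting_pos n i < nesting_pos n j) (late_rows n e @ square_rows n)" if "e \<le> n" for e
      using stage_word_rows(1)[OF that] set_rows[OF that] nesting_rows_sorted by blast
  qed (use ne_set_descending fits_nesting in blast)+
  then show ?thesis unfolding nesting_faces_closure using f by simp
qed

lemma crossing_word_condition:
  assumes f: "{b. f b \<noteq> 0} \<subseteq> reps n"
  shows "(\<forall>e\<le>n. \<not> has_dec (letters_le e (stage_word append_row n (mword n (square_part n f) n) (triangle_part f) e)) (Suc k)) \<longleftrightarrow>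
    {b. f b \<noteq> 0} \<in> crossing_faces n k"
proof -
  have "(\<forall>e\<le>n. \<not> has_dec (letters_le e (stage_word append_row n (mword n (square_part n f) n) (triangle_part f) e)) (Suc k)) \<longleftrightarrow>
      (\<forall>X. X \<subseteq> closure {b. f b \<noteq> 0} \<longrightarrow> se_set n X \<longrightarrow> card X \<le> k)"
  proof (rule word_condition[OF f, where pos = "\<lambda>j. - crossing_pos n j" and ks = "\<lambda>e. square_rows n @ rev (late_rows n e)"])
    show "stage_word append_row n (mword n (square_part n f) n) (triangle_part f) e =
        concat (map (row_letters n f) (square_rows n @ rev (late_rows n e))) \<and>
        set (square_rows n @ rev (late_rows n e)) = {j \<in> vertices n. j < 0 \<or> int e < j} \<and>
        sorted_wrt (\<lambda>i j. - crossing_pos n i < - crossing_pos n j) (square_rows n @ rev (late_rows n e))" if "e \<le> n" for e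
    proof -
      have "set (square_rows n @ rev (late_rows n e)) = set (late_rows n e @ square_rows n)" by auto
      then show ?thesis using stage_word_rows(2)[OF that] set_rows[OF that] crossing_rows_sorted by metis
    qed
    show "\<And>X. se_set n X \<Longrightarrow> descending (\<lambda>j. - crossing_pos n j) X" using se_set_descending by blast
    show "\<And>X. X \<subseteq> nesting_polyomino n \<Longrightarrow> se_set n X \<Longrightarrow> finite X \<Longrightarrow> X \<noteq> {} \<Longrightarrow> \<exists>e\<le>n. fits e X"
      by (rule fits_crossing)
    show "\<And>X e. X \<subseteq> nesting_polyomino n \<Longrightarrow> descending (\<lambda>j. - crossing_pos n j) X \<Longrightarrow> fits e X \<Longrightarrow> se_set n X"
      using se_set_descending fits_rectangle by blast
  qed
  then show ?thesis unfolding crossing_faces_def using f by simp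
qed

lemma top_face_bounds:
  assumes "\<exists>\<omega>'\<in>top_faces n k \<F>. \<omega> \<subseteq> \<omega>'" "\<F> \<subseteq> Pow (reps n)"
  shows "card (\<omega> \<inter> main_diagonal n) \<le> k \<and> card (\<omega> - main_diagonal n) \<le> fan_dim n k"
proof -
  obtain \<omega>' where w: "\<omega>' \<in> top_faces n k \<F>" "\<omega> \<subseteq> \<omega>'" using assms(1) by blast
  then have "finite \<omega>'" using assms(2) finite_reps[of n] by (auto simp: top_faces_def intro: finite_subset)
  then have "card (\<omega> \<inter> main_diagonal n) \<le> card (\<omega>' \<inter> main_diagonal n)" "card (\<omega> - main_diagonal n) \<le> card (\<omega>' - main_diagonal n)"
    using w(2) by (auto intro!: card_mono)
  then show ?thesis using w(1) by (simp add: top_faces_def)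
qed

text \<open>Both families satisfy the assumptions of \<open>card_top_faces_eq\<close>: the dimension bounds hold because every face lies in a top face, and the
fillings are counted by \<open>card_word_fillings\<close>.\<close>

theorem card_top_faces:
  assumes "1 \<le> k" "k < n"
  shows "card (top_faces n k (nesting_faces n k)) = card (top_faces n k (crossing_faces n k))"
  unfolding top_faces_def
proof (rule card_top_faces_eq[OF finite_reps])
  show N: "nesting_faces n k \<subseteq> Pow (reps n)" and X: "crossing_faces n k \<subseteq> Pow (reps n)"
    by (auto simp: nesting_faces_def crossing_faces_def)
  fix \<sigma> assume "\<sigma> \<in> nesting_faces n k \<union> crossing_faces n k"
  then show "card (\<sigma> \<inter> main_diagonal n) \<le> k \<and> card (\<sigma> - main_diagonal n) \<le> fan_dim n k"
  proof
    assume "\<sigma> \<in> nesting_faces n k"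
    from nesting_face_extends[OF assms this] show ?thesis using top_face_bounds[OF _ N] by blast
  next
    assume "\<sigma> \<in> crossing_faces n k"
    from crossing_face_extends[OF assms this] show ?thesis using top_face_bounds[OF _ X] by blast
  qed
next
  fix t
  have N: "nesting_faces n k \<subseteq> Pow (reps n)" and X: "crossing_faces n k \<subseteq> Pow (reps n)"
    by (auto simp: nesting_faces_def crossing_faces_def)
  show "card {f. {b. f b \<noteq> 0} \<in> nesting_faces n k \<and> (\<Sum>b\<in>reps n. box_weight (main_diagonal n) b * f b) = t} =
        card {f. {b. f b \<noteq> 0} \<in> crossing_faces n k \<and> (\<Sum>b\<in>reps n. box_weight (main_diagonal n) b * f b) = t}"
    by (rule trans[OF card_fillings_word_fillings[OF nesting_word_condition N]
          trans[OF card_word_fillings card_fillings_word_fillings[OF crossing_word_condition X, symmetric]]])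
qed

section \<open>Maximal fillings\<close>

text \<open>Stated abstractly to cover fillings and triangulations: \<open>supp\<close> describes an object by boxes of \<open>reps n\<close>, \<open>L\<close> is the length of a longest chain,
and \<open>add\<close> puts in a missing box or diagonal. A maximal object is its own top face, because an enlargement inside a top face would not increase
\<open>L\<close>; conversely a top face has a chain of \<open>k\<close> boxes on the diagonal, and no face properly contains it.\<close>

lemma card_maximal_eq_top_faces:
  fixes supp :: "'x \<Rightarrow> box set"
  assumes k: "1 \<le> k"
    and bij: "bij_betw supp \<S> (Pow (reps n))"
    and L: "\<And>x. x \<in> \<S> \<Longrightarrow> L x \<le> k \<longleftrightarrow> supp x \<in> \<F>" "\<And>x. x \<in> \<S> \<Longrightarrow> card (supp x \<inter> main_diagonal n) \<le> L x"
    and add: "\<And>x b. x \<in> \<S> \<Longrightarrow> b \<in> I \<Longrightarrow> add x b \<in> \<S> \<and> supp (add x b) = insert (rep b) (supp x)"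
    and absent: "\<And>x b. x \<in> \<S> \<Longrightarrow> b \<in> I \<Longrightarrow> absent x b \<longleftrightarrow> rep b \<notin> supp x"
    and rep: "rep ` I = reps n"
    and sub: "\<F> \<subseteq> Pow (reps n)"
    and ext: "\<And>\<omega>. \<omega> \<in> \<F> \<Longrightarrow> \<exists>\<omega>'\<in>top_faces n k \<F>. \<omega> \<subseteq> \<omega>'"
    and down: "\<And>\<omega> \<omega>'. \<omega> \<subseteq> \<omega>' \<Longrightarrow> \<omega>' \<in> \<F> \<Longrightarrow> \<omega> \<in> \<F>"
  shows "card {x \<in> \<S>. L x = k \<and> (\<forall>b\<in>I. absent x b \<longrightarrow> L x < L (add x b))} = card (top_faces n k \<F>)" (is "card ?M = _")
proof (rule bij_betw_same_card[of supp], unfold bij_betw_def, intro conjI equalityI subsetI)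
  show "inj_on supp ?M" using bij by (auto simp: bij_betw_def intro: inj_on_subset)
next
  fix \<omega> assume "\<omega> \<in> supp ` ?M"
  then obtain x where x: "x \<in> \<S>" "\<omega> = supp x" "L x = k" and m: "\<And>b. b \<in> I \<Longrightarrow> absent x b \<Longrightarrow> L x < L (add x b)" by blast
  then have "\<omega> \<in> \<F>" using L(1)[OF x(1)] by simp
  from ext[OF this] obtain \<omega>' where w': "\<omega>' \<in> top_faces n k \<F>" "\<omega> \<subseteq> \<omega>'" by blast
  have F: "\<omega>' \<in> \<F>" using w'(1) by (simp add: top_faces_def)
  have "\<omega>' \<subseteq> \<omega>"
  proof (rule subsetI, rule ccontr)
    fix b assume b: "b \<in> \<omega>'" "b \<notin> \<omega>"
    then have "b \<in> reps n" using F sub by blast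
    then obtain d where d: "d \<in> I" "b = rep d" using rep by blast
    have "insert b \<omega> \<in> \<F>" using down[OF _ F] b(1) w'(2) by blast
    then have "L (add x d) \<le> k" using add[OF x(1) d(1)] L(1) x(2) d(2) by simp
    then show False using m[OF d(1)] absent[OF x(1) d(1)] b(2) x(2,3) d(2) by simp
  qed
  then show "\<omega> \<in> top_faces n k \<F>" using w' by auto
next
  fix \<omega> assume w: "\<omega> \<in> top_faces n k \<F>"
  then have F: "\<omega> \<in> \<F>" "card (\<omega> \<inter> main_diagonal n) = k" by (auto simp: top_faces_def)
  have "\<omega> \<in> supp ` \<S>" using bij F(1) sub by (auto simp: bij_betw_def)
  then obtain x where x: "x \<in> \<S>" "\<omega> = supp x" by blast
  have Lk: "L x = k" using L[OF x(1)] F x(2) by simp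
  have "L x < L (add x b)" if b: "b \<in> I" "absent x b" for b
  proof (rule ccontr)
    assume "\<not> L x < L (add x b)"
    then have "insert (rep b) \<omega> \<in> \<F>" using add[OF x(1) b(1)] L(1) Lk x(2) by (metis linorder_not_less)
    from ext[OF this] obtain \<omega>' where w': "\<omega>' \<in> top_faces n k \<F>" "insert (rep b) \<omega> \<subseteq> \<omega>'" by blast
    have "finite \<omega>'" using w'(1) sub finite_reps[of n] by (auto simp: top_faces_def intro: finite_subset)
    then have "\<omega> = \<omega>'" using top_face_maximal[OF w w'(1)] w'(2) by blast
    then show False using w'(2) absent[OF x(1) b(1)] b(2) x(2) by blast
  qed
  then show "\<omega> \<in> supp ` ?M" using x Lk by blast
qed

lemma crossing_polyomino_eq: "crossing_polyomino n = nesting_polyomino n"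
  unfolding crossing_polyomino_def nesting_polyomino_def
  by (auto simp: crossing_pos_def nesting_pos_def vertices_def)

definition rep_of :: "nat \<Rightarrow> box \<Rightarrow> box" where
  "rep_of n b = (if b \<in> reps n then b else mirror b)"

definition support :: "nat \<Rightarrow> (box \<Rightarrow> nat) \<Rightarrow> box set" where
  "support n F = {b \<in> nesting_polyomino n. F b \<noteq> 0}"

lemma symmetric_filling_mirror:
  assumes "F \<in> symmetric_fillings n (nesting_polyomino n)" "b \<in> nesting_polyomino n"
  shows "F (mirror b) = F b"
  using assms by (cases b) (auto simp: symmetric_fillings_def nesting_box_iff dest!: bspec[of _ _ "fst b"] bspec[of _ _ "- snd b"])

lemma support_closure:
  assumes F: "F \<in> symmetric_fillings n (nesting_polyomino n)"
  shows "support n F = closure (support n F \<inter> reps n)"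
proof -
  have "b \<in> support n F \<longleftrightarrow> b \<in> closure (support n F \<inter> reps n)" if b: "b \<in> nesting_polyomino n" for b
    unfolding in_closure_iff[of "support n F \<inter> reps n" n b, OF Int_lower2 b]
    using not_reps_mirror[OF b] symmetric_filling_mirror[OF F b] mirror_in[OF b] b by (auto simp: support_def)
  moreover have "closure (support n F \<inter> reps n) \<subseteq> nesting_polyomino n" by (rule closure_subset) simp
  ultimately show ?thesis by (auto simp: support_def)
qed

lemma fillings_bij:
  "bij_betw (\<lambda>F. support n F \<inter> reps n) (symmetric_fillings n (nesting_polyomino n)) (Pow (reps n))"
proof (rule bij_betw_byWitness[where f' = "\<lambda>\<omega>. \<lambda>b\<in>nesting_polyomino n. if b \<in> closure \<omega> then 1 else 0"])
  show "\<forall>F\<in>symmetric_fillings n (nesting_polyomino n).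
      (\<lambda>b\<in>nesting_polyomino n. if b \<in> closure (support n F \<inter> reps n) then 1 else 0) = F"
  proof
    fix F assume F: "F \<in> symmetric_fillings n (nesting_polyomino n)"
    show "(\<lambda>b\<in>nesting_polyomino n. if b \<in> closure (support n F \<inter> reps n) then 1 else 0) = F"
      unfolding support_closure[OF F, symmetric]
      using F by (auto simp: fun_eq_iff symmetric_fillings_def support_def PiE_iff extensional_def)
  qed
  have supp: "support n (\<lambda>b\<in>nesting_polyomino n. if b \<in> closure \<omega> then 1 else 0) = closure \<omega>" if "\<omega> \<subseteq> reps n" for \<omega>
    using closure_subset[OF that] by (auto simp: support_def)
  then show "\<forall>\<omega>\<in>Pow (reps n). support n (\<lambda>b\<in>nesting_polyomino n. if b \<in> closure \<omega> then 1 else 0) \<inter> reps n = \<omega>"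
    using closure_reps by blast
  show "(\<lambda>\<omega>. \<lambda>b\<in>nesting_polyomino n. if b \<in> closure \<omega> then 1 else 0) ` Pow (reps n) \<subseteq> symmetric_fillings n (nesting_polyomino n)"
  proof (rule image_subsetI)
    fix \<omega> assume w: "\<omega> \<in> Pow (reps n)"
    have "(i, - j) \<in> closure \<omega> \<longleftrightarrow> (j, - i) \<in> closure \<omega>" if "i \<in> {1..int n}" "j \<in> {1..int n}" for i j
    proof -
      have m: "mirror b \<in> closure \<omega>" if "b \<in> closure \<omega>" for b
        using that w mirror_mirror by (auto simp: closure_def reps_def)
      show ?thesis using m[of "(i, - j)"] m[of "(j, - i)"] that by auto
    qed
    moreover have "(i, - j) \<in> nesting_polyomino n \<and> (j, - i) \<in> nesting_polyomino n" if "i \<in> {1..int n}" "j \<in> {1..int n}" for i j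
      using that by (auto simp: nesting_box_iff)
    ultimately show "(\<lambda>b\<in>nesting_polyomino n. if b \<in> closure \<omega> then 1 else 0) \<in> symmetric_fillings n (nesting_polyomino n)"
      by (auto simp: symmetric_fillings_def)
  qed
qed auto

lemma filling_update:
  assumes F: "F \<in> symmetric_fillings n (nesting_polyomino n)" and b: "b \<in> nesting_polyomino n"
  shows "F(b := 1, mirror b := 1) \<in> symmetric_fillings n (nesting_polyomino n)"
    and "support n (F(b := 1, mirror b := 1)) \<inter> reps n = insert (rep_of n b) (support n F \<inter> reps n)"
proof -
  let ?G = "F(b := 1, mirror b := 1)"
  have m: "mirror b \<in> nesting_polyomino n" by (rule mirror_in[OF b])
  have "?G (i, - j) = ?G (j, - i)" if ij: "i \<in> {1..int n}" "j \<in> {1..int n}" for i j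
  proof -
    have P: "(i, - j) \<in> nesting_polyomino n" using ij by (auto simp: nesting_box_iff)
    have mi: "mirror (i, - j) = (j, - i)" using ij by simp
    have "F (i, - j) = F (j, - i)" using symmetric_filling_mirror[OF F P] mi by simp
    moreover have "(i, - j) = b \<longleftrightarrow> (j, - i) = mirror b" "(i, - j) = mirror b \<longleftrightarrow> (j, - i) = b"
      using mi mirror_mirror[OF P] mirror_mirror[OF b] by metis+
    ultimately show ?thesis by simp
  qed
  moreover have "?G \<in> nesting_polyomino n \<rightarrow>\<^sub>E {0, 1}" using F b m by (auto simp: symmetric_fillings_def PiE_iff extensional_def)
  ultimately show "?G \<in> symmetric_fillings n (nesting_polyomino n)" unfolding symmetric_fillings_def by blast
  have "support n ?G = insert b (insert (mirror b) (support n F))" using b m by (auto simp: support_def)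
  then show "support n ?G \<inter> reps n = insert (rep_of n b) (support n F \<inter> reps n)"
    using not_reps_mirror[OF b] mirror_reps[of b n] by (auto simp: rep_of_def)
qed

lemma rep_of_image: "rep_of n ` nesting_polyomino n = reps n"
proof (intro equalityI image_subsetI)
  show "rep_of n b \<in> reps n" if "b \<in> nesting_polyomino n" for b using not_reps_mirror[OF that] by (simp add: rep_of_def)
  show "reps n \<subseteq> rep_of n ` nesting_polyomino n"
  proof
    fix b assume "b \<in> reps n"
    then show "b \<in> rep_of n ` nesting_polyomino n" by (intro image_eqI[of _ _ b]) (auto simp: rep_of_def reps_def)
  qed
qed

lemma filling_zero_iff:
  assumes F: "F \<in> symmetric_fillings n (nesting_polyomino n)" and b: "b \<in> nesting_polyomino n"
  shows "F b = 0 \<longleftrightarrow> rep_of n b \<notin> support n F \<inter> reps n"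
  using symmetric_filling_mirror[OF F b] mirror_in[OF b] b not_reps_mirror[OF b] by (auto simp: rep_of_def support_def)

subsection \<open>Chains as sets\<close>

text \<open>Sorting by columns turns a set of pairwise comparable boxes into a chain.\<close>

lemma chain_list:
  fixes X :: "box set"
  assumes "finite X" "\<And>b c. b \<in> X \<Longrightarrow> c \<in> X \<Longrightarrow> b \<noteq> c \<Longrightarrow> R b c \<or> R c b" and R: "\<And>b c. R b c \<Longrightarrow> fst b < fst c"
  shows "\<exists>bs. set bs = X \<and> length bs = card X \<and> sorted_wrt R bs"
proof -
  have inj: "inj_on fst X" using assms(2) R by (metis inj_onI less_irrefl)
  let ?c = "the_inv_into X fst" and ?m = "sorted_list_of_set (fst ` X)"
  have fin: "finite (fst ` X)" using assms(1) by simp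
  have c: "?c i \<in> X" "fst (?c i) = i" if "i \<in> fst ` X" for i
    using the_inv_into_into[OF inj that subset_refl] f_the_inv_into_f[OF inj that] by blast+
  have "set (map ?c ?m) = X" using the_inv_into_onto[OF inj] fin by simp
  moreover have "length (map ?c ?m) = card X" using card_image[OF inj] by simp
  moreover have "sorted_wrt R (map ?c ?m)" unfolding sorted_wrt_map
  proof (rule sorted_wrt_mono_rel[OF _ strict_sorted_list_of_set])
    fix i j assume "i \<in> set ?m" "j \<in> set ?m" "i < j"
    then have ij: "i \<in> fst ` X" "j \<in> fst ` X" "i < j" using fin by simp_all
    have "?c i \<noteq> ?c j" using c(2)[OF ij(1)] c(2)[OF ij(2)] ij(3) by auto
    then show "R (?c i) (?c j)" using assms(2)[OF c(1)[OF ij(1)] c(1)[OF ij(2)]] R c(2)[OF ij(1)] c(2)[OF ij(2)] ij(3) by fastforce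
  qed
  ultimately show ?thesis by blast
qed

lemma sorted_chain:
  assumes "sorted_wrt R bs" and R: "\<And>b c. R b c \<Longrightarrow> fst b < fst (c :: box)"
  shows "length bs = card (set bs)" "\<And>b c. b \<in> set bs \<Longrightarrow> c \<in> set bs \<Longrightarrow> b \<noteq> c \<Longrightarrow> R b c \<or> R c b"
proof -
  have "sorted_wrt (<) (map fst bs)" unfolding sorted_wrt_map by (rule sorted_wrt_mono_rel[OF R assms(1)])
  then have "distinct bs" by (simp add: strict_sorted_iff distinct_map)
  then show "length bs = card (set bs)" by (simp add: distinct_card)
  show "R b c \<or> R c b" if bc: "b \<in> set bs" "c \<in> set bs" "b \<noteq> c" for b c
  proof -
    obtain r r' where "r < length bs" "r' < length bs" "b = bs ! r" "c = bs ! r'" "r \<noteq> r'"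
      using bc by (metis in_set_conv_nth)
    then show ?thesis using sorted_wrt_nth_less[OF assms(1)] by (metis linorder_neqE_nat)
  qed
qed

lemma Max_length_le_iff:
  assumes "[] \<in> B" "\<And>bs. bs \<in> B \<Longrightarrow> length bs \<le> N"
  shows "Max (length ` B) \<le> j \<longleftrightarrow> (\<forall>bs\<in>B. length bs \<le> j)"
proof -
  have "length ` B \<subseteq> {..N}" using assms(2) by auto
  then have "finite (length ` B)" by (rule finite_subset) simp
  moreover have "length ` B \<noteq> {}" using assms(1) by blast
  ultimately show ?thesis by simp
qed

lemma longest_ne_le_iff: "longest_ne n F \<le> j \<longleftrightarrow> (\<forall>X. X \<subseteq> support n F \<longrightarrow> ne_set n X \<longrightarrow> card X \<le> j)"
proof -
  have chain: "ne_chain n F bs \<longleftrightarrow> set bs \<subseteq> support n F \<and> sorted_wrt (nested n) bs" for bs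
  proof -
    have "transp (nested n)" by (auto simp: transp_def nested_def)
    moreover have "(\<lambda>b c. fst b < fst c \<and> nesting_pos n (snd c) < nesting_pos n (snd b)) = nested n"
      by (simp add: fun_eq_iff nested_def)
    ultimately show ?thesis unfolding ne_chain_def support_def by (auto simp: successively_conv_sorted_wrt)
  qed
  have lt: "nested n b c \<Longrightarrow> fst b < fst c" for b c by (simp add: nested_def)
  have fin: "finite (support n F)" using finite_nesting_polyomino[of n] by (simp add: support_def)
  have "Max (length ` {bs. ne_chain n F bs}) \<le> j \<longleftrightarrow> (\<forall>bs\<in>{bs. ne_chain n F bs}. length bs \<le> j)"
  proof (rule Max_length_le_iff)
    show "length bs \<le> card (support n F)" if "bs \<in> {bs. ne_chain n F bs}" for bs
      using that sorted_chain(1)[of "nested n" bs, OF _ lt] card_mono[OF fin] chain by auto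
  qed (simp add: ne_chain_def)
  also have "\<dots> \<longleftrightarrow> (\<forall>X. X \<subseteq> support n F \<longrightarrow> ne_set n X \<longrightarrow> card X \<le> j)"
  proof (intro iffI ballI allI impI)
    fix X assume h: "\<forall>bs\<in>{bs. ne_chain n F bs}. length bs \<le> j" and X: "X \<subseteq> support n F" "ne_set n X"
    obtain bs where "set bs = X" "length bs = card X" "sorted_wrt (nested n) bs"
      using chain_list[of X "nested n", OF finite_subset[OF X(1) fin] _ lt] X(2) unfolding ne_set_def by metis
    then show "card X \<le> j" using h chain X(1) by auto
  next
    fix bs assume h: "\<forall>X. X \<subseteq> support n F \<longrightarrow> ne_set n X \<longrightarrow> card X \<le> j" and "bs \<in> {bs. ne_chain n F bs}"
    then have bs: "set bs \<subseteq> support n F" "sorted_wrt (nested n) bs" using chain by auto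
    have "ne_set n (set bs)" unfolding ne_set_def using sorted_chain(2)[of "nested n" bs, OF bs(2) lt] by blast
    then show "length bs \<le> j" using h bs(1) sorted_chain(1)[of "nested n" bs, OF bs(2) lt] by simp
  qed
  finally show ?thesis by (simp add: longest_ne_def)
qed

lemma bounding_rectangle_iff:
  assumes "X \<subseteq> nesting_polyomino n"
  shows "bounding_rectangle n X \<subseteq> crossing_polyomino n \<longleftrightarrow> (\<forall>b\<in>X. \<forall>c\<in>X. fst b < crossing_pos n (snd c))"
proof (intro iffI ballI subsetI)
  fix b c assume h: "bounding_rectangle n X \<subseteq> crossing_polyomino n" "b \<in> X" "c \<in> X"
  have "snd c \<in> vertices n" using assms h(3) by (auto simp: nesting_box_iff vertices_def)
  then have "(fst b, snd c) \<in> bounding_rectangle n X" using h(2,3) by (auto simp: bounding_rectangle_def)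
  then have "(fst b, snd c) \<in> crossing_polyomino n" using h(1) by blast
  then show "fst b < crossing_pos n (snd c)" by (auto simp: crossing_polyomino_def crossing_pos_def split: if_splits)
next
  fix d assume h: "\<forall>b\<in>X. \<forall>c\<in>X. fst b < crossing_pos n (snd c)" and d: "d \<in> bounding_rectangle n X"
  obtain i j where ij: "d = (i, j)" by (cases d)
  obtain b b' c where b: "b \<in> X" "fst b \<le> i" "b' \<in> X" "i \<le> fst b'" "c \<in> X" "crossing_pos n (snd c) \<le> crossing_pos n j"
    and j: "j \<in> vertices n" using d unfolding ij bounding_rectangle_def by blast
  have "1 \<le> fst b" "fst b' \<le> int n" using b assms by (auto simp: nesting_box_iff)
  moreover have "fst b' < crossing_pos n (snd c)" using h b by blast
  ultimately show "d \<in> crossing_polyomino n" using b j by (auto simp: ij crossing_polyomino_def crossing_pos_def)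
qed

text \<open>For boxes of the polyomino, the bounding rectangle lies inside iff every column of the chain is to the left of every row position.\<close>

lemma longest_se_le_iff: "longest_se n F \<le> j \<longleftrightarrow> (\<forall>X. X \<subseteq> support n F \<longrightarrow> se_set n X \<longrightarrow> card X \<le> j)"
proof -
  define R where "R = (\<lambda>b c. fst b < fst c \<and> crossing_pos n (snd b) < crossing_pos n (snd (c :: box)))"
  have chain: "se_chain n F bs \<longleftrightarrow> set bs \<subseteq> support n F \<and> sorted_wrt R bs \<and>
      (\<forall>b\<in>set bs. \<forall>c\<in>set bs. fst b < crossing_pos n (snd c))" for bs
  proof (cases "set bs \<subseteq> nesting_polyomino n")
    case True
    have "transp R" by (auto simp: transp_def R_def)
    then have "sorted_wrt R bs \<longleftrightarrow> successively R bs" by (simp add: successively_conv_sorted_wrt)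
    then show ?thesis unfolding se_chain_def support_def R_def[symmetric] bounding_rectangle_iff[OF True]
      unfolding crossing_polyomino_eq using True by auto
  next
    case False
    then show ?thesis by (auto simp: se_chain_def support_def crossing_polyomino_eq)
  qed
  have lt: "R b c \<Longrightarrow> fst b < fst c" for b c by (simp add: R_def)
  have fin: "finite (support n F)" using finite_nesting_polyomino[of n] by (simp add: support_def)
  have "Max (length ` {bs. se_chain n F bs}) \<le> j \<longleftrightarrow> (\<forall>bs\<in>{bs. se_chain n F bs}. length bs \<le> j)"
  proof (rule Max_length_le_iff)
    show "length bs \<le> card (support n F)" if "bs \<in> {bs. se_chain n F bs}" for bs
      using that sorted_chain(1)[of R bs, OF _ lt] card_mono[OF fin] chain by auto
  qed (use chain in simp)
  also have "\<dots> \<longleftrightarrow> (\<forall>X. X \<subseteq> support n F \<longrightarrow> se_set n X \<longrightarrow> card X \<le> j)"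
  proof (intro iffI ballI allI impI)
    fix X assume h: "\<forall>bs\<in>{bs. se_chain n F bs}. length bs \<le> j" and X: "X \<subseteq> support n F" "se_set n X"
    have tot: "R b c \<or> R c b" if "b \<in> X" "c \<in> X" "b \<noteq> c" for b c using X(2) that unfolding se_set_def R_def by blast
    obtain bs where bs: "set bs = X" "length bs = card X" "sorted_wrt R bs"
      using chain_list[of X R, OF finite_subset[OF X(1) fin] tot lt] by blast
    have "\<forall>b\<in>X. \<forall>c\<in>X. fst b < crossing_pos n (snd c)" using X(2) unfolding se_set_def by blast
    then have "se_chain n F bs" using chain bs X(1) by simp
    then show "card X \<le> j" using h bs(2) by auto
  next
    fix bs assume h: "\<forall>X. X \<subseteq> support n F \<longrightarrow> se_set n X \<longrightarrow> card X \<le> j" and "bs \<in> {bs. se_chain n F bs}"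
    then have bs: "set bs \<subseteq> support n F" "sorted_wrt R bs" "\<forall>b\<in>set bs. \<forall>c\<in>set bs. fst b < crossing_pos n (snd c)"
      using chain by auto
    have "se_set n (set bs)" unfolding se_set_def using sorted_chain(2)[of R bs, OF bs(2) lt] bs(3) unfolding R_def by blast
    then show "length bs \<le> j" using h bs(1) sorted_chain(1)[of R bs, OF bs(2) lt] by simp
  qed
  finally show ?thesis by (simp add: longest_se_def)
qed

lemma diagonal_chains:
  assumes "X \<subseteq> main_diagonal n"
  shows "ne_set n X" "se_set n X"
proof -
  have d: "1 \<le> fst b \<and> fst b \<le> int n \<and> snd b = - fst b" if "b \<in> X" for b
    using assms that by (auto simp: main_diagonal_def)
  show "ne_set n X" unfolding ne_set_def
  proof (intro ballI impI)
    fix b c assume "b \<in> X" "c \<in> X" "b \<noteq> c"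
    then show "nested n b c \<or> nested n c b" using d[of b] d[of c] by (auto simp: nested_def nesting_pos_def prod_eq_iff)
  qed
  show "se_set n X" unfolding se_set_def
  proof (intro ballI)
    fix b c assume "b \<in> X" "c \<in> X"
    then show "fst b < crossing_pos n (snd c) \<and> (b \<noteq> c \<longrightarrow>
       (fst b < fst c \<and> crossing_pos n (snd b) < crossing_pos n (snd c)) \<or>
       (fst c < fst b \<and> crossing_pos n (snd c) < crossing_pos n (snd b)))"
      using d[of b] d[of c] by (auto simp: crossing_pos_def prod_eq_iff)
  qed
qed

theorem card_maximal_nesting_fillings:
  assumes "1 \<le> k" "k < n"
  shows "card (maximal_nesting_fillings n k) = card (top_faces n k (nesting_faces n k))"
  unfolding maximal_nesting_fillings_def
proof (rule card_maximal_eq_top_faces[OF assms(1) fillings_bij, where rep = "rep_of n"])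
  fix F assume F: "F \<in> symmetric_fillings n (nesting_polyomino n)"
  show "longest_ne n F \<le> k \<longleftrightarrow> support n F \<inter> reps n \<in> nesting_faces n k"
    unfolding longest_ne_le_iff nesting_faces_closure using support_closure[OF F] by simp
  show "card (support n F \<inter> reps n \<inter> main_diagonal n) \<le> longest_ne n F"
    by (rule iffD1[OF longest_ne_le_iff order_refl, rule_format]) (auto intro: diagonal_chains)
  fix b assume b: "b \<in> nesting_polyomino n"
  show "F(b := 1, mirror b := 1) \<in> symmetric_fillings n (nesting_polyomino n) \<and>
      support n (F(b := 1, mirror b := 1)) \<inter> reps n = insert (rep_of n b) (support n F \<inter> reps n)"
    using filling_update[OF F b] by blast
  show "F b = 0 \<longleftrightarrow> rep_of n b \<notin> support n F \<inter> reps n" by (rule filling_zero_iff[OF F b])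
next
  show "rep_of n ` nesting_polyomino n = reps n" by (rule rep_of_image)
  show "nesting_faces n k \<subseteq> Pow (reps n)" by (auto simp: nesting_faces_def)
  show "\<exists>\<omega>'\<in>top_faces n k (nesting_faces n k). \<omega> \<subseteq> \<omega>'" if "\<omega> \<in> nesting_faces n k" for \<omega>
    using nesting_face_extends[OF assms that] by blast
  show "\<omega> \<in> nesting_faces n k" if "\<omega> \<subseteq> \<omega>'" "\<omega>' \<in> nesting_faces n k" for \<omega> \<omega>'
    using that unfolding nesting_faces_def by blast
qed

lemma crossing_faces_down: "\<omega> \<subseteq> \<omega>' \<Longrightarrow> \<omega>' \<in> crossing_faces n k \<Longrightarrow> \<omega> \<in> crossing_faces n k"
  unfolding crossing_faces_def closure_def by blast

theorem card_maximal_crossing_fillings: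
  assumes "1 \<le> k" "k < n"
  shows "card (maximal_crossing_fillings n k) = card (top_faces n k (crossing_faces n k))"
  unfolding maximal_crossing_fillings_def crossing_polyomino_eq
proof (rule card_maximal_eq_top_faces[OF assms(1) fillings_bij, where rep = "rep_of n"])
  fix F assume F: "F \<in> symmetric_fillings n (nesting_polyomino n)"
  show "longest_se n F \<le> k \<longleftrightarrow> support n F \<inter> reps n \<in> crossing_faces n k"
    unfolding longest_se_le_iff crossing_faces_def using support_closure[OF F] by simp
  show "card (support n F \<inter> reps n \<inter> main_diagonal n) \<le> longest_se n F"
    by (rule iffD1[OF longest_se_le_iff order_refl, rule_format]) (auto intro: diagonal_chains)
  fix b assume b: "b \<in> nesting_polyomino n"
  show "F(b := 1, mirror b := 1) \<in> symmetric_fillings n (nesting_polyomino n) \<and>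
      support n (F(b := 1, mirror b := 1)) \<inter> reps n = insert (rep_of n b) (support n F \<inter> reps n)"
    using filling_update[OF F b] by blast
  show "F b = 0 \<longleftrightarrow> rep_of n b \<notin> support n F \<inter> reps n" by (rule filling_zero_iff[OF F b])
next
  show "rep_of n ` nesting_polyomino n = reps n" by (rule rep_of_image)
  show "crossing_faces n k \<subseteq> Pow (reps n)" by (auto simp: crossing_faces_def)
  show "\<exists>\<omega>'\<in>top_faces n k (crossing_faces n k). \<omega> \<subseteq> \<omega>'" if "\<omega> \<in> crossing_faces n k" for \<omega>
    by (rule crossing_face_extends[OF assms that])
qed (rule crossing_faces_down)

section \<open>Triangulations\<close>

text \<open>The diagonal encoded by a box. Diagonals with two negative endpoints have no box, but their rotated images have one.\<close>

definition chord :: "box \<Rightarrow> int set" where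
  "chord b = {fst b, snd b}"

definition symmetric_diagonals :: "nat \<Rightarrow> int set set set" where
  "symmetric_diagonals n = {\<omega>. \<omega> \<subseteq> diagonals n \<and> (\<forall>d\<in>\<omega>. rotate180 d \<in> \<omega>)}"

definition chord_boxes :: "nat \<Rightarrow> int set set \<Rightarrow> box set" where
  "chord_boxes n \<omega> = {b \<in> nesting_polyomino n. chord b \<in> \<omega>}"

lemma rotate180_rotate180: "rotate180 (rotate180 d) = d"
  by (simp add: rotate180_def image_image)

lemma chord_inj: "inj_on chord (nesting_polyomino n)"
  by (rule inj_onI) (auto simp: chord_def doubleton_eq_iff nesting_box_iff prod_eq_iff)

lemma diagonalsE:
  assumes "d \<in> diagonals n"
  obtains i j where "d = {i, j}" "i \<in> vertices n" "j \<in> vertices n" "i \<noteq> j"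
  using assms unfolding diagonals_def by blast

lemma diagonalsI: "i \<in> vertices n \<Longrightarrow> j \<in> vertices n \<Longrightarrow> i \<noteq> j \<Longrightarrow> {i, j} \<in> diagonals n"
  unfolding diagonals_def by blast

lemma chord_diagonal: "b \<in> nesting_polyomino n \<Longrightarrow> chord b \<in> diagonals n"
  unfolding chord_def by (rule diagonalsI) (auto simp: nesting_box_iff vertices_def)

lemma rotate180_diagonal: "d \<in> diagonals n \<Longrightarrow> rotate180 d \<in> diagonals n"
proof (elim diagonalsE)
  fix i j assume h: "d = {i, j}" "i \<in> vertices n" "j \<in> vertices n" "i \<noteq> j"
  then have "- i \<in> vertices n" "- j \<in> vertices n" "- i \<noteq> - j" by (auto simp: vertices_def)
  then show "rotate180 d \<in> diagonals n" using diagonalsI[of "- i" n "- j"] h(1) by (simp add: rotate180_def)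
qed

lemma chord_mirror: "b \<in> nesting_polyomino n \<Longrightarrow> snd b < 0 \<Longrightarrow> chord (mirror b) = rotate180 (chord b)"
  by (cases b) (auto simp: chord_def rotate180_def)

lemma diagonal_with_positive:
  assumes "d \<in> diagonals n" "v \<in> d" "0 < v"
  obtains b where "b \<in> nesting_polyomino n" "d = chord b"
proof -
  obtain w where w: "d = {v, w}" "v \<in> vertices n" "w \<in> vertices n" "v \<noteq> w"
    using assms(1,2) by (elim diagonalsE) auto
  define b where "b = (if 0 < w \<and> w < v then (w, v) else (v, w))"
  have "b \<in> nesting_polyomino n" "d = chord b"
    using w assms(3) by (auto simp: b_def nesting_box_iff vertices_def chord_def)
  then show ?thesis using that by blast
qed

lemma diagonal_orbit:
  assumes "d \<in> diagonals n"
  shows "\<exists>b\<in>reps n. d = chord b \<or> d = rotate180 (chord b)"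
proof -
  have main: "\<exists>b\<in>reps n. e = chord b \<or> e = rotate180 (chord b)" if e: "e \<in> diagonals n" "v \<in> e" "0 < v" for e v
  proof -
    obtain b where b: "b \<in> nesting_polyomino n" "e = chord b" using diagonal_with_positive[OF e] by blast
    show ?thesis
    proof (cases "b \<in> reps n")
      case False
      then have neg: "snd b < 0" using b(1) by (cases b) (auto simp: reps_def nesting_box_iff)
      have "e = rotate180 (chord (mirror b))" using chord_mirror[OF b(1) neg] b(2) by (simp add: rotate180_rotate180)
      then show ?thesis using not_reps_mirror[OF b(1) False] by blast
    qed (use b in blast)
  qed
  obtain i j where ij: "d = {i, j}" "i \<in> vertices n" "j \<in> vertices n" "i \<noteq> j" using assms by (rule diagonalsE)
  show ?thesis
  proof (cases "0 < i \<or> 0 < j")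
    case True
    then show ?thesis using main[OF assms] ij(1) by blast
  next
    case False
    then have "0 < - i" "- i \<in> rotate180 d" using ij by (auto simp: vertices_def rotate180_def)
    then obtain b where "b \<in> reps n" "rotate180 d = chord b \<or> rotate180 d = rotate180 (chord b)"
      using main[OF rotate180_diagonal[OF assms]] by blast
    then show ?thesis by (metis rotate180_rotate180)
  qed
qed

lemma orbit_unique:
  assumes b: "b \<in> reps n" and c: "c \<in> reps n" and e: "chord b = chord c \<or> chord b = rotate180 (chord c)"
  shows "b = c"
proof -
  have P: "b \<in> nesting_polyomino n" "c \<in> nesting_polyomino n" using b c by (auto simp: reps_def)
  show ?thesis
  proof (cases "chord b = chord c")
    case True
    then show ?thesis using chord_inj P by (auto dest: inj_onD)
  next
    case False
    then have r: "chord b = rotate180 (chord c)" using e by blast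
    have "snd c < 0"
    proof (rule ccontr)
      assume "\<not> snd c < 0"
      then have "\<forall>v\<in>rotate180 (chord c). v \<le> 0" using P(2) by (auto simp: rotate180_def chord_def nesting_box_iff)
      moreover have "fst b \<in> rotate180 (chord c)" unfolding r[symmetric] by (simp add: chord_def)
      ultimately show False using P(1) by (force simp: nesting_box_iff)
    qed
    then have "chord b = chord (mirror c)" using r chord_mirror[OF P(2)] by simp
    then have "b = mirror c" using chord_inj P(1) mirror_in[OF P(2)] by (auto dest: inj_onD)
    then show ?thesis using mirror_reps[OF c] b by simp
  qed
qed

definition orbit_box :: "nat \<Rightarrow> int set \<Rightarrow> box" where
  "orbit_box n d = (SOME b. b \<in> reps n \<and> (d = chord b \<or> d = rotate180 (chord b)))"

lemma orbit_box:
  assumes "d \<in> diagonals n"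
  shows "orbit_box n d \<in> reps n" "d = chord (orbit_box n d) \<or> d = rotate180 (chord (orbit_box n d))"
proof -
  have "\<exists>b. b \<in> reps n \<and> (d = chord b \<or> d = rotate180 (chord b))" using diagonal_orbit[OF assms] by blast
  from someI_ex[OF this] show "orbit_box n d \<in> reps n" "d = chord (orbit_box n d) \<or> d = rotate180 (chord (orbit_box n d))"
    unfolding orbit_box_def by blast+
qed

lemma orbit_box_iff:
  assumes d: "d \<in> diagonals n" and b: "b \<in> reps n"
  shows "b = orbit_box n d \<longleftrightarrow> chord b = d \<or> chord b = rotate180 d"
proof
  show "b = orbit_box n d \<Longrightarrow> chord b = d \<or> chord b = rotate180 d" using orbit_box(2)[OF d] by (metis rotate180_rotate180)
  assume "chord b = d \<or> chord b = rotate180 d"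
  then have "chord b = chord (orbit_box n d) \<or> chord b = rotate180 (chord (orbit_box n d))"
    using orbit_box(2)[OF d] by (metis rotate180_rotate180)
  then show "b = orbit_box n d" by (rule orbit_unique[OF b orbit_box(1)[OF d]])
qed

lemma orbit_box_mem:
  assumes w: "\<omega> \<in> symmetric_diagonals n" and d: "d \<in> diagonals n"
  shows "d \<in> \<omega> \<longleftrightarrow> chord (orbit_box n d) \<in> \<omega>"
proof -
  have "rotate180 e \<in> \<omega>" if "e \<in> \<omega>" for e using w that by (simp add: symmetric_diagonals_def)
  then show ?thesis using orbit_box(2)[OF d] by (metis rotate180_rotate180)
qed

lemma chord_boxes_closure:
  assumes w: "\<omega> \<in> symmetric_diagonals n"
  shows "chord_boxes n \<omega> = closure (chord_boxes n \<omega> \<inter> reps n)"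
proof -
  have rot: "rotate180 e \<in> \<omega> \<longleftrightarrow> e \<in> \<omega>" for e
    using w unfolding symmetric_diagonals_def by (metis (no_types, lifting) mem_Collect_eq rotate180_rotate180)
  have "b \<in> chord_boxes n \<omega> \<longleftrightarrow> b \<in> closure (chord_boxes n \<omega> \<inter> reps n)" if b: "b \<in> nesting_polyomino n" for b
  proof (cases "b \<in> reps n")
    case True
    then show ?thesis using in_closure_iff[OF Int_lower2 b] by simp
  next
    case False
    then have "snd b < 0" using b by (cases b) (auto simp: reps_def nesting_box_iff)
    then have "chord (mirror b) \<in> \<omega> \<longleftrightarrow> chord b \<in> \<omega>" using chord_mirror[OF b] rot by simp
    then show ?thesis using in_closure_iff[of "chord_boxes n \<omega> \<inter> reps n" n b, OF Int_lower2 b] False not_reps_mirror[OF b False] b mirror_in[OF b]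
      by (simp add: chord_boxes_def)
  qed
  moreover have "closure (chord_boxes n \<omega> \<inter> reps n) \<subseteq> nesting_polyomino n" by (rule closure_subset) simp
  ultimately show ?thesis by (auto simp: chord_boxes_def)
qed

lemma symmetric_diagonals_bij:
  "bij_betw (\<lambda>\<omega>. chord_boxes n \<omega> \<inter> reps n) (symmetric_diagonals n) (Pow (reps n))"
proof (rule bij_betw_byWitness[where f' = "\<lambda>\<sigma>. {d \<in> diagonals n. orbit_box n d \<in> \<sigma>}"])
  have R: "b \<in> nesting_polyomino n" if "b \<in> reps n" for b using that by (auto simp: reps_def)
  have o: "orbit_box n (chord b) = b" if "b \<in> reps n" for b
    using orbit_box_iff[OF chord_diagonal[OF R[OF that]] that] by simp
  show "\<forall>\<omega>\<in>symmetric_diagonals n. {d \<in> diagonals n. orbit_box n d \<in> chord_boxes n \<omega> \<inter> reps n} = \<omega>"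
  proof
    fix \<omega> assume w: "\<omega> \<in> symmetric_diagonals n"
    have "orbit_box n d \<in> chord_boxes n \<omega> \<inter> reps n \<longleftrightarrow> d \<in> \<omega>" if "d \<in> diagonals n" for d
      using orbit_box_mem[OF w that] orbit_box(1)[OF that] R by (auto simp: chord_boxes_def)
    then show "{d \<in> diagonals n. orbit_box n d \<in> chord_boxes n \<omega> \<inter> reps n} = \<omega>"
      using w by (auto simp: symmetric_diagonals_def)
  qed
  show "\<forall>\<sigma>\<in>Pow (reps n). chord_boxes n {d \<in> diagonals n. orbit_box n d \<in> \<sigma>} \<inter> reps n = \<sigma>"
    using o R chord_diagonal by (fastforce simp: chord_boxes_def)
  show "(\<lambda>\<sigma>. {d \<in> diagonals n. orbit_box n d \<in> \<sigma>}) ` Pow (reps n) \<subseteq> symmetric_diagonals n"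
  proof (rule image_subsetI)
    fix \<sigma>
    have "orbit_box n (rotate180 d) = orbit_box n d" if "d \<in> diagonals n" for d
      using orbit_box_iff[OF rotate180_diagonal[OF that] orbit_box(1)[OF that]] orbit_box_iff[OF that orbit_box(1)[OF that]]
      unfolding rotate180_rotate180 by metis
    then show "{d \<in> diagonals n. orbit_box n d \<in> \<sigma>} \<in> symmetric_diagonals n"
      using rotate180_diagonal by (simp add: symmetric_diagonals_def)
  qed
qed auto

lemma symmetric_diagonals_insert:
  assumes w: "\<omega> \<in> symmetric_diagonals n" and d: "d \<in> diagonals n"
  shows "\<omega> \<union> {d, rotate180 d} \<in> symmetric_diagonals n"
    and "chord_boxes n (\<omega> \<union> {d, rotate180 d}) \<inter> reps n = insert (orbit_box n d) (chord_boxes n \<omega> \<inter> reps n)"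
proof -
  show "\<omega> \<union> {d, rotate180 d} \<in> symmetric_diagonals n"
    using w d rotate180_diagonal[OF d] by (auto simp: symmetric_diagonals_def rotate180_rotate180)
  have "b \<in> chord_boxes n (\<omega> \<union> {d, rotate180 d}) \<longleftrightarrow> b = orbit_box n d \<or> b \<in> chord_boxes n \<omega>" if "b \<in> reps n" for b
    using orbit_box_iff[OF d that] that by (auto simp: chord_boxes_def reps_def)
  then show "chord_boxes n (\<omega> \<union> {d, rotate180 d}) \<inter> reps n = insert (orbit_box n d) (chord_boxes n \<omega> \<inter> reps n)"
    using orbit_box(1)[OF d] by blast
qed

subsection \<open>Crossing chords and chains\<close>

lemma interleaved_boxes:
  assumes "b \<in> nesting_polyomino n" "c \<in> nesting_polyomino n"
  shows "interleaved n (chord b) (chord c) \<longleftrightarrow>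
    fst b < fst c \<and> fst c < crossing_pos n (snd b) \<and> crossing_pos n (snd b) < crossing_pos n (snd c)"
proof -
  have pos: "crossing_pos n (fst x) = fst x \<and> fst x < crossing_pos n (snd x)" if "x \<in> nesting_polyomino n" for x
    using that by (auto simp: nesting_box_iff crossing_pos_def)
  show ?thesis
  proof
    assume "interleaved n (chord b) (chord c)"
    then obtain i j k l where h: "{fst b, snd b} = {i, j}" "{fst c, snd c} = {k, l}"
      "crossing_pos n i < crossing_pos n k" "crossing_pos n k < crossing_pos n j" "crossing_pos n j < crossing_pos n l"
      unfolding interleaved_def chord_def by blast
    have "i = fst b \<and> j = snd b" using h(1,3,4) pos[OF assms(1)] by (auto simp: doubleton_eq_iff)
    moreover have "k = fst c \<and> l = snd c" using h(2,4,5) pos[OF assms(2)] by (auto simp: doubleton_eq_iff)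
    ultimately show "fst b < fst c \<and> fst c < crossing_pos n (snd b) \<and> crossing_pos n (snd b) < crossing_pos n (snd c)"
      using h pos assms by metis
  next
    assume h: "fst b < fst c \<and> fst c < crossing_pos n (snd b) \<and> crossing_pos n (snd b) < crossing_pos n (snd c)"
    show "interleaved n (chord b) (chord c)" unfolding interleaved_def chord_def
      by (intro exI[of _ "fst b"] exI[of _ "snd b"] exI[of _ "fst c"] exI[of _ "snd c"]) (use h pos assms in simp)
  qed
qed

lemma se_set_iff_crossing:
  assumes "X \<subseteq> nesting_polyomino n"
  shows "se_set n X \<longleftrightarrow> pairwise (crosses n) (chord ` X)"
proof
  assume X: "se_set n X"
  show "pairwise (crosses n) (chord ` X)"
  proof (rule pairwiseI)
    fix d e assume "d \<in> chord ` X" "e \<in> chord ` X" "d \<noteq> e"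
    then obtain b c where bc: "b \<in> X" "c \<in> X" "d = chord b" "e = chord c" "b \<noteq> c" by blast
    then have P: "b \<in> nesting_polyomino n" "c \<in> nesting_polyomino n" using assms by blast+
    have "fst b < crossing_pos n (snd c)" "fst c < crossing_pos n (snd b)"
      "(fst b < fst c \<and> crossing_pos n (snd b) < crossing_pos n (snd c)) \<or>
       (fst c < fst b \<and> crossing_pos n (snd c) < crossing_pos n (snd b))" using X bc unfolding se_set_def by blast+
    then show "crosses n d e" unfolding crosses_def bc(3,4) using interleaved_boxes P by metis
  qed
next
  assume X: "pairwise (crosses n) (chord ` X)"
  show "se_set n X" unfolding se_set_def
  proof (intro ballI)
    fix b c assume bc: "b \<in> X" "c \<in> X"
    then have P: "b \<in> nesting_polyomino n" "c \<in> nesting_polyomino n" using assms by blast+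
    show "fst b < crossing_pos n (snd c) \<and> (b \<noteq> c \<longrightarrow>
       (fst b < fst c \<and> crossing_pos n (snd b) < crossing_pos n (snd c)) \<or>
       (fst c < fst b \<and> crossing_pos n (snd c) < crossing_pos n (snd b)))"
    proof (cases "b = c")
      case True
      then show ?thesis using P by (auto simp: nesting_box_iff crossing_pos_def)
    next
      case False
      then have "chord b \<noteq> chord c" using inj_onD[OF chord_inj _ P] by blast
      then have "crosses n (chord b) (chord c)" using X bc unfolding pairwise_def by blast
      then show ?thesis unfolding crosses_def interleaved_boxes[OF P] interleaved_boxes[OF P(2,1)] by auto
    qed
  qed
qed

text \<open>The rotation shifts positions cyclically by \<open>n\<close>; the five cases are the possible numbers of endpoints that wrap around.\<close>

lemma interleaved_rotate180:
  assumes "d \<in> diagonals n" "e \<in> diagonals n" "interleaved n d e"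
  shows "crosses n (rotate180 d) (rotate180 e)"
proof -
  obtain i j k l where h: "d = {i, j}" "e = {k, l}"
      "crossing_pos n i < crossing_pos n k" "crossing_pos n k < crossing_pos n j" "crossing_pos n j < crossing_pos n l"
    using assms(3) unfolding interleaved_def by blast
  have r: "rotate180 d = {- i, - j}" "rotate180 e = {- k, - l}" "{- i, - j} = {- j, - i}" "{- k, - l} = {- l, - k}"
    by (auto simp: h rotate180_def)
  have pos: "crossing_pos n (- v) = (if 0 < v then crossing_pos n v + int n else crossing_pos n v - int n)"
    "0 < v \<longleftrightarrow> crossing_pos n v \<le> int n" "0 < crossing_pos n v" "crossing_pos n v \<le> 2 * int n" if "v \<in> {i, j, k, l}" for v
  proof -
    have "v \<in> vertices n" using assms(1,2) that h(1,2) by (auto elim!: diagonalsE)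
    then show "crossing_pos n (- v) = (if 0 < v then crossing_pos n v + int n else crossing_pos n v - int n)"
      "0 < v \<longleftrightarrow> crossing_pos n v \<le> int n" "0 < crossing_pos n v" "crossing_pos n v \<le> 2 * int n"
      by (auto simp: vertices_def crossing_pos_def)
  qed
  have il: "interleaved n {a, b} {c, d}"
    if "crossing_pos n a < crossing_pos n c" "crossing_pos n c < crossing_pos n b" "crossing_pos n b < crossing_pos n d" for a b c d
    unfolding interleaved_def using that by blast
  note p = pos[of i] pos[of j] pos[of k] pos[of l]
  consider "crossing_pos n l \<le> int n" | "crossing_pos n j \<le> int n" "int n < crossing_pos n l"
    | "crossing_pos n k \<le> int n" "int n < crossing_pos n j" | "crossing_pos n i \<le> int n" "int n < crossing_pos n k"
    | "int n < crossing_pos n i" by linarith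
  then show ?thesis
  proof cases
    case 1
    then have "interleaved n {- i, - j} {- k, - l}" using h p by (intro il) auto
    then show ?thesis by (simp add: crosses_def r)
  next
    case 2
    then have "interleaved n {- l, - k} {- i, - j}" using h p by (intro il) auto
    then show ?thesis unfolding crosses_def r(1,2) using r(4) by metis
  next
    case 3
    then have "interleaved n {- j, - i} {- l, - k}" using h p by (intro il) auto
    then show ?thesis unfolding crosses_def r(1,2) using r(3,4) by metis
  next
    case 4
    then have "interleaved n {- k, - l} {- j, - i}" using h p by (intro il) auto
    then show ?thesis unfolding crosses_def r(1,2) using r(3) by metis
  next
    case 5
    then have "interleaved n {- i, - j} {- k, - l}" using h p by (intro il) auto
    then show ?thesis by (simp add: crosses_def r)
  qed
qed

lemma crosses_rotate180:
  "d \<in> diagonals n \<Longrightarrow> e \<in> diagonals n \<Longrightarrow> crosses n d e \<Longrightarrow> crosses n (rotate180 d) (rotate180 e)"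
  using interleaved_rotate180[of d n e] interleaved_rotate180[of e n d] unfolding crosses_def by blast

lemma crosses_negative:
  assumes "d \<in> diagonals n" "e \<in> diagonals n" "crosses n d e" "\<forall>v\<in>d. v < 0"
  shows "\<exists>v\<in>e. v < 0"
proof -
  have "v < 0" if "w \<in> d" "crossing_pos n w < crossing_pos n v" "v \<in> e" for v w
  proof -
    have "w < 0" "v \<in> vertices n" using assms(2,4) that by (auto elim!: diagonalsE)
    then show ?thesis using that(2) by (auto simp: crossing_pos_def vertices_def split: if_splits)
  qed
  then show ?thesis using assms(3) unfolding crosses_def interleaved_def by blast
qed

text \<open>A set of pairwise crossing diagonals corresponds to a chain as soon as all its members have a positive endpoint. If one member has none,
then all the others, which cross it, have a negative endpoint, and rotating the set gives every member a positive one.\<close>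

lemma crossing_sets_iff:
  assumes w: "\<omega> \<in> symmetric_diagonals n"
  shows "(\<forall>S. S \<subseteq> \<omega> \<longrightarrow> pairwise (crosses n) S \<longrightarrow> card S \<le> m) \<longleftrightarrow>
    (\<forall>X. X \<subseteq> chord_boxes n \<omega> \<longrightarrow> se_set n X \<longrightarrow> card X \<le> m)"
proof (intro iffI allI impI)
  fix X assume h: "\<forall>S. S \<subseteq> \<omega> \<longrightarrow> pairwise (crosses n) S \<longrightarrow> card S \<le> m" and X: "X \<subseteq> chord_boxes n \<omega>" "se_set n X"
  have P: "X \<subseteq> nesting_polyomino n" "chord ` X \<subseteq> \<omega>" using X(1) by (auto simp: chord_boxes_def)
  then have "card (chord ` X) \<le> m" using h se_set_iff_crossing[OF P(1)] X(2) by blast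
  then show "card X \<le> m" using card_image[OF inj_on_subset[OF chord_inj P(1)]] by simp
next
  fix S assume h: "\<forall>X. X \<subseteq> chord_boxes n \<omega> \<longrightarrow> se_set n X \<longrightarrow> card X \<le> m" and S: "S \<subseteq> \<omega>" "pairwise (crosses n) S"
  have D: "d \<in> diagonals n" if "d \<in> \<omega>" for d using w that by (auto simp: symmetric_diagonals_def)
  have positive: "card T \<le> m" if T: "T \<subseteq> \<omega>" "pairwise (crosses n) T" "\<forall>d\<in>T. \<exists>v\<in>d. 0 < v" for T
  proof -
    let ?X = "{b \<in> nesting_polyomino n. chord b \<in> T}"
    have "T \<subseteq> chord ` ?X"
    proof
      fix d assume d: "d \<in> T"
      then obtain v where "v \<in> d" "0 < v" using T(3) by blast
      then obtain b where "b \<in> nesting_polyomino n" "d = chord b" using diagonal_with_positive[OF D] d T(1) by blast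
      then show "d \<in> chord ` ?X" using d by blast
    qed
    then have e: "chord ` ?X = T" by blast
    have P: "?X \<subseteq> nesting_polyomino n" "?X \<subseteq> chord_boxes n \<omega>" using T(1) by (auto simp: chord_boxes_def)
    then have "card ?X \<le> m" using h se_set_iff_crossing[OF P(1)] T(2) e by metis
    moreover have "finite ?X" using finite_nesting_polyomino[of n] by simp
    then have "card (chord ` ?X) \<le> card ?X" by (rule card_image_le)
    ultimately show ?thesis unfolding e by simp
  qed
  show "card S \<le> m"
  proof (cases "\<forall>d\<in>S. \<exists>v\<in>d. 0 < v")
    case True
    then show ?thesis by (rule positive[OF S])
  next
    case False
    then obtain d where d: "d \<in> S" "\<forall>v\<in>d. \<not> 0 < v" by blast
    have "d \<in> diagonals n" using D d(1) S(1) by blast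
    then have "0 \<notin> d" by (auto simp: vertices_def elim!: diagonalsE)
    then have neg: "\<forall>v\<in>d. v < 0" using d(2) by (metis linorder_neqE_linordered_idom)
    have ex: "\<exists>v\<in>e. v < 0" if e: "e \<in> S" for e
    proof (cases "e = d")
      case True
      obtain i j where "d = {i, j}" using D[of d] d(1) S(1) by (auto elim!: diagonalsE)
      then show ?thesis using True neg by blast
    next
      case False
      then have "crosses n d e" using S(2) d(1) e unfolding pairwise_def by blast
      then show ?thesis using crosses_negative D S(1) d(1) e neg by blast
    qed
    have inj: "inj_on rotate180 S" by (rule inj_onI) (metis rotate180_rotate180)
    have "card (rotate180 ` S) \<le> m"
    proof (rule positive)
      show "rotate180 ` S \<subseteq> \<omega>" using S(1) w by (auto simp: symmetric_diagonals_def)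
      show "pairwise (crosses n) (rotate180 ` S)"
      proof (rule pairwiseI)
        fix x y assume "x \<in> rotate180 ` S" "y \<in> rotate180 ` S" "x \<noteq> y"
        then obtain a b where ab: "a \<in> S" "b \<in> S" "x = rotate180 a" "y = rotate180 b" "a \<noteq> b" by blast
        then have "crosses n a b" using S(2) unfolding pairwise_def by blast
        then show "crosses n x y" unfolding ab(3,4) using crosses_rotate180 D ab(1,2) S(1) by blast
      qed
      show "\<forall>d\<in>rotate180 ` S. \<exists>v\<in>d. 0 < v" using ex by (fastforce simp: rotate180_def)
    qed
    then show ?thesis using card_image[OF inj] by simp
  qed
qed

lemma max_crossing_le_iff:
  assumes w: "\<omega> \<in> symmetric_diagonals n"
  shows "max_crossing n \<omega> \<le> m \<longleftrightarrow> (\<forall>X. X \<subseteq> chord_boxes n \<omega> \<longrightarrow> se_set n X \<longrightarrow> card X \<le> m)"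
proof -
  have "diagonals n \<subseteq> Pow (vertices n)" by (auto elim!: diagonalsE)
  moreover have "finite (vertices n)" by (simp add: vertices_def)
  ultimately have "finite \<omega>" using w by (auto simp: symmetric_diagonals_def intro: finite_subset)
  then have fin: "finite {S. S \<subseteq> \<omega> \<and> pairwise (crosses n) S}" by (auto intro: finite_subset[of _ "Pow \<omega>"])
  have "{} \<in> {S. S \<subseteq> \<omega> \<and> pairwise (crosses n) S}" by simp
  then have ne: "{S. S \<subseteq> \<omega> \<and> pairwise (crosses n) S} \<noteq> {}" by blast
  have "max_crossing n \<omega> \<le> m \<longleftrightarrow> (\<forall>S. S \<subseteq> \<omega> \<longrightarrow> pairwise (crosses n) S \<longrightarrow> card S \<le> m)"
    unfolding max_crossing_def using fin ne by auto
  then show ?thesis unfolding crossing_sets_iff[OF w] .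
qed

theorem card_triangulations:
  assumes "1 \<le> k" "k < n"
  shows "card (triangulations n k) = card (top_faces n k (crossing_faces n k))"
proof -
  have "card {\<omega> \<in> symmetric_diagonals n. max_crossing n \<omega> = k \<and>
      (\<forall>d\<in>diagonals n. d \<notin> \<omega> \<longrightarrow> max_crossing n \<omega> < max_crossing n (\<omega> \<union> {d, rotate180 d}))} =
    card (top_faces n k (crossing_faces n k))"
  proof (rule card_maximal_eq_top_faces[OF assms(1) symmetric_diagonals_bij, where rep = "orbit_box n"])
    fix \<omega> assume w: "\<omega> \<in> symmetric_diagonals n"
    show "max_crossing n \<omega> \<le> k \<longleftrightarrow> chord_boxes n \<omega> \<inter> reps n \<in> crossing_faces n k"
      unfolding max_crossing_le_iff[OF w] crossing_faces_def using chord_boxes_closure[OF w] by simp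
    show "card (chord_boxes n \<omega> \<inter> reps n \<inter> main_diagonal n) \<le> max_crossing n \<omega>"
      by (rule iffD1[OF max_crossing_le_iff[OF w] order_refl, rule_format]) (auto intro: diagonal_chains)
    fix d assume d: "d \<in> diagonals n"
    show "\<omega> \<union> {d, rotate180 d} \<in> symmetric_diagonals n \<and>
        chord_boxes n (\<omega> \<union> {d, rotate180 d}) \<inter> reps n = insert (orbit_box n d) (chord_boxes n \<omega> \<inter> reps n)"
      using symmetric_diagonals_insert[OF w d] by blast
    show "d \<notin> \<omega> \<longleftrightarrow> orbit_box n d \<notin> chord_boxes n \<omega> \<inter> reps n"
      using orbit_box_mem[OF w d] orbit_box(1)[OF d] by (auto simp: chord_boxes_def reps_def)
  next
    show "orbit_box n ` diagonals n = reps n"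
    proof (intro equalityI image_subsetI subsetI)
      show "orbit_box n d \<in> reps n" if "d \<in> diagonals n" for d by (rule orbit_box(1)[OF that])
      fix b assume b: "b \<in> reps n"
      then have "chord b \<in> diagonals n" by (auto simp: reps_def intro: chord_diagonal)
      then show "b \<in> orbit_box n ` diagonals n" using orbit_box_iff[OF _ b] by blast
    qed
    show "crossing_faces n k \<subseteq> Pow (reps n)" by (auto simp: crossing_faces_def)
    show "\<exists>\<omega>'\<in>top_faces n k (crossing_faces n k). \<omega> \<subseteq> \<omega>'" if "\<omega> \<in> crossing_faces n k" for \<omega>
      by (rule crossing_face_extends[OF assms that])
  qed (rule crossing_faces_down)
  moreover have "triangulations n k = {\<omega> \<in> symmetric_diagonals n. max_crossing n \<omega> = k \<and>
      (\<forall>d\<in>diagonals n. d \<notin> \<omega> \<longrightarrow> max_crossing n \<omega> < max_crossing n (\<omega> \<union> {d, rotate180 d}))}"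
    by (auto simp: triangulations_def symmetric_diagonals_def)
  ultimately show ?thesis by simp
qed

theorem theorem7p1:
  fixes n k :: nat
  assumes "1 \<le> k" and "k \<le> n - 1"
  shows "card (triangulations n k) = card (symmetric_fans n k) \<and>
         card (maximal_nesting_fillings n k) = card (maximal_crossing_fillings n k)"
proof -
  have k: "1 \<le> k" "k < n" using assms by auto
  show ?thesis
    unfolding card_triangulations[OF k] card_symmetric_fans[OF k] card_maximal_nesting_fillings[OF k]
      card_maximal_crossing_fillings[OF k] card_top_faces[OF k] by simp
qed

end
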